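(* Let $\mathcal T$ be a regular simplicial mesh of $\Omega$. The operator $Q_{\mathcal T}:=\Pi^0_{\mathcal T}P_{\mathcal T}':H^{-1}(\Omega)\to\mathcal P^0(\mathcal T)$ has the following properties, with a constant $C>0$ depending only on $d$ and the shape regularity of $\mathcal T$: (a) Projection: $Q_{\mathcal T}^2=Q_{\mathcal T}$. (b) Approximation: $\|(1-Q_{\mathcal T})\phi\|_{-1}\le C\|h_{\mathcal T}\phi\|$ for all $\phi\in L^2(\Omega)$. (c) Local boundedness for $L^2(\Omega)$ functions: for all $T\in\mathcal T$ and $\phi\in L^2(\Omega)$, $$\|Q_{\mathcal T}\phi\|_T\le C\|\phi\|_{\Omega_{\mathcal T}(T)}\quad\text{and}\quad\|Q_{\mathcal T}\phi\|_{-1,T}\le C\|\phi\|_{-1,\Omega_{\mathcal T}(T)}.$$ (d) Global boundedness: $\|Q_{\mathcal T}\phi\|_{-1}\le C\|\phi\|_{-1}$ for all $\phi\in H^{-1}(\Omega)$.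
   Context: $\Omega\subset\mathbb R^d$ ($d\ge2$) is a nonempty bounded connected Lipschitz domain with boundary $\Gamma$, fixed throughout. For a Lipschitz domain $\omega$, $\|\cdot\|_\omega$ and $(\cdot,\cdot)_\omega$ are the $L^2(\omega)$ norm and inner product; $H^{-1}(\omega):=(H_0^1(\omega))'$ with norm $\|\phi\|_{-1,\omega}:=\sup_{0\ne v\in H_0^1(\omega)}\langle\phi,v\rangle_\omega/\|\nabla v\|_\omega$, the duality extending the $L^2(\omega)$ inner product. The index $\omega$ is omitted if $\omega=\Omega$. A regular mesh $\mathcal T$ of $\Omega$ is a conforming mesh of finitely many open simplices with $\overline\Omega=\bigcup_{T\in\mathcal T}\overline T$; $h_T:=\mathrm{diam}(T)$, $h_{\mathcal T}|_T:=h_T$; the shape regularity of $\mathcal T$ is measured by $\max_{T\in\mathcal T}\mathrm{diam}(T)^d/|T|$. $\mathcal P^0(\mathcal T)$, $\mathcal P^1(\mathcal T)$ are the spaces of $\mathcal T$-piecewise polynomials of degree $\le0$, $\le1$ (no continuity), and $\Pi^0_{\mathcal T}$ is the $L^2(\Omega)$-orthogonal projection onto $\mathcal P^0(\mathcal T)$. For $T\in\mathcal T$, $\Omega_{\mathcal T}(T)$ is the domain formed by all $T'\in\mathcal T$ with $\overline{T'}\cap\overline T\neq\emptyset$ (interior of the union of their closures). Let $\mathcal N(T)$ be the set of vertices of $T$, $\mathcal N_{\mathcal T}^\Omega$ the set of vertices of $\mathcal T$ not lying on $\Gamma$, and $\eta_{\mathcal T,z}$ the nodal hat function (continuous, piecewise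 affine, $\eta_{\mathcal T,z}(z')=\delta_{z,z'}$ for all vertices $z'$). Let $\omega_{\mathcal T}(z):=\{T\in\mathcal T:z\in\overline T\}$. For $T\in\mathcal T$, $z\in\mathcal N(T)$, let $\psi_{T,z}$ be the affine function on $T$ with $(\psi_{T,z},\eta_{\mathcal T,z'})_T=\delta_{z,z'}$ for all $z'\in\mathcal N(T)$. Let $\eta_{b,T}:=\prod_{z\in\mathcal N(T)}\eta_{\mathcal T,z}$. For $v\in L^2(\Omega)$ define $$J_{\mathcal T}v:=\sum_{z\in\mathcal N_{\mathcal T}^\Omega}\Big(\sum_{T\in\omega_{\mathcal T}(z)}\frac{|T|\,(v,\psi_{T,z})_T}{\sum_{T'\in\omega_{\mathcal T}(z)}|T'|}\Big)\eta_{\mathcal T,z},\qquad P_{\mathcal T}v:=J_{\mathcal T}v+\sum_{T\in\mathcal T}\frac{(v-J_{\mathcal T}v,1)_T}{(\eta_{b,T},1)_T}\,\eta_{b,T}.$$ $P_{\mathcal T}'$ is the adjoint of $P_{\mathcal T}$ with respect to the $L^2(\Omega)$ inner product; since $P_{\mathcal T}$ is bounded on $H_0^1(\Omega)$, it is well defined as an operator $P_{\mathcal T}':H^{-1}(\Omega)\to\mathcal P^1(\mathcal T)$ through $(P_{\mathcal T}'\phi,v)=\langle\phi,P_{\mathcal T}v\rangle$ for $v\in H_0^1(\Omega)$. *)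

theory Defs
  imports "HOL-Analysis.Analysis"
begin

section \<open>Domains\<close>

text \<open>Near each boundary point, \<open>\<omega>\<close> is the strict epigraph, in direction \<open>e\<close>, of a Lipschitz function
  on the hyperplane orthogonal to \<open>e\<close>.\<close>

definition lipschitz_domain :: "'a::euclidean_space set \<Rightarrow> bool" where
  "lipschitz_domain \<omega> \<longleftrightarrow>
     open \<omega> \<and> connected \<omega> \<and> bounded \<omega> \<and> \<omega> \<noteq> {} \<and>
     (\<forall>p\<in>frontier \<omega>. \<exists>U e L \<gamma>.
        open U \<and> p \<in> U \<and> norm e = 1 \<and> L-lipschitz_on {y. y \<bullet> e = 0} \<gamma> \<and>
        \<omega> \<inter> U = {y\<in>U. \<gamma> (y - (y \<bullet> e) *\<^sub>R e) < y \<bullet> e})"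

section \<open>Lebesgue and Sobolev spaces\<close>

text \<open>Elements of function spaces over \<open>\<omega>\<close> are represented by functions on the whole space; their
  values outside \<open>\<omega>\<close>, and on null sets, are immaterial.\<close>

definition L2 :: "'a::euclidean_space set \<Rightarrow> ('a \<Rightarrow> 'b::euclidean_space) set" where
  "L2 \<omega> = {v \<in> borel_measurable (lebesgue_on \<omega>). integrable (lebesgue_on \<omega>) (\<lambda>x. (norm (v x))\<^sup>2)}"

definition L2_norm :: "'a::euclidean_space set \<Rightarrow> ('a \<Rightarrow> 'b::euclidean_space) \<Rightarrow> real" where
  "L2_norm \<omega> v = sqrt (LINT x|lebesgue_on \<omega>. (norm (v x))\<^sup>2)"

definition L2_inner :: "'a::euclidean_space set \<Rightarrow> ('a \<Rightarrow> real) \<Rightarrow> ('a \<Rightarrow> real) \<Rightarrow> real" where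
  "L2_inner \<omega> u v = (LINT x|lebesgue_on \<omega>. u x * v x)"

primrec C_k :: "nat \<Rightarrow> ('a::euclidean_space \<Rightarrow> real) \<Rightarrow> bool" where
  "C_k 0 f \<longleftrightarrow> continuous_on UNIV f"
| "C_k (Suc k) f \<longleftrightarrow>
     (\<forall>x. f differentiable (at x)) \<and> (\<forall>b\<in>Basis. C_k k (\<lambda>x. frechet_derivative f (at x) b))"

definition test_functions :: "'a::euclidean_space set \<Rightarrow> ('a \<Rightarrow> real) set" where
  "test_functions \<omega> = {f. (\<forall>k. C_k k f) \<and> (\<exists>K. compact K \<and> K \<subseteq> \<omega> \<and> (\<forall>x. x \<notin> K \<longrightarrow> f x = 0))}"

definition grad :: "('a::euclidean_space \<Rightarrow> real) \<Rightarrow> 'a \<Rightarrow> 'a" where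
  "grad f x = (THE D. GDERIV f x :> D)"

definition has_weak_gradient ::
    "'a::euclidean_space set \<Rightarrow> ('a \<Rightarrow> real) \<Rightarrow> ('a \<Rightarrow> 'a) \<Rightarrow> bool" where
  "has_weak_gradient \<omega> v g \<longleftrightarrow>
     (\<forall>f\<in>test_functions \<omega>.
        (LINT x|lebesgue_on \<omega>. v x *\<^sub>R grad f x) = - (LINT x|lebesgue_on \<omega>. f x *\<^sub>R g x))"

definition H1 :: "'a::euclidean_space set \<Rightarrow> ('a \<Rightarrow> real) set" where
  "H1 \<omega> = {v \<in> L2 \<omega>. \<exists>g\<in>L2 \<omega>. has_weak_gradient \<omega> v g}"

text \<open>For open \<open>\<omega>\<close> the weak gradient is unique up to null sets.\<close>

definition weak_gradient :: "'a::euclidean_space set \<Rightarrow> ('a \<Rightarrow> real) \<Rightarrow> 'a \<Rightarrow> 'a" where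
  "weak_gradient \<omega> v = (SOME g. g \<in> L2 \<omega> \<and> has_weak_gradient \<omega> v g)"

text \<open>The closure of the test functions in the \<open>H1\<close> norm.\<close>

definition H10 :: "'a::euclidean_space set \<Rightarrow> ('a \<Rightarrow> real) set" where
  "H10 \<omega> = {v \<in> H1 \<omega>. \<exists>f. (\<forall>n::nat. f n \<in> test_functions \<omega>) \<and>
     (\<lambda>n. L2_norm \<omega> (\<lambda>x. f n x - v x)) \<longlonglongrightarrow> 0 \<and>
     (\<lambda>n. L2_norm \<omega> (\<lambda>x. grad (f n) x - weak_gradient \<omega> v x)) \<longlonglongrightarrow> 0}"

text \<open>Boundedness makes the functionals insensitive to the choice of representatives: if \<open>u\<close> and \<open>v\<close>
  agree almost everywhere on \<open>\<omega>\<close>, the weak gradient of their difference vanishes. Values of a functional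
  outside \<open>H10 \<omega>\<close> carry no information.\<close>

definition Hm1 :: "'a::euclidean_space set \<Rightarrow> (('a \<Rightarrow> real) \<Rightarrow> real) set" where
  "Hm1 \<omega> = {\<phi>.
     (\<forall>u\<in>H10 \<omega>. \<forall>v\<in>H10 \<omega>. \<phi> (\<lambda>x. u x + v x) = \<phi> u + \<phi> v) \<and>
     (\<forall>c. \<forall>v\<in>H10 \<omega>. \<phi> (\<lambda>x. c * v x) = c * \<phi> v) \<and>
     (\<exists>B. \<forall>v\<in>H10 \<omega>. \<bar>\<phi> v\<bar> \<le> B * L2_norm \<omega> (weak_gradient \<omega> v))}"

text \<open>The supremum is taken in the extended reals, so that it is meaningful without a boundedness
  side condition.\<close>

definition Hm1_norm :: "'a::euclidean_space set \<Rightarrow> (('a \<Rightarrow> real) \<Rightarrow> real) \<Rightarrow> ereal" where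
  "Hm1_norm \<omega> \<phi> =
     (SUP v \<in> {v \<in> H10 \<omega>. \<not> (AE x in lebesgue_on \<omega>. v x = 0)}.
        ereal (\<phi> v / L2_norm \<omega> (weak_gradient \<omega> v)))"

text \<open>The embedding of \<open>L2 \<omega>\<close> into \<open>Hm1 \<omega>\<close>.\<close>

definition L2_functional :: "'a::euclidean_space set \<Rightarrow> ('a \<Rightarrow> real) \<Rightarrow> ('a \<Rightarrow> real) \<Rightarrow> real" where
  "L2_functional \<omega> f = (\<lambda>v. L2_inner \<omega> f v)"

section \<open>Meshes\<close>

text \<open>Elements are open simplices. Distinct elements are disjoint, because a common face of two
  full-dimensional simplices with nonempty interior is all of both.\<close>

definition regular_mesh :: "'a::euclidean_space set \<Rightarrow> 'a set set \<Rightarrow> bool" where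
  "regular_mesh \<Omega> \<T> \<longleftrightarrow>
     finite \<T> \<and>
     (\<forall>T\<in>\<T>. \<exists>S. int DIM('a) simplex S \<and> T = interior S) \<and>
     (\<forall>T\<in>\<T>. \<forall>T'\<in>\<T>. (closure T \<inter> closure T') face_of closure T \<and>
                       (closure T \<inter> closure T') face_of closure T') \<and>
     closure \<Omega> = (\<Union>T\<in>\<T>. closure T)"

definition shape_regularity :: "'a::euclidean_space set set \<Rightarrow> real" where
  "shape_regularity \<T> = Max ((\<lambda>T. diameter T ^ DIM('a) / measure lebesgue T) ` \<T>)"

definition mesh_size :: "'a::euclidean_space set set \<Rightarrow> 'a \<Rightarrow> real" where
  "mesh_size \<T> x = (\<Sum>T\<in>\<T>. diameter T * indicator T x)"

definition element_patch :: "'a::euclidean_space set set \<Rightarrow> 'a set \<Rightarrow> 'a set" where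
  "element_patch \<T> T = interior (\<Union>T'\<in>{T'\<in>\<T>. closure T' \<inter> closure T \<noteq> {}}. closure T')"

definition vertices :: "'a::euclidean_space set \<Rightarrow> 'a set" where
  "vertices T = {z. z extreme_point_of (closure T)}"

definition interior_vertices :: "'a::euclidean_space set \<Rightarrow> 'a set set \<Rightarrow> 'a set" where
  "interior_vertices \<Omega> \<T> = (\<Union>T\<in>\<T>. vertices T) - frontier \<Omega>"

definition vertex_elements :: "'a::euclidean_space set set \<Rightarrow> 'a \<Rightarrow> 'a set set" where
  "vertex_elements \<T> z = {T\<in>\<T>. z \<in> closure T}"

section \<open>Piecewise polynomials\<close>

definition affine_fun_on :: "'a::euclidean_space set \<Rightarrow> ('a \<Rightarrow> real) \<Rightarrow> bool" where
  "affine_fun_on S f \<longleftrightarrow> (\<exists>a c. \<forall>x\<in>S. f x = a \<bullet> x + c)"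

text \<open>The value 0 off the open elements (on \<open>\<Omega>\<close>, a null set) selects one representative of each
  piecewise polynomial, so that equality of functions is equality in \<open>L2 \<Omega>\<close>.\<close>

definition P0 :: "'a::euclidean_space set set \<Rightarrow> ('a \<Rightarrow> real) set" where
  "P0 \<T> = {p. (\<forall>T\<in>\<T>. \<exists>c. \<forall>x\<in>T. p x = c) \<and> (\<forall>x. x \<notin> \<Union>\<T> \<longrightarrow> p x = 0)}"

definition P1 :: "'a::euclidean_space set set \<Rightarrow> ('a \<Rightarrow> real) set" where
  "P1 \<T> = {p. (\<forall>T\<in>\<T>. affine_fun_on T p) \<and> (\<forall>x. x \<notin> \<Union>\<T> \<longrightarrow> p x = 0)}"

definition proj0 :: "'a::euclidean_space set \<Rightarrow> 'a set set \<Rightarrow> ('a \<Rightarrow> real) \<Rightarrow> 'a \<Rightarrow> real" where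
  "proj0 \<Omega> \<T> f = (THE p. p \<in> P0 \<T> \<and> (\<forall>q\<in>P0 \<T>. L2_inner \<Omega> (\<lambda>x. f x - p x) q = 0))"

definition hat :: "'a::euclidean_space set set \<Rightarrow> 'a \<Rightarrow> 'a \<Rightarrow> real" where
  "hat \<T> z = (THE \<eta>.
     continuous_on (\<Union>T\<in>\<T>. closure T) \<eta> \<and>
     (\<forall>T\<in>\<T>. affine_fun_on (closure T) \<eta>) \<and>
     (\<forall>z'\<in>(\<Union>T\<in>\<T>. vertices T). \<eta> z' = (if z' = z then 1 else 0)) \<and>
     (\<forall>x. x \<notin> (\<Union>T\<in>\<T>. closure T) \<longrightarrow> \<eta> x = 0))"

text \<open>\<open>dual_hat \<T> T z\<close> is taken affine on the whole space; only its restriction to \<open>T\<close> is used.\<close>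

definition dual_hat :: "'a::euclidean_space set set \<Rightarrow> 'a set \<Rightarrow> 'a \<Rightarrow> 'a \<Rightarrow> real" where
  "dual_hat \<T> T z = (THE \<psi>. affine_fun_on UNIV \<psi> \<and>
     (\<forall>z'\<in>vertices T. L2_inner T \<psi> (hat \<T> z') = (if z' = z then 1 else 0)))"

definition bubble :: "'a::euclidean_space set set \<Rightarrow> 'a set \<Rightarrow> 'a \<Rightarrow> real" where
  "bubble \<T> T x = (\<Prod>z\<in>vertices T. hat \<T> z x)"

section \<open>The operators\<close>

definition J_op :: "'a::euclidean_space set \<Rightarrow> 'a set set \<Rightarrow> ('a \<Rightarrow> real) \<Rightarrow> 'a \<Rightarrow> real" where
  "J_op \<Omega> \<T> v x =
     (\<Sum>z\<in>interior_vertices \<Omega> \<T>.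
        (\<Sum>T\<in>vertex_elements \<T> z.
           measure lebesgue T * L2_inner T v (dual_hat \<T> T z) /
           (\<Sum>T'\<in>vertex_elements \<T> z. measure lebesgue T')) * hat \<T> z x)"

definition P_op :: "'a::euclidean_space set \<Rightarrow> 'a set set \<Rightarrow> ('a \<Rightarrow> real) \<Rightarrow> 'a \<Rightarrow> real" where
  "P_op \<Omega> \<T> v x = J_op \<Omega> \<T> v x +
     (\<Sum>T\<in>\<T>. L2_inner T (\<lambda>y. v y - J_op \<Omega> \<T> v y) (\<lambda>_. 1) / L2_inner T (bubble \<T> T) (\<lambda>_. 1)
              * bubble \<T> T x)"

definition P_adj ::
    "'a::euclidean_space set \<Rightarrow> 'a set set \<Rightarrow> (('a \<Rightarrow> real) \<Rightarrow> real) \<Rightarrow> 'a \<Rightarrow> real" where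
  "P_adj \<Omega> \<T> \<phi> = (THE w. w \<in> P1 \<T> \<and> (\<forall>v\<in>H10 \<Omega>. L2_inner \<Omega> w v = \<phi> (P_op \<Omega> \<T> v)))"

definition Q_op ::
    "'a::euclidean_space set \<Rightarrow> 'a set set \<Rightarrow> (('a \<Rightarrow> real) \<Rightarrow> real) \<Rightarrow> 'a \<Rightarrow> real" where
  "Q_op \<Omega> \<T> \<phi> = proj0 \<Omega> \<T> (P_adj \<Omega> \<T> \<phi>)"

end

theory Submission
  imports Defs
begin

text \<open>\<open>Q\<close> is the transpose of an operator \<open>Qd\<close> that depends on a function only through its integrals over
  the elements: \<open>Qd f\<close> has at an interior vertex \<open>z\<close> the average of \<open>f\<close> over the star of \<open>z\<close>, and bubble
  functions correct it so that \<open>f\<close> and \<open>Qd f\<close> have the same integral over each element. The latter is the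
  projection property. All bounds reduce to local estimates for \<open>Qd\<close>, because
  \<open>(Q \<phi>, f) = \<phi> (Qd f)\<close>: global ones come from \<open>f - Qd f\<close> and \<open>grad (Qd f)\<close> for test functions \<open>f\<close>, local
  ones from \<open>f\<close> the indicator of an element.

  The mean values of \<open>f\<close> over two elements with a common facet differ by at most a multiple of
  \<open>h |T|^(-1/2) \<parallel>grad f\<parallel>\<close>, because both are compared with the mean of the trace on that facet, and the
  same bound holds for the mean value itself if a facet is on the boundary. Since stars of interior
  vertices are connected through facets, while from every element at a boundary vertex such a chain
  leads to a boundary facet, the coefficients of \<open>Qd f\<close> are close to the mean values of \<open>f\<close>; a Poincare
  inequality on each element does the rest. The length of the chains is bounded by the shape regularity.\<close>

text \<open>\<open>Qd\<close> is \<open>P_op\<close> applied to the elementwise means of its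
  argument: against a constant, the dual function of a vertex has integral 1, so the coefficients of
  \<open>J_op\<close> turn into star averages and the size of \<open>dual_hat\<close> never enters
  an estimate. No trace operator occurs. The mean on a facet is the mean over the element of
  \<open>f\<close> composed with the projection of the element onto that facet along an edge. An
  affine map between two neighbours that fixes the common facet commutes with these projections, so
  both sides give the same number. \<open>H10\<close> asks for approximation by test functions,
  while hats and bubbles are merely Lipschitz. They are therefore first cut down to compact support
  and then mollified. The regularity of the boundary enters as
  \<open>interior (closure \<Omega>) = \<Omega>\<close>. This is what forbids the elements at a
  boundary vertex to surround it, so that a facet chain must end at an unshared facet. In the local
  dual estimate, the gradient of \<open>Qd\<close> of an indicator costs 1/h, and the Friedrichs
  inequality on the element gives the factor h back.\<close>

abbreviation vol :: "'a::euclidean_space set \<Rightarrow> real" where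
  "vol \<equiv> measure lebesgue"

section \<open>Tools for smooth functions, \<open>L2\<close> and \<open>H10\<close>\<close>

section \<open>Smooth functions\<close>

lemma grad_eqI:
  fixes f :: "'a::euclidean_space \<Rightarrow> real"
  shows "(f has_derivative (\<lambda>h. h \<bullet> D)) (at x) \<Longrightarrow> grad f x = D"
proof -
  assume a: "(f has_derivative (\<lambda>h. h \<bullet> D)) (at x)"
  show ?thesis unfolding grad_def
  proof (rule the_equality)
    show "GDERIV f x :> D" using a by (simp add: gderiv_def)
    fix D' assume "GDERIV f x :> D'"
    then have "(f has_derivative (\<lambda>h. h \<bullet> D')) (at x)" by (simp add: gderiv_def)
    from has_derivative_unique[OF this a] have "(\<lambda>h. h \<bullet> D') = (\<lambda>h. h \<bullet> D)" .
    then show "D' = D" using vector_eq_ldot[of D' D] by meson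
  qed
qed

lemma differentiable_grad:
  fixes f :: "'a::euclidean_space \<Rightarrow> real"
  assumes "f differentiable (at x)"
  shows "(f has_derivative (\<lambda>h. h \<bullet> grad f x)) (at x)"
    and "grad f x = (\<Sum>b\<in>Basis. frechet_derivative f (at x) b *\<^sub>R b)"
    and "grad f x \<bullet> h = frechet_derivative f (at x) h"
proof -
  let ?F = "frechet_derivative f (at x)"
  have D: "(f has_derivative ?F) (at x)" using assms frechet_derivative_works by blast
  then have lin: "linear ?F" by (rule has_derivative_linear)
  have eq: "?F h = h \<bullet> (\<Sum>b\<in>Basis. ?F b *\<^sub>R b)" for h
  proof -
    have "?F h = ?F (\<Sum>b\<in>Basis. (h \<bullet> b) *\<^sub>R b)" by (simp add: euclidean_representation)
    also have "\<dots> = (\<Sum>b\<in>Basis. (h \<bullet> b) * ?F b)"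
      using lin by (simp add: linear_sum linear_cmul)
    finally show ?thesis by (simp add: inner_sum_right mult.commute)
  qed
  have *: "(f has_derivative (\<lambda>h. h \<bullet> (\<Sum>b\<in>Basis. ?F b *\<^sub>R b))) (at x)"
    using D eq by (simp flip: eq)
  from grad_eqI[OF this] show g: "grad f x = (\<Sum>b\<in>Basis. ?F b *\<^sub>R b)" .
  with * show "(f has_derivative (\<lambda>h. h \<bullet> grad f x)) (at x)" by simp
  show "grad f x \<bullet> h = ?F h" unfolding g eq[of h] by (rule inner_commute)
qed

lemma C_k_Suc_D: "C_k (Suc k) f \<Longrightarrow> C_k k f"
proof (induction k arbitrary: f)
  case 0
  then show ?case
    by (auto intro!: continuous_at_imp_continuous_on differentiable_imp_continuous_within)
next
  case (Suc k)
  then show ?case by (metis C_k.simps(2))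
qed

lemma C_k_const: "C_k k (\<lambda>x::'a::euclidean_space. c)"
  by (induction k arbitrary: c) auto

lemma C_k_inner: "C_k k (\<lambda>x::'a::euclidean_space. x \<bullet> a)"
proof (cases k)
  case (Suc j)
  have D: "((\<lambda>x::'a. x \<bullet> a) has_derivative (\<lambda>h. h \<bullet> a)) (at x)" for x
    by (auto intro!: derivative_eq_intros)
  then have "frechet_derivative (\<lambda>x::'a. x \<bullet> a) (at x) = (\<lambda>h. h \<bullet> a)" for x
    by (metis frechet_derivative_at)
  with D show ?thesis unfolding Suc by (auto simp: C_k_const differentiable_def)
qed (auto intro!: continuous_intros)

lemma C_k_add:
  "C_k k f \<Longrightarrow> C_k k g \<Longrightarrow> C_k k (\<lambda>x::'a::euclidean_space. f x + g x)"
proof (induction k arbitrary: f g)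
  case (Suc k)
  have "frechet_derivative (\<lambda>x. f x + g x) (at x) = (\<lambda>h. frechet_derivative f (at x) h + frechet_derivative g (at x) h)" for x
    using Suc.prems by (intro frechet_derivative_at[symmetric] has_derivative_add) (auto simp: frechet_derivative_works)
  then show ?case using Suc by auto
qed (auto intro: continuous_intros)

lemma C_k_mult:
  "C_k k f \<Longrightarrow> C_k k g \<Longrightarrow> C_k k (\<lambda>x::'a::euclidean_space. f x * g x)"
proof (induction k arbitrary: f g)
  case (Suc k)
  have "frechet_derivative (\<lambda>x. f x * g x) (at x) = (\<lambda>h. f x * frechet_derivative g (at x) h + frechet_derivative f (at x) h * g x)" for x
    using Suc.prems by (intro frechet_derivative_at[symmetric] has_derivative_mult) (auto simp: frechet_derivative_works)
  moreover have "C_k k f" "C_k k g" using Suc.prems C_k_Suc_D by blast+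
  ultimately show ?case using Suc by (auto intro!: C_k_add)
qed (auto intro: continuous_intros)

lemma C_k_prod: "(\<And>i. i \<in> I \<Longrightarrow> C_k k (f i)) \<Longrightarrow> C_k k (\<lambda>x::'a::euclidean_space. \<Prod>i\<in>I. f i x)"
  by (induction I rule: infinite_finite_induct) (auto intro: C_k_mult C_k_const)

text \<open>The family \<theta> is closed under differentiation up to constants and index shifts, so
  an induction on \<open>k\<close> for all indices at once suffices. The pattern
  \<open>j + 1\<close>, \<open>j + 2\<close> is that of exp(-1/t) t^(-j); the constant family exp
  fits it with \<alpha> = 0.\<close>

lemma C_k_compose:
  fixes \<theta> :: "nat \<Rightarrow> real \<Rightarrow> real" and q :: "'a::euclidean_space \<Rightarrow> real"
  assumes D: "\<And>j t. (\<theta> j has_real_derivative (\<alpha> j * \<theta> (Suc j) t + \<theta> (Suc (Suc j)) t)) (at t)"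
    and q: "\<And>k. C_k k q"
  shows "C_k k (\<lambda>x. \<theta> j (q x))"
proof (induction k arbitrary: j)
  case 0
  have "continuous_on UNIV (\<theta> j)" using D
    by (meson DERIV_isCont continuous_at_imp_continuous_on)
  moreover have "continuous_on UNIV q" using q[of 0] by simp
  ultimately show ?case by (auto intro: continuous_on_compose2)
next
  case (Suc k)
  have qd: "q differentiable (at x)" for x using q[of "Suc 0"] by simp
  have hd: "((\<lambda>x. \<theta> j (q x)) has_derivative (\<lambda>h. frechet_derivative q (at x) h * (\<alpha> j * \<theta> (Suc j) (q x) + \<theta> (Suc (Suc j)) (q x)))) (at x)" for x
    by (rule DERIV_compose_FDERIV[OF D]) (use qd frechet_derivative_works in blast)
  then have fd: "frechet_derivative (\<lambda>x. \<theta> j (q x)) (at x) = (\<lambda>h. frechet_derivative q (at x) h * (\<alpha> j * \<theta> (Suc j) (q x) + \<theta> (Suc (Suc j)) (q x)))" for x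
    by (metis frechet_derivative_at)
  show ?case
    unfolding C_k.simps fd
    using hd q[of "Suc k"] Suc by (auto intro!: C_k_mult C_k_add C_k_const simp: differentiable_def)
qed

text \<open>The flat function exp(-1/t), continued by 0, times powers of 1/t. The powers are
  included because differentiation produces them.\<close>

definition exp_ramp :: "nat \<Rightarrow> real \<Rightarrow> real" where
  "exp_ramp j t = (if t > 0 then exp (- inverse t) * inverse t ^ j else 0)"

text \<open>With y = 1/t the limit from the right is that of y^j / exp y at infinity; from the left
  the function is 0.\<close>

lemma exp_ramp_tendsto_0: "(exp_ramp j \<longlongrightarrow> 0) (at 0)"
proof -
  have "((\<lambda>y::real. y ^ j / exp y) \<longlongrightarrow> 0) at_top" by (rule tendsto_power_div_exp_0)
  then have "((\<lambda>t::real. inverse t ^ j / exp (inverse t)) \<longlongrightarrow> 0) (at_right 0)"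
    by (rule filterlim_compose[OF _ filterlim_inverse_at_top_right])
  then have r: "(exp_ramp j \<longlongrightarrow> 0) (at_right 0)"
    by (rule Lim_transform_eventually)
       (auto simp: exp_ramp_def eventually_at_right_field exp_minus divide_inverse intro!: exI[of _ 1])
  have l: "(exp_ramp j \<longlongrightarrow> 0) (at_left 0)"
    by (rule Lim_transform_eventually[OF tendsto_const])
       (auto simp: exp_ramp_def eventually_at_left_field intro!: exI[of _ "-1"])
  show ?thesis using l r filterlim_split_at by blast
qed

lemma exp_ramp_deriv:
  "(exp_ramp j has_real_derivative (- real j * exp_ramp (Suc j) t + exp_ramp (Suc (Suc j)) t)) (at t)"
proof -
  consider "t > 0" | "t < 0" | "t = 0" by linarith
  then show ?thesis
  proof cases
    case 1
    have "((\<lambda>t. exp (- inverse t) * inverse t ^ j) has_real_derivative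
        (- real j * exp_ramp (Suc j) t + exp_ramp (Suc (Suc j)) t)) (at t)"
      using 1
      apply (auto intro!: derivative_eq_intros simp: exp_ramp_def)
      apply (cases j; simp add: field_simps power2_eq_square)
      done
    then show ?thesis
      by (rule has_field_derivative_transform_within_open[of _ _ _ "{0<..}"]) (use 1 in \<open>auto simp: exp_ramp_def\<close>)
  next
    case 2
    have "((\<lambda>t. 0) has_real_derivative (- real j * exp_ramp (Suc j) t + exp_ramp (Suc (Suc j)) t)) (at t)"
      using 2 by (auto simp: exp_ramp_def)
    then show ?thesis
      by (rule has_field_derivative_transform_within_open[of _ _ _ "{..<0}"]) (use 2 in \<open>auto simp: exp_ramp_def\<close>)
  next
    case 3
    \<comment> \<open>At 0 the difference quotient of \<open>exp_ramp j\<close> is itself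
      \<open>exp_ramp (Suc j)\<close>, so its limit is already known.\<close>
    have "((\<lambda>h. exp_ramp (Suc j) h) \<longlongrightarrow> 0) (at 0)" by (rule exp_ramp_tendsto_0)
    then have "((\<lambda>h. (exp_ramp j (0 + h) - exp_ramp j 0) / h) \<longlongrightarrow> 0) (at 0)"
      by (rule Lim_transform_eventually) (auto simp: exp_ramp_def eventually_at_filter divide_inverse)
    then show ?thesis using 3 by (simp add: DERIV_def) (simp add: exp_ramp_def)
  qed
qed

text \<open>If \<open>a\<close> lies below \<open>b\<close> in every coordinate, a factor is
  positive exactly when that coordinate of \<open>x\<close> is strictly between those of
  \<open>a\<close> and \<open>b\<close>. The support is thus a box, the shape of set on which
  integrals are tested later.\<close>

definition bump :: "'a::euclidean_space \<Rightarrow> 'a \<Rightarrow> 'a \<Rightarrow> real" where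
  "bump a b x = (\<Prod>i\<in>Basis. exp_ramp 0 ((x \<bullet> i - a \<bullet> i) * (b \<bullet> i - x \<bullet> i)))"

lemma C_k_bump: "C_k k (bump a b)"
proof -
  have q: "C_k k (\<lambda>x. (x \<bullet> i + - (a \<bullet> i)) * (b \<bullet> i + (-1) * (x \<bullet> i)))" for i k
    by (rule C_k_mult[OF C_k_add[OF C_k_inner C_k_const] C_k_add[OF C_k_const C_k_mult[OF C_k_const C_k_inner]]])
  have "C_k k (\<lambda>x. exp_ramp 0 ((x \<bullet> i + - (a \<bullet> i)) * (b \<bullet> i + (-1) * (x \<bullet> i))))" for i
    by (rule C_k_compose[where \<theta>=exp_ramp and \<alpha>="\<lambda>j. - real j" and q="\<lambda>x. (x \<bullet> i + - (a \<bullet> i)) * (b \<bullet> i + (-1) * (x \<bullet> i))", OF exp_ramp_deriv q])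
  from C_k_prod[of Basis, OF this] show ?thesis by (simp add: bump_def[abs_def])
qed

lemma exp_ramp_0_pos: "0 < exp_ramp 0 t \<longleftrightarrow> 0 < t" "0 \<le> exp_ramp j t" "exp_ramp 0 t = 0 \<longleftrightarrow> t \<le> 0"
  by (auto simp: exp_ramp_def)

lemma bump_nonneg: "0 \<le> bump a b x"
  unfolding bump_def by (intro prod_nonneg) (auto simp: exp_ramp_0_pos)

lemma bump_pos_iff:
  assumes "\<And>i. i \<in> Basis \<Longrightarrow> a \<bullet> i \<le> b \<bullet> i"
  shows "0 < bump a b x \<longleftrightarrow> x \<in> box a b"
proof -
  have "0 < bump a b x \<longleftrightarrow> (\<forall>i\<in>Basis. 0 < exp_ramp 0 ((x \<bullet> i - a \<bullet> i) * (b \<bullet> i - x \<bullet> i)))"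
    unfolding bump_def
    by (metis (no_types, lifting) exp_ramp_0_pos(2) finite_Basis less_eq_real_def prod_pos prod_zero_iff order_less_irrefl)
  also have "\<dots> \<longleftrightarrow> (\<forall>i\<in>Basis. a \<bullet> i < x \<bullet> i \<and> x \<bullet> i < b \<bullet> i)"
  proof (intro ball_cong refl)
    fix i :: 'a assume i: "i \<in> Basis"
    show "(0 < exp_ramp 0 ((x \<bullet> i - a \<bullet> i) * (b \<bullet> i - x \<bullet> i))) = (a \<bullet> i < x \<bullet> i \<and> x \<bullet> i < b \<bullet> i)"
      using assms[OF i] by (auto simp: exp_ramp_0_pos zero_less_mult_iff)
  qed
  finally show ?thesis by (simp add: box_def)
qed

lemma C_k_exp:
  fixes q :: "'a::euclidean_space \<Rightarrow> real"
  assumes q: "\<And>k. C_k k q"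
  shows "C_k k (\<lambda>x. exp (q x))"
  by (rule C_k_compose[where \<theta>="\<lambda>_. exp" and \<alpha>="\<lambda>_. 0" and q=q]) (simp_all add: q)

section \<open>Test functions\<close>

lemma test_functionsD:
  assumes "f \<in> test_functions \<U>"
  shows "\<And>k. C_k k f" "\<And>x. f differentiable (at x)" "continuous_on UNIV f" "continuous_on UNIV (grad f)"
    "\<And>x. (f has_derivative (\<lambda>h. h \<bullet> grad f x)) (at x)" "\<And>x. x \<notin> \<U> \<Longrightarrow> f x = 0"
proof -
  show C: "C_k k f" for k using assms by (auto simp: test_functions_def)
  from C[of "Suc 0"] show d: "f differentiable (at x)" for x by simp
  from C[of 0] show "continuous_on UNIV f" by simp
  have "continuous_on UNIV (\<lambda>x. \<Sum>b\<in>Basis. frechet_derivative f (at x) b *\<^sub>R b)"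
    using C[of "Suc 0"] by (auto intro!: continuous_intros)
  then show "continuous_on UNIV (grad f)" using differentiable_grad(2)[OF d] by (simp add: fun_eq_iff cong: continuous_on_cong)
  show "(f has_derivative (\<lambda>h. h \<bullet> grad f x)) (at x)" for x using d differentiable_grad(1) by blast
  show "f x = 0" if "x \<notin> \<U>" for x using assms that by (auto simp: test_functions_def)
qed

lemma test_functions_support:
  assumes "f \<in> test_functions \<U>"
  obtains K where "compact K" "K \<subseteq> \<U>" "\<And>x. x \<notin> K \<Longrightarrow> f x = 0" "\<And>x. x \<notin> K \<Longrightarrow> grad f x = 0"
proof -
  obtain K where K: "compact K" "K \<subseteq> \<U>" "\<And>x. x \<notin> K \<Longrightarrow> f x = 0"
    using assms by (auto simp: test_functions_def)
  have "grad f x = 0" if "x \<notin> K" for x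
  proof (rule grad_eqI)
    have "open (- K)" using K compact_imp_closed by blast
    then show "(f has_derivative (\<lambda>h. h \<bullet> 0)) (at x)"
      using has_derivative_transform_within_open[of "\<lambda>_. 0" "\<lambda>h. h \<bullet> 0" x UNIV "- K" f] K that by auto
  qed
  with K that show ?thesis by blast
qed

lemma grad_lincomb:
  fixes f g :: "'a::euclidean_space \<Rightarrow> real"
  assumes "f differentiable (at x)" "g differentiable (at x)"
  shows "grad (\<lambda>x. c * f x + d * g x) x = c *\<^sub>R grad f x + d *\<^sub>R grad g x"
  by (rule grad_eqI)
     (auto intro!: derivative_eq_intros differentiable_grad(1) assms simp: inner_add_right)

lemma test_functions_lincomb:
  assumes "f \<in> test_functions \<U>" "g \<in> test_functions \<U>"
  shows "(\<lambda>x. c * f x + d * g x) \<in> test_functions \<U>"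
proof -
  obtain K where "compact K" "K \<subseteq> \<U>" "\<And>x. x \<notin> K \<Longrightarrow> f x = 0" by (rule test_functions_support[OF assms(1)]) blast
  moreover obtain K' where "compact K'" "K' \<subseteq> \<U>" "\<And>x. x \<notin> K' \<Longrightarrow> g x = 0" by (rule test_functions_support[OF assms(2)]) blast
  ultimately have "compact (K \<union> K') \<and> K \<union> K' \<subseteq> \<U> \<and> (\<forall>x. x \<notin> K \<union> K' \<longrightarrow> c * f x + d * g x = 0)" by auto
  then show ?thesis unfolding test_functions_def
    by (auto intro!: C_k_add C_k_mult C_k_const test_functionsD(1)[OF assms(1)] test_functionsD(1)[OF assms(2)])
qed

lemma test_functionsI:
  "(\<And>k. C_k k f) \<Longrightarrow> compact K \<Longrightarrow> K \<subseteq> \<U> \<Longrightarrow> (\<And>x. x \<notin> K \<Longrightarrow> f x = 0) \<Longrightarrow> f \<in> test_functions \<U>"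
  unfolding test_functions_def by blast

lemma bump_eq_0:
  assumes "\<And>i. i \<in> Basis \<Longrightarrow> a \<bullet> i \<le> b \<bullet> i" "x \<notin> box a b"
  shows "bump a b x = 0"
  using bump_pos_iff[of a b x] bump_nonneg[of a b x] assms by force

section \<open>The spaces L2\<close>

lemma L2D:
  assumes "v \<in> L2 \<U>"
  shows "v \<in> borel_measurable (lebesgue_on \<U>)" "integrable (lebesgue_on \<U>) (\<lambda>x. (norm (v x))\<^sup>2)"
  using assms by (auto simp: L2_def)

lemma L2_norm_nonneg: "0 \<le> L2_norm \<U> v"
  by (simp add: L2_norm_def)

lemma L2_norm_power2: "(L2_norm \<U> v)\<^sup>2 = (LINT x|lebesgue_on \<U>. (norm (v x))\<^sup>2)"
  by (simp add: L2_norm_def)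

lemma L2_norm_mult_integrable:
  assumes "u \<in> L2 \<U>" "v \<in> L2 \<U>"
  shows "integrable (lebesgue_on \<U>) (\<lambda>x. norm (u x) * norm (v x))"
proof (rule Bochner_Integration.integrable_bound)
  show "integrable (lebesgue_on \<U>) (\<lambda>x. (norm (u x))\<^sup>2 + (norm (v x))\<^sup>2)"
    using assms by (auto dest: L2D)
  show "(\<lambda>x. norm (u x) * norm (v x)) \<in> borel_measurable (lebesgue_on \<U>)"
    using assms[THEN L2D(1)] by measurable
  have "a * b \<le> a\<^sup>2 + b\<^sup>2" if "0 \<le> a" "0 \<le> b" for a b :: real
    using sum_squares_bound[of a b] mult_nonneg_nonneg[OF that] by linarith
  then show "AE x in lebesgue_on \<U>. norm (norm (u x) * norm (v x)) \<le> norm ((norm (u x))\<^sup>2 + (norm (v x))\<^sup>2)"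
    by (intro AE_I2) auto
qed

text \<open>Cauchy-Schwarz from the nonnegative quadratic a - 2tc + t^2 b, evaluated at its minimum
  t = c / b. If b = 0, it is linear in t and would be -1 at t = (a + 1) / (2c). The norms allow one
  factor to be scalar and the other a vector.\<close>

lemma L2_norm_mult_le:
  assumes "u \<in> L2 \<U>" "v \<in> L2 \<U>"
  shows "(LINT x|lebesgue_on \<U>. norm (u x) * norm (v x)) \<le> L2_norm \<U> u * L2_norm \<U> v"
proof -
  let ?M = "lebesgue_on \<U>"
  define a b c where "a = (LINT x|?M. (norm (u x))\<^sup>2)" and "b = (LINT x|?M. (norm (v x))\<^sup>2)"
    and "c = (LINT x|?M. norm (u x) * norm (v x))"
  note int = L2D(2)[OF assms(1)] L2D(2)[OF assms(2)] L2_norm_mult_integrable[OF assms]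
  have pos: "0 \<le> a - 2 * t * c + t\<^sup>2 * b" for t
  proof -
    have "0 \<le> (LINT x|?M. (norm (u x) - t * norm (v x))\<^sup>2)" by simp
    also have "\<dots> = (LINT x|?M. (norm (u x))\<^sup>2 - (2 * t) * (norm (u x) * norm (v x)) + t\<^sup>2 * (norm (v x))\<^sup>2)"
      by (simp add: power2_eq_square algebra_simps)
    also have "\<dots> = a - 2 * t * c + t\<^sup>2 * b"
      unfolding a_def b_def c_def using int by simp
    finally show ?thesis .
  qed
  have nn: "0 \<le> a" "0 \<le> b" "0 \<le> c" by (auto simp: a_def b_def c_def)
  have "c\<^sup>2 \<le> a * b"
  proof (cases "b = 0")
    case True
    have "c = 0"
    proof (rule ccontr)
      assume "c \<noteq> 0"
      then have "0 \<le> a - 2 * ((a + 1) / (2 * c)) * c" using pos[of "(a + 1) / (2 * c)"] True by simp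
      then show False using \<open>c \<noteq> 0\<close> by (simp add: field_simps)
    qed
    then show ?thesis using True by simp
  next
    case False
    then have "b > 0" using nn by simp
    then show ?thesis using pos[of "c / b"] by (simp add: field_simps power2_eq_square)
  qed
  then have "c \<le> sqrt (a * b)" using nn real_le_rsqrt by blast
  then show ?thesis by (simp add: a_def b_def c_def L2_norm_def real_sqrt_mult)
qed

lemma L2_inner_integrable:
  assumes "u \<in> L2 \<U>" "v \<in> L2 \<U>"
  shows "integrable (lebesgue_on \<U>) (\<lambda>x. u x \<bullet> v x)"
  by (rule Bochner_Integration.integrable_bound[OF L2_norm_mult_integrable[OF assms]])
     (use assms[THEN L2D(1)] Cauchy_Schwarz_ineq2 in auto)

lemma L2_Cauchy_Schwarz:
  assumes "u \<in> L2 \<U>" "v \<in> L2 \<U>"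
  shows "\<bar>LINT x|lebesgue_on \<U>. u x \<bullet> v x\<bar> \<le> L2_norm \<U> u * L2_norm \<U> v"
proof -
  have "\<bar>LINT x|lebesgue_on \<U>. u x \<bullet> v x\<bar> \<le> (LINT x|lebesgue_on \<U>. norm (u x \<bullet> v x))"
    using integral_norm_bound[of "lebesgue_on \<U>" "\<lambda>x. u x \<bullet> v x"] by simp
  also have "\<dots> \<le> (LINT x|lebesgue_on \<U>. norm (u x) * norm (v x))"
    by (rule integral_mono[OF integrable_norm[OF L2_inner_integrable[OF assms]] L2_norm_mult_integrable[OF assms]])
      (simp add: Cauchy_Schwarz_ineq2)
  also have "\<dots> \<le> L2_norm \<U> u * L2_norm \<U> v" by (rule L2_norm_mult_le[OF assms])
  finally show ?thesis .
qed

lemma L2_scaleR_integrable: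
  fixes u :: "'a::euclidean_space \<Rightarrow> real" and v :: "'a \<Rightarrow> 'b::euclidean_space"
  assumes "u \<in> L2 \<U>" "v \<in> L2 \<U>"
  shows "integrable (lebesgue_on \<U>) (\<lambda>x. u x *\<^sub>R v x)"
  by (rule Bochner_Integration.integrable_bound[OF L2_norm_mult_integrable[OF assms]])
     (use assms[THEN L2D(1)] in auto)

lemma L2_lincomb:
  assumes "u \<in> L2 \<U>" "v \<in> L2 \<U>"
  shows "(\<lambda>x. a *\<^sub>R u x + b *\<^sub>R v x) \<in> L2 \<U>"
proof -
  have m: "(\<lambda>x. a *\<^sub>R u x + b *\<^sub>R v x) \<in> borel_measurable (lebesgue_on \<U>)"
    using assms[THEN L2D(1)] by measurable
  have "integrable (lebesgue_on \<U>) (\<lambda>x. (norm (a *\<^sub>R u x + b *\<^sub>R v x))\<^sup>2)"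
  proof (rule Bochner_Integration.integrable_bound)
    show "integrable (lebesgue_on \<U>) (\<lambda>x. 2 * a\<^sup>2 * (norm (u x))\<^sup>2 + 2 * b\<^sup>2 * (norm (v x))\<^sup>2)"
      using assms[THEN L2D(2)] by auto
    have "(norm (a *\<^sub>R p + b *\<^sub>R q))\<^sup>2 \<le> 2 * a\<^sup>2 * (norm p)\<^sup>2 + 2 * b\<^sup>2 * (norm q)\<^sup>2" for p q :: 'b
    proof -
      have "(norm (a *\<^sub>R p + b *\<^sub>R q))\<^sup>2 \<le> (norm (a *\<^sub>R p) + norm (b *\<^sub>R q))\<^sup>2"
        by (intro power_mono norm_triangle_ineq) auto
      also have "\<dots> \<le> 2 * (norm (a *\<^sub>R p))\<^sup>2 + 2 * (norm (b *\<^sub>R q))\<^sup>2"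
        using sum_squares_bound[of "norm (a *\<^sub>R p)" "norm (b *\<^sub>R q)"] by (simp add: power2_sum)
      finally show ?thesis by (simp add: power_mult_distrib)
    qed
    then show "AE x in lebesgue_on \<U>. norm ((norm (a *\<^sub>R u x + b *\<^sub>R v x))\<^sup>2) \<le> norm (2 * a\<^sup>2 * (norm (u x))\<^sup>2 + 2 * b\<^sup>2 * (norm (v x))\<^sup>2)"
      by (intro AE_I2) auto
  qed (use m in measurable)
  with m show ?thesis by (simp add: L2_def)
qed

lemma L2_add: "u \<in> L2 \<U> \<Longrightarrow> v \<in> L2 \<U> \<Longrightarrow> (\<lambda>x. u x + v x) \<in> L2 \<U>"
  using L2_lincomb[of u \<U> v 1 1] by simp

lemma L2_diff: "u \<in> L2 \<U> \<Longrightarrow> v \<in> L2 \<U> \<Longrightarrow> (\<lambda>x. u x - v x) \<in> L2 \<U>"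
  using L2_lincomb[of u \<U> v 1 "-1"] by simp

lemma L2_scaleR: "u \<in> L2 \<U> \<Longrightarrow> (\<lambda>x. a *\<^sub>R u x) \<in> L2 \<U>"
  using L2_lincomb[of u \<U> u a 0] by simp

lemma L2_zero: "(\<lambda>x. 0) \<in> L2 \<U>"
  by (simp add: L2_def)

lemma L2_sum: "(\<And>i. i \<in> I \<Longrightarrow> u i \<in> L2 \<U>) \<Longrightarrow> (\<lambda>x. \<Sum>i\<in>I. u i x) \<in> L2 \<U>"
  by (induction I rule: infinite_finite_induct) (auto intro: L2_zero L2_add)

lemma L2_norm_triangle:
  assumes "u \<in> L2 \<U>" "v \<in> L2 \<U>"
  shows "L2_norm \<U> (\<lambda>x. u x + v x) \<le> L2_norm \<U> u + L2_norm \<U> v"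
proof (rule power2_le_imp_le)
  have "(L2_norm \<U> (\<lambda>x. u x + v x))\<^sup>2 = (LINT x|lebesgue_on \<U>. (norm (u x + v x))\<^sup>2)"
    by (rule L2_norm_power2)
  also have "\<dots> \<le> (LINT x|lebesgue_on \<U>. (norm (u x))\<^sup>2 + 2 * (norm (u x) * norm (v x)) + (norm (v x))\<^sup>2)"
  proof (rule integral_mono)
    show "integrable (lebesgue_on \<U>) (\<lambda>x. (norm (u x + v x))\<^sup>2)" using L2_add[OF assms] by (rule L2D)
    show "integrable (lebesgue_on \<U>) (\<lambda>x. (norm (u x))\<^sup>2 + 2 * (norm (u x) * norm (v x)) + (norm (v x))\<^sup>2)"
      using L2_norm_mult_integrable[OF assms] assms[THEN L2D(2)] by auto
    show "(norm (u x + v x))\<^sup>2 \<le> (norm (u x))\<^sup>2 + 2 * (norm (u x) * norm (v x)) + (norm (v x))\<^sup>2" for x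
      using power_mono[OF norm_triangle_ineq[of "u x" "v x"], of 2] by (simp add: power2_sum)
  qed
  also have "\<dots> = (L2_norm \<U> u)\<^sup>2 + 2 * (LINT x|lebesgue_on \<U>. norm (u x) * norm (v x)) + (L2_norm \<U> v)\<^sup>2"
    using L2_norm_mult_integrable[OF assms] assms[THEN L2D(2)] by (simp add: L2_norm_power2)
  also have "\<dots> \<le> (L2_norm \<U> u + L2_norm \<U> v)\<^sup>2"
    using L2_norm_mult_le[OF assms] by (simp add: power2_sum)
  finally show "(L2_norm \<U> (\<lambda>x. u x + v x))\<^sup>2 \<le> (L2_norm \<U> u + L2_norm \<U> v)\<^sup>2" .
qed (simp add: L2_norm_nonneg)

lemma L2_norm_scaleR: "L2_norm \<U> (\<lambda>x. a *\<^sub>R u x) = \<bar>a\<bar> * L2_norm \<U> u"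
  by (simp add: L2_norm_def power_mult_distrib real_sqrt_mult)

lemma L2_norm_minus_commute: "L2_norm \<U> (\<lambda>x. u x - v x) = L2_norm \<U> (\<lambda>x. v x - u x)"
  by (simp add: L2_norm_def norm_minus_commute)

lemma L2_norm_diff_le:
  assumes "u \<in> L2 \<U>" "v \<in> L2 \<U>"
  shows "\<bar>L2_norm \<U> u - L2_norm \<U> v\<bar> \<le> L2_norm \<U> (\<lambda>x. u x - v x)"
  using L2_norm_triangle[OF L2_diff[OF assms] assms(2)] L2_norm_triangle[OF L2_diff[OF assms(2,1)] assms(1)]
  by (simp add: L2_norm_minus_commute[of \<U> v u])

lemma L2_norm_tendsto:
  assumes "\<And>n. u n \<in> L2 \<U>" "v \<in> L2 \<U>" "(\<lambda>n. L2_norm \<U> (\<lambda>x. u n x - v x)) \<longlonglongrightarrow> 0"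
  shows "(\<lambda>n. L2_norm \<U> (u n)) \<longlonglongrightarrow> L2_norm \<U> v"
  by (rule Lim_transform_bound[THEN LIM_zero_cancel])
     (use assms L2_norm_diff_le[OF assms(1,2)] in \<open>auto intro!: always_eventually simp: L2_norm_nonneg\<close>)

lemma L2_inner_tendsto:
  assumes "\<And>n. u n \<in> L2 \<U>" "v \<in> L2 \<U>" "w \<in> L2 \<U>" "(\<lambda>n. L2_norm \<U> (\<lambda>x. u n x - v x)) \<longlonglongrightarrow> 0"
  shows "(\<lambda>n. LINT x|lebesgue_on \<U>. w x \<bullet> u n x) \<longlonglongrightarrow> (LINT x|lebesgue_on \<U>. w x \<bullet> v x)"
proof (rule LIM_zero_cancel, rule Lim_transform_bound)
  show "(\<lambda>n. L2_norm \<U> w * L2_norm \<U> (\<lambda>x. u n x - v x)) \<longlonglongrightarrow> 0"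
    using tendsto_mult_left[OF assms(4), of "L2_norm \<U> w"] by simp
  have "(LINT x|lebesgue_on \<U>. w x \<bullet> u n x) - (LINT x|lebesgue_on \<U>. w x \<bullet> v x)
      = (LINT x|lebesgue_on \<U>. w x \<bullet> (u n x - v x))" for n
    using L2_inner_integrable[OF assms(3)] assms(1,2) by (simp add: inner_diff_right)
  then show "\<forall>\<^sub>F n in sequentially. norm ((LINT x|lebesgue_on \<U>. w x \<bullet> u n x) - (LINT x|lebesgue_on \<U>. w x \<bullet> v x)) \<le> norm (L2_norm \<U> w * L2_norm \<U> (\<lambda>x. u n x - v x))"
    using L2_Cauchy_Schwarz[OF assms(3) L2_diff[OF assms(1,2)]]
    by (auto intro!: always_eventually simp: L2_norm_nonneg)
qed

lemma L2_norm_eq_0_iff: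
  assumes "v \<in> L2 \<U>"
  shows "L2_norm \<U> v = 0 \<longleftrightarrow> (AE x in lebesgue_on \<U>. v x = 0)"
  using integral_nonneg_eq_0_iff_AE[OF L2D(2)[OF assms]] by (simp add: L2_norm_def)

lemma L2_norm_cong_AE:
  assumes "u \<in> L2 \<U>" "v \<in> L2 \<U>" "AE x in lebesgue_on \<U>. u x = v x"
  shows "L2_norm \<U> u = L2_norm \<U> v"
  unfolding L2_norm_def
  by (intro arg_cong[of _ _ sqrt] integral_cong_AE borel_measurable_integrable L2D(2) assms) (use assms(3) in auto)

lemma L2_bounded:
  assumes "\<U> \<in> lmeasurable" "v \<in> borel_measurable (lebesgue_on \<U>)" "\<And>x. x \<in> \<U> \<Longrightarrow> norm (v x) \<le> B"
  shows "v \<in> L2 \<U>" "(L2_norm \<U> v)\<^sup>2 \<le> B\<^sup>2 * vol \<U>"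
proof -
  have c: "integrable (lebesgue_on \<U>) (\<lambda>x. B\<^sup>2)"
    using assms(1) by (simp add: finite_measure.integrable_const finite_measure_lebesgue_on)
  have b: "(norm (v x))\<^sup>2 \<le> B\<^sup>2" if "x \<in> \<U>" for x using assms(3)[OF that] by (intro power_mono) auto
  have i: "integrable (lebesgue_on \<U>) (\<lambda>x. (norm (v x))\<^sup>2)"
    by (rule Bochner_Integration.integrable_bound[OF c]) (use assms b in \<open>auto intro!: AE_I2\<close>)
  then show "v \<in> L2 \<U>" using assms by (simp add: L2_def)
  have "(L2_norm \<U> v)\<^sup>2 \<le> (LINT x|lebesgue_on \<U>. B\<^sup>2)"
    unfolding L2_norm_power2 by (rule integral_mono[OF i c]) (use b in auto)
  also have "\<dots> = B\<^sup>2 * vol \<U>"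
    using assms(1) by (simp add: measure_restrict_space)
  finally show "(L2_norm \<U> v)\<^sup>2 \<le> B\<^sup>2 * vol \<U>" .
qed

lemma integrable_lebesgue_on_subset:
  fixes f :: "'a::euclidean_space \<Rightarrow> 'b::{banach, second_countable_topology}"
  assumes "integrable (lebesgue_on \<U>) f" "\<U>' \<subseteq> \<U>" "\<U>' \<in> sets lebesgue" "\<U> \<in> sets lebesgue"
  shows "integrable (lebesgue_on \<U>') f"
proof -
  have "integrable lebesgue (\<lambda>x. indicator \<U>' x *\<^sub>R (indicator \<U> x *\<^sub>R f x))"
    by (rule integrable_mult_indicator) (use assms in \<open>auto simp: integrable_restrict_space\<close>)
  also have "(\<lambda>x. indicator \<U>' x *\<^sub>R (indicator \<U> x *\<^sub>R f x)) = (\<lambda>x. indicator \<U>' x *\<^sub>R f x)"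
    using assms(2) by (auto simp: indicator_def fun_eq_iff)
  finally show ?thesis using assms by (simp add: integrable_restrict_space)
qed

lemma L2_subset:
  assumes "v \<in> L2 \<U>" "\<U>' \<subseteq> \<U>" "\<U>' \<in> sets lebesgue" "\<U> \<in> sets lebesgue"
  shows "v \<in> L2 \<U>'" "L2_norm \<U>' v \<le> L2_norm \<U> v"
proof -
  have m: "v \<in> borel_measurable (lebesgue_on \<U>')"
    using assms measurable_restrict_mono[of v lebesgue \<U> borel \<U>'] L2D(1) by blast
  note j = L2D(2)[OF assms(1)]
  note i = integrable_lebesgue_on_subset[OF j assms(2-4)]
  show "v \<in> L2 \<U>'" using m i by (simp add: L2_def)
  have "(LINT x|lebesgue. indicator \<U>' x *\<^sub>R (norm (v x))\<^sup>2) \<le> (LINT x|lebesgue. indicator \<U> x *\<^sub>R (norm (v x))\<^sup>2)"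
    using i j assms by (intro integral_mono) (auto simp: integrable_restrict_space indicator_def)
  then show "L2_norm \<U>' v \<le> L2_norm \<U> v"
    unfolding L2_norm_def using assms by (simp add: integral_restrict_space)
qed

text \<open>Off a null set, the indicator of the whole set is the sum of the indicators of the
  disjoint pieces.\<close>

lemma integral_partition:
  fixes f :: "'a::euclidean_space \<Rightarrow> 'b::{banach, second_countable_topology}"
  assumes "finite F" "disjoint F" "\<And>T. T \<in> F \<Longrightarrow> T \<in> sets lebesgue" "\<And>T. T \<in> F \<Longrightarrow> T \<subseteq> \<U>"
    and \<U>: "\<U> \<in> sets lebesgue" and n: "negligible (\<U> - \<Union>F)" and f: "integrable (lebesgue_on \<U>) f"
  shows "(LINT x|lebesgue_on \<U>. f x) = (\<Sum>T\<in>F. LINT x|lebesgue_on T. f x)"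
proof -
  have fT: "integrable lebesgue (\<lambda>x. indicator T x *\<^sub>R f x)" if "T \<in> F" for T
    using integrable_lebesgue_on_subset[OF f assms(4)[OF that] assms(3)[OF that] \<U>] assms(3)[OF that]
    by (simp add: integrable_restrict_space)
  have eq: "indicator \<U> x *\<^sub>R f x = (\<Sum>T\<in>F. indicator T x *\<^sub>R f x)" if "x \<notin> \<U> - \<Union>F" for x
  proof (cases "x \<in> \<Union>F")
    case True
    then obtain T where T: "T \<in> F" "x \<in> T" by blast
    then have "x \<notin> T'" if "T' \<in> F" "T' \<noteq> T" for T' using that assms(2) by (auto simp: pairwise_def disjnt_def)
    then have "(\<Sum>T'\<in>F. indicator T' x *\<^sub>R f x) = (\<Sum>T'\<in>F. if T' = T then f x else 0)"
      using T by (intro sum.cong) (auto simp: indicator_def)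
    moreover have "x \<in> \<U>" using T assms(4) by blast
    ultimately show ?thesis using T assms(1) by (simp add: sum.delta')
  next
    case False
    then have "x \<notin> \<U>" using that by blast
    then show ?thesis using False by (auto simp: indicator_def intro!: sum.neutral[symmetric])
  qed
  have "(LINT x|lebesgue_on \<U>. f x) = (LINT x|lebesgue. indicator \<U> x *\<^sub>R f x)"
    using \<U> by (simp add: integral_restrict_space)
  also have "\<dots> = (LINT x|lebesgue. (\<Sum>T\<in>F. indicator T x *\<^sub>R f x))"
  proof (rule integral_cong_AE)
    show "(\<lambda>x. indicator \<U> x *\<^sub>R f x) \<in> borel_measurable lebesgue"
      using f \<U> by (simp add: integrable_restrict_space borel_measurable_integrable)
    show "(\<lambda>x. \<Sum>T\<in>F. indicator T x *\<^sub>R f x) \<in> borel_measurable lebesgue"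
      using fT by (intro borel_measurable_sum borel_measurable_integrable)
    have "AE x in lebesgue. x \<notin> \<U> - \<Union>F"
      using n AE_not_in negligible_iff_null_sets by blast
    then show "AE x in lebesgue. indicator \<U> x *\<^sub>R f x = (\<Sum>T\<in>F. indicator T x *\<^sub>R f x)"
      by eventually_elim (use eq in blast)
  qed
  also have "\<dots> = (\<Sum>T\<in>F. LINT x|lebesgue. indicator T x *\<^sub>R f x)"
    by (rule Bochner_Integration.integral_sum) (rule fT)
  also have "\<dots> = (\<Sum>T\<in>F. LINT x|lebesgue_on T. f x)"
    using assms(3) by (intro sum.cong) (auto simp: integral_restrict_space)
  finally show ?thesis .
qed

section \<open>Weak gradients\<close>

lemma lborel_integral_affine:
  fixes f :: "'a::euclidean_space \<Rightarrow> 'b::{banach, second_countable_topology}"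
  assumes f: "f \<in> borel_measurable borel" and c: "c \<noteq> 0"
  shows "(LINT x|lborel. f x) = \<bar>c\<bar> ^ DIM('a) *\<^sub>R (LINT x|lborel. f (t + c *\<^sub>R x))"
  using f by (subst lborel_affine[OF c, of t]) (simp add: integral_density integral_distr)

lemma lborel_nn_integral_affine:
  fixes f :: "'a::euclidean_space \<Rightarrow> ennreal"
  assumes f: "f \<in> borel_measurable borel" and c: "c \<noteq> 0"
  shows "(\<integral>\<^sup>+x. f x \<partial>lborel) = ennreal (\<bar>c\<bar> ^ DIM('a)) * (\<integral>\<^sup>+x. f (t + c *\<^sub>R x) \<partial>lborel)"
  using f by (subst lborel_affine[OF c, of t]) (simp add: nn_integral_density nn_integral_distr nn_integral_cmult)

lemma continuous_compact_support_integrable: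
  fixes u :: "'a::euclidean_space \<Rightarrow> 'b::{banach, second_countable_topology}"
  assumes "continuous_on UNIV u" "compact K" "\<And>x. x \<notin> K \<Longrightarrow> u x = 0"
  shows "integrable lborel u"
proof -
  have "(\<lambda>x. indicator K x *\<^sub>R u x) = u" using assms(3) by (auto simp: indicator_def fun_eq_iff)
  with borel_integrable_compact[OF assms(2), of u] continuous_on_subset[OF assms(1)] show ?thesis by simp
qed

lemma integrable_lborel_imp_lebesgue_on:
  fixes u :: "'a::euclidean_space \<Rightarrow> 'b::{banach, second_countable_topology}"
  assumes "integrable lborel u" "\<U> \<in> sets lebesgue"
  shows "integrable (lebesgue_on \<U>) u"
proof -
  have "integrable lebesgue u" using assms(1) integrable_completion[of u lborel] borel_measurable_integrable by blast
  then show ?thesis using assms(2) by (simp add: integrable_restrict_space integrable_mult_indicator)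
qed

lemma continuous_compact_support_L2:
  fixes u :: "'a::euclidean_space \<Rightarrow> 'b::euclidean_space"
  assumes "continuous_on UNIV u" "compact K" "\<And>x. x \<notin> K \<Longrightarrow> u x = 0" "\<U> \<in> sets lebesgue"
  shows "u \<in> L2 \<U>"
proof -
  have "u \<in> borel_measurable (lebesgue_on \<U>)"
    using assms continuous_imp_measurable_on_sets_lebesgue continuous_on_subset by blast
  moreover have "integrable (lebesgue_on \<U>) (\<lambda>x. (norm (u x))\<^sup>2)"
    by (rule integrable_lborel_imp_lebesgue_on[OF continuous_compact_support_integrable[OF _ assms(2)]])
       (use assms in \<open>auto intro!: continuous_intros\<close>)
  ultimately show ?thesis by (simp add: L2_def)
qed

lemma test_functions_L2:
  assumes "f \<in> test_functions \<U>'" "\<U> \<in> sets lebesgue"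
  shows "f \<in> L2 \<U>" "grad f \<in> L2 \<U>"
proof -
  obtain K where K: "compact K" "K \<subseteq> \<U>'" "\<And>x. x \<notin> K \<Longrightarrow> f x = 0" "\<And>x. x \<notin> K \<Longrightarrow> grad f x = 0"
    by (rule test_functions_support[OF assms(1)]) blast
  show "f \<in> L2 \<U>" "grad f \<in> L2 \<U>"
    using continuous_compact_support_L2[OF test_functionsD(3)[OF assms(1)] K(1,3) assms(2)]
      continuous_compact_support_L2[OF test_functionsD(4)[OF assms(1)] K(1,4) assms(2)] by auto
qed

lemma test_functions_lebesgue_on:
  assumes "f \<in> test_functions \<U>" "\<U> \<in> sets lebesgue"
  shows "(LINT x|lebesgue_on \<U>. (norm (f x))\<^sup>2) = (LINT x|lborel. (f x)\<^sup>2)"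
    and "(LINT x|lebesgue_on \<U>. (norm (grad f x))\<^sup>2) = (LINT x|lborel. (norm (grad f x))\<^sup>2)"
proof -
  obtain K where K: "compact K" "K \<subseteq> \<U>" "\<And>x. x \<notin> K \<Longrightarrow> f x = 0" "\<And>x. x \<notin> K \<Longrightarrow> grad f x = 0"
    by (rule test_functions_support[OF assms(1)]) blast
  have *: "(LINT x|lebesgue_on \<U>. u x) = (LINT x|lborel. u x)"
    if "continuous_on UNIV u" "\<And>x. x \<notin> K \<Longrightarrow> u x = 0" for u :: "'a \<Rightarrow> real"
  proof -
    have "(LINT x|lebesgue_on \<U>. u x) = (LINT x|lebesgue. indicator \<U> x *\<^sub>R u x)"
      using assms(2) by (simp add: integral_restrict_space)
    also have "(\<lambda>x. indicator \<U> x *\<^sub>R u x) = u" using K(2) that(2) by (auto simp: indicator_def fun_eq_iff)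
    also have "(LINT x|lebesgue. u x) = (LINT x|lborel. u x)"
      using that(1) by (intro integral_completion) (simp add: borel_measurable_continuous_onI)
    finally show ?thesis .
  qed
  show "(LINT x|lebesgue_on \<U>. (norm (f x))\<^sup>2) = (LINT x|lborel. (f x)\<^sup>2)"
    using *[of "\<lambda>x. (f x)\<^sup>2"] K test_functionsD[OF assms(1)] by (simp add: continuous_intros)
  show "(LINT x|lebesgue_on \<U>. (norm (grad f x))\<^sup>2) = (LINT x|lborel. (norm (grad f x))\<^sup>2)"
    by (rule *) (use K test_functionsD[OF assms(1)] in \<open>auto intro!: continuous_intros\<close>)
qed

lemma L2_dominated_convergence:
  fixes s :: "nat \<Rightarrow> 'a::euclidean_space \<Rightarrow> 'b::euclidean_space"
  assumes \<U>: "\<U> \<in> lmeasurable" and m: "\<And>n. s n \<in> borel_measurable (lebesgue_on \<U>)"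
    and b: "\<And>n x. x \<in> \<U> \<Longrightarrow> norm (s n x) \<le> B" and l: "AE x in lebesgue_on \<U>. (\<lambda>n. s n x) \<longlonglongrightarrow> 0"
  shows "(\<lambda>n. L2_norm \<U> (s n)) \<longlonglongrightarrow> 0"
proof -
  have "(\<lambda>n. LINT x|lebesgue_on \<U>. (norm (s n x))\<^sup>2) \<longlonglongrightarrow> (LINT x|lebesgue_on \<U>. 0)"
  proof (rule integral_dominated_convergence[where w="\<lambda>_. B\<^sup>2"])
    show "integrable (lebesgue_on \<U>) (\<lambda>x. B\<^sup>2)"
      using \<U> by (simp add: finite_measure.integrable_const finite_measure_lebesgue_on)
    show "AE x in lebesgue_on \<U>. (\<lambda>n. (norm (s n x))\<^sup>2) \<longlonglongrightarrow> 0"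
      using l by eventually_elim (auto intro!: tendsto_eq_intros)
    show "AE x in lebesgue_on \<U>. norm ((norm (s n x))\<^sup>2) \<le> B\<^sup>2" for n
      using b by (intro AE_I2) (auto intro!: power_mono)
  qed (use m in auto)
  then show ?thesis unfolding L2_norm_def using tendsto_real_sqrt by fastforce
qed

text \<open>Where the bump vanishes the function is 0, and where it is positive the exponential
  decays to 0. So the indicator of the open box is a limit of test functions that it dominates
  itself.\<close>

lemma smooth_approx_indicator_box:
  assumes "cbox a b \<subseteq> \<U>" "\<And>i. i \<in> Basis \<Longrightarrow> a \<bullet> i \<le> b \<bullet> i"
  shows "(\<lambda>x. 1 - exp (- real n * bump a b x)) \<in> test_functions \<U>"
    and "(\<lambda>n. 1 - exp (- real n * bump a b x)) \<longlonglongrightarrow> indicator (box a b) x"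
    and "\<bar>1 - exp (- real n * bump a b x)\<bar> \<le> indicator (box a b) x"
proof -
  have C: "C_k k (\<lambda>x. 1 + (-1) * exp (- real n * bump a b x))" for k
    by (intro C_k_add C_k_mult C_k_const C_k_exp C_k_bump)
  show "(\<lambda>x. 1 - exp (- real n * bump a b x)) \<in> test_functions \<U>"
  proof (rule test_functionsI[where K="cbox a b"])
    show "1 - exp (- real n * bump a b x) = 0" if "x \<notin> cbox a b" for x
      using bump_eq_0[OF assms(2), of x] that box_subset_cbox by fastforce
  qed (use C assms in auto)
  show "(\<lambda>n. 1 - exp (- real n * bump a b x)) \<longlonglongrightarrow> indicator (box a b) x"
  proof (cases "x \<in> box a b")
    case True
    then have "0 < bump a b x" using bump_pos_iff[OF assms(2)] by blast
    then have "(\<lambda>n. exp (- (real n * bump a b x))) \<longlonglongrightarrow> 0"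
      using LIMSEQ_power_zero[of "exp (- bump a b x)"] by (simp flip: exp_of_nat_mult)
    from tendsto_diff[OF tendsto_const this, of 1] show ?thesis using True by simp
  next
    case False
    then show ?thesis using bump_eq_0[OF assms(2)] by simp
  qed
  show "\<bar>1 - exp (- real n * bump a b x)\<bar> \<le> indicator (box a b) x"
    using bump_eq_0[OF assms(2), of x] bump_nonneg[of a b x] by (cases "x \<in> box a b") auto
qed

text \<open>Dominated convergence along the smooth approximations of indicators shows that
  \<open>h\<close> has integral 0 over every box in \<U>. Lebesgue differentiation over shrinking
  cubes then gives \<open>h x = 0\<close> for almost all \<open>x\<close>.\<close>

lemma fundamental_lemma:
  fixes h :: "'a::euclidean_space \<Rightarrow> real"
  assumes \<U>: "open \<U>" and h: "h \<in> L2 \<U>"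
    and z: "\<And>f. f \<in> test_functions \<U> \<Longrightarrow> (LINT x|lebesgue_on \<U>. f x * h x) = 0"
  shows "AE x in lebesgue_on \<U>. h x = 0"
proof -
  have sl: "\<U> \<in> sets lebesgue" using \<U> by auto
  \<comment> \<open>The extension by zero, so that differentiation of integrals on the whole space
    applies.\<close>
  define k where "k x = indicator \<U> x * h x" for x
  have k_int: "set_integrable lebesgue (cbox a b) k" for a b
  proof -
    have "(\<lambda>x. 1::real) \<in> L2 (\<U> \<inter> cbox a b)"
      using sl fmeasurable_Int_fmeasurable[OF lmeasurable_cbox[of a b] sl]
      by (intro L2_bounded(1)[where B=1]) (auto simp: Int_commute)
    moreover have "h \<in> L2 (\<U> \<inter> cbox a b)" by (rule L2_subset[OF h]) (use sl in auto)
    ultimately have "integrable (lebesgue_on (\<U> \<inter> cbox a b)) h"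
      using L2_inner_integrable[of "\<lambda>x. 1::real" "\<U> \<inter> cbox a b" h] by simp
    moreover have "(\<lambda>x. indicator (\<U> \<inter> cbox a b) x *\<^sub>R h x) = (\<lambda>x. indicator (cbox a b) x *\<^sub>R k x)"
      by (auto simp: k_def indicator_def)
    moreover have "\<U> \<inter> cbox a b \<in> sets lebesgue" using sl by auto
    ultimately show ?thesis by (simp add: integrable_restrict_space set_integrable_def)
  qed
  have k0: "integral (cbox a b) k = 0" if "cbox a b \<subseteq> \<U>" "\<And>i. i \<in> Basis \<Longrightarrow> a \<bullet> i \<le> b \<bullet> i" for a b
  proof -
    let ?s = "\<lambda>n x. (1 - exp (- real n * bump a b x))"
    have "(\<lambda>n. LINT x|lebesgue. ?s n x * k x) \<longlonglongrightarrow> (LINT x|lebesgue. indicator (box a b) x * k x)"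
    proof (rule integral_dominated_convergence[where w="\<lambda>x. \<bar>indicator (cbox a b) x *\<^sub>R k x\<bar>"])
      have km: "k \<in> borel_measurable lebesgue"
        using L2D(1)[OF h] sl by (simp add: borel_measurable_restrict_space_iff k_def[abs_def])
      have "continuous_on UNIV (?s n)" for n
        using test_functionsD(3)[OF smooth_approx_indicator_box(1)[OF that]] .
      then have "?s n \<in> borel_measurable lebesgue" for n
        by (intro measurable_completion) (simp add: borel_measurable_continuous_onI)
      then show "(\<lambda>x. ?s n x * k x) \<in> borel_measurable lebesgue" for n using km by simp
      show "(\<lambda>x. indicator (box a b) x * k x) \<in> borel_measurable lebesgue"
        by (intro borel_measurable_times km borel_measurable_indicator) auto
      show "integrable lebesgue (\<lambda>x. \<bar>indicator (cbox a b) x *\<^sub>R k x\<bar>)"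
        using k_int unfolding set_integrable_def by (rule integrable_abs)
      show "AE x in lebesgue. (\<lambda>n. ?s n x * k x) \<longlonglongrightarrow> indicator (box a b) x * k x"
        using smooth_approx_indicator_box(2)[OF that] by (intro AE_I2 tendsto_mult) auto
      show "AE x in lebesgue. norm (?s n x * k x) \<le> \<bar>indicator (cbox a b) x *\<^sub>R k x\<bar>" for n
      proof (intro AE_I2)
        fix x
        have "\<bar>?s n x\<bar> \<le> indicator (cbox a b) x"
          using box_subset_cbox[of a b]
          by (intro order_trans[OF smooth_approx_indicator_box(3)[OF that]]) (auto simp: indicator_def)
        then show "norm (?s n x * k x) \<le> \<bar>indicator (cbox a b) x *\<^sub>R k x\<bar>"
          by (simp add: abs_mult mult_right_mono)
      qed
    qed
    moreover have "(LINT x|lebesgue. ?s n x * k x) = 0" for n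
      using z[OF smooth_approx_indicator_box(1)[OF that], of n] sl
      by (simp add: integral_restrict_space k_def mult_ac)
    ultimately have "(LINT x|lebesgue. indicator (box a b) x * k x) = 0"
      by (simp add: LIMSEQ_const_iff)
    then have "integral (box a b) k = 0"
      using set_lebesgue_integral_eq_integral[of "box a b" k] set_integrable_subset[OF k_int[of a b], of "box a b"] box_subset_cbox[of a b]
      by (simp add: set_lebesgue_integral_def)
    then show ?thesis by (simp add: integral_open_interval)
  qed
  obtain N where N: "negligible N" "\<And>x e. \<lbrakk>x \<notin> N; 0 < e\<rbrakk> \<Longrightarrow>
      \<exists>d>0. \<forall>t. 0 < t \<and> t < d \<longrightarrow> norm (integral (cbox x (x + t *\<^sub>R One)) k /\<^sub>R t ^ DIM('a) - k x) < e"
    by (rule integrable_ccontinuous_explicit[of k, OF set_lebesgue_integral_eq_integral(1)[OF k_int]]) blast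
  have "k x = 0" if xN: "x \<notin> N" "x \<in> \<U>" for x
  proof (rule ccontr)
    assume "k x \<noteq> 0"
    then obtain d where d: "d > 0" "\<And>t. 0 < t \<Longrightarrow> t < d \<Longrightarrow> norm (integral (cbox x (x + t *\<^sub>R One)) k /\<^sub>R t ^ DIM('a) - k x) < \<bar>k x\<bar>"
      using N(2)[OF xN(1), of "\<bar>k x\<bar>"] by auto
    obtain r where r: "r > 0" "ball x r \<subseteq> \<U>" using \<U> xN openE by blast
    define n1 where "n1 = norm (One :: 'a)"
    have n1: "n1 \<ge> 0" by (simp add: n1_def)
    \<comment> \<open>A side length below the differentiation threshold \<open>d\<close> for which
      the cube at \<open>x\<close>, with diagonal \<open>t * n1\<close>, stays inside the ball
      contained in \<U>.\<close>
    define t where "t = min (d / 2) (r / (2 * (n1 + 1)))"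
    have "t \<le> d / 2" unfolding t_def by (rule min.cobounded1)
    then have t: "0 < t" "t < d" using d(1) r(1) n1 by (auto simp: t_def)
    have "t * n1 < r"
    proof -
      have "0 < n1 * r + r * 2" using n1 r(1) by (intro add_nonneg_pos) auto
      then have "r / (2 * (n1 + 1)) * n1 < r" using n1 r(1) by (simp add: field_simps)
      moreover have "t * n1 \<le> r / (2 * (n1 + 1)) * n1" using n1 by (intro mult_right_mono) (auto simp: t_def)
      ultimately show ?thesis by linarith
    qed
    have "cbox x (x + t *\<^sub>R One) \<subseteq> ball x r"
    proof
      fix y assume y: "y \<in> cbox x (x + t *\<^sub>R One)"
      have "norm (y - x) \<le> norm (t *\<^sub>R One :: 'a)"
        by (rule norm_le_componentwise) (use y t in \<open>auto simp: mem_box inner_diff_left inner_add_left\<close>)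
      also have "\<dots> = t * n1" using t by (simp add: n1_def)
      finally show "y \<in> ball x r" using \<open>t * n1 < r\<close> by (simp add: dist_norm norm_minus_commute)
    qed
    then have "integral (cbox x (x + t *\<^sub>R One)) k = 0"
      by (intro k0) (use r t in \<open>auto simp: inner_add_left\<close>)
    with d(2)[OF t] show False by simp
  qed
  moreover have "AE x in lebesgue. x \<notin> N" using N(1) AE_not_in negligible_iff_null_sets by blast
  ultimately have "AE x in lebesgue. x \<in> \<U> \<longrightarrow> h x = 0"
    by (auto simp: k_def indicator_def elim!: eventually_mono)
  then show ?thesis using sl by (simp add: AE_restrict_space_iff)
qed

lemma weak_gradient_unique:
  assumes \<U>: "open \<U>" and g: "g \<in> L2 \<U>" "has_weak_gradient \<U> v g" and g': "g' \<in> L2 \<U>" "has_weak_gradient \<U> v g'"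
  shows "AE x in lebesgue_on \<U>. g x = g' x"
proof -
  have sl: "\<U> \<in> sets lebesgue" using \<U> by auto
  have "AE x in lebesgue_on \<U>. (g x - g' x) \<bullet> b = 0" if "b \<in> Basis" for b
  proof (rule fundamental_lemma[OF \<U>])
    have d: "(\<lambda>x. g x - g' x) \<in> L2 \<U>" using g g' by (intro L2_diff)
    have m: "(\<lambda>x. (g x - g' x) \<bullet> b) \<in> borel_measurable (lebesgue_on \<U>)"
      using L2D(1)[OF d] by simp
    have "norm ((norm ((g x - g' x) \<bullet> b))\<^sup>2) \<le> norm ((norm (g x - g' x))\<^sup>2)" for x
      using power_mono[OF Basis_le_norm[OF that, of "g x - g' x"], of 2] by simp
    then have "integrable (lebesgue_on \<U>) (\<lambda>x. (norm ((g x - g' x) \<bullet> b))\<^sup>2)"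
      by (intro Bochner_Integration.integrable_bound[OF L2D(2)[OF d]] borel_measurable_power borel_measurable_norm[THEN measurable_compose[OF m]]) auto
    with m show "(\<lambda>x. (g x - g' x) \<bullet> b) \<in> L2 \<U>" by (simp add: L2_def)
    fix f assume f: "f \<in> test_functions \<U>"
    note fi = L2_scaleR_integrable[OF test_functions_L2(1)[OF f sl]]
    have "(LINT x|lebesgue_on \<U>. f x *\<^sub>R g x) = (LINT x|lebesgue_on \<U>. f x *\<^sub>R g' x)"
      using g(2)[unfolded has_weak_gradient_def, rule_format, OF f] g'(2)[unfolded has_weak_gradient_def, rule_format, OF f] by simp
    then have "(LINT x|lebesgue_on \<U>. f x *\<^sub>R (g x - g' x)) = 0"
      using fi[OF g(1)] fi[OF g'(1)] by (simp add: scaleR_diff_right)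
    then have "(LINT x|lebesgue_on \<U>. (f x *\<^sub>R (g x - g' x)) \<bullet> b) = 0"
      by (subst integral_inner_left[OF fi[OF d]]) simp
    then show "(LINT x|lebesgue_on \<U>. f x * ((g x - g' x) \<bullet> b)) = 0" by simp
  qed
  then have "AE x in lebesgue_on \<U>. \<forall>b\<in>Basis. (g x - g' x) \<bullet> b = 0"
    by (intro AE_finite_allI) auto
  then show ?thesis by eventually_elim (metis euclidean_all_zero_iff eq_iff_diff_eq_0)
qed

section \<open>Lipschitz functions\<close>

lemma AE_lborel_not_in_negligible: "negligible Z \<Longrightarrow> AE x in lborel. x \<notin> Z"
  using AE_not_in[of Z lebesgue] by (simp add: negligible_iff_null_sets AE_completion_iff)

lemma integral_lebesgue_on_eq_lborel:
  fixes h :: "'a::euclidean_space \<Rightarrow> 'b::{banach, second_countable_topology}"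
  assumes "h \<in> borel_measurable borel" "\<U> \<in> sets lebesgue" "\<And>x. x \<notin> \<U> \<Longrightarrow> h x = 0"
  shows "(LINT x|lebesgue_on \<U>. h x) = (LINT x|lborel. h x)"
proof -
  have "(LINT x|lebesgue_on \<U>. h x) = (LINT x|lebesgue. indicator \<U> x *\<^sub>R h x)"
    using assms(2) by (simp add: integral_restrict_space)
  also have "(\<lambda>x. indicator \<U> x *\<^sub>R h x) = h" using assms(3) by (auto simp: indicator_def fun_eq_iff)
  also have "(LINT x|lebesgue. h x) = (LINT x|lborel. h x)"
    using assms(1) by (intro integral_completion) simp
  finally show ?thesis .
qed

lemma directional_derivative_LIMSEQ:
  fixes f :: "'a::euclidean_space \<Rightarrow> real"
  assumes f: "(f has_derivative (\<lambda>h. h \<bullet> D)) (at x)" and c: "c \<longlonglongrightarrow> 0" "\<And>n. c n \<noteq> 0"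
  shows "(\<lambda>n. (f (x + c n *\<^sub>R b) - f x) / c n) \<longlonglongrightarrow> b \<bullet> D"
proof -
  have "((\<lambda>t. f (x + t *\<^sub>R b)) has_derivative (\<lambda>t. (t *\<^sub>R b) \<bullet> D)) (at 0)"
    by (rule has_derivative_compose[where g=f and f="\<lambda>t. x + t *\<^sub>R b"])
       (use f in \<open>auto intro!: derivative_eq_intros\<close>)
  then have "((\<lambda>t. f (x + t *\<^sub>R b)) has_real_derivative (b \<bullet> D)) (at 0)"
    by (rule has_derivative_imp_has_field_derivative) simp
  then have "((\<lambda>h. (f (x + h *\<^sub>R b) - f x) / h) \<longlongrightarrow> b \<bullet> D) (at 0)"
    by (simp add: DERIV_def)
  moreover have "filterlim c (at 0) sequentially"
    using c by (simp add: filterlim_at)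
  ultimately show ?thesis by (rule filterlim_compose)
qed

lemma LIMSEQ_inverse_Suc: "(\<lambda>n. 1 / real (Suc n)) \<longlonglongrightarrow> 0"
  using LIMSEQ_inverse_real_of_nat by (simp add: inverse_eq_divide)

text \<open>By translation invariance every difference quotient of \<open>w\<close> has integral 0.
  The Lipschitz constant dominates the quotients on a fixed ball, and off \<open>Z\<close> they
  converge to the directional derivative.\<close>

lemma integral_derivative_eq_0:
  fixes w :: "'a::euclidean_space \<Rightarrow> real"
  assumes w: "L-lipschitz_on UNIV w" and K: "compact K" "\<And>x. x \<notin> K \<Longrightarrow> w x = 0"
    and Z: "negligible Z" "\<And>x. x \<notin> Z \<Longrightarrow> (w has_derivative (\<lambda>h. h \<bullet> g x)) (at x)"
    and g: "g \<in> borel_measurable borel"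
  shows "(LINT x|lborel. g x \<bullet> b) = 0"
proof -
  define c where "c n = 1 / real (Suc n)" for n
  define s where "s n x = (w (x + c n *\<^sub>R b) - w x) / c n" for n x
  have c: "c \<longlonglongrightarrow> 0" "c n > 0" "c n \<le> 1" for n
    using LIMSEQ_inverse_Suc by (auto simp: c_def[abs_def])
  have cw: "continuous_on UNIV w" using w by (rule lipschitz_on_continuous_on)
  have iw: "integrable lborel w" by (rule continuous_compact_support_integrable[OF cw K])
  have bw: "w \<in> borel_measurable borel" using cw by (rule borel_measurable_continuous_onI)
  have tr: "(LINT x|lborel. w (x + t)) = (LINT x|lborel. w x)" for t
    using lborel_integral_affine[OF bw, of 1 t] by (simp add: add.commute)
  have it: "integrable lborel (\<lambda>x. w (x + t))" for t
  proof (rule continuous_compact_support_integrable)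
    show "continuous_on UNIV (\<lambda>x. w (x + t))"
      by (rule continuous_on_compose2[OF cw]) (auto intro!: continuous_intros)
    show "compact ((\<lambda>x. - t + x) ` K)" using K(1) by (rule compact_translation)
    show "w (x + t) = 0" if "x \<notin> (\<lambda>x. - t + x) ` K" for x
      using K(2)[of "x + t"] that by force
  qed
  have s0: "(LINT x|lborel. s n x) = 0" for n
    unfolding s_def using iw it tr by simp
  obtain R0 where R0: "K \<subseteq> cball 0 R0"
    using compact_imp_bounded[OF K(1)] by (auto simp: bounded_iff subset_iff)
  \<comment> \<open>The steps \<open>c n\<close> are at most 1, so outside of this larger ball both
    \<open>x\<close> and \<open>x + c n *\<^sub>R b\<close> avoid \<open>K\<close>.\<close>
  define R where "R = R0 + norm b"
  have "(\<lambda>n. LINT x|lborel. s n x) \<longlonglongrightarrow> (LINT x|lborel. g x \<bullet> b)"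
  proof (rule integral_dominated_convergence[where w="\<lambda>x. L * norm b * indicator (cball 0 R) x"])
    show "(\<lambda>x. g x \<bullet> b) \<in> borel_measurable lborel" using g by simp
    show "s n \<in> borel_measurable lborel" for n
      unfolding s_def using it[of "c n *\<^sub>R b"] iw by (intro borel_measurable_divide borel_measurable_diff) auto
    show "integrable lborel (\<lambda>x. L * norm b * indicator (cball 0 R) x)"
      using borel_integrable_compact[of "cball 0 R" "\<lambda>_. L * norm b"] by (simp add: mult.commute)
    show "AE x in lborel. (\<lambda>n. s n x) \<longlonglongrightarrow> g x \<bullet> b"
      using AE_lborel_not_in_negligible[OF Z(1)]
    proof eventually_elim
      case (elim x)
      have "(\<lambda>n. (w (x + c n *\<^sub>R b) - w x) / c n) \<longlonglongrightarrow> b \<bullet> g x"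
        by (rule directional_derivative_LIMSEQ[OF Z(2)[OF elim] c(1)]) (use c(2) in \<open>simp add: less_imp_neq[THEN not_sym]\<close>)
      then show ?case by (simp add: s_def inner_commute)
    qed
    show "AE x in lborel. norm (s n x) \<le> L * norm b * indicator (cball 0 R) x" for n
    proof (intro AE_I2)
      fix x
      show "norm (s n x) \<le> L * norm b * indicator (cball 0 R) x"
      proof (cases "x \<in> cball 0 R")
        case True
        have "\<bar>w (x + c n *\<^sub>R b) - w x\<bar> \<le> L * (c n * norm b)"
          using lipschitz_onD[OF w, of "x + c n *\<^sub>R b" x] c(2)[of n] by (simp add: dist_norm)
        then show ?thesis using True c(2)[of n] by (simp add: s_def field_simps)
      next
        case False
        have "norm (c n *\<^sub>R b) \<le> norm b" using c(2,3)[of n] by (simp add: mult_left_le_one_le)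
        moreover have "norm x > R0 + norm b" using False by (simp add: R_def)
        ultimately have "norm (x + c n *\<^sub>R b) > R0" "norm x > R0"
          using norm_triangle_ineq2[of x "- (c n *\<^sub>R b)"] norm_ge_zero[of b] unfolding diff_minus_eq_add norm_minus_cancel by linarith+
        then have "x + c n *\<^sub>R b \<notin> K" "x \<notin> K" using R0 by auto
        then show ?thesis using False K(2) by (simp add: s_def)
      qed
    qed
  qed
  then show ?thesis using s0 by (simp add: LIMSEQ_const_iff)
qed

lemma test_functions_bounds:
  fixes f :: "'a::euclidean_space \<Rightarrow> real"
  assumes "f \<in> test_functions \<U>"
  obtains M where "M \<ge> 0" "\<And>x. \<bar>f x\<bar> \<le> M" "\<And>x. norm (grad f x) \<le> M" "M-lipschitz_on UNIV f"
proof -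
  obtain K where K: "compact K" "K \<subseteq> \<U>" "\<And>x. x \<notin> K \<Longrightarrow> f x = 0" "\<And>x. x \<notin> K \<Longrightarrow> grad f x = 0"
    by (rule test_functions_support[OF assms]) blast
  have "bounded (f ` K)" "bounded (grad f ` K)"
    using K(1) test_functionsD(3,4)[OF assms] by (meson compact_imp_bounded compact_continuous_image continuous_on_subset top_greatest)+
  then obtain M1 M2 where M: "\<And>x. x \<in> K \<Longrightarrow> \<bar>f x\<bar> \<le> M1" "\<And>x. x \<in> K \<Longrightarrow> norm (grad f x) \<le> M2"
    unfolding bounded_iff by auto
  define M where "M = max 0 (max M1 M2)"
  have b: "M \<ge> 0" "\<bar>f x\<bar> \<le> M" "norm (grad f x) \<le> M" for x
    using M(1)[of x] M(2)[of x] K(3)[of x] K(4)[of x] by (cases "x \<in> K"; force simp: M_def)+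
  have "M-lipschitz_on UNIV f"
  proof (rule bounded_derivative_imp_lipschitz)
    show "(f has_derivative (\<lambda>h. h \<bullet> grad f x)) (at x within UNIV)" for x
      using test_functionsD(5)[OF assms] by simp
    show "onorm (\<lambda>h. h \<bullet> grad f x) \<le> M" for x
    proof (rule onorm_le)
      fix h show "norm (h \<bullet> grad f x) \<le> M * norm h"
        using Cauchy_Schwarz_ineq2[of h "grad f x"] mult_left_mono[OF b(3)[of x], of "norm h"] by (simp add: mult.commute)
    qed
  qed (use b in auto)
  with b that show ?thesis by blast
qed

lemma lipschitz_on_mult_bounded:
  fixes u f :: "'a::metric_space \<Rightarrow> real"
  assumes "Ka-lipschitz_on X u" "Kb-lipschitz_on X f" "\<And>x. x \<in> X \<Longrightarrow> \<bar>u x\<bar> \<le> M1" "\<And>x. x \<in> X \<Longrightarrow> \<bar>f x\<bar> \<le> M2" "0 \<le> M1" "0 \<le> M2"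
  shows "(M1 * Kb + M2 * Ka)-lipschitz_on X (\<lambda>x. u x * f x)"
proof (rule lipschitz_onI)
  fix x y assume xy: "x \<in> X" "y \<in> X"
  have "dist (u x * f x) (u y * f y) = \<bar>u x * (f x - f y) + f y * (u x - u y)\<bar>"
    by (simp add: dist_real_def algebra_simps)
  also have "\<dots> \<le> \<bar>u x\<bar> * \<bar>f x - f y\<bar> + \<bar>f y\<bar> * \<bar>u x - u y\<bar>"
    by (metis abs_mult abs_triangle_ineq)
  also have "\<dots> \<le> M1 * (Kb * dist x y) + M2 * (Ka * dist x y)"
    using xy assms lipschitz_onD[OF assms(1) xy] lipschitz_onD[OF assms(2) xy]
    by (intro add_mono mult_mono) (auto simp: dist_real_def)
  finally show "dist (u x * f x) (u y * f y) \<le> (M1 * Kb + M2 * Ka) * dist x y" by (simp add: algebra_simps)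
next
  show "0 \<le> M1 * Kb + M2 * Ka"
    using assms lipschitz_on_nonneg by (metis add_nonneg_nonneg mult_nonneg_nonneg)
qed

text \<open>The product of \<open>u\<close> and a test function is Lipschitz with compact support,
  so its derivative integrates to 0. The product rule splits this integral into the two sides of the
  definition of a weak gradient.\<close>

lemma has_weak_gradient_lipschitz:
  fixes u :: "'a::euclidean_space \<Rightarrow> real"
  assumes \<U>: "open \<U>" and u: "L-lipschitz_on UNIV u" "\<And>x. \<bar>u x\<bar> \<le> M"
    and Z: "negligible Z" "\<And>x. x \<notin> Z \<Longrightarrow> (u has_derivative (\<lambda>h. h \<bullet> g x)) (at x)"
    and g: "g \<in> borel_measurable borel" "\<And>x. norm (g x) \<le> G"
  shows "has_weak_gradient \<U> u g"
  unfolding has_weak_gradient_def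
proof
  fix f assume f: "f \<in> test_functions \<U>"
  have sl: "\<U> \<in> sets lebesgue" using \<U> by auto
  obtain K where K: "compact K" "K \<subseteq> \<U>" "\<And>x. x \<notin> K \<Longrightarrow> f x = 0" "\<And>x. x \<notin> K \<Longrightarrow> grad f x = 0"
    by (rule test_functions_support[OF f]) blast
  obtain F where F: "F \<ge> 0" "\<And>x. \<bar>f x\<bar> \<le> F" "\<And>x. norm (grad f x) \<le> F" "F-lipschitz_on UNIV f"
    by (rule test_functions_bounds[OF f]) blast
  have M: "0 \<le> M" using u(2)[of 0] by linarith
  have G: "0 \<le> G" using g(2)[of 0] norm_ge_zero order_trans by blast
  have cf: "f \<in> borel_measurable borel" "grad f \<in> borel_measurable borel" "u \<in> borel_measurable borel"
    using test_functionsD(3,4)[OF f] lipschitz_on_continuous_on[OF u(1)] by (auto intro: borel_measurable_continuous_onI)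
  have m1: "(\<lambda>x. u x *\<^sub>R grad f x) \<in> borel_measurable borel" and m2: "(\<lambda>x. f x *\<^sub>R g x) \<in> borel_measurable borel"
    using cf g(1) by (auto intro!: borel_measurable_scaleR)
  have ib: "integrable lborel h" if "h \<in> borel_measurable borel" "\<And>x. norm (h x) \<le> B" "\<And>x. x \<notin> K \<Longrightarrow> h x = 0" for h :: "'a \<Rightarrow> 'a" and B
  proof (rule Bochner_Integration.integrable_bound)
    show "integrable lborel (\<lambda>x. indicator K x *\<^sub>R B)"
      by (rule borel_integrable_compact[OF K(1)]) simp
    show "AE x in lborel. norm (h x) \<le> norm (indicator K x *\<^sub>R B)"
    proof (intro AE_I2)
      fix x show "norm (h x) \<le> norm (indicator K x *\<^sub>R B)"
        using that(2)[of x] that(3)[of x] by (cases "x \<in> K") auto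
    qed
  qed (use that(1) in simp)
  have i1: "integrable lborel (\<lambda>x. u x *\<^sub>R grad f x)"
    by (rule ib[OF m1, where B="M * F"]) (use u(2) F M K in \<open>auto intro!: mult_mono\<close>)
  have i2: "integrable lborel (\<lambda>x. f x *\<^sub>R g x)"
    by (rule ib[OF m2, where B="F * G"]) (use g(2) F G K in \<open>auto intro!: mult_mono\<close>)
  have "(LINT x|lborel. u x *\<^sub>R grad f x + f x *\<^sub>R g x) = 0"
  proof (rule euclidean_eqI)
    fix b :: 'a assume "b \<in> Basis"
    have "(LINT x|lborel. (u x *\<^sub>R grad f x + f x *\<^sub>R g x) \<bullet> b) = 0"
    proof (rule integral_derivative_eq_0[OF lipschitz_on_mult_bounded[OF u(1) F(4) u(2) F(2) M F(1)] K(1) _ Z(1)])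
      show "((\<lambda>x. u x * f x) has_derivative (\<lambda>h. h \<bullet> (u x *\<^sub>R grad f x + f x *\<^sub>R g x))) (at x)" if "x \<notin> Z" for x
        by (rule has_derivative_eq_rhs[OF has_derivative_mult[OF Z(2)[OF that] test_functionsD(5)[OF f]]])
           (simp add: inner_add_right fun_eq_iff mult.commute)
    qed (use K m1 m2 in auto)
    then show "(LINT x|lborel. u x *\<^sub>R grad f x + f x *\<^sub>R g x) \<bullet> b = 0 \<bullet> b"
      using integral_inner_left[of b lborel "\<lambda>x. u x *\<^sub>R grad f x + f x *\<^sub>R g x"] i1 i2 by simp
  qed
  then have "(LINT x|lborel. u x *\<^sub>R grad f x) = - (LINT x|lborel. f x *\<^sub>R g x)"
    using i1 i2 by (simp add: eq_neg_iff_add_eq_0)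
  then show "(LINT x|lebesgue_on \<U>. u x *\<^sub>R grad f x) = - (LINT x|lebesgue_on \<U>. f x *\<^sub>R g x)"
    using K by (subst (1 2) integral_lebesgue_on_eq_lborel[OF _ sl]) (use m1 m2 in auto)
qed

section \<open>Mollification\<close>

text \<open>Every derivative is moved onto \<rho> by the Leibniz rule, so continuity of
  \<open>v\<close> is enough. The induction therefore runs over all \<rho>, whose partial
  derivatives are the kernels of the next step.\<close>

lemma C_k_convolution:
  fixes v :: "'a::euclidean_space \<Rightarrow> real"
  assumes v: "continuous_on UNIV v" and \<rho>: "C_k k \<rho>"
  shows "C_k k (\<lambda>x. integral (cbox a b) (\<lambda>y. \<rho> (x - y) * v y))"
  using \<rho>
proof (induction k arbitrary: \<rho>)
  case 0
  have "continuous_on (UNIV \<times> cbox a b) (\<lambda>(x, y). \<rho> (x - y) * v y)"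
    unfolding split_def using 0 v
    by (auto intro!: continuous_intros continuous_on_compose2[of UNIV \<rho>] continuous_on_compose2[of UNIV v])
  then show ?case by (simp add: integral_continuous_on_param)
next
  case (Suc k)
  have d: "\<rho> differentiable (at x)" for x using Suc.prems by simp
  have cd: "C_k 0 (\<lambda>x. frechet_derivative \<rho> (at x) e)" if "e \<in> Basis" for e
  proof -
    have "C_k k (\<lambda>x. frechet_derivative \<rho> (at x) e)" using Suc.prems that by simp
    then show ?thesis by (cases k) (auto intro!: continuous_at_imp_continuous_on differentiable_imp_continuous_within)
  qed
  have cg: "continuous_on UNIV (grad \<rho>)"
    unfolding differentiable_grad(2)[OF d, abs_def] using cd by (auto intro!: continuous_intros)
  have c\<rho>: "continuous_on UNIV \<rho>"
    using d by (auto intro!: continuous_at_imp_continuous_on differentiable_imp_continuous_within)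
  define D where "D x y = blinfun_inner_left (v y *\<^sub>R grad \<rho> (x - y))" for x y
  have cD: "continuous_on (UNIV \<times> cbox a b) (\<lambda>(x, y). D x y)"
    unfolding split_def D_def using cg v
    by (auto intro!: continuous_intros bounded_linear.continuous_on[OF bounded_linear_blinfun_inner_left]
        continuous_on_compose2[of UNIV "grad \<rho>"] continuous_on_compose2[of UNIV v])
  have hd: "((\<lambda>x. integral (cbox a b) (\<lambda>y. \<rho> (x - y) * v y)) has_derivative integral (cbox a b) (D x0)) (at x0 within UNIV)" for x0
  proof (rule leibniz_rule[OF _ _ cD])
    fix x y
    have "((\<lambda>x. \<rho> (x - y)) has_derivative (\<lambda>h. h \<bullet> grad \<rho> (x - y))) (at x)"
      by (rule has_derivative_compose[where g=\<rho> and f="\<lambda>x. x - y", OF _ differentiable_grad(1)[OF d]])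
         (auto intro!: derivative_eq_intros)
    then show "((\<lambda>x. \<rho> (x - y) * v y) has_derivative blinfun_apply (D x y)) (at x within UNIV)"
      by (auto intro!: derivative_eq_intros simp: D_def)
    show "(\<lambda>y. \<rho> (x - y) * v y) integrable_on cbox a b"
      by (rule integrable_continuous)
         (auto intro!: continuous_intros continuous_on_compose2[OF c\<rho>] continuous_on_subset[OF v])
  qed auto
  have ap: "blinfun_apply (integral (cbox a b) (D x)) e = integral (cbox a b) (\<lambda>y. frechet_derivative \<rho> (at (x - y)) e * v y)" for x e
  proof -
    have "D x integrable_on cbox a b"
      by (rule integrable_continuous)
         (use continuous_on_compose2[OF cD, of "cbox a b" "\<lambda>y. (x, y)"] in \<open>auto simp: continuous_on_Pair\<close>)
    from integral_linear[OF this blinfun.bounded_linear_left[of e]]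
    have "blinfun_apply (integral (cbox a b) (D x)) e = integral (cbox a b) (\<lambda>y. blinfun_apply (D x y) e)"
      by (simp add: o_def)
    then show ?thesis
      using differentiable_grad(3)[OF d] by (simp add: D_def inner_commute mult.commute)
  qed
  have fd: "frechet_derivative (\<lambda>x. integral (cbox a b) (\<lambda>y. \<rho> (x - y) * v y)) (at x) = blinfun_apply (integral (cbox a b) (D x))" for x
    using frechet_derivative_at[OF hd] by simp
  show ?case
    unfolding C_k.simps fd ap
    using hd Suc.IH Suc.prems by (auto simp: differentiable_def)
qed


lemma borel_measurable_continuous_off_closed:
  fixes g :: "'a::euclidean_space \<Rightarrow> 'b::euclidean_space"
  assumes "closed Z" "continuous_on (- Z) g" "\<And>x. x \<in> Z \<Longrightarrow> g x = 0"
  shows "g \<in> borel_measurable borel"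
proof -
  have "(\<lambda>x. indicator (- Z) x *\<^sub>R g x) \<in> borel_measurable borel"
    using assms by (intro borel_measurable_continuous_on_indicator) auto
  also have "(\<lambda>x. indicator (- Z) x *\<^sub>R g x) = g" using assms(3) by (auto simp: indicator_def fun_eq_iff)
  finally show ?thesis .
qed

lemma borel_measurable_lebesgue_onI: "g \<in> borel_measurable borel \<Longrightarrow> g \<in> borel_measurable (lebesgue_on \<U>)"
  by (intro measurable_restrict_space1 measurable_completion) simp

lemma AE_lborel_reflect:
  fixes Z :: "'a::euclidean_space set"
  assumes "closed Z" "negligible Z"
  shows "AE y in lborel. x - y \<notin> Z"
proof -
  have "(\<integral>\<^sup>+y. indicator Z y \<partial>lborel) = (0::ennreal)"
    using assms by (simp add: negligible_iff_emeasure0 borel_closed)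
  then have "(\<integral>\<^sup>+y. indicator Z (x + (-1) *\<^sub>R y) \<partial>lborel) = (0::ennreal)"
    using lborel_nn_integral_affine[of "indicator Z" "-1" x] assms(1) by simp
  then have "AE y in lborel. indicator Z (x + (-1) *\<^sub>R y) = (0::ennreal)"
    by (subst (asm) nn_integral_0_iff_AE) (use assms(1) in \<open>auto intro!: measurable_compose[of _ _ borel, OF _ borel_measurable_indicator]\<close>)
  then show ?thesis by eventually_elim (auto simp: indicator_def split: if_splits)
qed

text \<open>Convolution with normalized bumps on shrinking cubes. Values converge uniformly by the
  Lipschitz bound. Gradients are bounded and converge wherever \<open>g\<close> is continuous, that
  is off \<open>Z\<close>, so dominated convergence covers them.\<close>

lemma mollifier_approximation:
  fixes v :: "'a::euclidean_space \<Rightarrow> real"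
  assumes \<U>: "open \<U>" "bounded \<U>" and v: "L-lipschitz_on UNIV v"
    and K: "compact K" "K \<subseteq> \<U>" "\<And>x. x \<notin> K \<Longrightarrow> v x = 0"
    and Z: "closed Z" "negligible Z" "\<And>x. x \<notin> Z \<Longrightarrow> (v has_derivative (\<lambda>h. h \<bullet> g x)) (at x)"
    and g: "continuous_on (- Z) g" "\<And>x. x \<in> Z \<Longrightarrow> g x = 0" "\<And>x. norm (g x) \<le> L"
    and e: "e > 0"
  shows "\<exists>f\<in>test_functions \<U>. L2_norm \<U> (\<lambda>x. f x - v x) < e \<and> L2_norm \<U> (\<lambda>x. grad f x - g x) < e"
proof -
  have L: "L \<ge> 0" using v lipschitz_on_nonneg by blast
  have sl: "\<U> \<in> sets lebesgue" and lm: "\<U> \<in> lmeasurable"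
    using \<U> by (auto simp: bounded_set_imp_lmeasurable)
  have cv: "continuous_on UNIV v" using v by (rule lipschitz_on_continuous_on)
  have bg: "g \<in> borel_measurable borel" by (rule borel_measurable_continuous_off_closed[OF Z(1) g(1,2)])
  define One' where "One' = (One :: 'a)"
  define n1 where "n1 = norm One'"
  define c where "c n = 1 / real (Suc n)" for n
  have c: "c \<longlonglongrightarrow> 0" "c n > 0" "c n \<le> 1" "c n \<noteq> 0" for n
    using LIMSEQ_inverse_Suc by (auto simp: c_def[abs_def])
  have n1: "n1 \<ge> 0" by (simp add: n1_def)
  define \<beta> where "\<beta> n = bump (- (c n *\<^sub>R One')) (c n *\<^sub>R One')" for n
  have le: "- (c n *\<^sub>R One') \<bullet> i \<le> (c n *\<^sub>R One') \<bullet> i" if "i \<in> Basis" for i n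
    using c(2)[of n] that by (simp add: One'_def)
  define B where "B n = cbox (- (c n *\<^sub>R One')) (c n *\<^sub>R One')" for n
  have \<beta>0: "\<beta> n x = 0" if "x \<notin> B n" for x n
    using that bump_eq_0[OF le, of x n] box_subset_cbox unfolding \<beta>_def B_def by blast
  have Bn: "norm x \<le> c n * n1" if "x \<in> B n" for x n
  proof -
    have "norm x \<le> norm (c n *\<^sub>R One')"
    proof (rule norm_le_componentwise)
      fix i :: 'a assume "i \<in> Basis"
      then show "\<bar>x \<bullet> i\<bar> \<le> \<bar>c n *\<^sub>R One' \<bullet> i\<bar>"
        using that c(2)[of n] by (fastforce simp: B_def mem_box One'_def)
    qed
    then show ?thesis using c(2)[of n] by (simp add: n1_def)
  qed
  have \<beta>nn: "0 \<le> \<beta> n x" for n x by (simp add: \<beta>_def bump_nonneg)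
  have cK: "continuous_on UNIV (\<beta> n)" for n using C_k_bump[of 0] by (simp add: \<beta>_def)
  have i\<beta>: "integrable lborel (\<beta> n)" for n
    by (rule continuous_compact_support_integrable[OF cK, of "B n"]) (auto simp: \<beta>0 B_def)
  define I where "I n = (LINT x|lborel. \<beta> n x)" for n
  have I: "I n > 0" for n
  proof -
    have "I n \<noteq> 0"
    proof
      assume "I n = 0"
      then have "AE x in lborel. \<beta> n x = 0"
        using integral_nonneg_eq_0_iff_AE[OF i\<beta>[of n]] \<beta>nn by (simp add: I_def)
      then have "AE x in lborel. x \<notin> box (- (c n *\<^sub>R One')) (c n *\<^sub>R One')"
      proof eventually_elim
        case (elim x)
        then show ?case using bump_pos_iff[OF le, of n x] unfolding \<beta>_def by linarith
      qed
      then have "emeasure lborel (box (- (c n *\<^sub>R One')) (c n *\<^sub>R One')) = 0"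
        by (subst (asm) AE_iff_measurable[OF _ refl]) auto
      moreover have "0 < (\<Prod>b\<in>Basis. (c n *\<^sub>R One' - - (c n *\<^sub>R One')) \<bullet> b)"
        using c(2)[of n] by (intro prod_pos) (simp add: One'_def inner_add_left)
      then have "emeasure lborel (box (- (c n *\<^sub>R One')) (c n *\<^sub>R One')) \<noteq> 0"
        using emeasure_lborel_box[OF le, of n] by (simp only: ennreal_eq_0_iff not_le not_False_eq_True)
      ultimately show False by simp
    qed
    moreover have "I n \<ge> 0" unfolding I_def using \<beta>nn by (intro Bochner_Integration.integral_nonneg)
    ultimately show ?thesis by linarith
  qed
  define \<rho> where "\<rho> n x = (1 / I n) * \<beta> n x" for n x
  have \<rho>C: "C_k k (\<rho> n)" for n k
    unfolding \<rho>_def \<beta>_def by (intro C_k_mult C_k_const C_k_bump)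
  have \<rho>nn: "\<rho> n x \<ge> 0" for n x using I[of n] by (simp add: \<rho>_def \<beta>_def bump_nonneg)
  have \<rho>c: "continuous_on UNIV (\<rho> n)" for n using \<rho>C[of 0] by simp
  have \<rho>0: "\<rho> n x = 0" if "x \<notin> B n" for n x using \<beta>0[OF that] by (simp add: \<rho>_def)
  have \<rho>1: "(LINT x|lborel. \<rho> n x) = 1" for n using I[of n] i\<beta>[of n] by (simp add: \<rho>_def flip: I_def)
  have \<rho>i: "integrable lborel (\<rho> n)" for n using i\<beta>[of n] by (simp add: \<rho>_def[abs_def])
  have \<rho>b: "\<rho> n \<in> borel_measurable borel" for n using \<rho>c by (rule borel_measurable_continuous_onI)
  have iB: "integrable lborel (\<lambda>y. \<rho> n y * h y)" if "h \<in> borel_measurable borel" "\<And>y. \<bar>h y\<bar> \<le> H" for n h H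
  proof (rule Bochner_Integration.integrable_bound[where f="\<lambda>y. \<rho> n y * H"])
    show "integrable lborel (\<lambda>y. \<rho> n y * H)" using \<rho>i by simp
    show "(\<lambda>y. \<rho> n y * h y) \<in> borel_measurable lborel" using \<rho>b that by simp
    show "AE y in lborel. norm (\<rho> n y * h y) \<le> norm (\<rho> n y * H)"
    proof (intro AE_I2)
      fix y show "norm (\<rho> n y * h y) \<le> norm (\<rho> n y * H)"
        using that(2)[of y] \<rho>nn[of n y] by (simp add: abs_mult mult_left_mono)
    qed
  qed
  \<comment> \<open>Averages against the density \<open>\<rho> n\<close>, which has integral 1 and
    lives on \<open>B n\<close>, are as close to \<open>z\<close> as the integrand is on
    \<open>B n\<close>. This is used for the values, for the bound of the gradients (with
    \<open>z = 0\<close>) and for their limits.\<close>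
  have avg: "\<bar>(LINT y|lborel. \<rho> n y * h y) - z\<bar> \<le> \<epsilon>"
    if h: "h \<in> borel_measurable borel" "\<And>y. \<bar>h y\<bar> \<le> H" and z: "\<And>y. y \<in> B n \<Longrightarrow> \<bar>h y - z\<bar> \<le> \<epsilon>" for n h H z \<epsilon>
  proof -
    have "(LINT y|lborel. \<rho> n y * h y) - z = (LINT y|lborel. \<rho> n y * h y) - (LINT y|lborel. \<rho> n y * z)"
      using \<rho>1[of n] \<rho>i[of n] by simp
    also have "\<dots> = (LINT y|lborel. \<rho> n y * h y - \<rho> n y * z)"
      using iB[OF h] \<rho>i[of n] by simp
    finally have "\<bar>(LINT y|lborel. \<rho> n y * h y) - z\<bar> \<le> (LINT y|lborel. norm (\<rho> n y * h y - \<rho> n y * z))"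
      using integral_norm_bound[of lborel "\<lambda>y. \<rho> n y * h y - \<rho> n y * z"] by simp
    also have "\<dots> \<le> (LINT y|lborel. \<rho> n y * \<epsilon>)"
    proof (rule integral_mono)
      show "integrable lborel (\<lambda>y. norm (\<rho> n y * h y - \<rho> n y * z))" using iB[OF h] \<rho>i[of n] by (intro integrable_norm Bochner_Integration.integrable_diff) auto
      show "norm (\<rho> n y * h y - \<rho> n y * z) \<le> \<rho> n y * \<epsilon>" for y
      proof (cases "y \<in> B n")
        case True
        then show ?thesis using z[OF True] \<rho>nn[of n y] by (simp add: abs_mult mult_left_mono flip: right_diff_distrib)
      qed (simp add: \<rho>0)
    qed (use \<rho>i in simp)
    also have "\<dots> = \<epsilon>" using \<rho>1[of n] \<rho>i[of n] by simp
    finally show ?thesis .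
  qed
  obtain V where V: "\<And>x. \<bar>v x\<bar> \<le> V"
  proof -
    have "bounded (v ` K)" by (meson K(1) cv compact_imp_bounded compact_continuous_image continuous_on_subset top_greatest)
    then obtain M where "\<And>x. x \<in> K \<Longrightarrow> \<bar>v x\<bar> \<le> M" unfolding bounded_iff by auto
    then have "\<bar>v x\<bar> \<le> max 0 M" for x using K(3)[of x] by (cases "x \<in> K") (auto simp: le_max_iff_disj)
    with that show ?thesis by blast
  qed
  have vxb: "(\<lambda>y. v (x - y)) \<in> borel_measurable borel" for x
    by (intro borel_measurable_continuous_onI continuous_on_compose2[OF cv]) (auto intro!: continuous_intros)
  obtain a b where ab: "K \<subseteq> cbox a b" using bounded_subset_cbox_symmetric[OF compact_imp_bounded[OF K(1)]] by blast
  \<comment> \<open>In this form, over a fixed box and with the shift on \<rho>, smoothness is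
    known. The next form has the shift on \<open>v\<close>, which is needed for all
    estimates.\<close>
  define m where "m n x = integral (cbox a b) (\<lambda>y. \<rho> n (x - y) * v y)" for n x
  have mC: "C_k k (m n)" for n k unfolding m_def by (rule C_k_convolution[OF cv \<rho>C])
  have m: "m n x = (LINT y|lborel. \<rho> n y * v (x - y))" for n x
  proof -
    let ?F = "\<lambda>y. \<rho> n (x - y) * v y"
    have cF: "continuous_on UNIV ?F"
      by (auto intro!: continuous_intros continuous_on_compose2[OF \<rho>c] cv)
    have "integrable lborel ?F" by (rule continuous_compact_support_integrable[OF cF K(1)]) (use K(3) in simp)
    then have "(?F has_integral (LINT y|lborel. ?F y)) UNIV" by (rule has_integral_integral_lborel)
    moreover have "(\<lambda>y. if y \<in> cbox a b then ?F y else 0) = ?F" using ab K(3) by (auto simp: fun_eq_iff)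
    ultimately have "m n x = (LINT y|lborel. ?F y)"
      unfolding m_def using integral_restrict_UNIV[of "cbox a b" ?F] by (simp add: integral_unique)
    also have "\<dots> = (LINT y|lborel. ?F (x + (-1) *\<^sub>R y))"
      using lborel_integral_affine[of ?F "-1" x] cF by (simp add: borel_measurable_continuous_onI)
    finally show ?thesis by simp
  qed
  have close: "\<bar>m n x - v x\<bar> \<le> L * (c n * n1)" for n x
    unfolding m
  proof (rule avg[OF vxb V])
    fix y assume "y \<in> B n"
    then have "\<bar>v (x - y) - v x\<bar> \<le> L * norm y" using lipschitz_onD[OF v, of "x - y" x] by (simp add: dist_norm)
    also have "\<dots> \<le> L * (c n * n1)" using Bn[OF \<open>y \<in> B n\<close>] L by (intro mult_left_mono)
    finally show "\<bar>v (x - y) - v x\<bar> \<le> L * (c n * n1)" .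
  qed
  have gxb: "(\<lambda>y. g (x - y) \<bullet> i) \<in> borel_measurable borel" for x i
    using measurable_compose[OF _ bg, of "\<lambda>y. x - y" borel] by simp
  have gb: "\<bar>g y \<bullet> i\<bar> \<le> L" if "i \<in> Basis" for y i
    using Basis_le_norm[OF that, of "g y"] g(3)[of y] by linarith
  have md: "(m n has_derivative (\<lambda>h. h \<bullet> grad (m n) x)) (at x)" for n x
    using mC[of "Suc 0" n] by (intro differentiable_grad(1)) simp
  \<comment> \<open>The derivative is moved onto \<open>v\<close> instead of \<rho>: difference
    quotients of \<open>v\<close> are bounded by \<open>L\<close>, and they converge for almost all
    \<open>y\<close> because \<open>x - y\<close> avoids \<open>Z\<close> almost everywhere.\<close>
  have gm: "grad (m n) x \<bullet> i = (LINT y|lborel. \<rho> n y * (g (x - y) \<bullet> i))" if i: "i \<in> Basis" for n x i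
  proof -
    let ?q = "\<lambda>k y. \<rho> n y * ((v (x - y + c k *\<^sub>R i) - v (x - y)) / c k)"
    have "(\<lambda>k. (m n (x + c k *\<^sub>R i) - m n x) / c k) \<longlonglongrightarrow> i \<bullet> grad (m n) x"
      by (rule directional_derivative_LIMSEQ[OF md c(1)]) (use c(4) in auto)
    also have "(\<lambda>k. (m n (x + c k *\<^sub>R i) - m n x) / c k) = (\<lambda>k. LINT y|lborel. ?q k y)"
    proof
      fix k
      have "m n (x + c k *\<^sub>R i) - m n x = (LINT y|lborel. \<rho> n y * v (x + c k *\<^sub>R i - y) - \<rho> n y * v (x - y))"
        unfolding m using iB[OF vxb V] by simp
      then show "(m n (x + c k *\<^sub>R i) - m n x) / c k = (LINT y|lborel. ?q k y)"
        by (simp add: algebra_simps diff_divide_distrib flip: integral_divide_zero)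
    qed
    finally have l1: "(\<lambda>k. LINT y|lborel. ?q k y) \<longlonglongrightarrow> i \<bullet> grad (m n) x" .
    have "(\<lambda>k. LINT y|lborel. ?q k y) \<longlonglongrightarrow> (LINT y|lborel. \<rho> n y * (g (x - y) \<bullet> i))"
    proof (rule integral_dominated_convergence[where w="\<lambda>y. \<rho> n y * L"])
      show "(\<lambda>y. \<rho> n y * (g (x - y) \<bullet> i)) \<in> borel_measurable lborel" using \<rho>b gxb by simp
      show "?q k \<in> borel_measurable lborel" for k
        using \<rho>b vxb[of x] vxb[of "x + c k *\<^sub>R i"] by (simp add: algebra_simps)
      show "integrable lborel (\<lambda>y. \<rho> n y * L)" using \<rho>i by simp
      show "AE y in lborel. (\<lambda>k. ?q k y) \<longlonglongrightarrow> \<rho> n y * (g (x - y) \<bullet> i)"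
        using AE_lborel_reflect[OF Z(1,2), of x]
      proof eventually_elim
        case (elim y)
        have "(\<lambda>k. (v (x - y + c k *\<^sub>R i) - v (x - y)) / c k) \<longlonglongrightarrow> i \<bullet> g (x - y)"
          by (rule directional_derivative_LIMSEQ[OF Z(3)[OF elim] c(1)]) (use c(4) in auto)
        then show ?case by (intro tendsto_mult_left) (simp add: inner_commute)
      qed
      show "AE y in lborel. norm (?q k y) \<le> \<rho> n y * L" for k
      proof (intro AE_I2)
        fix y
        have "\<bar>v (x - y + c k *\<^sub>R i) - v (x - y)\<bar> \<le> L * c k"
          using lipschitz_onD[OF v, of "x - y + c k *\<^sub>R i" "x - y"] c(2)[of k] i by (simp add: dist_norm)
        then have "\<bar>(v (x - y + c k *\<^sub>R i) - v (x - y)) / c k\<bar> \<le> L" using c(2)[of k] by (simp add: field_simps)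
        then show "norm (?q k y) \<le> \<rho> n y * L" using mult_left_mono[OF _ \<rho>nn[of n y]] \<rho>nn[of n y]
          by (simp only: real_norm_def abs_mult abs_of_nonneg)
      qed
    qed
    from LIMSEQ_unique[OF l1 this] show ?thesis by (simp add: inner_commute)
  qed
  have gmb: "norm (grad (m n) x) \<le> L * DIM('a)" for n x
  proof -
    have "\<bar>grad (m n) x \<bullet> i\<bar> \<le> L" if "i \<in> Basis" for i
      using avg[OF gxb[of x] gb[OF that], where z=0 and n=n and \<epsilon>=L] gb[OF that] by (simp add: gm[OF that])
    then have "(\<Sum>i\<in>Basis. \<bar>grad (m n) x \<bullet> i\<bar>) \<le> (\<Sum>i\<in>(Basis::'a set). L)" by (intro sum_mono)
    then show ?thesis using norm_le_l1[of "grad (m n) x"] by (simp add: mult.commute)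
  qed
  have gml: "(\<lambda>n. grad (m n) x - g x) \<longlonglongrightarrow> 0" if x: "x \<notin> Z" for x
  proof -
    have "(\<lambda>n. grad (m n) x \<bullet> i) \<longlonglongrightarrow> g x \<bullet> i" if i: "i \<in> Basis" for i
    proof (rule LIMSEQ_I)
      fix \<epsilon> :: real assume "\<epsilon> > 0"
      have "isCont g x" using g(1) Z(1) x continuous_on_eq_continuous_at[of "- Z" g] by auto
      then obtain \<delta> where \<delta>: "\<delta> > 0" "\<And>y. norm (y - x) < \<delta> \<Longrightarrow> norm (g y - g x) < \<epsilon> / 2"
        using \<open>\<epsilon> > 0\<close> unfolding continuous_at_eps_delta dist_norm by (metis half_gt_zero)
      have "(\<lambda>n. c n * n1) \<longlonglongrightarrow> 0" using tendsto_mult_right[OF c(1), of n1] by simp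
      then obtain N where N: "\<And>n. n \<ge> N \<Longrightarrow> \<bar>c n * n1\<bar> < \<delta>"
        using LIMSEQ_D[OF _ \<delta>(1), of "\<lambda>n. c n * n1" 0] by auto
      show "\<exists>no. \<forall>n\<ge>no. norm (grad (m n) x \<bullet> i - g x \<bullet> i) < \<epsilon>"
      proof (intro exI allI impI)
        fix n assume "n \<ge> N"
        have "\<bar>grad (m n) x \<bullet> i - g x \<bullet> i\<bar> \<le> \<epsilon> / 2"
          unfolding gm[OF i]
        proof (rule avg[OF gxb gb[OF i]])
          fix y assume "y \<in> B n"
          then have "norm (x - y - x) < \<delta>" using Bn[of y n] N[OF \<open>n \<ge> N\<close>] by simp
          from \<delta>(2)[OF this] Basis_le_norm[OF i, of "g (x - y) - g x"]
          show "\<bar>g (x - y) \<bullet> i - g x \<bullet> i\<bar> \<le> \<epsilon> / 2" by (simp add: inner_diff_left)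
        qed
        then show "norm (grad (m n) x \<bullet> i - g x \<bullet> i) < \<epsilon>" using \<open>\<epsilon> > 0\<close> by simp
      qed
    qed
    then have "(\<lambda>n. grad (m n) x) \<longlonglongrightarrow> g x"
      by (subst tendsto_componentwise_iff) blast
    then show ?thesis by (rule LIM_zero)
  qed
  have mb: "m n \<in> borel_measurable borel" "grad (m n) \<in> borel_measurable borel" "continuous_on UNIV (m n)" for n
  proof -
    show "continuous_on UNIV (m n)" using mC[of 0 n] by simp
    then show "m n \<in> borel_measurable borel" by (rule borel_measurable_continuous_onI)
    have "continuous_on UNIV (\<lambda>x. \<Sum>b\<in>Basis. frechet_derivative (m n) (at x) b *\<^sub>R b)"
      using mC[of "Suc 0" n] by (auto intro!: continuous_intros)
    moreover have "grad (m n) x = (\<Sum>b\<in>Basis. frechet_derivative (m n) (at x) b *\<^sub>R b)" for x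
      using mC[of "Suc 0" n] by (intro differentiable_grad(2)) simp
    ultimately have "continuous_on UNIV (grad (m n))" by (simp cong: continuous_on_cong)
    then show "grad (m n) \<in> borel_measurable borel" by (rule borel_measurable_continuous_onI)
  qed
  have vb: "v \<in> borel_measurable borel" using cv by (rule borel_measurable_continuous_onI)
  have lim1: "(\<lambda>n. L2_norm \<U> (\<lambda>x. m n x - v x)) \<longlonglongrightarrow> 0"
  proof (rule L2_dominated_convergence[OF lm, where B="L * n1"])
    show "(\<lambda>x. m n x - v x) \<in> borel_measurable (lebesgue_on \<U>)" for n
      using mb vb by (intro borel_measurable_lebesgue_onI) simp
    show "norm (m n x - v x) \<le> L * n1" for n x
    proof -
      have "L * (c n * n1) \<le> L * n1" using c(2,3)[of n] n1 L by (intro mult_left_mono) (auto intro: mult_left_le_one_le)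
      with close[of n x] show ?thesis by simp
    qed
    have "(\<lambda>n. m n x - v x) \<longlonglongrightarrow> 0" for x
      by (rule Lim_null_comparison[of _ "\<lambda>n. L * (c n * n1)"])
         (use close c(1) in \<open>auto intro!: always_eventually tendsto_eq_intros\<close>)
    then show "AE x in lebesgue_on \<U>. (\<lambda>n. m n x - v x) \<longlonglongrightarrow> 0" by simp
  qed
  have lim2: "(\<lambda>n. L2_norm \<U> (\<lambda>x. grad (m n) x - g x)) \<longlonglongrightarrow> 0"
  proof (rule L2_dominated_convergence[OF lm, where B="L * DIM('a) + L"])
    show "(\<lambda>x. grad (m n) x - g x) \<in> borel_measurable (lebesgue_on \<U>)" for n
      using mb bg by (intro borel_measurable_lebesgue_onI) simp
    show "norm (grad (m n) x - g x) \<le> L * DIM('a) + L" for n x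
      using norm_triangle_ineq4[of "grad (m n) x" "g x"] gmb[of n x] g(3)[of x] by linarith
    have "AE x in lebesgue. x \<notin> Z" using Z(2) AE_not_in negligible_iff_null_sets by blast
    then have "AE x in lebesgue. x \<in> \<U> \<longrightarrow> (\<lambda>n. grad (m n) x - g x) \<longlonglongrightarrow> 0"
      by eventually_elim (use gml in blast)
    then show "AE x in lebesgue_on \<U>. (\<lambda>n. grad (m n) x - g x) \<longlonglongrightarrow> 0" using sl by (simp add: AE_restrict_space_iff)
  qed
  \<comment> \<open>The support of \<open>m n\<close> lies within distance \<open>c n * n1\<close>
    of \<open>K\<close>, so it is contained in \<U> once this number is below
    \<open>r\<close>.\<close>
  obtain r where r: "r > 0" "(\<Union>x\<in>K. ball x r) \<subseteq> \<U>"
    using compact_subset_open_imp_ball_epsilon_subset[OF K(1) \<U>(1) K(2)] by blast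
  have "(\<lambda>n. c n * n1) \<longlonglongrightarrow> 0" using tendsto_mult_right[OF c(1), of n1] by simp
  then have "\<forall>\<^sub>F n in sequentially. c n * n1 < r" using r(1) by (rule order_tendstoD)
  moreover have "\<forall>\<^sub>F n in sequentially. L2_norm \<U> (\<lambda>x. m n x - v x) < e" using lim1 e by (rule order_tendstoD)
  moreover have "\<forall>\<^sub>F n in sequentially. L2_norm \<U> (\<lambda>x. grad (m n) x - g x) < e" using lim2 e by (rule order_tendstoD)
  ultimately have "\<forall>\<^sub>F n in sequentially. c n * n1 < r \<and> L2_norm \<U> (\<lambda>x. m n x - v x) < e \<and> L2_norm \<U> (\<lambda>x. grad (m n) x - g x) < e"
    by eventually_elim blast
  then obtain n where n: "c n * n1 < r" "L2_norm \<U> (\<lambda>x. m n x - v x) < e" "L2_norm \<U> (\<lambda>x. grad (m n) x - g x) < e"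
    by (auto simp: eventually_sequentially)
  have "m n \<in> test_functions \<U>"
  proof (rule test_functionsI[OF mC])
    let ?K = "{p + q |p q. p \<in> K \<and> q \<in> cball 0 (c n * n1)}"
    show "compact ?K" using compact_sums[OF K(1) compact_cball] .
    show "?K \<subseteq> \<U>"
    proof
      fix x assume "x \<in> ?K"
      then obtain p q where "x = p + q" "p \<in> K" "norm q \<le> c n * n1" by auto
      then have "x \<in> ball p r" using n(1) by (simp add: dist_norm)
      with r(2) \<open>p \<in> K\<close> show "x \<in> \<U>" by blast
    qed
    fix x assume x: "x \<notin> ?K"
    have "\<rho> n y * v (x - y) = 0" for y
    proof (cases "y \<in> B n")
      case True
      then have "x - y \<notin> K" using x Bn[OF True] by force
      then show ?thesis using K(3) by simp
    qed (simp add: \<rho>0)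
    then have "(\<lambda>y. \<rho> n y * v (x - y)) = (\<lambda>_. 0)" by blast
    then show "m n x = 0" by (simp add: m del: mult_eq_0_iff)
  qed
  with n show ?thesis by blast
qed

section \<open>The space H10\<close>

lemma weak_gradient_properties:
  assumes "open \<U>" "g \<in> L2 \<U>" "has_weak_gradient \<U> v g"
  shows "weak_gradient \<U> v \<in> L2 \<U>" "has_weak_gradient \<U> v (weak_gradient \<U> v)"
    "AE x in lebesgue_on \<U>. weak_gradient \<U> v x = g x"
proof -
  have *: "weak_gradient \<U> v \<in> L2 \<U> \<and> has_weak_gradient \<U> v (weak_gradient \<U> v)"
    unfolding weak_gradient_def by (rule someI[of _ g]) (use assms in blast)
  then show "weak_gradient \<U> v \<in> L2 \<U>" "has_weak_gradient \<U> v (weak_gradient \<U> v)" by auto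
  with weak_gradient_unique[OF assms(1) _ _ assms(2,3)] show "AE x in lebesgue_on \<U>. weak_gradient \<U> v x = g x" by blast
qed

lemma H10D:
  assumes "v \<in> H10 \<U>"
  shows "v \<in> L2 \<U>" "weak_gradient \<U> v \<in> L2 \<U>" "has_weak_gradient \<U> v (weak_gradient \<U> v)"
proof -
  have "v \<in> L2 \<U> \<and> (\<exists>g. g \<in> L2 \<U> \<and> has_weak_gradient \<U> v g)" using assms by (auto simp: H10_def H1_def)
  then show "v \<in> L2 \<U>" "weak_gradient \<U> v \<in> L2 \<U>" "has_weak_gradient \<U> v (weak_gradient \<U> v)"
    unfolding weak_gradient_def using someI_ex[of "\<lambda>g. g \<in> L2 \<U> \<and> has_weak_gradient \<U> v g"] by auto
qed

lemma H10_approx: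
  assumes "v \<in> H10 \<U>"
  obtains f where "\<And>n::nat. f n \<in> test_functions \<U>"
    "(\<lambda>n. L2_norm \<U> (\<lambda>x. f n x - v x)) \<longlonglongrightarrow> 0"
    "(\<lambda>n. L2_norm \<U> (\<lambda>x. grad (f n) x - weak_gradient \<U> v x)) \<longlonglongrightarrow> 0"
  using assms by (auto simp: H10_def)

lemma L2_norm_cong_AE_diff:
  assumes "u \<in> L2 \<U>" "g \<in> L2 \<U>" "g' \<in> L2 \<U>" "AE x in lebesgue_on \<U>. g x = g' x"
  shows "L2_norm \<U> (\<lambda>x. u x - g x) = L2_norm \<U> (\<lambda>x. u x - g' x)"
  by (rule L2_norm_cong_AE) (use assms in \<open>auto intro: L2_diff\<close>)

text \<open>Allows the use of any explicit weak gradient \<open>g\<close>: it agrees almost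
  everywhere with the one that \<open>weak_gradient\<close> chooses, so the approximation carries
  over.\<close>

lemma H10_I:
  assumes \<U>: "open \<U>" and v: "v \<in> L2 \<U>" and g: "g \<in> L2 \<U>" "has_weak_gradient \<U> v g"
    and app: "\<And>e::real. e > 0 \<Longrightarrow> \<exists>f\<in>test_functions \<U>. L2_norm \<U> (\<lambda>x. f x - v x) < e \<and> L2_norm \<U> (\<lambda>x. grad f x - g x) < e"
  shows "v \<in> H10 \<U>"
proof -
  have sl: "\<U> \<in> sets lebesgue" using \<U> by auto
  note w = weak_gradient_properties[OF \<U> g]
  have "\<forall>n. \<exists>f. f \<in> test_functions \<U> \<and> L2_norm \<U> (\<lambda>x. f x - v x) < 1 / real (Suc n) \<and> L2_norm \<U> (\<lambda>x. grad f x - g x) < 1 / real (Suc n)"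
    using app by (metis of_nat_0_less_iff zero_less_Suc zero_less_divide_1_iff)
  then obtain f where f: "\<And>n. f n \<in> test_functions \<U>" "\<And>n. L2_norm \<U> (\<lambda>x. f n x - v x) < 1 / real (Suc n)"
    "\<And>n. L2_norm \<U> (\<lambda>x. grad (f n) x - g x) < 1 / real (Suc n)" by metis
  have "L2_norm \<U> (\<lambda>x. grad (f n) x - weak_gradient \<U> v x) = L2_norm \<U> (\<lambda>x. grad (f n) x - g x)" for n
    by (rule L2_norm_cong_AE_diff[OF test_functions_L2(2)[OF f(1) sl] w(1) g(1) w(3)])
  then have "(\<lambda>n. L2_norm \<U> (\<lambda>x. grad (f n) x - weak_gradient \<U> v x)) \<longlonglongrightarrow> 0"
    by (intro Lim_null_comparison[OF _ LIMSEQ_inverse_Suc]) (use f(3) in \<open>auto intro!: always_eventually less_imp_le simp: L2_norm_nonneg\<close>)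
  moreover have "(\<lambda>n. L2_norm \<U> (\<lambda>x. f n x - v x)) \<longlonglongrightarrow> 0"
    by (intro Lim_null_comparison[OF _ LIMSEQ_inverse_Suc]) (use f(2) in \<open>auto intro!: always_eventually less_imp_le simp: L2_norm_nonneg\<close>)
  ultimately show ?thesis using f(1) v g unfolding H10_def H1_def by blast
qed

lemma H10_test_function:
  assumes \<U>: "open \<U>" and f: "f \<in> test_functions \<U>"
  shows "f \<in> H10 \<U>" "AE x in lebesgue_on \<U>. weak_gradient \<U> f x = grad f x"
proof -
  have sl: "\<U> \<in> sets lebesgue" using \<U> by auto
  note fL = test_functions_L2[OF f sl]
  obtain M where M: "M \<ge> 0" "\<And>x. \<bar>f x\<bar> \<le> M" "\<And>x. norm (grad f x) \<le> M" "M-lipschitz_on UNIV f"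
    by (rule test_functions_bounds[OF f]) blast
  have w: "has_weak_gradient \<U> f (grad f)"
    by (rule has_weak_gradient_lipschitz[OF \<U> M(4,2), of "{}"])
       (use test_functionsD(4,5)[OF f] M(3) in \<open>auto intro: borel_measurable_continuous_onI\<close>)
  show "f \<in> H10 \<U>"
    by (rule H10_I[OF \<U> fL w]) (use f in \<open>auto intro!: bexI[of _ f] simp: L2_norm_def\<close>)
  show "AE x in lebesgue_on \<U>. weak_gradient \<U> f x = grad f x"
    using weak_gradient_properties(3)[OF \<U> fL(2) w] .
qed

lemma H10_lincomb:
  assumes \<U>: "open \<U>" and u: "u \<in> H10 \<U>" and v: "v \<in> H10 \<U>"
  shows "(\<lambda>x. a * u x + b * v x) \<in> H10 \<U>"
    "AE x in lebesgue_on \<U>. weak_gradient \<U> (\<lambda>x. a * u x + b * v x) x = a *\<^sub>R weak_gradient \<U> u x + b *\<^sub>R weak_gradient \<U> v x"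
proof -
  have sl: "\<U> \<in> sets lebesgue" using \<U> by auto
  note uD = H10D[OF u] and vD = H10D[OF v]
  let ?w = "\<lambda>x. a * u x + b * v x" and ?g = "\<lambda>x. a *\<^sub>R weak_gradient \<U> u x + b *\<^sub>R weak_gradient \<U> v x"
  have w: "?w \<in> L2 \<U>" using L2_lincomb[OF uD(1) vD(1), of a b] by simp
  have g: "?g \<in> L2 \<U>" by (rule L2_lincomb[OF uD(2) vD(2)])
  have wg: "has_weak_gradient \<U> ?w ?g"
    unfolding has_weak_gradient_def
  proof
    fix f assume f: "f \<in> test_functions \<U>"
    note fL = test_functions_L2[OF f sl]
    have "(LINT x|lebesgue_on \<U>. (a * u x + b * v x) *\<^sub>R grad f x) = (LINT x|lebesgue_on \<U>. a *\<^sub>R (u x *\<^sub>R grad f x) + b *\<^sub>R (v x *\<^sub>R grad f x))"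
      by (simp add: scaleR_add_left)
    also have "\<dots> = a *\<^sub>R (LINT x|lebesgue_on \<U>. u x *\<^sub>R grad f x) + b *\<^sub>R (LINT x|lebesgue_on \<U>. v x *\<^sub>R grad f x)"
      by (subst Bochner_Integration.integral_add)
         (auto intro!: integrable_scaleR_right L2_scaleR_integrable uD(1) vD(1) fL(2) simp del: scaleR_scaleR)
    also have "\<dots> = - (a *\<^sub>R (LINT x|lebesgue_on \<U>. f x *\<^sub>R weak_gradient \<U> u x) + b *\<^sub>R (LINT x|lebesgue_on \<U>. f x *\<^sub>R weak_gradient \<U> v x))"
      using uD(3) vD(3) f by (simp add: has_weak_gradient_def)
    also have "a *\<^sub>R (LINT x|lebesgue_on \<U>. f x *\<^sub>R weak_gradient \<U> u x) + b *\<^sub>R (LINT x|lebesgue_on \<U>. f x *\<^sub>R weak_gradient \<U> v x)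
        = (LINT x|lebesgue_on \<U>. a *\<^sub>R (f x *\<^sub>R weak_gradient \<U> u x) + b *\<^sub>R (f x *\<^sub>R weak_gradient \<U> v x))"
      by (subst Bochner_Integration.integral_add)
         (auto intro!: integrable_scaleR_right L2_scaleR_integrable uD(2) vD(2) fL(1) simp del: scaleR_scaleR)
    also have "\<dots> = (LINT x|lebesgue_on \<U>. f x *\<^sub>R ?g x)"
      by (simp add: scaleR_add_right mult.commute)
    finally show "(LINT x|lebesgue_on \<U>. ?w x *\<^sub>R grad f x) = - (LINT x|lebesgue_on \<U>. f x *\<^sub>R ?g x)" .
  qed
  show "AE x in lebesgue_on \<U>. weak_gradient \<U> ?w x = ?g x"
    using weak_gradient_properties(3)[OF \<U> g wg] .
  obtain p where p: "\<And>n::nat. p n \<in> test_functions \<U>" "(\<lambda>n. L2_norm \<U> (\<lambda>x. p n x - u x)) \<longlonglongrightarrow> 0"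
    "(\<lambda>n. L2_norm \<U> (\<lambda>x. grad (p n) x - weak_gradient \<U> u x)) \<longlonglongrightarrow> 0" by (rule H10_approx[OF u]) blast
  obtain q where q: "\<And>n::nat. q n \<in> test_functions \<U>" "(\<lambda>n. L2_norm \<U> (\<lambda>x. q n x - v x)) \<longlonglongrightarrow> 0"
    "(\<lambda>n. L2_norm \<U> (\<lambda>x. grad (q n) x - weak_gradient \<U> v x)) \<longlonglongrightarrow> 0" by (rule H10_approx[OF v]) blast
  have key: "L2_norm \<U> (\<lambda>x. (a *\<^sub>R P x + b *\<^sub>R Q x) - (a *\<^sub>R U x + b *\<^sub>R V x)) \<le> \<bar>a\<bar> * L2_norm \<U> (\<lambda>x. P x - U x) + \<bar>b\<bar> * L2_norm \<U> (\<lambda>x. Q x - V x)"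
    if "P \<in> L2 \<U>" "Q \<in> L2 \<U>" "U \<in> L2 \<U>" "V \<in> L2 \<U>" for P Q U V :: "'a \<Rightarrow> 'b::euclidean_space"
  proof -
    have "(\<lambda>x. (a *\<^sub>R P x + b *\<^sub>R Q x) - (a *\<^sub>R U x + b *\<^sub>R V x)) = (\<lambda>x. a *\<^sub>R (P x - U x) + b *\<^sub>R (Q x - V x))"
      by (simp add: algebra_simps)
    then show ?thesis
      using L2_norm_triangle[OF L2_scaleR[OF L2_diff[OF that(1,3)], of a] L2_scaleR[OF L2_diff[OF that(2,4)], of b]]
      by (simp add: L2_norm_scaleR)
  qed
  have lim: "(\<lambda>n. \<bar>a\<bar> * s n + \<bar>b\<bar> * t n) \<longlonglongrightarrow> 0" if "s \<longlonglongrightarrow> 0" "t \<longlonglongrightarrow> 0" for s t :: "nat \<Rightarrow> real"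
    using tendsto_add[OF tendsto_mult_left[OF that(1), of "\<bar>a\<bar>"] tendsto_mult_left[OF that(2), of "\<bar>b\<bar>"]] by simp
  show "?w \<in> H10 \<U>"
  proof (rule H10_I[OF \<U> w g wg])
    fix e :: real assume "e > 0"
    have "\<forall>\<^sub>F n in sequentially. \<bar>a\<bar> * L2_norm \<U> (\<lambda>x. p n x - u x) + \<bar>b\<bar> * L2_norm \<U> (\<lambda>x. q n x - v x) < e
      \<and> \<bar>a\<bar> * L2_norm \<U> (\<lambda>x. grad (p n) x - weak_gradient \<U> u x) + \<bar>b\<bar> * L2_norm \<U> (\<lambda>x. grad (q n) x - weak_gradient \<U> v x) < e"
      using order_tendstoD(2)[OF lim[OF p(2) q(2)] \<open>e > 0\<close>] order_tendstoD(2)[OF lim[OF p(3) q(3)] \<open>e > 0\<close>]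
      by (rule eventually_conj)
    then obtain n where n: "\<bar>a\<bar> * L2_norm \<U> (\<lambda>x. p n x - u x) + \<bar>b\<bar> * L2_norm \<U> (\<lambda>x. q n x - v x) < e"
      "\<bar>a\<bar> * L2_norm \<U> (\<lambda>x. grad (p n) x - weak_gradient \<U> u x) + \<bar>b\<bar> * L2_norm \<U> (\<lambda>x. grad (q n) x - weak_gradient \<U> v x) < e"
      by (auto simp: eventually_sequentially)
    let ?f = "\<lambda>x. a * p n x + b * q n x"
    have gf: "grad ?f x = a *\<^sub>R grad (p n) x + b *\<^sub>R grad (q n) x" for x
      by (rule grad_lincomb) (use test_functionsD(2) p(1) q(1) in blast)+
    have "?f \<in> test_functions \<U>" by (rule test_functions_lincomb[OF p(1) q(1)])
    moreover have "L2_norm \<U> (\<lambda>x. ?f x - ?w x) < e"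
      using key[OF test_functions_L2(1)[OF p(1)[of n] sl] test_functions_L2(1)[OF q(1)[of n] sl] uD(1) vD(1)] n(1) by simp
    moreover have "L2_norm \<U> (\<lambda>x. grad ?f x - ?g x) < e"
      unfolding gf using key[OF test_functions_L2(2)[OF p(1)[of n] sl] test_functions_L2(2)[OF q(1)[of n] sl] uD(2) vD(2)] n(2) by simp
    ultimately show "\<exists>f\<in>test_functions \<U>. L2_norm \<U> (\<lambda>x. f x - ?w x) < e \<and> L2_norm \<U> (\<lambda>x. grad f x - ?g x) < e"
      by (intro bexI[of _ ?f] conjI)
  qed
qed

lemma H10_zero:
  assumes "open \<U>"
  shows "(\<lambda>x. 0) \<in> H10 \<U>" "AE x in lebesgue_on \<U>. weak_gradient \<U> (\<lambda>x. 0) x = 0"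
proof -
  have t: "(\<lambda>x. 0) \<in> test_functions \<U>" by (rule test_functionsI[where K="{}"]) (auto simp: C_k_const)
  have "grad (\<lambda>x. 0::real) x = (0::'a)" for x by (rule grad_eqI) simp
  with H10_test_function[OF assms t] show "(\<lambda>x. 0) \<in> H10 \<U>" "AE x in lebesgue_on \<U>. weak_gradient \<U> (\<lambda>x. 0) x = 0" by auto
qed

lemma H10_sum:
  assumes \<U>: "open \<U>" and "finite I"
    and u: "\<And>i. i \<in> I \<Longrightarrow> u i \<in> H10 \<U>" "\<And>i. i \<in> I \<Longrightarrow> AE x in lebesgue_on \<U>. weak_gradient \<U> (u i) x = g i x"
  shows "(\<lambda>x. \<Sum>i\<in>I. a i * u i x) \<in> H10 \<U> \<and>
    (AE x in lebesgue_on \<U>. weak_gradient \<U> (\<lambda>x. \<Sum>i\<in>I. a i * u i x) x = (\<Sum>i\<in>I. a i *\<^sub>R g i x))"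
  using assms(2) u
proof (induction I rule: finite_induct)
  case empty
  then show ?case using H10_zero[OF \<U>] by simp
next
  case (insert i I)
  let ?S = "\<lambda>x. \<Sum>i\<in>I. a i * u i x"
  have S: "?S \<in> H10 \<U>" "AE x in lebesgue_on \<U>. weak_gradient \<U> ?S x = (\<Sum>i\<in>I. a i *\<^sub>R g i x)"
    using insert by auto
  have ui: "u i \<in> H10 \<U>" "AE x in lebesgue_on \<U>. weak_gradient \<U> (u i) x = g i x" using insert.prems by auto
  have "AE x in lebesgue_on \<U>. weak_gradient \<U> (\<lambda>x. a i * u i x + 1 * ?S x) x = a i *\<^sub>R g i x + (\<Sum>i\<in>I. a i *\<^sub>R g i x)"
    using H10_lincomb(2)[OF \<U> ui(1) S(1), of "a i" 1] ui(2) S(2) by eventually_elim simp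
  moreover have "(\<lambda>x. a i * u i x + 1 * ?S x) \<in> H10 \<U>" by (rule H10_lincomb(1)[OF \<U> ui(1) S(1)])
  ultimately show ?case using insert(1,2) by simp
qed

text \<open>A continuously differentiable truncation: it vanishes for \<open>t \<le> \<delta>\<close>, so that it cuts a function
  that vanishes outside of an open set down to compact support.\<close>

definition soft_trunc :: "real \<Rightarrow> real \<Rightarrow> real" where
  "soft_trunc \<delta> t = max t \<delta> - 2 * \<delta> + \<delta>\<^sup>2 / max t \<delta>"

definition soft_trunc_deriv :: "real \<Rightarrow> real \<Rightarrow> real" where
  "soft_trunc_deriv \<delta> t = 1 - (\<delta> / max t \<delta>)\<^sup>2"

text \<open>With s = max t \<delta> the value of \<open>soft_trunc\<close> is (s - \<delta>)^2 / s.
  The double zero at s = \<delta> is what makes the derivative continuous there.\<close>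

lemma soft_trunc_eq_0: "0 < \<delta> \<Longrightarrow> t \<le> \<delta> \<Longrightarrow> soft_trunc \<delta> t = 0"
  by (simp add: soft_trunc_def max_absorb2 power2_eq_square)

lemma soft_trunc_deriv_bounds:
  assumes "0 < \<delta>"
  shows "0 \<le> soft_trunc_deriv \<delta> t" "soft_trunc_deriv \<delta> t \<le> 1"
proof -
  have "0 \<le> \<delta> / max t \<delta>" "\<delta> / max t \<delta> \<le> 1" using assms by (auto simp: max_def)
  then show "0 \<le> soft_trunc_deriv \<delta> t" "soft_trunc_deriv \<delta> t \<le> 1"
    by (auto simp: soft_trunc_deriv_def power_le_one)
qed

lemma soft_trunc_has_derivative:
  assumes "0 < \<delta>"
  shows "(soft_trunc \<delta> has_real_derivative soft_trunc_deriv \<delta> t) (at t)"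
proof -
  consider "t > \<delta>" | "t < \<delta>" | "t = \<delta>" by linarith
  then show ?thesis
  proof cases
    case 1
    have "((\<lambda>t. t - 2 * \<delta> + \<delta>\<^sup>2 / t) has_real_derivative soft_trunc_deriv \<delta> t) (at t)"
      using 1 assms by (auto intro!: derivative_eq_intros simp: soft_trunc_deriv_def max_absorb1 power2_eq_square)
    then show ?thesis
      by (rule has_field_derivative_transform_within_open[of _ _ _ "{\<delta><..}"]) (use 1 in \<open>auto simp: soft_trunc_def max_absorb1\<close>)
  next
    case 2
    have "((\<lambda>t. 0) has_real_derivative soft_trunc_deriv \<delta> t) (at t)"
      using 2 assms by (simp add: soft_trunc_deriv_def max_absorb2)
    then show ?thesis
      by (rule has_field_derivative_transform_within_open[of _ _ _ "{..<\<delta>}"]) (use 2 assms in \<open>auto simp: soft_trunc_eq_0\<close>)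
  next
    case 3
    have b: "\<bar>soft_trunc \<delta> (\<delta> + h) / h\<bar> \<le> \<bar>h\<bar> / \<delta>" for h
    proof (cases "h > 0")
      case True
      have "soft_trunc \<delta> (\<delta> + h) = h\<^sup>2 / (\<delta> + h)"
        using True assms by (simp add: soft_trunc_def max_absorb1 field_simps power2_eq_square)
      then have "soft_trunc \<delta> (\<delta> + h) / h = h / (\<delta> + h)" using True by (simp add: power2_eq_square)
      moreover have "h / (\<delta> + h) \<le> h / \<delta>" using True assms by (intro divide_left_mono) auto
      ultimately show ?thesis using True assms by simp
    next
      case False
      then show ?thesis using assms by (simp add: soft_trunc_eq_0 divide_nonpos_pos)
    qed
    have "((\<lambda>h. soft_trunc \<delta> (\<delta> + h) / h) \<longlongrightarrow> 0) (at 0)"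
      by (rule Lim_null_comparison[of _ "\<lambda>h. \<bar>h\<bar> / \<delta>"])
         (use b assms in \<open>auto intro!: always_eventually tendsto_eq_intros\<close>)
    then show ?thesis
      using 3 assms by (simp add: DERIV_def soft_trunc_eq_0 soft_trunc_deriv_def)
  qed
qed

lemma soft_trunc_lipschitz: "0 < \<delta> \<Longrightarrow> 1-lipschitz_on UNIV (soft_trunc \<delta>)"
proof (rule bounded_derivative_imp_lipschitz)
  assume d: "0 < \<delta>"
  show "(soft_trunc \<delta> has_derivative (*) (soft_trunc_deriv \<delta> t)) (at t within UNIV)" for t
    using soft_trunc_has_derivative[OF d] by (simp add: has_field_derivative_def)
  show "onorm ((*) (soft_trunc_deriv \<delta> t)) \<le> 1" for t
  proof (rule onorm_le)
    fix h show "norm (soft_trunc_deriv \<delta> t * h) \<le> 1 * norm h"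
      using soft_trunc_deriv_bounds[OF d, of t] by (simp add: abs_mult mult_left_le_one_le)
  qed
qed auto

lemma soft_trunc_close:
  assumes "0 < \<delta>" "0 \<le> t"
  shows "\<bar>soft_trunc \<delta> t - t\<bar> \<le> 2 * \<delta>"
proof (cases "t \<le> \<delta>")
  case True
  then show ?thesis using assms by (simp add: soft_trunc_eq_0)
next
  case False
  then have "0 \<le> \<delta>\<^sup>2 / t" "\<delta>\<^sup>2 / t \<le> \<delta>" using assms by (auto simp: field_simps power2_eq_square)
  then show ?thesis using False assms by (simp add: soft_trunc_def max_absorb1)
qed

lemma soft_trunc_deriv_tendsto:
  assumes "t > 0" "d \<longlonglongrightarrow> 0"
  shows "(\<lambda>n. soft_trunc_deriv (d n) t) \<longlonglongrightarrow> 1"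
proof -
  have "(\<lambda>n. max t (d n)) \<longlonglongrightarrow> max t 0" by (intro tendsto_max assms tendsto_const)
  then have "(\<lambda>n. 1 - (d n / max t (d n))\<^sup>2) \<longlonglongrightarrow> 1 - (0 / max t 0)\<^sup>2"
    using assms by (intro tendsto_intros) auto
  then show ?thesis by (simp add: soft_trunc_deriv_def)
qed

text \<open>Soft truncation of \<open>u\<close> gives functions with compact support in \<U>, and
  mollification turns these into test functions; each step spends half of the error.\<close>

lemma H10_lipschitz:
  fixes u :: "'a::euclidean_space \<Rightarrow> real"
  assumes \<U>: "open \<U>" "bounded \<U>" and u: "L-lipschitz_on UNIV u" "\<And>x. 0 \<le> u x" "\<And>x. x \<notin> \<U> \<Longrightarrow> u x = 0"
    and Z: "closed Z" "negligible Z" "\<And>x. x \<notin> Z \<Longrightarrow> (u has_derivative (\<lambda>h. h \<bullet> g x)) (at x)"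
    and g: "continuous_on (- Z) g" "\<And>x. x \<in> Z \<Longrightarrow> g x = 0" "\<And>x. norm (g x) \<le> L"
  shows "u \<in> H10 \<U>" "AE x in lebesgue_on \<U>. weak_gradient \<U> u x = g x"
proof -
  have L: "L \<ge> 0" using u(1) lipschitz_on_nonneg by blast
  have sl: "\<U> \<in> sets lebesgue" and lm: "\<U> \<in> lmeasurable"
    using \<U> by (auto simp: bounded_set_imp_lmeasurable)
  have cu: "continuous_on UNIV u" using u(1) by (rule lipschitz_on_continuous_on)
  have bg: "g \<in> borel_measurable borel" by (rule borel_measurable_continuous_off_closed[OF Z(1) g(1,2)])
  have bu: "u \<in> borel_measurable borel" using cu by (rule borel_measurable_continuous_onI)
  have cl: "compact (closure \<U>)" using \<U>(2) by simp
  obtain M where M: "\<And>x. \<bar>u x\<bar> \<le> M"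
  proof -
    have "bounded (u ` closure \<U>)" by (meson cl cu compact_imp_bounded compact_continuous_image continuous_on_subset top_greatest)
    then obtain M where "\<And>x. x \<in> closure \<U> \<Longrightarrow> \<bar>u x\<bar> \<le> M" unfolding bounded_iff by auto
    then have "\<bar>u x\<bar> \<le> max 0 M" for x
      using u(3)[of x] closure_subset[of \<U>] by (cases "x \<in> \<U>") (auto simp: le_max_iff_disj)
    with that show ?thesis by blast
  qed
  have uL: "u \<in> L2 \<U>" by (rule L2_bounded(1)[OF lm borel_measurable_lebesgue_onI[OF bu]]) (use M in simp)
  have gL: "g \<in> L2 \<U>" by (rule L2_bounded(1)[OF lm borel_measurable_lebesgue_onI[OF bg]]) (rule g(3))
  have wg: "has_weak_gradient \<U> u g"
    by (rule has_weak_gradient_lipschitz[OF \<U>(1) u(1) M Z(2,3) bg g(3)])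
  show "AE x in lebesgue_on \<U>. weak_gradient \<U> u x = g x"
    using weak_gradient_properties(3)[OF \<U>(1) gL wg] .
  define d where "d n = 1 / real (Suc n)" for n
  have d: "d \<longlonglongrightarrow> 0" "0 < d n" "d n \<le> 1" for n using LIMSEQ_inverse_Suc by (auto simp: d_def[abs_def])
  define w where "w n x = soft_trunc (d n) (u x)" for n x
  define G where "G n x = soft_trunc_deriv (d n) (u x) *\<^sub>R g x" for n x
  have wlip: "L-lipschitz_on UNIV (w n)" for n
    using lipschitz_on_compose2[OF u(1) lipschitz_on_subset[OF soft_trunc_lipschitz[OF d(2)[of n]]]] by (simp add: w_def[abs_def])
  have wder: "(w n has_derivative (\<lambda>h. h \<bullet> G n x)) (at x)" if "x \<notin> Z" for n x
    unfolding w_def[abs_def] G_def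
    by (rule has_derivative_eq_rhs[OF DERIV_compose_FDERIV[OF soft_trunc_has_derivative[OF d(2)] Z(3)[OF that]]]) (simp add: fun_eq_iff)
  have cG: "continuous_on (- Z) (G n)" for n
    unfolding G_def[abs_def] soft_trunc_deriv_def
    by (intro continuous_intros g(1) continuous_on_subset[OF cu]) (use d(2)[of n] in \<open>auto simp: max_def\<close>)
  have GL: "norm (G n x) \<le> L" for n x
    using soft_trunc_deriv_bounds[OF d(2)[of n], of "u x"] g(3)[of x] unfolding G_def
    by (simp add: mult_left_le_one_le order_trans[of _ "norm (g x)"])
  have bG: "G n \<in> borel_measurable borel" for n
    by (rule borel_measurable_continuous_off_closed[OF Z(1) cG]) (simp add: G_def g(2))
  have bw: "w n \<in> borel_measurable borel" for n
    by (rule borel_measurable_continuous_onI[OF lipschitz_on_continuous_on[OF wlip]])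
  have wM: "\<bar>w n x - u x\<bar> \<le> 2 * d n" for n x unfolding w_def by (rule soft_trunc_close[OF d(2) u(2)])
  have wL: "w n \<in> L2 \<U>" for n
  proof (rule L2_bounded(1)[OF lm borel_measurable_lebesgue_onI[OF bw]])
    show "norm (w n x) \<le> M + 2" for x using wM[of n x] M[of x] d(3)[of n] unfolding real_norm_def by linarith
  qed
  have GL2: "G n \<in> L2 \<U>" for n by (rule L2_bounded(1)[OF lm borel_measurable_lebesgue_onI[OF bG]]) (rule GL)
  have lim1: "(\<lambda>n. L2_norm \<U> (\<lambda>x. w n x - u x)) \<longlonglongrightarrow> 0"
  proof (rule L2_dominated_convergence[OF lm, where B=2])
    show "(\<lambda>x. w n x - u x) \<in> borel_measurable (lebesgue_on \<U>)" for n
      using bw bu by (intro borel_measurable_lebesgue_onI) simp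
    show "norm (w n x - u x) \<le> 2" for n x using wM[of n x] d(3)[of n] by simp
    have "(\<lambda>n. w n x - u x) \<longlonglongrightarrow> 0" for x
      by (rule Lim_null_comparison[of _ "\<lambda>n. 2 * d n"]) (use wM d(1) in \<open>auto intro!: always_eventually tendsto_eq_intros\<close>)
    then show "AE x in lebesgue_on \<U>. (\<lambda>n. w n x - u x) \<longlonglongrightarrow> 0" by simp
  qed
  \<comment> \<open>Since \<open>u\<close> is nonnegative, its zeros are minima. Hence truncation
    loses no gradient in the limit: where \<open>u\<close> is positive the factor tends to 1,
    elsewhere the gradient is 0.\<close>
  have gzero: "g x = 0" if "x \<notin> Z" "u x = 0" for x
  proof -
    have "(\<lambda>h. h \<bullet> g x) = (\<lambda>h. 0)"
      by (rule differential_zero_maxmin[of x UNIV u]) (use Z(3)[OF that(1)] that(2) u(2) in auto)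
    then have "g x \<bullet> g x = 0" by meson
    then show ?thesis by simp
  qed
  have Glim: "(\<lambda>n. G n x) \<longlonglongrightarrow> g x" if "x \<notin> Z" for x
  proof (cases "u x = 0")
    case True
    then show ?thesis using gzero[OF that True] by (simp add: G_def)
  next
    case False
    then have "u x > 0" using u(2)[of x] by linarith
    from tendsto_scaleR[OF soft_trunc_deriv_tendsto[OF this d(1)] tendsto_const[of "g x"]] show ?thesis by (simp add: G_def)
  qed
  have lim2: "(\<lambda>n. L2_norm \<U> (\<lambda>x. G n x - g x)) \<longlonglongrightarrow> 0"
  proof (rule L2_dominated_convergence[OF lm, where B="L + L"])
    show "(\<lambda>x. G n x - g x) \<in> borel_measurable (lebesgue_on \<U>)" for n
      using bG bg by (intro borel_measurable_lebesgue_onI) simp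
    show "norm (G n x - g x) \<le> L + L" for n x
      using norm_triangle_ineq4[of "G n x" "g x"] GL[of n x] g(3)[of x] by linarith
    have "AE x in lebesgue. x \<notin> Z" using Z(2) AE_not_in negligible_iff_null_sets by blast
    then have "AE x in lebesgue. x \<in> \<U> \<longrightarrow> (\<lambda>n. G n x - g x) \<longlonglongrightarrow> 0"
      by eventually_elim (use LIM_zero[OF Glim] in blast)
    then show "AE x in lebesgue_on \<U>. (\<lambda>n. G n x - g x) \<longlonglongrightarrow> 0" using sl by (simp add: AE_restrict_space_iff)
  qed
  show "u \<in> H10 \<U>"
  proof (rule H10_I[OF \<U>(1) uL gL wg])
    fix e :: real assume e: "e > 0"
    then have e2: "e / 2 > 0" by simp
    have "\<forall>\<^sub>F n in sequentially. L2_norm \<U> (\<lambda>x. w n x - u x) < e / 2 \<and> L2_norm \<U> (\<lambda>x. G n x - g x) < e / 2"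
      using order_tendstoD(2)[OF lim1 e2] order_tendstoD(2)[OF lim2 e2] by (rule eventually_conj)
    then obtain n where n: "L2_norm \<U> (\<lambda>x. w n x - u x) < e / 2" "L2_norm \<U> (\<lambda>x. G n x - g x) < e / 2"
      by (auto simp: eventually_sequentially)
    have "\<exists>f\<in>test_functions \<U>. L2_norm \<U> (\<lambda>x. f x - w n x) < e / 2 \<and> L2_norm \<U> (\<lambda>x. grad f x - G n x) < e / 2"
    proof (rule mollifier_approximation[OF \<U> wlip _ _ _ Z(1,2) wder cG _ GL e2])
      \<comment> \<open>A superlevel set of \<open>u\<close> at a positive level; it lies inside
        \<U> because \<open>u\<close> is 0 outside, and it is compact because \<U> is
        bounded.\<close>
      let ?K = "u -` {d n..} \<inter> closure \<U>"
      have "closed (u -` {d n..})" using cu by (intro continuous_closed_vimage) (auto simp: continuous_on_eq_continuous_at)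
      then show "compact ?K" using cl by (simp add: closed_Int_compact)
      show "?K \<subseteq> \<U>" using u(3) d(2)[of n] by force
      show "w n x = 0" if "x \<notin> ?K" for x
      proof (cases "x \<in> \<U>")
        case True
        then have "u x < d n" using that closure_subset[of \<U>] by auto
        then show ?thesis using d(2)[of n] by (simp add: w_def soft_trunc_eq_0)
      next
        case False
        then show ?thesis using u(3)[OF False] d(2)[of n] by (simp add: w_def soft_trunc_eq_0)
      qed
    qed (auto simp: G_def g(2))
    then obtain f where f: "f \<in> test_functions \<U>" "L2_norm \<U> (\<lambda>x. f x - w n x) < e / 2" "L2_norm \<U> (\<lambda>x. grad f x - G n x) < e / 2"
      by blast
    note fL = test_functions_L2[OF f(1) sl]
    have "L2_norm \<U> (\<lambda>x. f x - u x) < e"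
      using L2_norm_triangle[OF L2_diff[OF fL(1) wL[of n]] L2_diff[OF wL[of n] uL]] f(2) n(1) by simp
    moreover have "L2_norm \<U> (\<lambda>x. grad f x - g x) < e"
      using L2_norm_triangle[OF L2_diff[OF fL(2) GL2[of n]] L2_diff[OF GL2[of n] gL]] f(3) n(2) by simp
    ultimately show "\<exists>f\<in>test_functions \<U>. L2_norm \<U> (\<lambda>x. f x - u x) < e \<and> L2_norm \<U> (\<lambda>x. grad f x - g x) < e"
      using f(1) by blast
  qed
qed

section \<open>Geometry and integral inequalities on one simplex\<close>

section \<open>Barycentric coordinates\<close>

text \<open>Taken affine on the whole space, since coordinates of one element are later evaluated
  outside of it, in its neighbours and in cones.\<close>

definition bary :: "'a::euclidean_space set \<Rightarrow> 'a \<Rightarrow> 'a \<Rightarrow> real" where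
  "bary S z = (SOME f. affine_fun_on UNIV f \<and> (\<forall>z'\<in>S. f z' = (if z' = z then 1 else 0)))"

definition bary_grad :: "'a::euclidean_space set \<Rightarrow> 'a \<Rightarrow> 'a" where
  "bary_grad S z = (SOME a. \<exists>c. \<forall>x. bary S z x = a \<bullet> x + c)"

lemma affine_fun_sum:
  assumes "affine_fun_on UNIV f" "finite S" "sum u S = 1"
  shows "f (\<Sum>v\<in>S. u v *\<^sub>R v) = (\<Sum>v\<in>S. u v * f v)"
proof -
  obtain a c where f: "\<And>x. f x = a \<bullet> x + c" using assms(1) by (auto simp: affine_fun_on_def)
  have "(\<Sum>v\<in>S. u v * f v) = (\<Sum>v\<in>S. u v * (a \<bullet> v)) + (\<Sum>v\<in>S. u v) * c"
    by (simp add: f distrib_left sum.distrib sum_distrib_right)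
  then show ?thesis using assms(3) by (simp add: f inner_sum_right)
qed

locale simplex_vertices =
  fixes S :: "'a::euclidean_space set"
  assumes indep: "\<not> affine_dependent S" and card: "card S = Suc DIM('a)"
begin

lemma fin: "finite S" using indep by (rule aff_independent_finite)

lemma affine_hull_UNIV: "affine hull S = UNIV"
  using affine_independent_span_eq[OF indep] card by simp

text \<open>The other vertices are too few to span the space, so they lie in a hyperplane. The
  vertex \<open>z\<close> is off it, as the affine hull of all vertices is everything; the signed
  distance to the hyperplane is then normalized at \<open>z\<close>.\<close>

lemma bary_exists:
  assumes z: "z \<in> S"
  shows "\<exists>f. affine_fun_on UNIV f \<and> (\<forall>z'\<in>S. f z' = (if z' = z then 1 else 0))"
proof -
  have "aff_dim (S - {z}) < int DIM('a)"
    using aff_dim_le_card[of "S - {z}"] fin z card by simp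
  then obtain a b where ab: "a \<noteq> 0" "S - {z} \<subseteq> {x. a \<bullet> x = b}"
    by (rule aff_lowdim_subset_hyperplane)
  have "a \<bullet> z \<noteq> b"
  proof
    assume "a \<bullet> z = b"
    then have "S \<subseteq> {x. a \<bullet> x = b}" using ab(2) by blast
    then have "affine hull S \<subseteq> {x. a \<bullet> x = b}" by (intro hull_minimal affine_hyperplane)
    then have "{x. a \<bullet> x = b} = UNIV" using affine_hull_UNIV by blast
    then have "a \<bullet> a = b" "a \<bullet> 0 = b" by blast+
    then show False using ab(1) by simp
  qed
  define k where "k = a \<bullet> z - b"
  have "affine_fun_on UNIV (\<lambda>x. (a \<bullet> x - b) / k)"
    unfolding affine_fun_on_def by (intro exI[of _ "a /\<^sub>R k"] exI[of _ "- b / k"]) (simp add: divide_inverse algebra_simps)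
  moreover have "(a \<bullet> z' - b) / k = (if z' = z then 1 else 0)" if "z' \<in> S" for z'
    using ab(2) that \<open>a \<bullet> z \<noteq> b\<close> by (auto simp: k_def)
  ultimately show ?thesis by blast
qed

lemma bary_affine: "z \<in> S \<Longrightarrow> affine_fun_on UNIV (bary S z)"
  and bary_vertex: "z \<in> S \<Longrightarrow> z' \<in> S \<Longrightarrow> bary S z z' = (if z' = z then 1 else 0)"
  unfolding bary_def using someI_ex[OF bary_exists] by blast+

lemma bary_diff:
  assumes z: "z \<in> S"
  shows "bary S z x = bary S z y + bary_grad S z \<bullet> (x - y)"
proof -
  have "\<exists>a c. \<forall>x. bary S z x = a \<bullet> x + c" using bary_affine[OF z] by (auto simp: affine_fun_on_def)
  then have "\<exists>c. \<forall>x. bary S z x = bary_grad S z \<bullet> x + c" unfolding bary_grad_def by (rule someI_ex)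
  then show ?thesis by (auto simp: inner_diff_right)
qed

lemma bary_unique:
  assumes "sum u S = 1" "(\<Sum>v\<in>S. u v *\<^sub>R v) = x" "z \<in> S"
  shows "bary S z x = u z"
proof -
  have "bary S z x = (\<Sum>v\<in>S. u v * bary S z v)"
    using affine_fun_sum[OF bary_affine[OF assms(3)] fin assms(1)] assms(2) by simp
  also have "\<dots> = (\<Sum>v\<in>S. if v = z then u v else 0)"
    using assms(3) by (intro sum.cong) (auto simp: bary_vertex)
  finally show ?thesis using fin assms(3) by simp
qed

lemma bary_representation: "(\<Sum>v\<in>S. bary S v x) = 1" "(\<Sum>v\<in>S. bary S v x *\<^sub>R v) = x"
proof -
  have "x \<in> affine hull S" using affine_hull_UNIV by simp
  then obtain u where u: "sum u S = 1" "(\<Sum>v\<in>S. u v *\<^sub>R v) = x" using affine_hull_finite[OF fin] by auto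
  then have "bary S v x = u v" if "v \<in> S" for v using bary_unique that by blast
  then show "(\<Sum>v\<in>S. bary S v x) = 1" "(\<Sum>v\<in>S. bary S v x *\<^sub>R v) = x" using u by auto
qed

lemma affine_expand:
  assumes "affine_fun_on UNIV f"
  shows "f x = (\<Sum>v\<in>S. bary S v x * f v)"
  using affine_fun_sum[OF assms fin bary_representation(1)[of x]] bary_representation(2)[of x] by simp

text \<open>The coordinates add up to the constant 1. This identity allows a constant to be
  subtracted from all nodal values before gradients are estimated.\<close>

lemma bary_grad_sum: "(\<Sum>v\<in>S. bary_grad S v) = 0"
proof -
  have "(\<Sum>v\<in>S. bary_grad S v) \<bullet> y = 0" for y
  proof -
    have "(\<Sum>v\<in>S. bary S v y) = (\<Sum>v\<in>S. bary S v 0 + bary_grad S v \<bullet> (y - 0))"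
      by (intro sum.cong refl bary_diff)
    then show ?thesis by (simp add: bary_representation sum.distrib inner_sum_left)
  qed
  then show ?thesis using inner_eq_zero_iff by blast
qed

lemma convex_hull_bary: "convex hull S = {x. \<forall>v\<in>S. 0 \<le> bary S v x}"
proof (intro equalityI subsetI)
  fix x assume "x \<in> convex hull S"
  then obtain u where u: "\<forall>v\<in>S. 0 \<le> u v" "sum u S = 1" "(\<Sum>v\<in>S. u v *\<^sub>R v) = x"
    using convex_hull_finite[OF fin] by auto
  then show "x \<in> {x. \<forall>v\<in>S. 0 \<le> bary S v x}" using bary_unique[OF u(2,3)] by simp
next
  fix x assume "x \<in> {x. \<forall>v\<in>S. 0 \<le> bary S v x}"
  then show "x \<in> convex hull S"
    unfolding convex_hull_finite[OF fin] using bary_representation[of x] by auto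
qed

lemma interior_bary: "interior (convex hull S) = {x. \<forall>v\<in>S. 0 < bary S v x}"
proof -
  have "interior (convex hull S) = {y. \<exists>u. (\<forall>x\<in>S. 0 < u x) \<and> sum u S = 1 \<and> (\<Sum>x\<in>S. u x *\<^sub>R x) = y}"
    using interior_convex_hull_explicit_minimal[OF indep] card by simp
  also have "\<dots> = {x. \<forall>v\<in>S. 0 < bary S v x}"
  proof (intro equalityI subsetI)
    fix x assume "x \<in> {y. \<exists>u. (\<forall>x\<in>S. 0 < u x) \<and> sum u S = 1 \<and> (\<Sum>x\<in>S. u x *\<^sub>R x) = y}"
    then show "x \<in> {x. \<forall>v\<in>S. 0 < bary S v x}" using bary_unique by auto
  next
    fix x assume "x \<in> {x. \<forall>v\<in>S. 0 < bary S v x}"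
    then show "x \<in> {y. \<exists>u. (\<forall>x\<in>S. 0 < u x) \<and> sum u S = 1 \<and> (\<Sum>x\<in>S. u x *\<^sub>R x) = y}"
      using bary_representation[of x] by (intro CollectI exI[of _ "\<lambda>v. bary S v x"]) auto
  qed
  finally show ?thesis .
qed

abbreviation T where "T \<equiv> interior (convex hull S)"

definition barycenter where "barycenter = (\<Sum>v\<in>S. (1 / real (card S)) *\<^sub>R v)"

lemma bary_barycenter: "z \<in> S \<Longrightarrow> bary S z barycenter = 1 / (real DIM('a) + 1)"
  using bary_unique[of "\<lambda>_. 1 / real (card S)" barycenter z] card fin by (simp add: barycenter_def add.commute)

lemma barycenter_in: "barycenter \<in> T"
  unfolding interior_bary by (auto simp: bary_barycenter)

lemma T_props: "open T" "convex T" "bounded T" "T \<noteq> {}"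
  using barycenter_in by (auto intro!: convex_interior bounded_subset[OF finite_imp_bounded_convex_hull[OF fin] interior_subset])

lemma T_meas: "T \<in> lmeasurable" "T \<in> sets lebesgue" "T \<in> sets borel" "0 < vol T"
proof -
  show l: "T \<in> lmeasurable" using T_props(1,3) by (simp add: bounded_set_imp_lmeasurable)
  show "T \<in> sets lebesgue" "T \<in> sets borel" by auto
  have "\<not> negligible T" using open_not_negligible T_props by blast
  then show "0 < vol T" using l by (simp add: negligible_iff_measure zero_less_measure_iff measure_nonneg less_le)
qed

lemma closure_T: "closure T = convex hull S"
proof -
  have "closure T = closure (convex hull S)"
    using T_props(4) by (intro convex_closure_interior convex_convex_hull)
  also have "\<dots> = convex hull S"
    using finite_imp_compact_convex_hull[OF fin] by (simp add: compact_imp_closed)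
  finally show ?thesis .
qed

lemma vertices_T: "vertices T = S"
  unfolding vertices_def closure_T using extreme_point_of_convex_hull_affine_independent[OF indep] by auto

lemma dist_le_diameter: "x \<in> closure T \<Longrightarrow> y \<in> closure T \<Longrightarrow> dist x y \<le> diameter T"
  using diameter_bounded_bound[of "closure T" x y] T_props(3) by (simp add: diameter_closure bounded_closure)

lemma S_subset: "S \<subseteq> closure T" unfolding closure_T by (rule hull_subset)

lemma obtain_other: "z \<in> S \<Longrightarrow> \<exists>v\<in>S. v \<noteq> z"
proof (rule ccontr)
  assume "z \<in> S" "\<not> (\<exists>v\<in>S. v \<noteq> z)"
  then have "S = {z}" by blast
  then show False using card DIM_positive[where 'a='a] by simp
qed

text \<open>Along the edge the coordinate drops from 1 to 0. Read as a lower bound for the length of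
  an edge, this lets elements that share an edge be compared in size.\<close>

lemma edge: "z \<in> S \<Longrightarrow> z' \<in> S \<Longrightarrow> z' \<noteq> z \<Longrightarrow> 1 \<le> norm (bary_grad S z) * dist z z'"
proof -
  assume z: "z \<in> S" "z' \<in> S" "z' \<noteq> z"
  have "1 = bary_grad S z \<bullet> (z - z')" using bary_diff[OF z(1), of z z'] z by (simp add: bary_vertex)
  also have "\<dots> \<le> norm (bary_grad S z) * norm (z - z')" by (rule norm_cauchy_schwarz)
  finally show ?thesis by (simp add: dist_norm)
qed

lemma bary_grad_nonzero: "z \<in> S \<Longrightarrow> bary_grad S z \<noteq> 0"
  using obtain_other edge by fastforce

lemma diameter_pos: "0 < diameter T"
proof -
  obtain z where z: "z \<in> S" using card by fastforce
  then obtain v where v: "v \<in> S" "v \<noteq> z" using obtain_other by blast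
  then have "0 < dist v z" by simp
  also have "\<dots> \<le> diameter T" using z v S_subset by (intro dist_le_diameter) auto
  finally show ?thesis .
qed

lemma bary_bounds: "x \<in> closure T \<Longrightarrow> z \<in> S \<Longrightarrow> 0 \<le> bary S z x \<and> bary S z x \<le> 1"
proof -
  assume x: "x \<in> closure T" and z: "z \<in> S"
  then have nn: "\<forall>v\<in>S. 0 \<le> bary S v x" unfolding closure_T by (simp add: convex_hull_bary)
  then have "bary S z x \<le> (\<Sum>v\<in>S. bary S v x)" using fin z by (intro member_le_sum) auto
  then show ?thesis using nn z bary_representation(1) by simp
qed

lemma bary_bounds_interior: "x \<in> T \<Longrightarrow> z \<in> S \<Longrightarrow> 0 < bary S z x \<and> bary S z x < 1"
proof -
  assume x: "x \<in> T" and z: "z \<in> S"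
  then have p: "\<forall>v\<in>S. 0 < bary S v x" by (simp add: interior_bary)
  obtain v where v: "v \<in> S" "v \<noteq> z" using obtain_other z by blast
  have "bary S z x + bary S v x = (\<Sum>w\<in>{z, v}. bary S w x)" using v by simp
  also have "\<dots> \<le> (\<Sum>v\<in>S. bary S v x)" using fin z v p by (intro sum_mono2) (auto intro: less_imp_le)
  finally show ?thesis using p z v bary_representation(1)[of x] by force
qed

text \<open>The translates of a simplex by multiples of \<open>g / \<bar>g\<bar>\<^sup>2\<close>, where \<open>g\<close> is the gradient of a barycentric
  coordinate, lie in disjoint slabs; comparing volumes bounds \<open>g\<close>.\<close>

lemma bary_grad_bound:
  assumes z: "z \<in> S"
  shows "norm (bary_grad S z) * diameter T * vol T \<le> unit_ball_vol (real DIM('a)) * (2 * diameter T) ^ DIM('a)"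
proof -
  define g where "g = bary_grad S z"
  define h where "h = diameter T"
  have g: "g \<noteq> 0" using bary_grad_nonzero[OF z] by (simp add: g_def)
  have h: "h > 0" using diameter_pos by (simp add: h_def)
  define w where "w = g /\<^sub>R (norm g)\<^sup>2"
  \<comment> \<open>Since \<open>norm w = 1 / norm g\<close>, the translates up to index
    \<open>M\<close> move \<open>T\<close> by at most \<open>h\<close> and remain in the ball of
    radius \<open>2 * h\<close> about \<open>z\<close>.\<close>
  define M where "M = nat \<lfloor>h * norm g\<rfloor>"
  define A where "A m = (+) (real m *\<^sub>R w) ` T" for m
  have gw: "g \<bullet> w = 1" using g by (simp add: w_def power2_norm_eq_inner)
  have nw: "norm w = 1 / norm g" using g by (simp add: w_def power2_eq_square divide_inverse)
  have sub: "real m < bary S z y \<and> bary S z y < real m + 1" if yA: "y \<in> A m" for m y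
  proof -
    obtain x where x: "x \<in> T" "y = real m *\<^sub>R w + x" using yA unfolding A_def by blast
    have "bary S z y = bary S z x + real m"
      using bary_diff[OF z, of y x] gw by (simp add: x(2) g_def[symmetric])
    then show ?thesis using bary_bounds_interior[OF x(1) z] by simp
  qed
  have disj: "pairwise (\<lambda>i j. disjnt (A i) (A j)) {..M}"
  proof (intro pairwiseI)
    fix i j :: nat assume "i \<noteq> j"
    show "disjnt (A i) (A j)"
    proof (rule ccontr)
      assume "\<not> disjnt (A i) (A j)"
      then obtain y where "y \<in> A i" "y \<in> A j" by (auto simp: disjnt_def)
      then have "real i < real j + 1" "real j < real i + 1" using sub[of y i] sub[of y j] by linarith+
      then show False using \<open>i \<noteq> j\<close> by linarith
    qed
  qed
  have meas: "A m \<in> lmeasurable" "vol (A m) = vol T" for m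
    using T_meas(1) by (auto simp: A_def measurable_translation measure_translation)
  have incl: "A m \<subseteq> cball z (2 * h)" if "m \<le> M" for m
  proof
    fix y assume "y \<in> A m"
    then obtain x where x: "x \<in> T" "y = real m *\<^sub>R w + x" unfolding A_def by blast
    have "real m \<le> h * norm g" using that order_trans[OF of_nat_mono of_nat_floor[of "h * norm g"]] h by (simp add: M_def)
    then have "norm (real m *\<^sub>R w) \<le> h" using g by (simp add: nw field_simps)
    moreover have "dist z x \<le> h"
      unfolding h_def using z S_subset x closure_subset by (intro dist_le_diameter) auto
    ultimately show "y \<in> cball z (2 * h)"
      using norm_triangle_ineq4[of "z - x" "real m *\<^sub>R w"] by (simp add: x(2) dist_norm algebra_simps)
  qed
  have "(real M + 1) * vol T = (\<Sum>m\<in>{..M}. vol (A m))" by (simp add: meas algebra_simps)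
  also have "\<dots> = vol (\<Union>m\<in>{..M}. A m)"
    using disj meas(1) by (intro measure_UNION'[symmetric]) auto
  also have "\<dots> \<le> vol (cball z (2 * h))"
    using incl meas(1) by (intro measure_mono_fmeasurable) (auto intro!: sets.finite_UN fmeasurableD)
  also have "\<dots> = unit_ball_vol (real DIM('a)) * (2 * h) ^ DIM('a)"
    using h by (simp add: content_cball)
  finally have *: "(real M + 1) * vol T \<le> unit_ball_vol (real DIM('a)) * (2 * h) ^ DIM('a)" .
  have "h * norm g \<le> real M + 1" using h by (simp add: M_def)
  then have "norm g * h * vol T \<le> (real M + 1) * vol T"
    using T_meas(4) by (intro mult_right_mono) (auto simp: mult.commute)
  with * show ?thesis by (simp add: g_def h_def)
qed

lemma measure_T_le: "vol T \<le> unit_ball_vol (real DIM('a)) * diameter T ^ DIM('a)"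
proof -
  obtain z where z: "z \<in> S" using card by fastforce
  have "T \<subseteq> cball z (diameter T)"
    using dist_le_diameter[of z] z S_subset closure_subset[of T] by (simp add: subset_iff)
  then have "vol T \<le> vol (cball z (diameter T))"
    using T_meas by (intro measure_mono_fmeasurable) auto
  then show ?thesis using diameter_pos by (simp add: content_cball)
qed

lemma bary_homothety:
  "v \<in> S \<Longrightarrow> bary S v (p + s *\<^sub>R (x - p)) = (1 - s) * bary S v p + s * bary S v x"
proof -
  assume v: "v \<in> S"
  have "bary S v (p + s *\<^sub>R (x - p)) = bary S v p + s * (bary_grad S v \<bullet> (x - p))"
    using bary_diff[OF v, of "p + s *\<^sub>R (x - p)" p] by simp
  also have "bary_grad S v \<bullet> (x - p) = bary S v x - bary S v p" using bary_diff[OF v, of x p] by simp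
  finally show ?thesis by (simp add: algebra_simps)
qed

lemma measure_homothety:
  assumes A: "A \<in> sets borel" "A \<in> lmeasurable" and s: "0 < s"
    and sub: "\<And>x. x \<in> T \<Longrightarrow> p + s *\<^sub>R (x - p) \<in> A"
  shows "s ^ DIM('a) * vol T \<le> vol A"
proof -
  have em: "emeasure lborel B = ennreal (vol B)" if "B \<in> sets borel" "B \<in> lmeasurable" for B :: "'a set"
    using that emeasure_eq_measure2[of B lebesgue] by simp
  have eq: "(p - s *\<^sub>R p) + s *\<^sub>R x = p + s *\<^sub>R (x - p)" for x by (simp add: algebra_simps)
  have "ennreal (s ^ DIM('a) * vol T) = ennreal (s ^ DIM('a)) * (\<integral>\<^sup>+x. indicator T x \<partial>lborel)"
    using s em[OF T_meas(3,1)] T_meas(3) by (simp add: ennreal_mult)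
  also have "\<dots> \<le> ennreal (\<bar>s\<bar> ^ DIM('a)) * (\<integral>\<^sup>+x. indicator A ((p - s *\<^sub>R p) + s *\<^sub>R x) \<partial>lborel)"
    unfolding eq using s sub by (intro mult_mono nn_integral_mono) (auto simp: indicator_def)
  also have "\<dots> = (\<integral>\<^sup>+x. indicator A x \<partial>lborel)"
    using A(1) s by (intro lborel_nn_integral_affine[symmetric]) auto
  also have "\<dots> = ennreal (vol A)" using A em[OF A] by simp
  finally show ?thesis by simp
qed

text \<open>The homothety at \<open>z\<close> with ratio \<open>s\<close> maps the simplex into
  itself and into the ball. It gives the share of each element in a small ball at a vertex, which
  limits the number of elements there.\<close>

lemma measure_T_ball:
  assumes z: "z \<in> S" and s: "0 < s" "s \<le> 1"
  shows "s ^ DIM('a) * vol T \<le> vol (T \<inter> cball z (s * diameter T))"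
proof (rule measure_homothety[OF _ _ s(1)])
  show "T \<inter> cball z (s * diameter T) \<in> sets borel" "T \<inter> cball z (s * diameter T) \<in> lmeasurable"
    using T_meas(1) by (auto intro: fmeasurable_Int_fmeasurable)
  fix x assume x: "x \<in> T"
  have "0 < bary S v (z + s *\<^sub>R (x - z))" if v: "v \<in> S" for v
    unfolding bary_homothety[OF v] using s v z bary_bounds_interior[OF x v] by (auto simp: bary_vertex add_nonneg_pos)
  then have "z + s *\<^sub>R (x - z) \<in> T" by (simp add: interior_bary)
  moreover have "dist z x \<le> diameter T" using dist_le_diameter[of z x] z S_subset x closure_subset[of T] by blast
  then have "dist z (z + s *\<^sub>R (x - z)) \<le> s * diameter T"
    using s by (simp add: dist_norm norm_minus_commute)
  ultimately show "z + s *\<^sub>R (x - z) \<in> T \<inter> cball z (s * diameter T)" by simp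
qed

lemma bary_derivative: "z \<in> S \<Longrightarrow> (bary S z has_derivative (\<lambda>h. h \<bullet> bary_grad S z)) (at x)"
proof -
  assume "z \<in> S"
  then have "bary S z = (\<lambda>x. bary S z 0 + bary_grad S z \<bullet> (x - 0))" using bary_diff by blast
  moreover have "((\<lambda>x. bary S z 0 + bary_grad S z \<bullet> (x - 0)) has_derivative (\<lambda>h. h \<bullet> bary_grad S z)) (at x)"
    by (auto intro!: derivative_eq_intros simp: inner_commute)
  ultimately show ?thesis by simp
qed

lemma continuous_bary: "z \<in> S \<Longrightarrow> continuous_on A (bary S z)"
  using has_derivative_continuous[OF bary_derivative] by (intro continuous_at_imp_continuous_on) blast

lemma integrable_T_continuous:
  fixes f :: "'a \<Rightarrow> 'b::euclidean_space"
  assumes "continuous_on UNIV f"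
  shows "integrable (lebesgue_on T) f"
proof -
  have c: "compact (closure T)" using T_props(3) by simp
  have "integrable lborel (\<lambda>x. indicator (closure T) x *\<^sub>R f x)"
    using c assms by (intro borel_integrable_compact) (auto intro: continuous_on_subset)
  then have "integrable (lebesgue_on T) (\<lambda>x. indicator (closure T) x *\<^sub>R f x)"
    by (rule integrable_lborel_imp_lebesgue_on) (rule T_meas(2))
  moreover have "indicator (closure T) x *\<^sub>R f x = f x" if "x \<in> T" for x
    using that closure_subset[of T] by (auto simp: indicator_def)
  ultimately show ?thesis
    by (subst Bochner_Integration.integrable_cong[OF refl, of _ _ "\<lambda>x. indicator (closure T) x *\<^sub>R f x"]) auto
qed

text \<open>Halving the distance to the barycenter maps the simplex into the region where all
  coordinates are at least \<open>k\<close>, half of their common value 1/(d+1) at the barycenter.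
  The product of the d+1 coordinates is at least \<open>k ^ Suc d\<close> there.\<close>

lemma bubble_integral_lower:
  defines "k \<equiv> 1 / (2 * (real DIM('a) + 1))"
  shows "(1 / 2) ^ DIM('a) * k ^ Suc DIM('a) * vol T \<le> (LINT x|lebesgue_on T. (\<Prod>v\<in>S. bary S v x))"
proof -
  define A where "A = T \<inter> (\<Inter>v\<in>S. bary S v -` {k..})"
  have kp: "k > 0" by (simp add: k_def)
  have "closed (\<Inter>v\<in>S. bary S v -` {k..})"
    using continuous_bary[of _ UNIV] by (intro closed_INT) (auto intro!: continuous_closed_vimage simp: continuous_on_eq_continuous_at)
  then have Ab: "A \<in> sets borel" unfolding A_def by (intro sets.Int) auto
  have Al: "A \<in> lmeasurable"
    using T_props(3) Ab by (intro bounded_set_imp_lmeasurable) (auto simp: A_def intro: bounded_subset)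
  have m: "(1 / 2) ^ DIM('a) * vol T \<le> vol A"
  proof (rule measure_homothety[OF Ab Al])
    fix x assume x: "x \<in> T"
    have "k \<le> bary S v (barycenter + (1 / 2) *\<^sub>R (x - barycenter))" if v: "v \<in> S" for v
      unfolding bary_homothety[OF v] bary_barycenter[OF v] using bary_bounds_interior[OF x v] by (simp add: k_def)
    then show "barycenter + (1 / 2) *\<^sub>R (x - barycenter) \<in> A"
      using kp by (auto simp: A_def interior_bary intro: less_le_trans)
  qed simp
  have iA: "integrable (lebesgue_on T) (indicat_real A)"
    using Ab Al T_meas(2) by (intro integrable_lborel_imp_lebesgue_on integrable_real_indicator) (auto simp: fmeasurable_def)
  have "vol A = (LINT x|lebesgue. indicator T x *\<^sub>R indicat_real A x)"
  proof -
    have "(LINT x|lebesgue. indicator T x *\<^sub>R indicat_real A x) = (LINT x|lebesgue. indicat_real A x)"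
      by (rule Bochner_Integration.integral_cong) (auto simp: A_def indicator_def)
    moreover have "(LINT x|lebesgue. indicat_real A x) = vol A" using Al by (simp add: fmeasurable_def)
    ultimately show ?thesis by linarith
  qed
  also have "\<dots> = (LINT x|lebesgue_on T. indicat_real A x)"
    using T_meas(2) by (intro integral_restrict_space[symmetric]) auto
  finally have mA: "vol A = (LINT x|lebesgue_on T. indicat_real A x)" .
  have "k ^ Suc DIM('a) * vol A = (LINT x|lebesgue_on T. k ^ Suc DIM('a) * indicat_real A x)"
    by (simp add: mA del: power_Suc)
  also have "\<dots> \<le> (LINT x|lebesgue_on T. (\<Prod>v\<in>S. bary S v x))"
  proof (rule integral_mono)
    show "integrable (lebesgue_on T) (\<lambda>x. k ^ Suc DIM('a) * indicat_real A x)" using iA by simp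
    show "integrable (lebesgue_on T) (\<lambda>x. \<Prod>v\<in>S. bary S v x)"
      by (intro integrable_T_continuous continuous_on_prod continuous_bary)
    fix x assume "x \<in> space (lebesgue_on T)"
    then have x: "x \<in> T" by simp
    show "k ^ Suc DIM('a) * indicat_real A x \<le> (\<Prod>v\<in>S. bary S v x)"
    proof (cases "x \<in> A")
      case True
      have "k ^ Suc DIM('a) = (\<Prod>v\<in>S. k)" using card by simp
      also have "\<dots> \<le> (\<Prod>v\<in>S. bary S v x)"
        using True kp by (intro prod_mono) (auto simp: A_def)
      finally show ?thesis using True by simp
    next
      case False
      moreover have "0 \<le> (\<Prod>v\<in>S. bary S v x)"
        by (rule prod_nonneg) (use bary_bounds_interior[OF x] in \<open>auto intro: less_imp_le\<close>)
      ultimately show ?thesis by simp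
    qed
  qed
  finally have "k ^ Suc DIM('a) * vol A \<le> (LINT x|lebesgue_on T. (\<Prod>v\<in>S. bary S v x))" .
  moreover have "k ^ Suc DIM('a) * ((1 / 2) ^ DIM('a) * vol T) \<le> k ^ Suc DIM('a) * vol A"
    using m kp by (intro mult_left_mono) auto
  ultimately show ?thesis by (simp add: mult_ac)
qed

lemma affine_null:
  assumes "(LINT x|lebesgue_on T. (a \<bullet> x + c)\<^sup>2) = 0"
  shows "a = 0 \<and> c = 0"
proof (rule ccontr)
  assume "\<not> ?thesis"
  then have hyp: "negligible {x. a \<bullet> x = - c}" by (intro negligible_hyperplane) auto
  have "integrable (lebesgue_on T) (\<lambda>x. (a \<bullet> x + c)\<^sup>2)" by (intro integrable_T_continuous continuous_intros)
  then have "AE x in lebesgue_on T. (a \<bullet> x + c)\<^sup>2 = 0" using assms by (simp add: integral_nonneg_eq_0_iff_AE)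
  then have "AE x in lebesgue. x \<in> T \<longrightarrow> a \<bullet> x = - c"
    using T_meas(2) by (simp add: AE_restrict_space_iff eq_neg_iff_add_eq_0)
  moreover have "AE x in lebesgue. x \<notin> {x. a \<bullet> x = - c}" using hyp AE_not_in negligible_iff_null_sets by blast
  ultimately have "AE x in lebesgue. x \<notin> T" by eventually_elim blast
  then have "negligible T" using T_meas(2) by (simp add: negligible_iff_null_sets AE_iff_null_sets)
  then show False using open_not_negligible T_props by blast
qed

text \<open>The Riesz representer of the evaluation at \<open>z\<close> on affine functions; it is found by inverting the
  positive definite Gram map on the pairs of slope and constant term.\<close>

lemma affine_representer:
  "\<exists>\<psi>. affine_fun_on UNIV \<psi> \<and> (\<forall>p. affine_fun_on UNIV p \<longrightarrow> L2_inner T \<psi> p = p z)"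
proof -
  define G :: "'a \<times> real \<Rightarrow> 'a \<times> real" where
    "G w = (LINT x|lebesgue_on T. (fst w \<bullet> x + snd w) *\<^sub>R x, LINT x|lebesgue_on T. fst w \<bullet> x + snd w)" for w
  have i1: "integrable (lebesgue_on T) (\<lambda>x. (fst w \<bullet> x + snd w) *\<^sub>R x)"
    and i2: "integrable (lebesgue_on T) (\<lambda>x. fst w \<bullet> x + snd w)"
    for w :: "'a \<times> real"
    by (intro integrable_T_continuous continuous_intros)+
  have "linear G"
  proof (rule linearI)
    fix w w'
    have "(LINT x|lebesgue_on T. (fst (w + w') \<bullet> x + snd (w + w')) *\<^sub>R x)
        = (LINT x|lebesgue_on T. (fst w \<bullet> x + snd w) *\<^sub>R x + (fst w' \<bullet> x + snd w') *\<^sub>R x)"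
      by (simp add: inner_add_left algebra_simps)
    moreover have "(LINT x|lebesgue_on T. fst (w + w') \<bullet> x + snd (w + w'))
        = (LINT x|lebesgue_on T. (fst w \<bullet> x + snd w) + (fst w' \<bullet> x + snd w'))"
      by (simp add: inner_add_left algebra_simps)
    ultimately show "G (w + w') = G w + G w'"
      unfolding G_def by (simp add: Bochner_Integration.integral_add[OF i1 i1] Bochner_Integration.integral_add[OF i2 i2])
  next
    fix r w
    have "(LINT x|lebesgue_on T. (fst (r *\<^sub>R w) \<bullet> x + snd (r *\<^sub>R w)) *\<^sub>R x)
        = (LINT x|lebesgue_on T. r *\<^sub>R ((fst w \<bullet> x + snd w) *\<^sub>R x))"
      by (simp add: algebra_simps)
    also have "\<dots> = r *\<^sub>R (LINT x|lebesgue_on T. (fst w \<bullet> x + snd w) *\<^sub>R x)"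
      by (rule integral_scaleR_right)
    finally have "(LINT x|lebesgue_on T. (fst (r *\<^sub>R w) \<bullet> x + snd (r *\<^sub>R w)) *\<^sub>R x)
        = r *\<^sub>R (LINT x|lebesgue_on T. (fst w \<bullet> x + snd w) *\<^sub>R x)" .
    moreover have "(LINT x|lebesgue_on T. fst (r *\<^sub>R w) \<bullet> x + snd (r *\<^sub>R w))
        = (LINT x|lebesgue_on T. r * (fst w \<bullet> x + snd w))"
      by (simp add: algebra_simps)
    ultimately show "G (r *\<^sub>R w) = r *\<^sub>R G w" unfolding G_def by (simp del: scaleR_scaleR)
  qed
  have Gi: "G w \<bullet> w' = (LINT x|lebesgue_on T. (fst w \<bullet> x + snd w) * (fst w' \<bullet> x + snd w'))" for w w'
  proof -
    have "G w \<bullet> w' = (LINT x|lebesgue_on T. (fst w \<bullet> x + snd w) *\<^sub>R x) \<bullet> fst w' + (LINT x|lebesgue_on T. fst w \<bullet> x + snd w) * snd w'"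
      by (simp add: G_def inner_prod_def)
    also have "(LINT x|lebesgue_on T. (fst w \<bullet> x + snd w) *\<^sub>R x) \<bullet> fst w' = (LINT x|lebesgue_on T. ((fst w \<bullet> x + snd w) *\<^sub>R x) \<bullet> fst w')"
      using integral_inner_left[OF i1] by metis
    also have "(LINT x|lebesgue_on T. fst w \<bullet> x + snd w) * snd w' = (LINT x|lebesgue_on T. (fst w \<bullet> x + snd w) * snd w')"
      by simp
    also have "(LINT x|lebesgue_on T. ((fst w \<bullet> x + snd w) *\<^sub>R x) \<bullet> fst w') + (LINT x|lebesgue_on T. (fst w \<bullet> x + snd w) * snd w')
       = (LINT x|lebesgue_on T. ((fst w \<bullet> x + snd w) *\<^sub>R x) \<bullet> fst w' + (fst w \<bullet> x + snd w) * snd w')"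
      by (rule Bochner_Integration.integral_add[symmetric]; intro integrable_T_continuous continuous_intros)
    also have "\<dots> = (LINT x|lebesgue_on T. (fst w \<bullet> x + snd w) * (fst w' \<bullet> x + snd w'))"
      by (simp add: algebra_simps inner_commute)
    finally show ?thesis .
  qed
  have "inj G"
  proof (rule linear_injective_0[OF \<open>linear G\<close>, THEN iffD2], intro allI impI)
    fix w assume "G w = 0"
    then have "(LINT x|lebesgue_on T. (fst w \<bullet> x + snd w)\<^sup>2) = 0" using Gi[of w w] by (simp add: power2_eq_square)
    from affine_null[OF this] show "w = 0" by (simp add: prod_eq_iff)
  qed
  then have "surj G" using linear_injective_imp_surjective[OF \<open>linear G\<close>] by blast
  \<comment> \<open>Pairing \<open>(z, 1)\<close> with a slope and a constant term is evaluation of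
    that affine function at \<open>z\<close>.\<close>
  then obtain w where w: "G w = (z, 1)" by (metis surjD)
  show ?thesis
  proof (intro exI[of _ "\<lambda>x. fst w \<bullet> x + snd w"] conjI allI impI)
    show "affine_fun_on UNIV (\<lambda>x. fst w \<bullet> x + snd w)" by (auto simp: affine_fun_on_def)
    fix p :: "'a \<Rightarrow> real" assume "affine_fun_on UNIV p"
    then obtain a c where p: "p = (\<lambda>x. a \<bullet> x + c)" by (auto simp: affine_fun_on_def)
    show "L2_inner T (\<lambda>x. fst w \<bullet> x + snd w) p = p z"
      using Gi[of w "(a, c)"] by (simp add: w p L2_inner_def inner_commute)
  qed
qed

text \<open>The difference is affine, hence a combination of the barycentric coordinates, to all of
  which it is orthogonal; so it is orthogonal to itself.\<close>

lemma affine_representer_unique: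
  assumes "affine_fun_on UNIV \<psi>" "affine_fun_on UNIV \<psi>'"
    and eq: "\<And>v. v \<in> S \<Longrightarrow> L2_inner T \<psi> (bary S v) = L2_inner T \<psi>' (bary S v)"
  shows "\<psi> = \<psi>'"
proof -
  obtain a c where p: "\<psi> = (\<lambda>x. a \<bullet> x + c)" using assms(1) by (auto simp: affine_fun_on_def)
  obtain a' c' where p': "\<psi>' = (\<lambda>x. a' \<bullet> x + c')" using assms(2) by (auto simp: affine_fun_on_def)
  define \<delta> where "\<delta> x = \<psi> x - \<psi>' x" for x
  have \<delta>: "affine_fun_on UNIV \<delta>"
    unfolding affine_fun_on_def \<delta>_def p p' by (intro exI[of _ "a - a'"] exI[of _ "c - c'"]) (simp add: algebra_simps)
  have cont: "continuous_on UNIV \<psi>" "continuous_on UNIV \<psi>'" "continuous_on UNIV \<delta>"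
    unfolding \<delta>_def p p' by (intro continuous_intros)+
  have z: "(LINT x|lebesgue_on T. \<delta> x * bary S v x) = 0" if v: "v \<in> S" for v
  proof -
    have "(LINT x|lebesgue_on T. \<delta> x * bary S v x) = (LINT x|lebesgue_on T. \<psi> x * bary S v x - \<psi>' x * bary S v x)"
      by (simp add: \<delta>_def algebra_simps)
    also have "\<dots> = L2_inner T \<psi> (bary S v) - L2_inner T \<psi>' (bary S v)"
      unfolding L2_inner_def
      by (rule Bochner_Integration.integral_diff; intro integrable_T_continuous continuous_intros cont continuous_bary v)
    finally show ?thesis using eq[OF v] by simp
  qed
  have "(LINT x|lebesgue_on T. (\<delta> x)\<^sup>2) = (LINT x|lebesgue_on T. (\<Sum>v\<in>S. \<delta> v * (\<delta> x * bary S v x)))"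
  proof (rule Bochner_Integration.integral_cong[OF refl])
    fix x
    have "(\<delta> x)\<^sup>2 = \<delta> x * (\<Sum>v\<in>S. bary S v x * \<delta> v)"
      by (subst affine_expand[OF \<delta>, of x, symmetric]) (rule power2_eq_square)
    then show "(\<delta> x)\<^sup>2 = (\<Sum>v\<in>S. \<delta> v * (\<delta> x * bary S v x))" by (simp add: sum_distrib_left mult_ac)
  qed
  also have "\<dots> = (\<Sum>v\<in>S. LINT x|lebesgue_on T. \<delta> v * (\<delta> x * bary S v x))"
    by (rule Bochner_Integration.integral_sum; intro integrable_T_continuous continuous_intros cont continuous_bary)
  also have "\<dots> = 0" using z by simp
  finally have "(LINT x|lebesgue_on T. (\<delta> x)\<^sup>2) = 0" .
  then have "(LINT x|lebesgue_on T. ((a - a') \<bullet> x + (c - c'))\<^sup>2) = 0" by (simp add: \<delta>_def p p' algebra_simps)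
  from affine_null[OF this] show ?thesis by (simp add: p p')
qed

end

section \<open>Integral inequalities\<close>

text \<open>Cauchy-Schwarz on an interval, obtained by integrating (F' - m)^2 with the mean slope m.
  The right hand side is a nonnegative Lebesgue integral so that Tonelli applies later.\<close>

lemma C1_interval_bound:
  fixes F F' :: "real \<Rightarrow> real"
  assumes F: "\<And>t. (F has_real_derivative F' t) (at t)" and c: "continuous_on UNIV F'" and ab: "a \<le> b"
  shows "ennreal ((F b - F a)\<^sup>2) \<le> ennreal (b - a) * (\<integral>\<^sup>+t. ennreal ((F' t)\<^sup>2) * indicator {a..b} t \<partial>lborel)"
proof -
  let ?I = "\<lambda>g. integral {a..b} (g :: real \<Rightarrow> real)"
  define m where "m = (F b - F a) / (b - a)"
  have c': "continuous_on {a..b} F'" using c continuous_on_subset by blast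
  have i1: "(F' has_integral (F b - F a)) {a..b}"
    by (rule fundamental_theorem_of_calculus[OF ab])
       (use F in \<open>auto intro: has_field_derivative_at_within simp: has_real_derivative_iff_has_vector_derivative[symmetric]\<close>)
  have i2: "((\<lambda>t. (F' t)\<^sup>2) has_integral ?I (\<lambda>t. (F' t)\<^sup>2)) {a..b}"
    by (intro integrable_integral integrable_continuous_real continuous_intros c')
  have "((\<lambda>t. (F' t)\<^sup>2 - (2 * m) * F' t + m\<^sup>2) has_integral (?I (\<lambda>t. (F' t)\<^sup>2) - (2 * m) * (F b - F a) + measure lborel {a..b} *\<^sub>R m\<^sup>2)) {a..b}"
    using i1 i2 by (intro has_integral_add has_integral_diff has_integral_mult_right has_integral_const_real) auto
  then have "0 \<le> ?I (\<lambda>t. (F' t)\<^sup>2) - (2 * m) * (F b - F a) + measure lborel {a..b} *\<^sub>R m\<^sup>2"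
  proof (rule has_integral_nonneg)
    fix t
    have "0 \<le> (F' t - m)\<^sup>2" by simp
    then show "0 \<le> (F' t)\<^sup>2 - (2 * m) * F' t + m\<^sup>2" by (simp add: power2_eq_square algebra_simps)
  qed
  then have *: "(F b - F a)\<^sup>2 \<le> (b - a) * ?I (\<lambda>t. (F' t)\<^sup>2)"
  proof (cases "a = b")
    case False
    then have p: "b - a > 0" using ab by simp
    then have d: "F b - F a = m * (b - a)" by (simp add: m_def)
    assume "0 \<le> ?I (\<lambda>t. (F' t)\<^sup>2) - (2 * m) * (F b - F a) + measure lborel {a..b} *\<^sub>R m\<^sup>2"
    then have "m\<^sup>2 * (b - a) \<le> ?I (\<lambda>t. (F' t)\<^sup>2)"
      using ab by (simp add: d power2_eq_square algebra_simps)
    from mult_left_mono[OF this, of "b - a"] p show ?thesis by (simp add: d power2_eq_square mult_ac)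
  qed simp
  have "(\<integral>\<^sup>+t. ennreal ((F' t)\<^sup>2) * indicator {a..b} t \<partial>lborel) = (\<integral>\<^sup>+t. ennreal (indicator {a..b} t * (F' t)\<^sup>2) \<partial>lborel)"
    by (intro nn_integral_cong) (auto simp: indicator_def)
  also have "\<dots> = ennreal (?I (\<lambda>t. (F' t)\<^sup>2))"
    by (rule nn_integral_has_integral_lebesgue[OF _ i2]) simp
  finally show ?thesis using * ab by (simp add: ennreal_mult[symmetric] ennreal_leI integral_nonneg[OF has_integral_integrable[OF i2]])
qed

locale C1_function =
  fixes f :: "'a::euclidean_space \<Rightarrow> real"
  assumes derivative: "\<And>x. (f has_derivative (\<lambda>h. h \<bullet> grad f x)) (at x)" and cont_grad: "continuous_on UNIV (grad f)"
begin

lemma cont: "continuous_on UNIV f"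
  using has_derivative_continuous[OF derivative] by (intro continuous_at_imp_continuous_on) blast

lemma measurable [measurable]: "f \<in> borel_measurable borel" "grad f \<in> borel_measurable borel"
  using cont cont_grad by (auto intro: borel_measurable_continuous_onI)

lemma segment_bound:
  assumes "0 \<le> \<tau>"
  shows "ennreal ((f x - f (x - \<tau> *\<^sub>R w))\<^sup>2)
    \<le> ennreal \<tau> * (\<integral>\<^sup>+t. ennreal ((norm w)\<^sup>2 * (norm (grad f (x - t *\<^sub>R w)))\<^sup>2) * indicator {0..\<tau>} t \<partial>lborel)"
proof -
  define F where "F t = f (x - t *\<^sub>R w)" for t
  define F' where "F' t = - (w \<bullet> grad f (x - t *\<^sub>R w))" for t
  have "(F has_derivative (\<lambda>h. - (h *\<^sub>R w) \<bullet> grad f (x - t *\<^sub>R w))) (at t)" for t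
    unfolding F_def by (rule has_derivative_compose[OF _ derivative]) (auto intro!: derivative_eq_intros)
  then have D: "(F has_real_derivative F' t) (at t)" for t
    by (rule has_derivative_imp_has_field_derivative) (simp add: F'_def)
  have c: "continuous_on UNIV F'"
    unfolding F'_def by (intro continuous_intros continuous_on_compose2[OF cont_grad]) auto
  have "ennreal ((F \<tau> - F 0)\<^sup>2) \<le> ennreal (\<tau> - 0) * (\<integral>\<^sup>+t. ennreal ((F' t)\<^sup>2) * indicator {0..\<tau>} t \<partial>lborel)"
    by (rule C1_interval_bound[OF D c assms])
  also have "\<dots> \<le> ennreal \<tau> * (\<integral>\<^sup>+t. ennreal ((norm w)\<^sup>2 * (norm (grad f (x - t *\<^sub>R w)))\<^sup>2) * indicator {0..\<tau>} t \<partial>lborel)"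
  proof -
    have "(F' t)\<^sup>2 \<le> (norm w)\<^sup>2 * (norm (grad f (x - t *\<^sub>R w)))\<^sup>2" for t
      using power_mono[OF Cauchy_Schwarz_ineq2[of w "grad f (x - t *\<^sub>R w)"], of 2]
      by (simp add: F'_def power_mult_distrib)
    then show ?thesis by (intro mult_mono nn_integral_mono) (auto intro!: ennreal_leI)
  qed
  finally show ?thesis by (simp add: F_def power2_commute)
qed

text \<open>Integrate along the segment from \<open>x\<close> in direction \<open>- w\<close>,
  exchange the integrals, and use that for fixed \<open>t\<close> the shift by
  \<open>t *\<^sub>R w\<close> preserves the measure. A length \<tau> that depends on
  \<open>x\<close> covers the projection onto a facet as well as the constant shift of the
  Friedrichs inequality.\<close>

lemma translation_bound:
  assumes B: "B \<in> sets borel" and \<tau>: "\<And>x. x \<in> A \<Longrightarrow> 0 \<le> \<tau> x \<and> \<tau> x \<le> 1"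
    and sub: "\<And>x t. x \<in> A \<Longrightarrow> 0 \<le> t \<Longrightarrow> t \<le> \<tau> x \<Longrightarrow> x - t *\<^sub>R w \<in> B"
  shows "(\<integral>\<^sup>+x. ennreal ((f x - f (x - \<tau> x *\<^sub>R w))\<^sup>2) * indicator A x \<partial>lborel)
    \<le> ennreal ((norm w)\<^sup>2) * (\<integral>\<^sup>+x. ennreal ((norm (grad f x))\<^sup>2) * indicator B x \<partial>lborel)"
proof -
  define H where "H x = ennreal ((norm w)\<^sup>2 * (norm (grad f x))\<^sup>2) * indicator B x" for x
  note B [measurable]
  have mH [measurable]: "H \<in> borel_measurable borel" unfolding H_def using B by measurable
  have "(\<integral>\<^sup>+x. ennreal ((f x - f (x - \<tau> x *\<^sub>R w))\<^sup>2) * indicator A x \<partial>lborel)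
      \<le> (\<integral>\<^sup>+x. (\<integral>\<^sup>+t. H (x - t *\<^sub>R w) * indicator {0..1::real} t \<partial>lborel) \<partial>lborel)"
  proof (rule nn_integral_mono)
    fix x
    show "ennreal ((f x - f (x - \<tau> x *\<^sub>R w))\<^sup>2) * indicator A x \<le> (\<integral>\<^sup>+t. H (x - t *\<^sub>R w) * indicator {0..1} t \<partial>lborel)"
    proof (cases "x \<in> A")
      case True
      have le: "ennreal ((norm w)\<^sup>2 * (norm (grad f (x - t *\<^sub>R w)))\<^sup>2) * indicator {0..\<tau> x} t \<le> H (x - t *\<^sub>R w) * indicator {0..1} t" for t
        using \<tau>[OF True] sub[OF True, of t] by (cases "t \<in> {0..\<tau> x}") (auto simp: H_def)
      have "ennreal ((f x - f (x - \<tau> x *\<^sub>R w))\<^sup>2) \<le> ennreal (\<tau> x) * (\<integral>\<^sup>+t. ennreal ((norm w)\<^sup>2 * (norm (grad f (x - t *\<^sub>R w)))\<^sup>2) * indicator {0..\<tau> x} t \<partial>lborel)"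
        by (rule segment_bound) (use \<tau>[OF True] in blast)
      also have "\<dots> \<le> 1 * (\<integral>\<^sup>+t. H (x - t *\<^sub>R w) * indicator {0..1} t \<partial>lborel)"
        by (rule mult_mono[OF _ nn_integral_mono[OF le]]) (use \<tau>[OF True] in auto)
      finally show ?thesis using True by simp
    qed simp
  qed
  also have "\<dots> = (\<integral>\<^sup>+t. (\<integral>\<^sup>+x. H (x - t *\<^sub>R w) * indicator {0..1::real} t \<partial>lborel) \<partial>lborel)"
    by (rule lborel_pair.Fubini'[symmetric]) measurable
  also have "\<dots> = (\<integral>\<^sup>+t. indicator {0..1::real} t * (\<integral>\<^sup>+x. H x \<partial>lborel) \<partial>lborel)"
  proof (rule nn_integral_cong)
    fix t :: real
    have "(\<integral>\<^sup>+x. H (x - t *\<^sub>R w) * indicator {0..1} t \<partial>lborel) = (\<integral>\<^sup>+x. H (x - t *\<^sub>R w) \<partial>lborel) * indicator {0..1} t"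
      by (rule nn_integral_multc) measurable
    also have "(\<integral>\<^sup>+x. H (x - t *\<^sub>R w) \<partial>lborel) = (\<integral>\<^sup>+x. H x \<partial>lborel)"
      using lborel_nn_integral_affine[OF mH, of 1 "- (t *\<^sub>R w)"] by simp
    finally show "(\<integral>\<^sup>+x. H (x - t *\<^sub>R w) * indicator {0..1} t \<partial>lborel) = indicator {0..1} t * (\<integral>\<^sup>+x. H x \<partial>lborel)"
      by (simp add: mult.commute)
  qed
  also have "\<dots> = (\<integral>\<^sup>+x. H x \<partial>lborel)" by (simp add: nn_integral_multc)
  also have "\<dots> = (\<integral>\<^sup>+x. ennreal ((norm w)\<^sup>2) * (ennreal ((norm (grad f x))\<^sup>2) * indicator B x) \<partial>lborel)"
    by (intro nn_integral_cong) (simp add: H_def ennreal_mult mult.assoc)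
  also have "\<dots> = ennreal ((norm w)\<^sup>2) * (\<integral>\<^sup>+x. ennreal ((norm (grad f x))\<^sup>2) * indicator B x \<partial>lborel)"
    by (rule nn_integral_cmult) measurable
  finally show ?thesis .
qed

text \<open>The segment from \<open>x\<close> to \<open>y\<close> is split in the middle: on the half near \<open>y\<close> the point
  \<open>x + t (y - x)\<close> is integrated in \<open>y\<close>, where the Jacobian \<open>t ^ d\<close> is at least \<open>2 ^ -d\<close>.\<close>

lemma double_integral_bound:
  assumes T: "convex T" "T \<in> sets borel" and D: "\<And>x y. x \<in> T \<Longrightarrow> y \<in> T \<Longrightarrow> norm (x - y) \<le> D"
  shows "(\<integral>\<^sup>+x. (\<integral>\<^sup>+y. ennreal ((f x - f y)\<^sup>2) * indicator T y \<partial>lborel) * indicator T x \<partial>lborel)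
    \<le> ennreal (2 ^ DIM('a) * D\<^sup>2) * emeasure lborel T * (\<integral>\<^sup>+x. ennreal ((norm (grad f x))\<^sup>2) * indicator T x \<partial>lborel)"
proof -
  define G where "G x = ennreal ((norm (grad f x))\<^sup>2) * indicator T x" for x
  have G [measurable]: "G \<in> borel_measurable borel" unfolding G_def using T by measurable
  have iT [measurable]: "(indicator T :: 'a \<Rightarrow> ennreal) \<in> borel_measurable borel" using T by measurable
  let ?J = "\<integral>\<^sup>+x. G x \<partial>lborel"
  have half: "(\<integral>\<^sup>+y. G (z + t *\<^sub>R y) \<partial>lborel) \<le> ennreal (2 ^ DIM('a)) * ?J" if "1/2 \<le> t" for t z
  proof -
    have "?J = ennreal (\<bar>t\<bar> ^ DIM('a)) * (\<integral>\<^sup>+y. G (z + t *\<^sub>R y) \<partial>lborel)"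
      by (rule lborel_nn_integral_affine) (use that in auto)
    then have "ennreal (2 ^ DIM('a)) * ?J = (ennreal (2 ^ DIM('a)) * ennreal (\<bar>t\<bar> ^ DIM('a))) * (\<integral>\<^sup>+y. G (z + t *\<^sub>R y) \<partial>lborel)"
      by (simp add: mult.assoc)
    also have "ennreal (2 ^ DIM('a)) * ennreal (\<bar>t\<bar> ^ DIM('a)) = ennreal ((2 * t) ^ DIM('a))"
      using that by (simp add: ennreal_mult[symmetric] power_mult_distrib)
    finally have "ennreal (2 ^ DIM('a)) * ?J = ennreal ((2 * t) ^ DIM('a)) * (\<integral>\<^sup>+y. G (z + t *\<^sub>R y) \<partial>lborel)" .
    moreover have "1 \<le> (2 * t) ^ DIM('a)" using that by (intro one_le_power) simp
    then have "1 * (\<integral>\<^sup>+y. G (z + t *\<^sub>R y) \<partial>lborel) \<le> ennreal ((2 * t) ^ DIM('a)) * (\<integral>\<^sup>+y. G (z + t *\<^sub>R y) \<partial>lborel)"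
      by (intro mult_right_mono) (simp_all only: ennreal_ge_1 zero_le)
    ultimately show ?thesis by simp
  qed
  have pt: "ennreal ((f x - f y)\<^sup>2) * indicator T y * indicator T x
      \<le> (\<integral>\<^sup>+t. ennreal (D\<^sup>2) * (G (x - t *\<^sub>R (x - y)) * indicator T x * indicator T y * indicator {0..1} t) \<partial>lborel)" for x y
  proof (cases "x \<in> T \<and> y \<in> T")
    case True
    have "x - t *\<^sub>R (x - y) \<in> T" if "0 \<le> t" "t \<le> 1" for t
    proof -
      have "(1 - t) *\<^sub>R x + t *\<^sub>R y \<in> T" using T(1) True that by (auto simp: convex_alt)
      then show ?thesis by (simp add: algebra_simps)
    qed
    moreover have "(norm (x - y))\<^sup>2 \<le> D\<^sup>2" using D True by (intro power_mono) auto
    ultimately have le: "ennreal ((norm (x - y))\<^sup>2 * (norm (grad f (x - t *\<^sub>R (x - y))))\<^sup>2) * indicator {0..1} t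
        \<le> ennreal (D\<^sup>2) * (G (x - t *\<^sub>R (x - y)) * indicator T x * indicator T y * indicator {0..1} t)" for t
      using True by (cases "t \<in> {0..1}") (auto simp: G_def ennreal_mult[symmetric] intro!: ennreal_leI mult_right_mono)
    have "ennreal ((f x - f (x - 1 *\<^sub>R (x - y)))\<^sup>2)
      \<le> ennreal 1 * (\<integral>\<^sup>+t. ennreal ((norm (x - y))\<^sup>2 * (norm (grad f (x - t *\<^sub>R (x - y))))\<^sup>2) * indicator {0..1} t \<partial>lborel)"
      by (rule segment_bound) simp
    also have "\<dots> \<le> 1 * (\<integral>\<^sup>+t. ennreal (D\<^sup>2) * (G (x - t *\<^sub>R (x - y)) * indicator T x * indicator T y * indicator {0..1} t) \<partial>lborel)"
      by (rule mult_mono[OF _ nn_integral_mono[OF le]]) auto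
    finally show ?thesis using True by simp
  qed auto
  define R where "R t x y = G (x - t *\<^sub>R (x - y)) * indicator T x * indicator T y * indicator {0..1} t" for t :: real and x y
  have inner: "(\<integral>\<^sup>+x. (\<integral>\<^sup>+y. R t x y \<partial>lborel) \<partial>lborel) \<le> ennreal (2 ^ DIM('a)) * ?J * emeasure lborel T * indicator {0..1} t" for t
  proof (cases "t \<in> {0..1}")
    case True
    show ?thesis
    proof (cases "1/2 \<le> t")
      case h: True
      have "(\<integral>\<^sup>+x. (\<integral>\<^sup>+y. R t x y \<partial>lborel) \<partial>lborel) \<le> (\<integral>\<^sup>+x. (\<integral>\<^sup>+y. G ((x - t *\<^sub>R x) + t *\<^sub>R y) * indicator T x \<partial>lborel) \<partial>lborel)"
        by (intro nn_integral_mono) (auto simp: R_def indicator_def algebra_simps)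
      also have "\<dots> = (\<integral>\<^sup>+x. (\<integral>\<^sup>+y. G ((x - t *\<^sub>R x) + t *\<^sub>R y) \<partial>lborel) * indicator T x \<partial>lborel)"
        by (intro nn_integral_cong nn_integral_multc) measurable
      also have "\<dots> \<le> (\<integral>\<^sup>+x. ennreal (2 ^ DIM('a)) * ?J * indicator T x \<partial>lborel)"
        by (intro nn_integral_mono mult_right_mono half h) simp
      also have "\<dots> = ennreal (2 ^ DIM('a)) * ?J * emeasure lborel T" using T(2) by (simp add: nn_integral_cmult_indicator)
      finally show ?thesis using True by simp
    next
      case h: False
      \<comment> \<open>For \<open>t < 1/2\<close> the variables exchange their roles: the point is
        integrated in \<open>x\<close>, whose factor \<open>1 - t\<close> exceeds 1/2.\<close>
      have "(\<integral>\<^sup>+x. (\<integral>\<^sup>+y. R t x y \<partial>lborel) \<partial>lborel) = (\<integral>\<^sup>+y. (\<integral>\<^sup>+x. R t x y \<partial>lborel) \<partial>lborel)"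
        unfolding R_def by (rule lborel_pair.Fubini'[symmetric]) measurable
      also have "\<dots> \<le> (\<integral>\<^sup>+y. (\<integral>\<^sup>+x. G (t *\<^sub>R y + (1 - t) *\<^sub>R x) * indicator T y \<partial>lborel) \<partial>lborel)"
        by (intro nn_integral_mono) (auto simp: R_def indicator_def algebra_simps)
      also have "\<dots> = (\<integral>\<^sup>+y. (\<integral>\<^sup>+x. G (t *\<^sub>R y + (1 - t) *\<^sub>R x) \<partial>lborel) * indicator T y \<partial>lborel)"
        by (intro nn_integral_cong nn_integral_multc) measurable
      also have "\<dots> \<le> (\<integral>\<^sup>+y. ennreal (2 ^ DIM('a)) * ?J * indicator T y \<partial>lborel)"
        using h by (intro nn_integral_mono mult_right_mono half) auto
      also have "\<dots> = ennreal (2 ^ DIM('a)) * ?J * emeasure lborel T" using T(2) by (simp add: nn_integral_cmult_indicator)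
      finally show ?thesis using True by simp
    qed
  qed (simp add: R_def)
  have "(\<integral>\<^sup>+x. (\<integral>\<^sup>+y. ennreal ((f x - f y)\<^sup>2) * indicator T y \<partial>lborel) * indicator T x \<partial>lborel)
      = (\<integral>\<^sup>+x. (\<integral>\<^sup>+y. ennreal ((f x - f y)\<^sup>2) * indicator T y * indicator T x \<partial>lborel) \<partial>lborel)"
    by (intro nn_integral_cong nn_integral_multc[symmetric]) measurable
  also have "\<dots> \<le> (\<integral>\<^sup>+x. (\<integral>\<^sup>+y. (\<integral>\<^sup>+t. ennreal (D\<^sup>2) * R t x y \<partial>lborel) \<partial>lborel) \<partial>lborel)"
    unfolding R_def by (intro nn_integral_mono pt)
  also have "\<dots> = (\<integral>\<^sup>+x. (\<integral>\<^sup>+t. (\<integral>\<^sup>+y. ennreal (D\<^sup>2) * R t x y \<partial>lborel) \<partial>lborel) \<partial>lborel)"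
    unfolding R_def by (intro nn_integral_cong lborel_pair.Fubini') measurable
  also have "\<dots> = (\<integral>\<^sup>+t. (\<integral>\<^sup>+x. (\<integral>\<^sup>+y. ennreal (D\<^sup>2) * R t x y \<partial>lborel) \<partial>lborel) \<partial>lborel)"
    unfolding R_def by (intro lborel_pair.Fubini') measurable
  also have "\<dots> = (\<integral>\<^sup>+t. ennreal (D\<^sup>2) * (\<integral>\<^sup>+x. (\<integral>\<^sup>+y. R t x y \<partial>lborel) \<partial>lborel) \<partial>lborel)"
  proof (rule nn_integral_cong)
    fix t :: real
    have "(\<integral>\<^sup>+x. (\<integral>\<^sup>+y. ennreal (D\<^sup>2) * R t x y \<partial>lborel) \<partial>lborel) = (\<integral>\<^sup>+x. ennreal (D\<^sup>2) * (\<integral>\<^sup>+y. R t x y \<partial>lborel) \<partial>lborel)"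
      unfolding R_def by (intro nn_integral_cong nn_integral_cmult) measurable
    also have "\<dots> = ennreal (D\<^sup>2) * (\<integral>\<^sup>+x. (\<integral>\<^sup>+y. R t x y \<partial>lborel) \<partial>lborel)"
      unfolding R_def by (rule nn_integral_cmult) measurable
    finally show "(\<integral>\<^sup>+x. (\<integral>\<^sup>+y. ennreal (D\<^sup>2) * R t x y \<partial>lborel) \<partial>lborel) = ennreal (D\<^sup>2) * (\<integral>\<^sup>+x. (\<integral>\<^sup>+y. R t x y \<partial>lborel) \<partial>lborel)" .
  qed
  also have "\<dots> \<le> (\<integral>\<^sup>+t. ennreal (D\<^sup>2) * (ennreal (2 ^ DIM('a)) * ?J * emeasure lborel T * indicator {0..1::real} t) \<partial>lborel)"
    by (intro nn_integral_mono mult_left_mono inner) simp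
  also have "\<dots> = ennreal (D\<^sup>2) * (ennreal (2 ^ DIM('a)) * ?J * emeasure lborel T)"
    by (simp add: mult.assoc[symmetric] nn_integral_cmult_indicator)
  also have "\<dots> = ennreal (2 ^ DIM('a) * D\<^sup>2) * emeasure lborel T * ?J"
    by (simp add: ennreal_mult mult_ac)
  finally show ?thesis by (simp add: G_def)
qed

end

lemma nn_integral_eq_lebesgue_on:
  fixes g :: "'a::euclidean_space \<Rightarrow> real"
  assumes "integrable (lebesgue_on A) g" "A \<in> sets borel" "g \<in> borel_measurable borel" "\<And>x. 0 \<le> g x"
  shows "(\<integral>\<^sup>+x. ennreal (g x) * indicator A x \<partial>lborel) = ennreal (LINT x|lebesgue_on A. g x)"
proof -
  have "ennreal (LINT x|lebesgue_on A. g x) = (\<integral>\<^sup>+x. ennreal (g x) \<partial>lebesgue_on A)"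
    using assms by (intro nn_integral_eq_integral[symmetric]) auto
  also have "\<dots> = (\<integral>\<^sup>+x. ennreal (g x) * indicator A x \<partial>lebesgue)"
    using assms(2) by (intro nn_integral_restrict_space) auto
  finally show ?thesis by (simp add: nn_integral_completion)
qed

lemma C1_function_test: "f \<in> test_functions \<U> \<Longrightarrow> C1_function f"
  by unfold_locales (use test_functionsD in blast)+

text \<open>The mean minimizes the integral of (f - k)^2 over k. Taking k = f y and integrating over
  y bounds the variance times the volume by the double integral of (f x - f y)^2.\<close>

lemma Poincare_convex:
  fixes f :: "'a::euclidean_space \<Rightarrow> real"
  assumes f: "f \<in> test_functions \<U>" and T: "convex T" "open T" "bounded T" "T \<noteq> {}"
    and D: "\<And>x y. x \<in> T \<Longrightarrow> y \<in> T \<Longrightarrow> norm (x - y) \<le> D"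
  defines "c \<equiv> (LINT x|lebesgue_on T. f x) / vol T"
  shows "(LINT x|lebesgue_on T. (f x - c)\<^sup>2) \<le> 2 ^ DIM('a) * D\<^sup>2 * (LINT x|lebesgue_on T. (norm (grad f x))\<^sup>2)"
proof -
  interpret C1_function f using f by (rule C1_function_test)
  have Tb: "T \<in> sets borel" and Tl: "T \<in> sets lebesgue" and Tm: "T \<in> lmeasurable"
    using T by (auto simp: bounded_set_imp_lmeasurable)
  have pos: "0 < vol T"
    using open_not_negligible[OF T(2,4)] Tm by (simp add: negligible_iff_measure less_le)
  have cst: "(\<lambda>x. k) \<in> L2 T" for k :: real by (rule L2_bounded(1)[OF Tm, of _ "\<bar>k\<bar>"]) auto
  note fL = test_functions_L2[OF f Tl]
  have fi: "integrable (lebesgue_on T) f" using L2_inner_integrable[OF cst[of 1] fL(1)] by simp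
  have f2: "integrable (lebesgue_on T) (\<lambda>x. (f x)\<^sup>2)" using L2D(2)[OF fL(1)] by simp
  have ci: "integrable (lebesgue_on T) (\<lambda>x. k::real)" for k using L2_inner_integrable[OF cst[of 1] cst[of k]] by simp
  have d2: "integrable (lebesgue_on T) (\<lambda>x. (f x - k)\<^sup>2)" for k
    using L2D(2)[OF L2_diff[OF fL(1) cst[of k]]] by simp
  let ?m = "vol T" and ?V = "LINT x|lebesgue_on T. (f x - c)\<^sup>2"
  have mc: "(LINT x|lebesgue_on T. (k::real)) = k * ?m" for k using Tm by (simp add: measure_restrict_space fmeasurable_def)
  have expand: "(LINT x|lebesgue_on T. (f x - k)\<^sup>2) = (LINT x|lebesgue_on T. (f x)\<^sup>2) - 2 * k * (c * ?m) + k\<^sup>2 * ?m" for k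
  proof -
    have "(LINT x|lebesgue_on T. (f x - k)\<^sup>2) = (LINT x|lebesgue_on T. (f x)\<^sup>2 - (2 * k) * f x + k\<^sup>2)"
      by (simp add: power2_eq_square algebra_simps)
    also have "\<dots> = (LINT x|lebesgue_on T. (f x)\<^sup>2) - (2 * k) * (LINT x|lebesgue_on T. f x) + k\<^sup>2 * ?m"
      using f2 fi ci mc by simp
    also have "(LINT x|lebesgue_on T. f x) = c * ?m" using pos by (simp add: c_def)
    finally show ?thesis .
  qed
  have min: "?V \<le> (LINT x|lebesgue_on T. (f x - k)\<^sup>2)" for k
  proof -
    have "0 \<le> (k - c)\<^sup>2 * ?m" using pos by simp
    then show ?thesis unfolding expand by (simp add: power2_eq_square algebra_simps)
  qed
  have nn: "(\<integral>\<^sup>+x. ennreal ((f x - k)\<^sup>2) * indicator T x \<partial>lborel) = ennreal (LINT x|lebesgue_on T. (f x - k)\<^sup>2)" for k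
    by (rule nn_integral_eq_lebesgue_on[OF d2 Tb]) auto
  have "ennreal ?V * emeasure lborel T = (\<integral>\<^sup>+x. ennreal ?V * indicator T x \<partial>lborel)"
    using Tb by (simp add: nn_integral_cmult_indicator)
  also have "\<dots> \<le> (\<integral>\<^sup>+x. (\<integral>\<^sup>+y. ennreal ((f x - f y)\<^sup>2) * indicator T y \<partial>lborel) * indicator T x \<partial>lborel)"
    using min nn by (intro nn_integral_mono mult_right_mono) (auto simp: power2_commute intro!: ennreal_leI)
  also have "\<dots> \<le> ennreal (2 ^ DIM('a) * D\<^sup>2) * emeasure lborel T * (\<integral>\<^sup>+x. ennreal ((norm (grad f x))\<^sup>2) * indicator T x \<partial>lborel)"
    by (rule double_integral_bound[OF T(1) Tb D])
  also have "(\<integral>\<^sup>+x. ennreal ((norm (grad f x))\<^sup>2) * indicator T x \<partial>lborel) = ennreal (LINT x|lebesgue_on T. (norm (grad f x))\<^sup>2)"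
    by (rule nn_integral_eq_lebesgue_on[OF L2D(2)[OF fL(2)] Tb]) auto
  also have "emeasure lborel T = ennreal ?m"
    using emeasure_eq_measure2[OF Tm] Tb by simp
  finally have "ennreal (?V * ?m) \<le> ennreal (2 ^ DIM('a) * D\<^sup>2 * ?m * (LINT x|lebesgue_on T. (norm (grad f x))\<^sup>2))"
    using pos by (simp add: ennreal_mult')
  then have "?V * ?m \<le> (2 ^ DIM('a) * D\<^sup>2 * (LINT x|lebesgue_on T. (norm (grad f x))\<^sup>2)) * ?m"
    using pos by (subst (asm) ennreal_le_iff) (auto simp: mult_ac)
  then show ?thesis using pos by simp
qed

text \<open>A shift by more than the diameter takes every point of \<U> out of \<U>, where
  \<open>f\<close> vanishes; so \<open>f x\<close> is itself a difference along a segment of length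
  \<open>D\<close>.\<close>

lemma Friedrichs_test:
  fixes f :: "'a::euclidean_space \<Rightarrow> real"
  assumes f: "f \<in> test_functions \<U>" and \<U>: "\<U> \<in> sets lebesgue" "bounded \<U>" and D: "diameter \<U> < D"
  shows "L2_norm \<U> f \<le> D * L2_norm \<U> (grad f)"
proof -
  interpret C1_function f using f by (rule C1_function_test)
  define e where "e = (SOME b::'a. b \<in> Basis)"
  have e: "norm e = 1" using SOME_Basis[where 'a='a] norm_Basis unfolding e_def by blast
  have Dp: "D > 0" using D diameter_ge_0[OF \<U>(2)] by linarith
  have z: "f (x - 1 *\<^sub>R (D *\<^sub>R e)) = 0" if "x \<in> \<U>" for x
  proof (rule test_functionsD(6)[OF f], rule notI)
    assume "x - 1 *\<^sub>R (D *\<^sub>R e) \<in> \<U>"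
    from diameter_bounded_bound[OF \<U>(2) that this] D Dp e show False by (simp add: dist_norm)
  qed
  have f0: "f x = 0" if "x \<notin> \<U>" for x using test_functionsD(6)[OF f that] .
  obtain K where K: "compact K" "\<And>x. x \<notin> K \<Longrightarrow> f x = 0" "\<And>x. x \<notin> K \<Longrightarrow> grad f x = 0"
    by (rule test_functions_support[OF f]) blast
  have i1: "integrable lborel (\<lambda>x. (f x)\<^sup>2)"
    by (rule continuous_compact_support_integrable[OF _ K(1)]) (use K cont in \<open>auto intro!: continuous_intros\<close>)
  have i2: "integrable lborel (\<lambda>x. (norm (grad f x))\<^sup>2)"
    by (rule continuous_compact_support_integrable[OF _ K(1)]) (use K cont_grad in \<open>auto intro!: continuous_intros\<close>)
  have "ennreal (LINT x|lborel. (f x)\<^sup>2) = (\<integral>\<^sup>+x. ennreal ((f x)\<^sup>2) \<partial>lborel)"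
    by (rule nn_integral_eq_integral[symmetric, OF i1]) simp
  also have "\<dots> \<le> (\<integral>\<^sup>+x. ennreal ((f x - f (x - 1 *\<^sub>R (D *\<^sub>R e)))\<^sup>2) * indicator UNIV x \<partial>lborel)"
  proof (rule nn_integral_mono)
    fix x show "ennreal ((f x)\<^sup>2) \<le> ennreal ((f x - f (x - 1 *\<^sub>R (D *\<^sub>R e)))\<^sup>2) * indicator UNIV x"
      using z[of x] f0[of x] by (cases "x \<in> \<U>") auto
  qed
  also have "\<dots> \<le> ennreal ((norm (D *\<^sub>R e))\<^sup>2) * (\<integral>\<^sup>+x. ennreal ((norm (grad f x))\<^sup>2) * indicator UNIV x \<partial>lborel)"
    by (rule translation_bound) auto
  also have "\<dots> = ennreal (D\<^sup>2 * (LINT x|lborel. (norm (grad f x))\<^sup>2))"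
    using nn_integral_eq_integral[OF i2] e by (simp add: ennreal_mult')
  finally have "(LINT x|lborel. (f x)\<^sup>2) \<le> D\<^sup>2 * (LINT x|lborel. (norm (grad f x))\<^sup>2)"
    by (subst (asm) ennreal_le_iff) auto
  then have "(L2_norm \<U> f)\<^sup>2 \<le> (D * L2_norm \<U> (grad f))\<^sup>2"
    by (simp only: L2_norm_power2 power_mult_distrib test_functions_lebesgue_on[OF f \<U>(1)])
  then show ?thesis using Dp by (intro power2_le_imp_le[of "L2_norm \<U> f"]) (auto simp: L2_norm_nonneg)
qed

section \<open>The dual space Hm1\<close>

lemma H10_weak_gradient_tendsto:
  assumes \<U>: "open \<U>" and v: "v \<in> H10 \<U>" and f: "\<And>n::nat. f n \<in> test_functions \<U>"
    "(\<lambda>n. L2_norm \<U> (\<lambda>x. grad (f n) x - weak_gradient \<U> v x)) \<longlonglongrightarrow> 0"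
  shows "(\<lambda>n. L2_norm \<U> (grad (f n))) \<longlonglongrightarrow> L2_norm \<U> (weak_gradient \<U> v)"
  by (rule L2_norm_tendsto[OF test_functions_L2(2)[OF f(1)] H10D(2)[OF v] f(2)]) (use \<U> in auto)

lemma Friedrichs:
  assumes \<U>: "open \<U>" "bounded \<U>" and v: "v \<in> H10 \<U>" and D: "diameter \<U> < D"
  shows "L2_norm \<U> v \<le> D * L2_norm \<U> (weak_gradient \<U> v)"
proof -
  have sl: "\<U> \<in> sets lebesgue" using \<U> by auto
  obtain f where f: "\<And>n::nat. f n \<in> test_functions \<U>" "(\<lambda>n. L2_norm \<U> (\<lambda>x. f n x - v x)) \<longlonglongrightarrow> 0"
    "(\<lambda>n. L2_norm \<U> (\<lambda>x. grad (f n) x - weak_gradient \<U> v x)) \<longlonglongrightarrow> 0" by (rule H10_approx[OF v]) blast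
  have "(\<lambda>n. L2_norm \<U> (f n)) \<longlonglongrightarrow> L2_norm \<U> v"
    by (rule L2_norm_tendsto[OF test_functions_L2(1)[OF f(1) sl] H10D(1)[OF v] f(2)])
  moreover have "(\<lambda>n. D * L2_norm \<U> (grad (f n))) \<longlonglongrightarrow> D * L2_norm \<U> (weak_gradient \<U> v)"
    by (intro tendsto_mult_left H10_weak_gradient_tendsto[OF \<U>(1) v f(1,3)])
  ultimately show ?thesis
    by (rule LIMSEQ_le) (use Friedrichs_test[OF f(1) sl \<U>(2) D] in blast)
qed

lemma L2_functional_Hm1:
  assumes \<U>: "open \<U>" "bounded \<U>" and p: "p \<in> L2 \<U>"
  shows "L2_functional \<U> p \<in> Hm1 \<U>"
proof -
  have i: "integrable (lebesgue_on \<U>) (\<lambda>x. p x * v x)" if "v \<in> H10 \<U>" for v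
    using L2_inner_integrable[OF p H10D(1)[OF that]] by simp
  \<comment> \<open>Some number strictly above the diameter, as the Friedrichs inequality
    requires.\<close>
  define D where "D = diameter \<U> + 1"
  have "\<bar>L2_functional \<U> p v\<bar> \<le> (L2_norm \<U> p * D) * L2_norm \<U> (weak_gradient \<U> v)" if "v \<in> H10 \<U>" for v
  proof -
    have "\<bar>L2_functional \<U> p v\<bar> \<le> L2_norm \<U> p * L2_norm \<U> v"
      using L2_Cauchy_Schwarz[OF p H10D(1)[OF that]] by (simp add: L2_functional_def L2_inner_def)
    also have "\<dots> \<le> L2_norm \<U> p * (D * L2_norm \<U> (weak_gradient \<U> v))"
      by (intro mult_left_mono Friedrichs[OF \<U> that] L2_norm_nonneg) (simp add: D_def)
    finally show ?thesis by (simp add: mult.assoc)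
  qed
  then show ?thesis
    unfolding Hm1_def using i by (auto simp: L2_functional_def L2_inner_def distrib_left mult.left_commute)
qed

text \<open>Both sides are continuous along a sequence of test functions that approximates an
  element of \<open>H10\<close>. Hence dual norms of \<open>L2\<close> functions need only be tested
  with smooth functions.\<close>

lemma Hm1_norm_L2_le:
  assumes \<U>: "open \<U>" and p: "p \<in> L2 \<U>" and C: "0 \<le> C"
    and le: "\<And>f. f \<in> test_functions \<U> \<Longrightarrow> L2_inner \<U> p f \<le> C * L2_norm \<U> (grad f)"
  shows "Hm1_norm \<U> (L2_functional \<U> p) \<le> ereal C"
  unfolding Hm1_norm_def
proof (rule SUP_least)
  fix v assume "v \<in> {v \<in> H10 \<U>. \<not> (AE x in lebesgue_on \<U>. v x = 0)}"
  then have v: "v \<in> H10 \<U>" by simp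
  have sl: "\<U> \<in> sets lebesgue" using \<U> by auto
  obtain f where f: "\<And>n::nat. f n \<in> test_functions \<U>" "(\<lambda>n. L2_norm \<U> (\<lambda>x. f n x - v x)) \<longlonglongrightarrow> 0"
    "(\<lambda>n. L2_norm \<U> (\<lambda>x. grad (f n) x - weak_gradient \<U> v x)) \<longlonglongrightarrow> 0" by (rule H10_approx[OF v]) blast
  have "(\<lambda>n. L2_inner \<U> p (f n)) \<longlonglongrightarrow> L2_functional \<U> p v"
    using L2_inner_tendsto[OF test_functions_L2(1)[OF f(1) sl] H10D(1)[OF v] p f(2)]
    by (simp add: L2_inner_def L2_functional_def)
  moreover have "(\<lambda>n. C * L2_norm \<U> (grad (f n))) \<longlonglongrightarrow> C * L2_norm \<U> (weak_gradient \<U> v)"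
    by (intro tendsto_mult_left H10_weak_gradient_tendsto[OF \<U> v f(1,3)])
  ultimately have "L2_functional \<U> p v \<le> C * L2_norm \<U> (weak_gradient \<U> v)"
    by (rule LIMSEQ_le) (use le f(1) in blast)
  \<comment> \<open>If the gradient norm is 0, the quotient is 0 by the convention for division, and
    \<open>C\<close> is nonnegative.\<close>
  then have "L2_functional \<U> p v / L2_norm \<U> (weak_gradient \<U> v) \<le> C"
    using L2_norm_nonneg[of \<U> "weak_gradient \<U> v"] C by (cases "L2_norm \<U> (weak_gradient \<U> v) = 0") (auto simp: pos_divide_le_eq)
  then show "ereal (L2_functional \<U> p v / L2_norm \<U> (weak_gradient \<U> v)) \<le> ereal C" by simp
qed

lemma H10_scale:
  assumes "open \<U>" "v \<in> H10 \<U>"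
  shows "(\<lambda>x. c * v x) \<in> H10 \<U>" "L2_norm \<U> (weak_gradient \<U> (\<lambda>x. c * v x)) = \<bar>c\<bar> * L2_norm \<U> (weak_gradient \<U> v)"
proof -
  note l = H10_lincomb[OF assms(1,2,2), of c 0]
  show s: "(\<lambda>x. c * v x) \<in> H10 \<U>" using l(1) by simp
  have "L2_norm \<U> (weak_gradient \<U> (\<lambda>x. c * v x)) = L2_norm \<U> (\<lambda>x. c *\<^sub>R weak_gradient \<U> v x)"
    by (rule L2_norm_cong_AE[OF H10D(2)[OF s] L2_scaleR[OF H10D(2)[OF assms(2)]]]) (use l(2) in simp)
  then show "L2_norm \<U> (weak_gradient \<U> (\<lambda>x. c * v x)) = \<bar>c\<bar> * L2_norm \<U> (weak_gradient \<U> v)"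
    by (simp add: L2_norm_scaleR)
qed

text \<open>Turns the extended supremum into a real operator norm. A bump shows that the supremum is
  over a nonempty set, the bound in \<open>Hm1\<close> makes it finite, and passing to -v gives
  absolute values. Functions that vanish almost everywhere are excluded from the supremum, but their
  weak gradient is 0 and the bound makes \<phi> vanish on them.\<close>

lemma Hm1_norm_real:
  fixes \<U> :: "'a::euclidean_space set"
  assumes \<U>: "open \<U>" "\<U> \<noteq> {}" and \<phi>: "\<phi> \<in> Hm1 \<U>"
  obtains N where "0 \<le> N" "Hm1_norm \<U> \<phi> = ereal N" "\<And>u. u \<in> H10 \<U> \<Longrightarrow> \<bar>\<phi> u\<bar> \<le> N * L2_norm \<U> (weak_gradient \<U> u)"
proof -
  let ?n = "\<lambda>v. L2_norm \<U> (weak_gradient \<U> v)"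
  let ?X = "{v \<in> H10 \<U>. \<not> (AE x in lebesgue_on \<U>. v x = 0)}"
  have sl: "\<U> \<in> sets lebesgue" using \<U> by auto
  have "\<exists>B. \<forall>v\<in>H10 \<U>. \<bar>\<phi> v\<bar> \<le> B * ?n v" using \<phi> by (simp add: Hm1_def)
  then obtain B where B: "\<And>v. v \<in> H10 \<U> \<Longrightarrow> \<bar>\<phi> v\<bar> \<le> B * ?n v" by blast
  have sc: "\<phi> (\<lambda>x. c * v x) = c * \<phi> v" if "v \<in> H10 \<U>" for c v using \<phi> that by (auto simp: Hm1_def)
  have q: "\<bar>\<phi> v / ?n v\<bar> \<le> \<bar>B\<bar>" if "v \<in> H10 \<U>" for v
  proof (cases "?n v = 0")
    case False
    then have "?n v > 0" using L2_norm_nonneg[of \<U> "weak_gradient \<U> v"] by simp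
    moreover have "\<bar>\<phi> v\<bar> \<le> \<bar>B\<bar> * ?n v"
      using B[OF that] mult_right_mono[OF abs_ge_self[of B] L2_norm_nonneg[of \<U> "weak_gradient \<U> v"]] by linarith
    ultimately show ?thesis by (simp add: pos_divide_le_eq)
  qed simp
  have ex: "\<exists>v. v \<in> ?X"
  proof -
    obtain p where p: "p \<in> \<U>" using \<U>(2) by blast
    obtain a b where ab: "p \<in> box a b" "cbox a b \<subseteq> \<U>"
      by (rule open_contains_cbox[OF \<U>(1) p]) blast
    have le: "a \<bullet> i \<le> b \<bullet> i" if "i \<in> Basis" for i using ab(1) that by (force simp: mem_box)
    have t: "bump a b \<in> test_functions \<U>"
      by (rule test_functionsI[OF C_k_bump compact_cbox ab(2)]) (use bump_eq_0[OF le] box_subset_cbox in blast)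
    have "\<not> (AE x in lebesgue_on \<U>. bump a b x = 0)"
    proof
      assume "AE x in lebesgue_on \<U>. bump a b x = 0"
      then have ae: "AE x in lebesgue. x \<in> \<U> \<longrightarrow> bump a b x = 0" using sl by (simp add: AE_restrict_space_iff)
      have "AE x in lebesgue. x \<notin> box a b"
        using ae
      proof eventually_elim
        case (elim x)
        then show ?case using bump_pos_iff[OF le, of x] ab(2) box_subset_cbox[of a b] by fastforce
      qed
      then have "negligible (box a b)" by (simp add: negligible_iff_null_sets AE_iff_null_sets)
      then show False using open_not_negligible[of "box a b"] ab(1) by blast
    qed
    then show ?thesis using H10_test_function(1)[OF \<U>(1) t] by blast
  qed
  have neg: "(\<lambda>x. - 1 * v x) \<in> ?X" if "v \<in> ?X" for v using that H10_scale(1)[OF \<U>(1), of v "-1"] by auto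
  define N where "N = (SUP v\<in>?X. \<phi> v / ?n v)"
  have bdd: "bdd_above ((\<lambda>v. \<phi> v / ?n v) ` ?X)"
    by (rule bdd_aboveI2[of _ _ "\<bar>B\<bar>"]) (use q abs_le_D1 in blast)
  have le: "\<phi> v / ?n v \<le> N" if "v \<in> ?X" for v unfolding N_def by (rule cSUP_upper[OF that bdd])
  have le': "\<bar>\<phi> v / ?n v\<bar> \<le> N" if v: "v \<in> ?X" for v
  proof -
    have "\<phi> (\<lambda>x. - 1 * v x) / ?n (\<lambda>x. - 1 * v x) = - (\<phi> v / ?n v)"
      using sc[of v "-1"] H10_scale(2)[OF \<U>(1), of v "-1"] v by simp
    then show ?thesis using le[OF v] le[OF neg[OF v]] by linarith
  qed
  have N0: "0 \<le> N" using ex le' by (meson abs_ge_zero order_trans)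
  have "(SUP v\<in>?X. ereal (\<phi> v / ?n v)) \<le> ereal N" by (rule SUP_least) (use le in simp)
  moreover obtain v0 where "v0 \<in> ?X" using ex by blast
  then have "ereal (\<phi> v0 / ?n v0) \<le> (SUP v\<in>?X. ereal (\<phi> v / ?n v))" by (rule SUP_upper)
  ultimately have "\<bar>SUP v\<in>?X. ereal (\<phi> v / ?n v)\<bar> \<noteq> \<infinity>" by auto
  then have "Hm1_norm \<U> \<phi> = ereal N"
    unfolding Hm1_norm_def N_def by (rule ereal_SUP[symmetric])
  moreover have "\<bar>\<phi> u\<bar> \<le> N * ?n u" if u: "u \<in> H10 \<U>" for u
  proof (cases "AE x in lebesgue_on \<U>. u x = 0")
    case True
    have "has_weak_gradient \<U> u (\<lambda>x. 0)"
      unfolding has_weak_gradient_def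
    proof
      fix f assume "f \<in> test_functions \<U>"
      have "(LINT x|lebesgue_on \<U>. u x *\<^sub>R grad f x) = (LINT x|lebesgue_on \<U>. 0)"
      proof (rule integral_cong_AE)
        show "(\<lambda>x. u x *\<^sub>R grad f x) \<in> borel_measurable (lebesgue_on \<U>)"
          using L2D(1)[OF H10D(1)[OF u]] L2D(1)[OF test_functions_L2(2)[OF \<open>f \<in> test_functions \<U>\<close> sl]] by simp
        show "AE x in lebesgue_on \<U>. u x *\<^sub>R grad f x = 0" using True by eventually_elim simp
      qed simp
      then show "(LINT x|lebesgue_on \<U>. u x *\<^sub>R grad f x) = - (LINT x|lebesgue_on \<U>. f x *\<^sub>R 0)" by simp
    qed
    from weak_gradient_unique[OF \<U>(1) H10D(2,3)[OF u] L2_zero this]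
    have "?n u = 0" using L2_norm_eq_0_iff[OF H10D(2)[OF u]] by simp
    then show ?thesis using B[OF u] by simp
  next
    case False
    then have "u \<in> ?X" using u by simp
    from le'[OF this] show ?thesis
      using B[OF u] L2_norm_nonneg[of \<U> "weak_gradient \<U> u"] by (cases "?n u = 0") (auto simp: pos_divide_le_eq)
  qed
  ultimately show ?thesis using N0 that by blast
qed

section \<open>Conforming meshes and the combinatorics of vertex stars\<close>

section \<open>Meshes\<close>

text \<open>Just below a boundary point, in direction \<open>- e\<close>, the chart shows an open
  set that misses \<U>. So no boundary point is interior to the closure, and statements about the
  mesh, which covers the closure, can be transferred to the domain.\<close>

lemma lipschitz_domain_interior_closure:
  fixes \<U> :: "'a::euclidean_space set"
  assumes "lipschitz_domain \<U>"
  shows "interior (closure \<U>) = \<U>"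
proof
  have \<U>: "open \<U>" using assms by (simp add: lipschitz_domain_def)
  show "\<U> \<subseteq> interior (closure \<U>)" using \<U> closure_subset interior_maximal by blast
  show "interior (closure \<U>) \<subseteq> \<U>"
  proof
    fix p assume p: "p \<in> interior (closure \<U>)"
    show "p \<in> \<U>"
    proof (rule ccontr)
      assume np: "p \<notin> \<U>"
      then have "p \<in> frontier \<U>" using p interior_subset \<U> by (auto simp: frontier_def interior_open)
      then obtain U e L \<gamma> where U: "open U" "p \<in> U" "norm e = 1" "L-lipschitz_on {y. y \<bullet> e = 0} \<gamma>"
        and eq: "\<U> \<inter> U = {y\<in>U. \<gamma> (y - (y \<bullet> e) *\<^sub>R e) < y \<bullet> e}"
        using assms unfolding lipschitz_domain_def by meson
      define P where "P y = y - (y \<bullet> e) *\<^sub>R e" for y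
      have ee: "e \<bullet> e = 1" using U(3) by (simp add: norm_eq_1)
      have Pe: "P y \<bullet> e = 0" for y by (simp add: P_def inner_diff_left ee)
      have c\<gamma>: "continuous_on UNIV (\<lambda>y. \<gamma> (P y))"
      proof (rule continuous_on_compose2[OF lipschitz_on_continuous_on[OF U(4)]])
        show "continuous_on UNIV P" unfolding P_def by (intro continuous_intros)
        show "P ` UNIV \<subseteq> {y. y \<bullet> e = 0}" using Pe by blast
      qed
      have pp: "p \<bullet> e \<le> \<gamma> (P p)" 
      proof -
        have "p \<notin> {y\<in>U. \<gamma> (P y) < y \<bullet> e}" using np eq unfolding P_def by blast
        then show ?thesis using U(2) by simp
      qed
      obtain r where r: "r > 0" "ball p r \<subseteq> U" "ball p r \<subseteq> closure \<U>"
      proof -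
        have "open (U \<inter> interior (closure \<U>))" "p \<in> U \<inter> interior (closure \<U>)" using U p by auto
        then obtain r where "r > 0" "ball p r \<subseteq> U \<inter> interior (closure \<U>)" using openE by blast
        then show ?thesis using that interior_subset by blast
      qed
      define q where "q = p - (r / 2) *\<^sub>R e"
      have q: "q \<in> ball p r" using r(1) U(3) by (simp add: q_def dist_norm)
      have "P q = P p" by (simp add: P_def q_def inner_diff_left ee algebra_simps)
      then have lt: "q \<bullet> e < \<gamma> (P q)" using pp r(1) by (simp add: q_def inner_diff_left ee)
      let ?W = "U \<inter> {y. y \<bullet> e < \<gamma> (P y)}"
      have "open ?W" using U(1) c\<gamma> by (intro open_Int open_Collect_less) (auto intro!: continuous_intros)
      moreover have "q \<in> ?W" using q r(2) lt by blast
      moreover have "y \<notin> \<U>" if "y \<in> ?W" for y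
      proof
        assume "y \<in> \<U>"
        then have "y \<in> {y\<in>U. \<gamma> (P y) < y \<bullet> e}" using that eq unfolding P_def by blast
        then show False using that by simp
      qed
      then have "?W \<inter> \<U> = {}" by blast
      ultimately have "q \<notin> closure \<U>" using open_Int_closure_eq_empty[of ?W \<U>] by blast
      then show False using q r(3) by blast
    qed
  qed
qed

abbreviation nodal where "nodal T \<equiv> bary (vertices T)"
abbreviation nodal_grad where "nodal_grad T \<equiv> bary_grad (vertices T)"

locale mesh =
  fixes \<Omega> :: "'a::euclidean_space set" and \<T> :: "'a set set"
  assumes lipschitz: "lipschitz_domain \<Omega>" and regular: "regular_mesh \<Omega> \<T>"
begin

lemma domain: "open \<Omega>" "bounded \<Omega>" "\<Omega> \<noteq> {}" "\<Omega> \<in> sets lebesgue" "\<Omega> \<in> lmeasurable"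
  using lipschitz by (auto simp: lipschitz_domain_def bounded_set_imp_lmeasurable)

lemma interior_closure: "interior (closure \<Omega>) = \<Omega>"
  using lipschitz by (rule lipschitz_domain_interior_closure)

lemma finite_mesh: "finite \<T>" and cover: "closure \<Omega> = (\<Union>T\<in>\<T>. closure T)"
  using regular by (auto simp: regular_mesh_def)

lemma element_aux:
  assumes "T \<in> \<T>"
  shows "simplex_vertices (vertices T)" "T = interior (convex hull (vertices T))"
proof -
  obtain S where S: "int DIM('a) simplex S" "T = interior S"
    using regular assms by (auto simp: regular_mesh_def)
  then obtain C where C: "\<not> affine_dependent C" "int (card C) = int DIM('a) + 1" "S = convex hull C"
    unfolding simplex_def by blast
  then have sv: "simplex_vertices C" by unfold_locales auto
  then have "vertices T = C" using simplex_vertices.vertices_T S(2) C(3) by blast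
  with sv S C show "simplex_vertices (vertices T)" "T = interior (convex hull (vertices T))" by auto
qed

lemmas simplex_vertices = element_aux(1)
lemmas element_eq = element_aux(2)[symmetric]

lemma element:
  assumes T: "T \<in> \<T>"
  shows "open T" "convex T" "bounded T" "T \<noteq> {}" "T \<in> lmeasurable" "T \<in> sets lebesgue" "T \<in> sets borel"
    "0 < vol T" "0 < diameter T" "finite (vertices T)" "card (vertices T) = Suc DIM('a)" "vertices T \<subseteq> closure T"
    "closure T = convex hull (vertices T)"
  using simplex_vertices.T_props[OF simplex_vertices[OF T]] simplex_vertices.T_meas[OF simplex_vertices[OF T]]
    simplex_vertices.diameter_pos[OF simplex_vertices[OF T]] simplex_vertices.fin[OF simplex_vertices[OF T]]
    simplex_vertices.card[OF simplex_vertices[OF T]] simplex_vertices.S_subset[OF simplex_vertices[OF T]]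
    simplex_vertices.closure_T[OF simplex_vertices[OF T]]
  unfolding element_eq[OF T] by auto

lemma mem_element: "T \<in> \<T> \<Longrightarrow> x \<in> T \<longleftrightarrow> (\<forall>v\<in>vertices T. 0 < nodal T v x)"
  using simplex_vertices.interior_bary[OF simplex_vertices] element_eq by blast

lemma mem_closure_element: "T \<in> \<T> \<Longrightarrow> x \<in> closure T \<longleftrightarrow> (\<forall>v\<in>vertices T. 0 \<le> nodal T v x)"
  using simplex_vertices.convex_hull_bary[OF simplex_vertices] element(13) by blast

lemma vertices_inj: "T \<in> \<T> \<Longrightarrow> T' \<in> \<T> \<Longrightarrow> vertices T \<subseteq> vertices T' \<Longrightarrow> T = T'"
  by (metis card_subset_eq element(10,11) element_eq)

lemma element_subset: "T \<in> \<T> \<Longrightarrow> T \<subseteq> \<Omega>"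
proof -
  assume T: "T \<in> \<T>"
  have "closure T \<subseteq> closure \<Omega>" using T cover by blast
  then have "interior T \<subseteq> interior (closure \<Omega>)" using closure_subset interior_mono by (meson subset_trans)
  then show ?thesis using element(1)[OF T] by (simp add: interior_open interior_closure)
qed

text \<open>Extreme points of a face are the extreme points of the larger set that lie in it.
  Applied to both elements, this leaves the common vertices, and Krein-Milman recovers the
  intersection from them.\<close>

lemma shared_face:
  assumes T: "T \<in> \<T>" "T' \<in> \<T>"
  shows "closure T \<inter> closure T' = convex hull (vertices T \<inter> vertices T')"
proof -
  let ?F = "closure T \<inter> closure T'"
  have f: "?F face_of closure T" "?F face_of closure T'" using regular T by (auto simp: regular_mesh_def)
  have "{x. x extreme_point_of ?F} = vertices T \<inter> ?F" "{x. x extreme_point_of ?F} = vertices T' \<inter> ?F"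
    using extreme_point_of_face[OF f(1)] extreme_point_of_face[OF f(2)] by (auto simp: vertices_def)
  moreover have "vertices T \<inter> vertices T' \<subseteq> ?F" using element(12) T by blast
  ultimately have "{x. x extreme_point_of ?F} = vertices T \<inter> vertices T'" by blast
  moreover have "compact ?F" "convex ?F" using element(2,3) T by (auto intro: convex_Int convex_closure compact_Int)
  ultimately show ?thesis using Krein_Milman_Minkowski[of ?F] by simp
qed

text \<open>A common point is a combination of common vertices. Its weights, extended by 0, are its
  barycentric coordinates in either element. The continuity of hat functions rests on this.\<close>

lemma bary_shared:
  assumes T: "T \<in> \<T>" "T' \<in> \<T>" and x: "x \<in> closure T" "x \<in> closure T'" and z: "z \<in> vertices T"
  shows "nodal T z x = (if z \<in> vertices T' then nodal T' z x else 0)"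
proof -
  let ?c = "vertices T \<inter> vertices T'"
  have fc: "finite ?c" using element(10) T by blast
  have "x \<in> convex hull ?c" using shared_face[OF T] x by blast
  then obtain u where u: "sum u ?c = 1" "(\<Sum>v\<in>?c. u v *\<^sub>R v) = x" unfolding convex_hull_finite[OF fc] by blast
  define w where "w v = (if v \<in> ?c then u v else 0)" for v
  have ext: "sum w (vertices S) = 1 \<and> (\<Sum>v\<in>vertices S. w v *\<^sub>R v) = x" if S: "S \<in> \<T>" "?c \<subseteq> vertices S" for S
  proof -
    have fS: "finite (vertices S)" using element(10) S by blast
    have "sum w (vertices S) = sum w ?c" using S fS by (intro sum.mono_neutral_right) (auto simp: w_def)
    also have "\<dots> = 1" using u(1) by (simp add: w_def)
    finally have 1: "sum w (vertices S) = 1" .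
    have "(\<Sum>v\<in>vertices S. w v *\<^sub>R v) = (\<Sum>v\<in>?c. w v *\<^sub>R v)" using S fS by (intro sum.mono_neutral_right) (auto simp: w_def)
    also have "\<dots> = x" using u(2) by (simp add: w_def)
    finally show ?thesis using 1 by blast
  qed
  have "nodal T z x = w z"
    using simplex_vertices.bary_unique[OF simplex_vertices[OF T(1)]] ext[OF T(1)] z by blast
  moreover have "nodal T' z x = w z" if "z \<in> vertices T'"
    using simplex_vertices.bary_unique[OF simplex_vertices[OF T(2)]] ext[OF T(2)] that by blast
  moreover have "w z = 0" if "z \<notin> vertices T'" using that by (simp add: w_def)
  ultimately show ?thesis by auto
qed

text \<open>All coordinates of an inner point of \<open>T\<close> are positive, so every vertex of
  \<open>T\<close> is shared with \<open>T'\<close>; two elements with the same vertices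
  coincide.\<close>

lemma elements_disjoint:
  assumes T: "T \<in> \<T>" "T' \<in> \<T>" and x: "x \<in> T" "x \<in> closure T'"
  shows "T = T'"
proof (rule vertices_inj[OF T])
  show "vertices T \<subseteq> vertices T'"
  proof
    fix z assume z: "z \<in> vertices T"
    have "0 < nodal T z x" using mem_element[OF T(1)] x z by blast
    then show "z \<in> vertices T'"
      using bary_shared[OF T _ x(2) z] x(1) closure_subset by (force split: if_splits)
  qed
qed

lemma disjoint_mesh: "disjoint \<T>"
  unfolding pairwise_def disjnt_def using elements_disjoint closure_subset by blast

definition skeleton where "skeleton = (\<Union>T\<in>\<T>. frontier T)"

lemma skeleton: "closed skeleton" "negligible skeleton"
  unfolding skeleton_def using finite_mesh element(2) by (auto intro!: closed_UN negligible_Union negligible_convex_frontier)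

lemma not_skeleton: "x \<notin> skeleton \<Longrightarrow> x \<in> closure \<Omega> \<Longrightarrow> \<exists>T\<in>\<T>. x \<in> T"
proof -
  assume x: "x \<notin> skeleton" "x \<in> closure \<Omega>"
  then obtain T where T: "T \<in> \<T>" "x \<in> closure T" using cover by blast
  then have "x \<in> interior T" using x(1) unfolding skeleton_def frontier_def by blast
  then show ?thesis using T interior_subset by blast
qed

lemma mesh_cover_ae: "negligible (\<Omega> - \<Union>\<T>)"
  by (rule negligible_subset[OF skeleton(2)]) (use not_skeleton closure_subset in blast)

lemma integral_mesh:
  fixes f :: "'a \<Rightarrow> 'b::{banach, second_countable_topology}"
  assumes "integrable (lebesgue_on \<Omega>) f"
  shows "(LINT x|lebesgue_on \<Omega>. f x) = (\<Sum>T\<in>\<T>. LINT x|lebesgue_on T. f x)"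
  by (rule integral_partition[OF finite_mesh disjoint_mesh element(6) element_subset domain(4) mesh_cover_ae assms])

section \<open>Hat functions, dual functions and bubbles\<close>

abbreviation IV where "IV \<equiv> interior_vertices \<Omega> \<T>"

definition all_vertices where "all_vertices = (\<Union>T\<in>\<T>. vertices T)"

text \<open>An explicit candidate for \<open>hat\<close>. The choice of the element is harmless,
  because all elements that contain both the point and the vertex give the same value there.\<close>

definition hat_fun where
  "hat_fun z x = (if \<exists>T\<in>\<T>. x \<in> closure T \<and> z \<in> vertices T
     then bary (vertices (SOME T. T \<in> \<T> \<and> x \<in> closure T \<and> z \<in> vertices T)) z x else 0)"

lemma hat_fun:
  assumes T: "T \<in> \<T>" "x \<in> closure T"
  shows "hat_fun z x = (if z \<in> vertices T then nodal T z x else 0)"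
proof (cases "\<exists>T\<in>\<T>. x \<in> closure T \<and> z \<in> vertices T")
  case True
  define S where "S = (SOME T. T \<in> \<T> \<and> x \<in> closure T \<and> z \<in> vertices T)"
  from True have "\<exists>T. T \<in> \<T> \<and> x \<in> closure T \<and> z \<in> vertices T" by blast
  from someI_ex[OF this] have "S \<in> \<T> \<and> x \<in> closure S \<and> z \<in> vertices S" unfolding S_def .
  moreover have "hat_fun z x = bary (vertices S) z x" unfolding hat_fun_def S_def by (rule if_P[OF True])
  ultimately show ?thesis using bary_shared[of S T x z] T by metis
next
  case False
  then show ?thesis using T by (auto simp: hat_fun_def)
qed

lemma affine_on_element:
  assumes T: "T \<in> \<T>" and f: "affine_fun_on (closure T) f" and x: "x \<in> closure T"
  shows "f x = (\<Sum>v\<in>vertices T. nodal T v x * f v)"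
proof -
  interpret S: simplex_vertices "vertices T" by (rule simplex_vertices[OF T])
  obtain a c where ac: "\<And>x. x \<in> closure T \<Longrightarrow> f x = a \<bullet> x + c" using f by (auto simp: affine_fun_on_def)
  have "affine_fun_on UNIV (\<lambda>x. a \<bullet> x + c)" by (auto simp: affine_fun_on_def)
  from S.affine_expand[OF this, of x] show ?thesis
    using ac[OF x] ac element(12)[OF T] by (auto intro!: sum.cong)
qed

text \<open>Resolves the description in \<open>hat\<close>: a function that is affine on every
  closed element is determined by its values at the vertices.\<close>

lemma hat_eq: 
  assumes z: "z \<in> all_vertices"
  shows "hat \<T> z = hat_fun z"
  unfolding hat_def
proof (rule the_equality)
  have out: "hat_fun z x = 0" if "x \<notin> (\<Union>T\<in>\<T>. closure T)" for x using that by (auto simp: hat_fun_def)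
  have c1: "continuous_on (closure T) (hat_fun z) \<and> affine_fun_on (closure T) (hat_fun z)" if T: "T \<in> \<T>" for T
  proof (cases "z \<in> vertices T")
    case True
    interpret S: simplex_vertices "vertices T" by (rule simplex_vertices[OF T])
    have "continuous_on (closure T) (nodal T z)" by (rule S.continuous_bary[OF True])
    moreover have "affine_fun_on (closure T) (nodal T z)" using S.bary_affine[OF True] by (auto simp: affine_fun_on_def)
    ultimately show ?thesis using hat_fun[OF T] True by (simp add: affine_fun_on_def cong: continuous_on_cong)
  next
    case False
    then have z: "\<And>x. x \<in> closure T \<Longrightarrow> hat_fun z x = 0" using hat_fun[OF T] by simp
    have "affine_fun_on (closure T) (hat_fun z)"
      unfolding affine_fun_on_def by (intro exI[of _ 0] exI[of _ "0::real"]) (simp add: z)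
    moreover have "continuous_on (closure T) (hat_fun z)" using z by (simp cong: continuous_on_cong)
    ultimately show ?thesis by blast
  qed
  have vv: "hat_fun z z' = (if z' = z then 1 else 0)" if z': "z' \<in> (\<Union>T\<in>\<T>. vertices T)" for z'
  proof -
    obtain T where T: "T \<in> \<T>" "z' \<in> vertices T" using z' by blast
    interpret S: simplex_vertices "vertices T" by (rule simplex_vertices[OF T(1)])
    have h: "hat_fun z z' = (if z \<in> vertices T then nodal T z z' else 0)"
      using hat_fun[OF T(1)] T(2) element(12)[OF T(1)] by blast
    then show ?thesis using S.bary_vertex[of z z'] T(2) by auto
  qed
  show "continuous_on (\<Union>T\<in>\<T>. closure T) (hat_fun z) \<and>
    (\<forall>T\<in>\<T>. affine_fun_on (closure T) (hat_fun z)) \<and>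
    (\<forall>z'\<in>\<Union> (vertices ` \<T>). hat_fun z z' = (if z' = z then 1 else 0)) \<and>
    (\<forall>x. x \<notin> (\<Union>T\<in>\<T>. closure T) \<longrightarrow> hat_fun z x = 0)"
    using c1 vv out continuous_on_closed_Union[OF finite_mesh, of closure "hat_fun z"] by auto
  fix \<eta> assume \<eta>: "continuous_on (\<Union>T\<in>\<T>. closure T) \<eta> \<and>
    (\<forall>T\<in>\<T>. affine_fun_on (closure T) \<eta>) \<and>
    (\<forall>z'\<in>\<Union> (vertices ` \<T>). \<eta> z' = (if z' = z then 1 else 0)) \<and>
    (\<forall>x. x \<notin> (\<Union>T\<in>\<T>. closure T) \<longrightarrow> \<eta> x = 0)"
  show "\<eta> = hat_fun z"
  proof
    fix x
    show "\<eta> x = hat_fun z x"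
    proof (cases "x \<in> (\<Union>T\<in>\<T>. closure T)")
      case True
      then obtain T where T: "T \<in> \<T>" "x \<in> closure T" by blast
      have "\<eta> x = (\<Sum>v\<in>vertices T. nodal T v x * \<eta> v)" using affine_on_element[OF T(1) _ T(2)] \<eta> T(1) by blast
      also have "\<dots> = (\<Sum>v\<in>vertices T. nodal T v x * hat_fun z v)"
      proof (rule sum.cong[OF refl])
        fix v assume "v \<in> vertices T"
        then have "v \<in> \<Union> (vertices ` \<T>)" using T(1) by blast
        then show "nodal T v x * \<eta> v = nodal T v x * hat_fun z v" using \<eta> vv by metis
      qed
      also have "\<dots> = hat_fun z x" using affine_on_element[OF T(1) _ T(2)] c1[OF T(1)] by metis
      finally show ?thesis .
    qed (use \<eta> out in auto)
  qed
qed

lemma hat_on_element: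
  "z \<in> all_vertices \<Longrightarrow> T \<in> \<T> \<Longrightarrow> x \<in> closure T \<Longrightarrow> hat \<T> z x = (if z \<in> vertices T then nodal T z x else 0)"
  using hat_eq hat_fun by simp

lemma hat_outside: "z \<in> all_vertices \<Longrightarrow> x \<notin> closure \<Omega> \<Longrightarrow> hat \<T> z x = 0"
  using hat_eq cover by (auto simp: hat_fun_def)

lemma vertices_all: "T \<in> \<T> \<Longrightarrow> vertices T \<subseteq> all_vertices"
  by (auto simp: all_vertices_def)

lemma hat_bounds: "z \<in> all_vertices \<Longrightarrow> 0 \<le> hat \<T> z x \<and> hat \<T> z x \<le> 1"
proof (cases "x \<in> closure \<Omega>")
  case True
  assume z: "z \<in> all_vertices"
  obtain T where T: "T \<in> \<T>" "x \<in> closure T" using True cover by blast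
  then show ?thesis using hat_on_element[OF z T] simplex_vertices.bary_bounds[OF simplex_vertices[OF T(1)]] element_eq[OF T(1)] by simp
qed (simp add: hat_outside)

text \<open>On \<open>T\<close> the hats are the barycentric coordinates, a basis of the affine
  functions, so duality to them is the representation of the evaluation at \<open>z\<close>. With
  the constant 1 for \<open>p\<close>, it shows that the dual function has integral 1.\<close>

lemma dual_hat:
  assumes T: "T \<in> \<T>" and z: "z \<in> vertices T"
  shows "affine_fun_on UNIV (dual_hat \<T> T z)"
    and "affine_fun_on UNIV p \<Longrightarrow> L2_inner T (dual_hat \<T> T z) p = p z"
proof -
  interpret S: simplex_vertices "vertices T" by (rule simplex_vertices[OF T])
  note eq = element_eq[OF T]
  have hb: "L2_inner T \<psi> (hat \<T> z') = L2_inner T \<psi> (nodal T z')" if "z' \<in> vertices T" for \<psi> z'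
    unfolding L2_inner_def
  proof (rule Bochner_Integration.integral_cong[OF refl])
    fix x assume "x \<in> space (lebesgue_on T)"
    then have "x \<in> closure T" using closure_subset[of T] by auto
    moreover have "z' \<in> all_vertices" using that vertices_all[OF T] by blast
    ultimately have "hat \<T> z' x = nodal T z' x" using hat_on_element[OF _ T] that by simp
    then show "\<psi> x * hat \<T> z' x = \<psi> x * nodal T z' x" by simp
  qed
  obtain \<psi> where \<psi>: "affine_fun_on UNIV \<psi>" "\<And>p. affine_fun_on UNIV p \<Longrightarrow> L2_inner T \<psi> p = p z"
    using S.affine_representer[of z] unfolding eq by blast
  have "dual_hat \<T> T z = \<psi>"
    unfolding dual_hat_def
  proof (rule the_equality)
    show "affine_fun_on UNIV \<psi> \<and> (\<forall>z'\<in>vertices T. L2_inner T \<psi> (hat \<T> z') = (if z' = z then 1 else 0))"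
      using \<psi> S.bary_affine S.bary_vertex z by (auto simp: hb)
    fix \<psi>' assume \<psi>': "affine_fun_on UNIV \<psi>' \<and> (\<forall>z'\<in>vertices T. L2_inner T \<psi>' (hat \<T> z') = (if z' = z then 1 else 0))"
    show "\<psi>' = \<psi>"
      by (rule S.affine_representer_unique)
         (use \<psi> \<psi>' S.bary_affine S.bary_vertex z in \<open>auto simp: hb eq\<close>)
  qed
  with \<psi> show "affine_fun_on UNIV (dual_hat \<T> T z)" "affine_fun_on UNIV p \<Longrightarrow> L2_inner T (dual_hat \<T> T z) p = p z" by auto
qed

text \<open>On the boundary of \<open>T\<close> one of the coordinates is 0. At a point off the
  closure, any element that contains it lacks a vertex of \<open>T\<close>, whose hat function
  therefore vanishes.\<close>

lemma bubble_eq: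
  assumes T: "T \<in> \<T>"
  shows "bubble \<T> T x = (if x \<in> T then (\<Prod>v\<in>vertices T. nodal T v x) else 0)"
proof (cases "x \<in> closure T")
  case True
  have "bubble \<T> T x = (\<Prod>v\<in>vertices T. nodal T v x)"
    unfolding bubble_def using hat_on_element[OF _ T True] vertices_all[OF T] by (intro prod.cong) auto
  moreover have "\<exists>v\<in>vertices T. nodal T v x = 0" if xT: "x \<notin> T"
  proof -
    obtain v where v: "v \<in> vertices T" "\<not> 0 < nodal T v x" using xT mem_element[OF T] by blast
    moreover have "0 \<le> nodal T v x" using True v(1) mem_closure_element[OF T] by blast
    ultimately show ?thesis by (intro bexI[of _ v]) auto
  qed
  ultimately show ?thesis using element(10)[OF T] by auto
next
  case False
  have "\<exists>z\<in>vertices T. hat \<T> z x = 0"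
  proof (cases "x \<in> closure \<Omega>")
    case True
    then obtain T' where T': "T' \<in> \<T>" "x \<in> closure T'" using cover by blast
    then have "T \<noteq> T'" using False by blast
    then obtain z where "z \<in> vertices T" "z \<notin> vertices T'" using vertices_inj[OF T T'(1)] by blast
    then show ?thesis using hat_on_element[OF _ T'] vertices_all[OF T] by force
  next
    case F: False
    have "vertices T \<noteq> {}" using element(11)[OF T] by auto
    then show ?thesis using hat_outside[OF _ F] vertices_all[OF T] by blast
  qed
  moreover have "x \<notin> T" using False closure_subset by blast
  ultimately show ?thesis using element(10)[OF T] by (auto simp: bubble_def)
qed

lemma interior_vertices_eq: "IV = all_vertices \<inter> \<Omega>"
proof -
  have "all_vertices \<subseteq> closure \<Omega>" using element(12) cover by (auto simp: all_vertices_def)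
  then show ?thesis
    unfolding interior_vertices_def all_vertices_def[symmetric]
    using domain(1) by (auto simp: frontier_def interior_open)
qed

lemma finite_vertices: "finite all_vertices" "finite (IV)"
  using finite_mesh element(10) by (auto simp: all_vertices_def interior_vertices_eq)

text \<open>There are no hanging nodes: the coordinate of \<open>z\<close> in an element of which it
  is a vertex is 1, not 0, so \<open>z\<close> must also be a vertex of every other element that
  touches it.\<close>

lemma mem_vertex_elements: "T \<in> vertex_elements \<T> z \<longleftrightarrow> T \<in> \<T> \<and> z \<in> vertices T" if z: "z \<in> all_vertices"
proof -
  have "z \<in> vertices T" if T: "T \<in> \<T>" "z \<in> closure T" for T
  proof -
    obtain T' where T': "T' \<in> \<T>" "z \<in> vertices T'" using z by (auto simp: all_vertices_def)
    have zc: "z \<in> closure T'" using T' element(12) by blast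
    have "nodal T' z z = 1" using simplex_vertices.bary_vertex[OF simplex_vertices[OF T'(1)] T'(2) T'(2)] by simp
    then show ?thesis using bary_shared[OF T'(1) T(1) zc T(2) T'(2)] by (auto split: if_splits)
  qed
  then show ?thesis using element(12) by (auto simp: vertex_elements_def)
qed

end

section \<open>Stars of vertices\<close>

lemma negligible_UN: "finite I \<Longrightarrow> (\<And>i. i \<in> I \<Longrightarrow> negligible (A i)) \<Longrightarrow> negligible (\<Union>i\<in>I. A i)"
  by (rule negligible_Union) auto

context mesh
begin

text \<open>The cone with apex \<open>z\<close> that is spanned by \<open>T\<close>: the condition
  for the facet opposite to \<open>z\<close> is omitted, which makes the set invariant under
  homotheties at \<open>z\<close>.\<close>

definition cone where "cone T z = {x. \<forall>a\<in>vertices T - {z}. 0 \<le> nodal T a x}"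

definition star where "star z = {T\<in>\<T>. z \<in> vertices T}"

lemma star_eq: "z \<in> all_vertices \<Longrightarrow> vertex_elements \<T> z = star z"
  using mem_vertex_elements by (auto simp: star_def)

lemma star_finite: "finite (star z)" using finite_mesh by (simp add: star_def)

lemma bary_continuous: "T \<in> \<T> \<Longrightarrow> a \<in> vertices T \<Longrightarrow> continuous_on A (nodal T a)"
  using simplex_vertices.continuous_bary[OF simplex_vertices] by blast

lemma bary_line: "T \<in> \<T> \<Longrightarrow> a \<in> vertices T \<Longrightarrow>
    nodal T a (p + s *\<^sub>R (x - p)) = (1 - s) * nodal T a p + s * nodal T a x"
  using simplex_vertices.bary_homothety[OF simplex_vertices] by blast

lemma bary_at_vertex: "T \<in> \<T> \<Longrightarrow> a \<in> vertices T \<Longrightarrow> z \<in> vertices T \<Longrightarrow> nodal T a z = (if z = a then 1 else 0)"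
  using simplex_vertices.bary_vertex[OF simplex_vertices] by blast

lemma cone_scale:
  assumes "T \<in> \<T>" "z \<in> vertices T" "0 < s"
  shows "z + s *\<^sub>R (x - z) \<in> cone T z \<longleftrightarrow> x \<in> cone T z"
  unfolding cone_def using assms by (auto simp: bary_line bary_at_vertex zero_le_mult_iff)

lemma closed_cone: "T \<in> \<T> \<Longrightarrow> closed (cone T z)"
proof -
  assume T: "T \<in> \<T>"
  have "cone T z = (\<Inter>a\<in>vertices T - {z}. {x. 0 \<le> nodal T a x})" by (auto simp: cone_def)
  moreover have "closed {x. 0 \<le> nodal T a x}" if "a \<in> vertices T" for a
    by (rule closed_Collect_le) (use bary_continuous[OF T that] in \<open>auto intro!: continuous_intros\<close>)
  ultimately show ?thesis by (auto intro!: closed_INT)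
qed

lemma cone_closure: "T \<in> \<T> \<Longrightarrow> x \<in> cone T z \<Longrightarrow> 0 \<le> nodal T z x \<Longrightarrow> x \<in> closure T"
  using mem_closure_element by (auto simp: cone_def)

lemma closure_cone: "T \<in> \<T> \<Longrightarrow> x \<in> closure T \<Longrightarrow> x \<in> cone T z"
  using mem_closure_element by (auto simp: cone_def)

lemma cone_shrink:
  assumes T: "T \<in> \<T>" "z \<in> vertices T" and x: "x \<in> cone T z"
  obtains s where "0 < s" "s \<le> 1" "z + s *\<^sub>R (x - z) \<in> closure T"
proof -
  define b where "b = nodal T z x"
  define s where "s = 1 / (1 + \<bar>b\<bar>)"
  have s: "0 < s" "s \<le> 1" by (auto simp: s_def)
  have "s * (1 + \<bar>b\<bar>) = 1" by (simp add: s_def)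
  moreover have "s * (- \<bar>b\<bar>) \<le> s * b" using s by (intro mult_left_mono) auto
  ultimately have "0 \<le> (1 - s) + s * b" by (simp add: algebra_simps)
  then have "0 \<le> nodal T z (z + s *\<^sub>R (x - z))" by (simp add: bary_line[OF T] bary_at_vertex[OF T(1) T(2) T(2)] b_def)
  moreover have "z + s *\<^sub>R (x - z) \<in> cone T z" using cone_scale[OF T s(1)] x by blast
  ultimately show ?thesis using that s cone_closure[OF T(1)] by blast
qed

lemma open_line_nbhd:
  fixes p :: 'a
  assumes "open N" "p \<in> N"
  obtains e where "0 < e" "e \<le> 1" "\<And>t. \<bar>t\<bar> \<le> e \<Longrightarrow> p + t *\<^sub>R w \<in> N"
proof -
  obtain r where r: "r > 0" "ball p r \<subseteq> N" using assms openE by blast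
  define n where "n = norm w"
  have n: "n \<ge> 0" by (simp add: n_def)
  define e where "e = min 1 (r / (2 * (n + 1)))"
  have e: "0 < e" "e \<le> 1" "e \<le> r / (2 * (n + 1))" using r(1) n by (auto simp: e_def)
  have "p + t *\<^sub>R w \<in> N" if "\<bar>t\<bar> \<le> e" for t
  proof -
    have "norm (t *\<^sub>R w) = \<bar>t\<bar> * n" by (simp add: n_def)
    also have "\<dots> \<le> r / (2 * (n + 1)) * n" using that e(3) n by (intro mult_right_mono) auto
    also have "\<dots> < r / (2 * (n + 1)) * (2 * (n + 1))" using r(1) n by (intro mult_strict_left_mono) auto
    also have "\<dots> = r" using n by simp
    finally show ?thesis using r(2) by (auto simp: dist_norm)
  qed
  with e that show ?thesis by blast
qed

text \<open>A homothety at \<open>z\<close> with small ratio moves \<open>x\<close> into \<Omega>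
  and away from the finitely many closed elements that do not contain \<open>z\<close>, and cones
  are invariant under it.\<close>

lemma interior_vertex_cones:
  assumes z: "z \<in> all_vertices" "z \<in> \<Omega>"
  shows "\<exists>T\<in>star z. x \<in> cone T z"
proof -
  let ?U = "\<Omega> - (\<Union>T\<in>{T\<in>\<T>. z \<notin> closure T}. closure T)"
  have "open ?U" using domain(1) finite_mesh by (intro open_Diff closed_UN) auto
  moreover have "z \<in> ?U" using z by blast
  ultimately obtain s where s: "0 < s" "\<And>t. \<bar>t\<bar> \<le> s \<Longrightarrow> z + t *\<^sub>R (x - z) \<in> ?U"
    by (rule open_line_nbhd[where w="x - z"]) blast
  then have y: "z + s *\<^sub>R (x - z) \<in> ?U" by simp
  then obtain T where T: "T \<in> \<T>" "z + s *\<^sub>R (x - z) \<in> closure T" using cover closure_subset by blast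
  then have "z \<in> closure T" using y by blast
  then have "T \<in> vertex_elements \<T> z" using T by (simp add: vertex_elements_def)
  then have "T \<in> star z" using star_eq[OF z(1)] by simp
  moreover have "x \<in> cone T z"
    using cone_scale[of T z s x] \<open>T \<in> star z\<close> s(1) closure_cone[OF T] by (auto simp: star_def)
  ultimately show ?thesis by blast
qed

text \<open>All cones that contain \<open>x\<close> give it the same coordinate at \<open>z\<close>,
  since a homothety at \<open>z\<close> moves it into the elements themselves. This coordinate stays
  positive nearby, and each nearby point lies in one of these cones, hence in the element.\<close>

lemma hat_positive_interior_star:
  assumes z: "z \<in> all_vertices" "z \<in> \<Omega>" and pos: "0 < hat \<T> z x"
  shows "x \<in> interior (\<Union>T\<in>star z. closure T)"
proof -
  have "x \<in> closure \<Omega>" using hat_outside[OF z(1)] pos by fastforce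
  then obtain T0 where T0: "T0 \<in> \<T>" "x \<in> closure T0" using cover by blast
  then have zT0: "z \<in> vertices T0" and b0: "0 < bary (vertices T0) z x"
    using hat_on_element[OF z(1) T0] pos by (auto split: if_splits)
  have eq: "nodal T z x = bary (vertices T0) z x" if T: "T \<in> star z" and x: "x \<in> cone T z" for T
  proof -
    have T': "T \<in> \<T>" "z \<in> vertices T" using T by (auto simp: star_def)
    obtain s where s: "0 < s" "s \<le> 1" "z + s *\<^sub>R (x - z) \<in> closure T" using cone_shrink[OF T' x] by blast
    have "z \<in> closure T0" using zT0 element(12)[OF T0(1)] by blast
    then have "(1 - s) *\<^sub>R z + s *\<^sub>R x \<in> closure T0"
      using convex_closure[OF element(2)[OF T0(1)]] T0(2) s by (auto simp: convex_alt)
    moreover have "(1 - s) *\<^sub>R z + s *\<^sub>R x = z + s *\<^sub>R (x - z)" by (simp add: algebra_simps)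
    ultimately have "z + s *\<^sub>R (x - z) \<in> closure T0" by simp
    from bary_shared[OF T'(1) T0(1) s(3) this T'(2)] zT0
    have "(1 - s) + s * nodal T z x = (1 - s) + s * bary (vertices T0) z x"
      by (simp add: bary_line[OF T'] bary_line[OF T0(1) zT0] bary_at_vertex[OF T'(1) T'(2) T'(2)] bary_at_vertex[OF T0(1) zT0 zT0])
    then show ?thesis using s(1) by simp
  qed
  \<comment> \<open>Near \<open>x\<close>, the cones that contain \<open>x\<close> keep a positive
    coordinate at \<open>z\<close>, and the remaining cones, which are closed, are avoided.\<close>
  define N where "N = (\<Inter>T\<in>star z. if x \<in> cone T z then {y. 0 < nodal T z y} else - cone T z)"
  have "open N"
    unfolding N_def
  proof (intro open_INT star_finite ballI)
    fix T assume T: "T \<in> star z"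
    then have T': "T \<in> \<T>" "z \<in> vertices T" by (auto simp: star_def)
    have "open {y. 0 < nodal T z y}"
      by (rule open_Collect_less) (use bary_continuous[OF T'] in \<open>auto intro!: continuous_intros\<close>)
    then show "open (if x \<in> cone T z then {y. 0 < nodal T z y} else - cone T z)"
      using closed_cone[OF T'(1)] by auto
  qed
  moreover have "x \<in> N" unfolding N_def using eq b0 by auto
  moreover have "N \<subseteq> (\<Union>T\<in>star z. closure T)"
  proof
    fix y assume y: "y \<in> N"
    obtain T where T: "T \<in> star z" "y \<in> cone T z" using interior_vertex_cones[OF z] by blast
    have "y \<in> (if x \<in> cone T z then {y. 0 < nodal T z y} else - cone T z)"
      using y T(1) unfolding N_def by blast
    then have "0 < nodal T z y" using T(2) by (simp split: if_splits)
    then have "y \<in> closure T" using cone_closure[of T y z] T by (auto simp: star_def)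
    then show "y \<in> (\<Union>T\<in>star z. closure T)" using T by blast
  qed
  ultimately show ?thesis using interiorI by blast
qed

lemma interior_star_subset: "interior (\<Union>T\<in>star z. closure T) \<subseteq> \<Omega>"
proof -
  have "(\<Union>T\<in>star z. closure T) \<subseteq> closure \<Omega>" using cover by (auto simp: star_def)
  then show ?thesis using interior_mono interior_closure by metis
qed

lemma hat_zero_outside:
  assumes "z \<in> all_vertices" "z \<in> \<Omega>" "x \<notin> \<Omega>"
  shows "hat \<T> z x = 0"
proof -
  have "\<not> 0 < hat \<T> z x"
    using hat_positive_interior_star[OF assms(1,2)] interior_star_subset assms(3) by blast
  then show ?thesis using hat_bounds[OF assms(1), of x] by linarith
qed

section \<open>Facets\<close>

lemma facet_center:
  assumes T: "T \<in> \<T>" and a: "a \<in> vertices T"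
  obtains m where "m \<in> closure T" "nodal T a m = 0" "\<And>b. b \<in> vertices T - {a} \<Longrightarrow> 0 < nodal T b m"
proof -
  interpret S: simplex_vertices "vertices T" by (rule simplex_vertices[OF T])
  define u where "u v = (if v = a then 0 else 1 / real DIM('a))" for v
  have "sum u (vertices T) = sum u (vertices T - {a})" using S.fin a by (simp add: sum.remove u_def)
  also have "\<dots> = (\<Sum>v\<in>vertices T - {a}. 1 / real DIM('a))" by (intro sum.cong) (auto simp: u_def)
  also have "\<dots> = 1" using S.card S.fin a by simp
  finally have u: "sum u (vertices T) = 1" .
  define m where "m = (\<Sum>v\<in>vertices T. u v *\<^sub>R v)"
  have b: "nodal T v m = u v" if "v \<in> vertices T" for v
    by (rule S.bary_unique[OF u m_def[symmetric] that])
  have "m \<in> closure T" unfolding mem_closure_element[OF T] using b by (simp add: u_def)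
  moreover have "nodal T a m = 0" using b[OF a] by (simp add: u_def)
  moreover have "0 < nodal T b m" if "b \<in> vertices T - {a}" for b using b[of b] that by (simp add: u_def)
  ultimately show ?thesis using that by blast
qed

lemma open_bary_pos: "T \<in> \<T> \<Longrightarrow> B \<subseteq> vertices T \<Longrightarrow> open {y. \<forall>b\<in>B. 0 < nodal T b y}"
proof -
  assume T: "T \<in> \<T>" and B: "B \<subseteq> vertices T"
  have "finite B" using B element(10)[OF T] finite_subset by blast
  moreover have "open {y. 0 < nodal T b y}" if "b \<in> B" for b
    by (rule open_Collect_less) (use bary_continuous[OF T] B that in \<open>auto intro!: continuous_intros\<close>)
  moreover have "{y. \<forall>b\<in>B. 0 < nodal T b y} = (\<Inter>b\<in>B. {y. 0 < nodal T b y})" by auto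
  ultimately show ?thesis by (simp add: open_INT)
qed

text \<open>Expanding the coordinates of \<open>T'\<close>, which are affine, in the vertices of
  \<open>T\<close> gives both formulas. The factor \<kappa> is negative because otherwise a point
  slightly above the middle of the facet, on the side of \<open>a\<close>, would belong to both
  elements.\<close>

lemma facet_neighbour:
  assumes T: "T \<in> \<T>" "T' \<in> \<T>" "T \<noteq> T'" and a: "a \<in> vertices T" and sub: "vertices T - {a} \<subseteq> vertices T'"
  obtains a' \<kappa> where "a' \<notin> vertices T" "vertices T' = insert a' (vertices T - {a})" "\<kappa> < 0"
    "\<And>x. nodal T' a' x = \<kappa> * nodal T a x"
    "\<And>b x. b \<in> vertices T - {a} \<Longrightarrow> nodal T' b x = nodal T b x + nodal T' b a * nodal T a x"
proof -
  interpret S: simplex_vertices "vertices T" by (rule simplex_vertices[OF T(1)])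
  interpret S': simplex_vertices "vertices T'" by (rule simplex_vertices[OF T(2)])
  let ?F = "vertices T - {a}"
  have "card ?F = DIM('a)" using S.card a S.fin by simp
  then have "card (vertices T' - ?F) = 1" using S'.card S'.fin S.fin sub by (simp add: card_Diff_subset)
  then obtain a' where a': "vertices T' - ?F = {a'}" using card_1_singletonE by blast
  then have V': "vertices T' = insert a' ?F" using sub by blast
  have "a' \<notin> vertices T"
  proof
    assume "a' \<in> vertices T"
    then have "a' = a" using a' by blast
    then have "vertices T \<subseteq> vertices T'" using V' a by blast
    then show False using vertices_inj[OF T(1,2)] T(3) by blast
  qed
  define \<kappa> where "\<kappa> = nodal T' a' a"
  have a'V: "a' \<in> vertices T'" using V' by blast
  have k: "nodal T' a' x = \<kappa> * nodal T a x" for x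
  proof -
    have "nodal T' a' x = (\<Sum>v\<in>vertices T. nodal T v x * nodal T' a' v)"
      by (rule S.affine_expand[OF S'.bary_affine[OF a'V]])
    also have "\<dots> = nodal T a x * nodal T' a' a + (\<Sum>v\<in>?F. nodal T v x * nodal T' a' v)"
      using a S.fin by (simp add: sum.remove)
    also have "(\<Sum>v\<in>?F. nodal T v x * nodal T' a' v) = 0"
    proof (rule sum.neutral, rule ballI)
      fix v assume v: "v \<in> ?F"
      then have "v \<in> vertices T'" "v \<noteq> a'" using sub a' by blast+
      then show "nodal T v x * nodal T' a' v = 0" using S'.bary_vertex[OF a'V] by simp
    qed
    finally show ?thesis by (simp add: \<kappa>_def)
  qed
  have kb: "nodal T' b x = nodal T b x + nodal T' b a * nodal T a x" if b: "b \<in> ?F" for b x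
  proof -
    have bV: "b \<in> vertices T'" using b sub by blast
    have "nodal T' b x = (\<Sum>v\<in>vertices T. nodal T v x * nodal T' b v)"
      by (rule S.affine_expand[OF S'.bary_affine[OF bV]])
    also have "\<dots> = nodal T a x * nodal T' b a + (\<Sum>v\<in>?F. nodal T v x * nodal T' b v)"
      using a S.fin by (simp add: sum.remove)
    also have "(\<Sum>v\<in>?F. nodal T v x * nodal T' b v) = (\<Sum>v\<in>?F. if v = b then nodal T v x else 0)"
      using S'.bary_vertex[OF bV] sub by (intro sum.cong) auto
    also have "\<dots> = nodal T b x" using b S.fin by simp
    finally show ?thesis by simp
  qed
  have "1 = \<kappa> * nodal T a a'" using k[of a'] S'.bary_vertex[OF a'V a'V] by simp
  then have k0: "\<kappa> \<noteq> 0" by auto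
  have "\<kappa> < 0"
  proof (rule ccontr)
    assume "\<not> \<kappa> < 0"
    then have kp: "\<kappa> > 0" using k0 by linarith
    obtain m where m: "m \<in> closure T" "nodal T a m = 0" "\<And>b. b \<in> ?F \<Longrightarrow> 0 < nodal T b m"
      using facet_center[OF T(1) a] by blast
    let ?N = "{y. \<forall>b\<in>?F. 0 < nodal T b y} \<inter> {y. \<forall>b\<in>?F. 0 < nodal T' b y}"
    have "open ?N" using open_bary_pos[OF T(1), of ?F] open_bary_pos[OF T(2) sub] by (intro open_Int) auto
    moreover have "0 < nodal T' b m" if "b \<in> ?F" for b using kb[OF that, of m] m(2) m(3)[OF that] by simp
    then have "m \<in> ?N" using m(3) by blast
    ultimately obtain e where e: "0 < e" "e \<le> 1" "\<And>t. \<bar>t\<bar> \<le> e \<Longrightarrow> m + t *\<^sub>R (a - m) \<in> ?N"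
      by (rule open_line_nbhd[where w="a - m"]) blast
    let ?y = "m + e *\<^sub>R (a - m)"
    have yN: "?y \<in> ?N" using e by simp
    have ya: "nodal T a ?y = e" using m(2) by (simp add: bary_line[OF T(1) a] bary_at_vertex[OF T(1) a a])
    have "?y \<in> T" unfolding mem_element[OF T(1)] using yN ya e(1) by auto
    moreover have "?y \<in> T'" unfolding mem_element[OF T(2)] using yN k[of ?y] ya e(1) kp V' by auto
    ultimately show False using elements_disjoint[OF T(1,2)] T(3) closure_subset by blast
  qed
  with that \<open>a' \<notin> vertices T\<close> V' k kb show ?thesis by blast
qed

text \<open>Describes boundary facets by vertices alone: the facet opposite to \<open>a\<close>
  occurs in no other element.\<close>

definition unshared where "unshared T a \<longleftrightarrow> \<not> (\<exists>T'\<in>\<T>. T' \<noteq> T \<and> vertices T - {a} \<subseteq> vertices T')"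

text \<open>A point of the facet inside \<Omega> can be moved a little towards the middle of the
  facet, where \<open>T\<close> is the only closed element. Crossing the facet there leads to a
  point of \<Omega> that no element covers.\<close>

lemma unshared_facet_outside:
  assumes T: "T \<in> \<T>" "a \<in> vertices T" "unshared T a" and x: "x \<in> closure T" "nodal T a x = 0"
  shows "x \<notin> \<Omega>"
proof
  assume "x \<in> \<Omega>"
  obtain m where m: "m \<in> closure T" "nodal T a m = 0" "\<And>b. b \<in> vertices T - {a} \<Longrightarrow> 0 < nodal T b m"
    using facet_center[OF T(1,2)] by blast
  obtain e where e: "0 < e" "e \<le> 1" "\<And>t. \<bar>t\<bar> \<le> e \<Longrightarrow> x + t *\<^sub>R (m - x) \<in> \<Omega>"
    by (rule open_line_nbhd[OF domain(1) \<open>x \<in> \<Omega>\<close>, where w="m - x"]) blast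
  define y where "y = x + e *\<^sub>R (m - x)"
  have y\<Omega>: "y \<in> \<Omega>" using e by (simp add: y_def)
  have ya: "nodal T a y = 0" using m(2) x(2) by (simp add: y_def bary_line[OF T(1,2)])
  have yb: "0 < nodal T b y" if "b \<in> vertices T - {a}" for b
  proof -
    have "b \<in> vertices T" using that by blast
    moreover have "0 \<le> (1 - e) * nodal T b x"
      using x(1) mem_closure_element[OF T(1)] \<open>b \<in> vertices T\<close> e(2) by (intro mult_nonneg_nonneg) auto
    moreover have "0 < e * nodal T b m" using m(3)[OF that] e(1) by simp
    ultimately show ?thesis unfolding y_def by (simp only: bary_line[OF T(1)] add_nonneg_pos)
  qed
  have yT: "y \<in> closure T" unfolding mem_closure_element[OF T(1)] using ya yb by (metis DiffI less_eq_real_def singletonD)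
  \<comment> \<open>All coordinates of \<open>y\<close> except the one at \<open>a\<close> are
    positive, so an element that contains \<open>y\<close> has the whole facet.\<close>
  have only: "y \<notin> closure T'" if T': "T' \<in> \<T>" "T' \<noteq> T" for T'
  proof
    assume c: "y \<in> closure T'"
    have "b \<in> vertices T'" if "b \<in> vertices T - {a}" for b
      using bary_shared[OF T(1) T'(1) yT c, of b] yb[OF that] that by (auto split: if_splits)
    then show False using T(3) T' by (auto simp: unshared_def)
  qed
  let ?N = "\<Omega> - (\<Union>T'\<in>\<T> - {T}. closure T')"
  have "open ?N" using domain(1) finite_mesh by (intro open_Diff closed_UN) auto
  moreover have "y \<in> ?N" using y\<Omega> only by blast
  ultimately obtain e' where e': "0 < e'" "e' \<le> 1" "\<And>t. \<bar>t\<bar> \<le> e' \<Longrightarrow> y + t *\<^sub>R (a - y) \<in> ?N"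
    by (rule open_line_nbhd[where w="a - y"]) blast
  \<comment> \<open>Beyond the facet: the coordinate at \<open>a\<close> becomes negative, although
    near \<open>y\<close> only \<open>T\<close> can cover the domain.\<close>
  let ?w = "y + (- e') *\<^sub>R (a - y)"
  have "?w \<in> ?N" using e'(1) e'(3)[of "- e'"] by simp
  then have "?w \<in> closure T" using cover closure_subset by blast
  then have "0 \<le> nodal T a ?w" using mem_closure_element[OF T(1)] T(2) by blast
  moreover have "nodal T a ?w = - e'" using ya bary_line[OF T(1,2), of y "- e'" a] by (simp add: bary_at_vertex[OF T(1,2,2)])
  ultimately show False using e'(1) by linarith
qed

text \<open>If every facet at \<open>z\<close> of every element of \<open>A\<close> is shared with another element of \<open>A\<close>, a segment in
  general position, which avoids the faces of codimension 2, cannot leave the union of the cones.\<close>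

lemma cones_cover:
  assumes A: "A \<subseteq> star z" "A \<noteq> {}"
    and shared: "\<And>T a. T \<in> A \<Longrightarrow> a \<in> vertices T - {z} \<Longrightarrow> \<exists>T'\<in>A. T' \<noteq> T \<and> vertices T - {a} \<subseteq> vertices T'"
  shows "\<exists>T\<in>A. y \<in> cone T z"
proof (rule ccontr)
  assume no: "\<not> (\<exists>T\<in>A. y \<in> cone T z)"
  define C where "C = (\<Union>T\<in>A. cone T z)"
  have A': "T \<in> \<T>" "z \<in> vertices T" if "T \<in> A" for T using A(1) that by (auto simp: star_def)
  have fA: "finite A" using A(1) star_finite finite_subset by blast
  have clC: "closed C" unfolding C_def using fA closed_cone A' by (intro closed_UN) auto
  have hyp: "negligible {x. c1 + g \<bullet> x = 0}" if "g \<noteq> 0" for c1 and g :: 'a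
  proof -
    have "{x. c1 + g \<bullet> x = 0} = {x. g \<bullet> x = - c1}" by (intro Collect_cong) linarith
    then show ?thesis using negligible_hyperplane[of g "- c1"] that by simp
  qed
  have lam: "nodal T a x = nodal T a 0 + nodal_grad T a \<bullet> x" if "T \<in> A" "a \<in> vertices T" for T a x
    using simplex_vertices.bary_diff[OF simplex_vertices[OF A'(1)[OF that(1)]] that(2), of x 0] by simp
  obtain T0 where T0: "T0 \<in> A" using A(2) by blast
  \<comment> \<open>The start of the segment avoids the hyperplanes of all facets, which form a null
    set.\<close>
  obtain x where x: "x \<in> T0" "\<And>T a. T \<in> A \<Longrightarrow> a \<in> vertices T \<Longrightarrow> nodal T a x \<noteq> 0"
  proof -
    define H where "H = (\<Union>T\<in>A. \<Union>a\<in>vertices T. {x. nodal T a x = 0})"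
    have "negligible {x. nodal T a x = 0}" if "T \<in> A" "a \<in> vertices T" for T a
      using hyp[of "nodal_grad T a" "nodal T a 0"]
        simplex_vertices.bary_grad_nonzero[OF simplex_vertices[OF A'(1)[OF that(1)]] that(2)]
      by (subst lam[OF that]) auto
    then have "negligible H" unfolding H_def using fA element(10) A'(1) by (intro negligible_UN) auto
    moreover have "\<not> negligible T0" using open_not_negligible element(1,4) A'(1)[OF T0] by blast
    ultimately have "\<not> T0 \<subseteq> H" using negligible_subset by blast
    then obtain x where "x \<in> T0" "x \<notin> H" by blast
    then show ?thesis by (intro that[of x]) (auto simp: H_def)
  qed
  \<comment> \<open>The uncovered end point is perturbed within the open complement of
    \<open>C\<close>. The second condition says that two coordinates, which are affine along the
    segment, have no common zero before the end: this is how faces of codimension 2 are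
    avoided.\<close>
  obtain y where y: "y \<notin> C" "\<And>T a b. T \<in> A \<Longrightarrow> a \<in> vertices T - {z} \<Longrightarrow> b \<in> vertices T - {z} \<Longrightarrow> a \<noteq> b \<Longrightarrow>
      nodal T a x * nodal T b y \<noteq> nodal T b x * nodal T a y"
  proof -
    define P where "P T a b = {y. nodal T a x * nodal T b y = nodal T b x * nodal T a y}" for T a b
    define H where "H = (\<Union>T\<in>A. \<Union>a\<in>vertices T - {z}. \<Union>b\<in>vertices T - {z} - {a}. P T a b)"
    have "negligible (P T a b)" if T: "T \<in> A" and a: "a \<in> vertices T - {z}" and b: "b \<in> vertices T - {z} - {a}" for T a b
    proof -
      \<comment> \<open>The gradient of the affine condition to be avoided. It is nonzero because
        its product with \<open>b - z\<close> is \<open>nodal T a x\<close>, which does not vanish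
        by the choice of \<open>x\<close>.\<close>
      let ?g = "nodal T a x *\<^sub>R nodal_grad T b - nodal T b x *\<^sub>R nodal_grad T a"
      have "nodal_grad T b \<bullet> (b - z) = 1" "nodal_grad T a \<bullet> (b - z) = 0"
        using simplex_vertices.bary_diff[OF simplex_vertices[OF A'(1)[OF T]], of b b z]
          simplex_vertices.bary_diff[OF simplex_vertices[OF A'(1)[OF T]], of a b z] a b A'[OF T]
        by (auto simp: bary_at_vertex)
      then have "?g \<bullet> (b - z) = nodal T a x" by (simp add: inner_diff_left)
      then have "?g \<noteq> 0" using x(2)[OF T, of a] a by (metis DiffD1 inner_zero_left)
      moreover have "P T a b = {y. (nodal T a x * nodal T b 0 - nodal T b x * nodal T a 0) + ?g \<bullet> y = 0}"
        unfolding P_def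
      proof (rule Collect_cong)
        fix y
        have "a \<in> vertices T" "b \<in> vertices T" using a b by auto
        note l = lam[OF T this(1), of y] lam[OF T this(2), of y]
        show "(nodal T a x * nodal T b y = nodal T b x * nodal T a y) \<longleftrightarrow>
          (nodal T a x * nodal T b 0 - nodal T b x * nodal T a 0) + ?g \<bullet> y = 0"
          unfolding l by (auto simp: inner_diff_left algebra_simps)
      qed
      ultimately show ?thesis using hyp by presburger
    qed
    then have "negligible H" unfolding H_def using fA element(10) A'(1) by (intro negligible_UN) auto
    moreover have "\<not> negligible (- C)" using open_not_negligible[of "- C"] clC no unfolding C_def by blast
    ultimately have "\<not> - C \<subseteq> H" using negligible_subset by blast
    then obtain y where "y \<notin> C" "y \<notin> H" by blast
    then show ?thesis by (intro that[of y]) (auto simp: H_def P_def)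
  qed
  define \<gamma> where "\<gamma> t = x + t *\<^sub>R (y - x)" for t
  have c\<gamma>: "continuous_on UNIV \<gamma>" unfolding \<gamma>_def by (intro continuous_intros)
  let ?S = "{0..1} \<inter> \<gamma> -` C"
  have "closed (\<gamma> -` C)" using c\<gamma> clC by (intro continuous_closed_vimage) (auto simp: continuous_on_eq_continuous_at)
  then have "compact ?S" by (intro compact_Int_closed) auto
  moreover have "0 \<in> ?S"
    using x(1) T0 closure_cone[OF A'(1)[OF T0]] closure_subset[of T0] by (auto simp: \<gamma>_def C_def)
  ultimately obtain t where t: "t \<in> ?S" "\<And>s. s \<in> ?S \<Longrightarrow> s \<le> t" using compact_attains_sup[of ?S] by blast
  have t1: "t < 1" using t(1) y(1) by (cases "t = 1") (auto simp: \<gamma>_def)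
  \<comment> \<open>The parameter \<open>t\<close> is the last one at which the segment is in
    \<open>C\<close>, so it must leave \<open>C\<close> immediately afterwards.\<close>
  have no_nbhd: "\<not> (open N \<and> \<gamma> t \<in> N \<and> N \<subseteq> C)" for N
  proof
    assume N: "open N \<and> \<gamma> t \<in> N \<and> N \<subseteq> C"
    obtain e where e: "0 < e" "e \<le> 1" "\<And>s. \<bar>s\<bar> \<le> e \<Longrightarrow> \<gamma> t + s *\<^sub>R (y - x) \<in> N"
      by (rule open_line_nbhd[where w="y - x" and N=N and p="\<gamma> t"]) (use N in blast)+
    define s where "s = min e (1 - t)"
    have s: "0 < s" "s \<le> e" "t + s \<le> 1" using e(1) t1 by (auto simp: s_def)
    have "\<gamma> (t + s) = \<gamma> t + s *\<^sub>R (y - x)" by (simp add: \<gamma>_def algebra_simps)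
    then have "t + s \<in> ?S" using e(3)[of s] s N t(1) by auto
    then show False using t(2) s(1) by fastforce
  qed
  obtain T where T: "T \<in> A" "\<gamma> t \<in> cone T z" using t(1) by (auto simp: C_def)
  let ?l = "nodal T"
  have line: "?l a (\<gamma> t) = (1 - t) * ?l a x + t * ?l a y" if "a \<in> vertices T" for a
    unfolding \<gamma>_def by (rule bary_line[OF A'(1)[OF T(1)] that])
  show False
  proof (cases "\<forall>a\<in>vertices T - {z}. 0 < ?l a (\<gamma> t)")
    case True
    have "{y. \<forall>a\<in>vertices T - {z}. 0 < ?l a y} \<subseteq> C" using T(1) by (auto simp: C_def cone_def intro: less_imp_le)
    then show False using no_nbhd open_bary_pos[OF A'(1)[OF T(1)], of "vertices T - {z}"] True by blast
  next
    case False
    then obtain a where a: "a \<in> vertices T - {z}" "?l a (\<gamma> t) = 0" using T(2) unfolding cone_def by force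
    \<comment> \<open>Two vanishing coordinates at the exit point are excluded by the general
      position of \<open>y\<close>; it therefore lies on a single facet.\<close>
    have pos: "0 < ?l b (\<gamma> t)" if b: "b \<in> vertices T - {z} - {a}" for b
    proof (rule ccontr)
      assume "\<not> 0 < ?l b (\<gamma> t)"
      then have "?l b (\<gamma> t) = 0" using T(2) b unfolding cone_def by force
      then have e: "(1 - t) * ?l b x = - t * ?l b y" "(1 - t) * ?l a x = - t * ?l a y" using line[of b] line[of a] a b by auto
      have "(1 - t) * (?l a x * ?l b y - ?l b x * ?l a y) = ((1 - t) * ?l a x) * ?l b y - ((1 - t) * ?l b x) * ?l a y"
        by (simp add: algebra_simps)
      also have "\<dots> = 0" unfolding e by simp
      finally have "?l a x * ?l b y = ?l b x * ?l a y" using t1 by simp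
      then show False using y(2)[OF T(1) a(1), of b] b by blast
    qed
    obtain T' where T': "T' \<in> A" "T' \<noteq> T" "vertices T - {a} \<subseteq> vertices T'" using shared[OF T(1) a(1)] by blast
    have aT: "a \<in> vertices T" using a(1) by blast
    obtain a' \<kappa> where n: "a' \<notin> vertices T" "vertices T' = insert a' (vertices T - {a})" "\<kappa> < 0"
      "\<And>x. nodal T' a' x = \<kappa> * ?l a x"
      "\<And>b x. b \<in> vertices T - {a} \<Longrightarrow> nodal T' b x = ?l b x + nodal T' b a * ?l a x"
      by (rule facet_neighbour[OF A'(1)[OF T(1)] A'(1)[OF T'(1)] T'(2)[symmetric] aT T'(3)]) blast
    let ?B = "vertices T - {z} - {a}"
    let ?N = "{y. \<forall>b\<in>?B. 0 < ?l b y} \<inter> {y. \<forall>b\<in>?B. 0 < nodal T' b y}"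
    have "open ?N" using open_bary_pos[OF A'(1)[OF T(1)], of ?B] open_bary_pos[OF A'(1)[OF T'(1)], of ?B] n(2) by (intro open_Int) auto
    moreover have "0 < nodal T' b (\<gamma> t)" if "b \<in> ?B" for b
      using n(5)[of b "\<gamma> t"] pos[OF that] a(2) that by simp
    then have "\<gamma> t \<in> ?N" using pos by blast
    moreover have "?N \<subseteq> C"
    proof
      fix w assume w: "w \<in> ?N"
      \<comment> \<open>Near the exit point, the sign of the coordinate at \<open>a\<close> decides
        which of the two cones contains \<open>w\<close>; on the far side the negative \<kappa>
        makes the coordinate at \<open>a'\<close> positive.\<close>
      show "w \<in> C"
      proof (cases "0 \<le> ?l a w")
        case True
        then have "w \<in> cone T z" using w unfolding cone_def by (auto intro: less_imp_le)
        then show ?thesis using T(1) by (auto simp: C_def)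
      next
        case False
        then have "0 < nodal T' a' w" using n(3,4) by (simp add: mult_neg_neg)
        then have a'w: "0 \<le> nodal T' a' w" by simp
        have "0 \<le> nodal T' b w" if "b \<in> vertices T' - {z}" for b
        proof (cases "b = a'")
          case False
          then have "b \<in> ?B" using that n(2) by blast
          then have "0 < nodal T' b w" using w by blast
          then show ?thesis by simp
        qed (use a'w in simp)
        then have "w \<in> cone T' z" unfolding cone_def by blast
        then show ?thesis using T'(1) by (auto simp: C_def)
      qed
    qed
    ultimately show False using no_nbhd by blast
  qed
qed

text \<open>The removed vertex differs from \<open>z\<close>, so the common facet contains
  \<open>z\<close> and chains stay in the star.\<close>

definition facet_adj where
  "facet_adj z = {(T, T'). T \<in> star z \<and> T' \<in> star z \<and> T \<noteq> T' \<and> (\<exists>a\<in>vertices T - {z}. vertices T - {a} \<subseteq> vertices T')}"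

lemma facet_adj_star: "(T, T') \<in> (facet_adj z)\<^sup>* \<Longrightarrow> T \<in> star z \<Longrightarrow> T' \<in> star z"
  by (induction rule: rtrancl_induct) (auto simp: facet_adj_def)

lemma component_shared:
  assumes T: "T \<in> star z" "(T, T1) \<in> (facet_adj z)\<^sup>*" and a: "a \<in> vertices T1 - {z}" "\<not> unshared T1 a"
  shows "\<exists>T'\<in>{T'. (T, T') \<in> (facet_adj z)\<^sup>*}. T' \<noteq> T1 \<and> vertices T1 - {a} \<subseteq> vertices T'"
proof -
  have T1: "T1 \<in> star z" by (rule facet_adj_star[OF T(2,1)])
  obtain T' where T': "T' \<in> \<T>" "T' \<noteq> T1" "vertices T1 - {a} \<subseteq> vertices T'" using a(2) by (auto simp: unshared_def)
  have "z \<in> vertices T'" using T1 a(1) T'(3) by (auto simp: star_def)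
  then have "(T1, T') \<in> facet_adj z" using T1 T' a(1) unfolding facet_adj_def star_def by blast
  then show ?thesis using T(2) T' by (meson mem_Collect_eq rtrancl.rtrancl_into_rtrancl)
qed

text \<open>A facet at \<open>z\<close> contains a point of \<Omega> and is thus shared, with a
  member of the same component. So the cones of one component cover the space, and a point of
  \<open>T2\<close>, moved towards \<open>z\<close>, lies both in \<open>T2\<close> and in a closed
  element of the component.\<close>

lemma interior_star_connected:
  assumes z: "z \<in> \<Omega>" and T: "T \<in> star z" "T2 \<in> star z"
  shows "(T, T2) \<in> (facet_adj z)\<^sup>*"
proof -
  let ?A = "{T'. (T, T') \<in> (facet_adj z)\<^sup>*}"
  have A: "?A \<subseteq> star z" using facet_adj_star T(1) by blast
  have T2: "T2 \<in> \<T>" "z \<in> vertices T2" using T by (auto simp: star_def)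
  obtain x where x: "x \<in> T2" using element(4)[OF T2(1)] by blast
  have "\<exists>T'\<in>?A. x \<in> cone T' z"
  proof (rule cones_cover[OF A])
    fix T1 a assume T1: "T1 \<in> ?A" and a: "a \<in> vertices T1 - {z}"
    have T1': "T1 \<in> \<T>" "z \<in> vertices T1" using T1 A by (auto simp: star_def)
    have "\<not> unshared T1 a"
      using unshared_facet_outside[OF T1'(1), of a z] a z element(12)[OF T1'(1)] T1' by (auto simp: bary_at_vertex)
    then show "\<exists>T'\<in>?A. T' \<noteq> T1 \<and> vertices T1 - {a} \<subseteq> vertices T'" using component_shared[OF T(1) _ a] T1 by blast
  qed blast
  then obtain T' where T': "T' \<in> ?A" "x \<in> cone T' z" by blast
  then have T'': "T' \<in> \<T>" "z \<in> vertices T'" using A by (auto simp: star_def)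
  obtain s where s: "0 < s" "s \<le> 1" "z + s *\<^sub>R (x - z) \<in> closure T'" using cone_shrink[OF T'' T'(2)] by blast
  have "z + s *\<^sub>R (x - z) \<in> T2"
    unfolding mem_element[OF T2(1)]
  proof
    fix v assume v: "v \<in> vertices T2"
    have "0 < bary (vertices T2) v x" using x v mem_element[OF T2(1)] by blast
    then show "0 < bary (vertices T2) v (z + s *\<^sub>R (x - z))"
      using s by (auto simp: bary_line[OF T2(1) v] bary_at_vertex[OF T2(1) v T2(2)] add_nonneg_pos)
  qed
  then have "T2 = T'" using elements_disjoint[OF T2(1) T''(1) _ s(3)] by blast
  then show ?thesis using T'(1) by blast
qed

text \<open>If all facets at \<open>z\<close> in the component were shared, its cones would cover
  the space, and a neighbourhood of \<open>z\<close> would be contained in the closure of \<Omega>,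
  so that \<open>z\<close> would be an interior point.\<close>

lemma boundary_star_unshared:
  assumes z: "z \<notin> \<Omega>" and T: "T \<in> star z"
  shows "\<exists>T' a. (T, T') \<in> (facet_adj z)\<^sup>* \<and> a \<in> vertices T' - {z} \<and> unshared T' a"
proof (rule ccontr)
  assume no: "\<not> ?thesis"
  let ?A = "{T'. (T, T') \<in> (facet_adj z)\<^sup>*}"
  have A: "?A \<subseteq> star z" using facet_adj_star T by blast
  have fA: "finite ?A" using A star_finite finite_subset by blast
  have cov: "\<exists>T'\<in>?A. x \<in> cone T' z" for x
    by (rule cones_cover[OF A]) (use component_shared[OF T] no in blast)+
  let ?N = "\<Inter>T'\<in>?A. {y. \<forall>b\<in>{z}. 0 < nodal T' b y}"
  have "open {y. \<forall>b\<in>{z}. 0 < nodal T' b y}" if "T' \<in> ?A" for T'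
    by (rule open_bary_pos) (use A that in \<open>auto simp: star_def\<close>)
  then have "open ?N" using fA by (intro open_INT) blast+
  moreover have "z \<in> ?N" using A by (auto simp: star_def bary_at_vertex)
  moreover have "?N \<subseteq> closure \<Omega>"
  proof
    fix y assume y: "y \<in> ?N"
    obtain T' where T': "T' \<in> ?A" "y \<in> cone T' z" using cov by blast
    then have "T' \<in> \<T>" using A by (auto simp: star_def)
    moreover have "0 < nodal T' z y" using y T'(1) by blast
    ultimately have "y \<in> closure T'" using cone_closure T'(2) by (meson less_imp_le)
    then show "y \<in> closure \<Omega>" using cover \<open>T' \<in> \<T>\<close> by blast
  qed
  ultimately have "z \<in> interior (closure \<Omega>)" using interiorI by blast
  then show False using z interior_closure by simp
qed

end

section \<open>Piecewise smooth functions in H10\<close>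

text \<open>Reduces to the segment between the two points, where the closed pieces cut a real
  interval and the bounds can be chained.\<close>

lemma lipschitz_on_closed_pieces:
  fixes u :: "'a::euclidean_space \<Rightarrow> real"
  assumes I: "finite I" and C: "\<And>i. i \<in> I \<Longrightarrow> closed (C i)" "\<And>i. i \<in> I \<Longrightarrow> L-lipschitz_on (C i) u"
    and cov: "(\<Union>i\<in>I. C i) = UNIV" and L: "0 \<le> L"
  shows "L-lipschitz_on UNIV u"
proof (rule lipschitz_onI)
  fix x y :: 'a
  define F where "F t = u (x + t *\<^sub>R (y - x))" for t :: real
  define U where "U i = (\<lambda>t. x + t *\<^sub>R (y - x)) -` C i" for i
  have "(L * dist x y)-lipschitz_on {0..1} F"
  proof (rule lipschitz_on_closed_Union[OF _ _ I])
    show "closed (U i)" if "i \<in> I" for i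
      unfolding U_def by (rule continuous_closed_vimage[OF C(1)[OF that]]) (intro continuous_intros)
    show "(L * dist x y)-lipschitz_on (U i) F" if "i \<in> I" for i
    proof (rule lipschitz_onI)
      fix s t assume "s \<in> U i" "t \<in> U i"
      then have "dist (F s) (F t) \<le> L * dist (x + s *\<^sub>R (y - x)) (x + t *\<^sub>R (y - x))"
        unfolding F_def by (intro lipschitz_onD[OF C(2)[OF that]]) (auto simp: U_def)
      also have "dist (x + s *\<^sub>R (y - x)) (x + t *\<^sub>R (y - x)) = dist x y * dist s t"
        by (simp add: dist_norm dist_real_def norm_minus_commute mult.commute flip: scaleR_diff_left)
      finally show "dist (F s) (F t) \<le> L * dist x y * dist s t" by (simp add: mult.assoc)
    qed (use L in simp)
    show "{0..1} \<subseteq> (\<Union>i\<in>I. U i)" using cov unfolding U_def by blast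
  qed (use L in simp)
  from lipschitz_onD[OF this, of 0 1] show "dist (u x) (u y) \<le> L * dist x y" by (simp add: F_def)
qed (rule L)

context mesh
begin

lemma sum_indicator_element:
  fixes q :: "'a set \<Rightarrow> 'b::real_vector"
  assumes "T \<in> \<T>" "x \<in> T"
  shows "(\<Sum>T'\<in>\<T>. indicator T' x *\<^sub>R q T') = q T"
proof -
  have "x \<notin> T'" if "T' \<in> \<T>" "T' \<noteq> T" for T' using elements_disjoint[OF assms(1) that(1) assms(2)] that closure_subset by blast
  then have "(\<Sum>T'\<in>\<T>. indicator T' x *\<^sub>R q T') = (\<Sum>T'\<in>\<T>. if T' = T then q T else 0)"
    using assms by (intro sum.cong) (auto simp: indicator_def)
  then show ?thesis using assms finite_mesh by simp
qed

lemma sum_indicator_outside: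
  fixes q :: "'a set \<Rightarrow> 'b::real_vector"
  assumes "x \<notin> \<Union>\<T>"
  shows "(\<Sum>T'\<in>\<T>. indicator T' x *\<^sub>R q T') = 0"
  using assms by (intro sum.neutral) (auto simp: indicator_def)

lemma skeleton_outside: "x \<in> skeleton \<Longrightarrow> x \<notin> \<Union>\<T>"
proof
  assume "x \<in> skeleton" "x \<in> \<Union>\<T>"
  then obtain T T' where T: "T \<in> \<T>" "x \<in> T" "T' \<in> \<T>" "x \<in> frontier T'" by (auto simp: skeleton_def)
  then have "T = T'" using elements_disjoint[of T T' x] by (auto simp: frontier_def)
  then show False using T element(1)[OF T(1)] by (simp add: frontier_def interior_open)
qed

text \<open>Each closed element is convex, so bounded gradients make \<open>u\<close> Lipschitz on
  it; together with the complement of \<Omega>, where \<open>u\<close> is 0, these sets cover the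
  space. The skeleton is the exceptional null set for the derivative. The set \<U> is kept apart
  from \<Omega> in order to treat patches.\<close>

lemma piecewise_H10:
  fixes u :: "'a \<Rightarrow> real"
  assumes \<U>: "open \<U>" "bounded \<U>" and u: "\<And>x. 0 \<le> u x" "\<And>x. x \<notin> \<U> \<Longrightarrow> u x = 0" "\<And>x. x \<notin> \<Omega> \<Longrightarrow> u x = 0"
    and p: "\<And>T x. T \<in> \<T> \<Longrightarrow> (p T has_derivative (\<lambda>h. h \<bullet> q T x)) (at x)"
    and q: "\<And>T. T \<in> \<T> \<Longrightarrow> continuous_on UNIV (q T)"
    and up: "\<And>T x. T \<in> \<T> \<Longrightarrow> x \<in> closure T \<Longrightarrow> u x = p T x"
  shows "u \<in> H10 \<U> \<and> (AE x in lebesgue_on \<U>. weak_gradient \<U> u x = (\<Sum>T\<in>\<T>. indicator T x *\<^sub>R q T x))"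
proof -
  define g where "g x = (\<Sum>T\<in>\<T>. indicator T x *\<^sub>R q T x)" for x
  have gT: "g x = q T x" if "T \<in> \<T>" "x \<in> T" for T x
    unfolding g_def using sum_indicator_element[OF that, of "\<lambda>T. q T x"] .
  have g0: "g x = 0" if "x \<notin> \<Union>\<T>" for x
    unfolding g_def using sum_indicator_outside[OF that, of "\<lambda>T. q T x"] .
  have "\<exists>M. \<forall>x\<in>closure T. norm (q T x) \<le> M" if "T \<in> \<T>" for T
  proof -
    have "compact (q T ` closure T)"
      using q[OF that] element(3)[OF that] by (intro compact_continuous_image) (auto intro: continuous_on_subset)
    from compact_imp_bounded[OF this] obtain M where "\<forall>y\<in>q T ` closure T. norm y \<le> M" unfolding bounded_iff by blast
    then show ?thesis by blast
  qed
  then obtain M where M: "\<And>T x. T \<in> \<T> \<Longrightarrow> x \<in> closure T \<Longrightarrow> norm (q T x) \<le> M T" by metis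
  define L where "L = (\<Sum>T\<in>\<T>. \<bar>M T\<bar>)"
  have L0: "0 \<le> L" by (simp add: L_def sum_nonneg)
  have L: "norm (q T x) \<le> L" if "T \<in> \<T>" "x \<in> closure T" for T x
    using M[OF that] member_le_sum[OF that(1), of "\<lambda>T. \<bar>M T\<bar>"] finite_mesh unfolding L_def by force
  have lip: "L-lipschitz_on UNIV u"
  proof (rule lipschitz_on_closed_pieces[where I="insert (- \<Omega>) (closure ` \<T>)" and C="\<lambda>x. x"])
    show "closed i" if "i \<in> insert (- \<Omega>) (closure ` \<T>)" for i using that domain(1) by auto
    show "L-lipschitz_on i u" if i: "i \<in> insert (- \<Omega>) (closure ` \<T>)" for i
    proof (cases "i = - \<Omega>")
      case True
      then show ?thesis using u(3) L0 by (auto intro!: lipschitz_onI)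
    next
      case False
      then obtain T where T: "T \<in> \<T>" "i = closure T" using i by blast
      have "L-lipschitz_on (closure T) (p T)"
      proof (rule bounded_derivative_imp_lipschitz)
        show "(p T has_derivative (\<lambda>h. h \<bullet> q T x)) (at x within closure T)" for x
          using p[OF T(1)] has_derivative_at_withinI by blast
        show "onorm (\<lambda>h. h \<bullet> q T x) \<le> L" if "x \<in> closure T" for x
        proof (rule onorm_le)
          fix h show "norm (h \<bullet> q T x) \<le> L * norm h"
            using Cauchy_Schwarz_ineq2[of h "q T x"] mult_left_mono[OF L[OF T(1) that], of "norm h"] by (simp add: mult.commute)
        qed
      qed (use L0 convex_closure element(2)[OF T(1)] in auto)
      then show ?thesis
        unfolding T(2) using up[OF T(1)] by (auto simp: lipschitz_on_def)
    qed
    show "\<Union> ((\<lambda>x. x) ` insert (- \<Omega>) (closure ` \<T>)) = UNIV" using cover closure_subset[of \<Omega>] by auto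
  qed (use finite_mesh L0 in auto)
  have D: "(u has_derivative (\<lambda>h. h \<bullet> g x)) (at x) \<and> isCont g x" if x: "x \<notin> skeleton" for x
  proof (cases "x \<in> closure \<Omega>")
    case True
    then obtain T where T: "T \<in> \<T>" "x \<in> T" using not_skeleton x by blast
    have "(u has_derivative (\<lambda>h. h \<bullet> q T x)) (at x)"
      using has_derivative_transform_within_open[OF p[OF T(1)] element(1)[OF T(1)] T(2)] up[OF T(1)] closure_subset by (metis subsetD)
    moreover have "isCont (q T) x" using q[OF T(1)] by (simp add: continuous_on_eq_continuous_at)
    moreover have "\<forall>\<^sub>F y in nhds x. q T y = g y"
      unfolding eventually_nhds using element(1)[OF T(1)] T gT by (intro exI[of _ T]) auto
    ultimately have "isCont g x" using isCont_cong by blast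
    moreover have "(u has_derivative (\<lambda>h. h \<bullet> q T x)) (at x)" by fact
    ultimately show ?thesis using gT[OF T] by simp
  next
    case False
    have o: "open (- closure \<Omega>)" by (rule open_Compl[OF closed_closure])
    have un: "\<Union>\<T> \<subseteq> closure \<Omega>" using cover closure_subset by blast
    have "((\<lambda>x. 0) has_derivative (\<lambda>h. h \<bullet> (0::'a))) (at x)" by simp
    then have "(u has_derivative (\<lambda>h. h \<bullet> 0)) (at x)"
    proof (rule has_derivative_transform_within_open[OF _ o])
      show "0 = u y" if "y \<in> - closure \<Omega>" for y using u(3)[of y] that closure_subset[of \<Omega>] by auto
    qed (use False in simp)
    have ev: "\<forall>\<^sub>F y in nhds x. 0 = g y"
      unfolding eventually_nhds
    proof (intro exI[of _ "- closure \<Omega>"] conjI ballI o)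
      show "x \<in> - closure \<Omega>" using False by simp
      show "0 = g y" if "y \<in> - closure \<Omega>" for y using g0[of y] un that by auto
    qed
    have "isCont g x" using isCont_cong[OF ev] by simp
    moreover have "(u has_derivative (\<lambda>h. h \<bullet> 0)) (at x)" by fact
    moreover have "g x = 0" using g0 un False by blast
    ultimately show ?thesis by simp
  qed
  have cg: "continuous_on (- skeleton) g"
    using D by (intro continuous_at_imp_continuous_on) blast
  have gz: "g x = 0" if "x \<in> skeleton" for x using g0 skeleton_outside[OF that] by blast
  have gL: "norm (g x) \<le> L" for x
  proof (cases "x \<in> \<Union>\<T>")
    case True
    then show ?thesis using gT L closure_subset by (metis UnionE subsetD)
  qed (simp add: g0 L0)
  from H10_lipschitz[OF \<U> lip u(1,2) skeleton _ cg gz gL] D show ?thesis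
    unfolding g_def by blast
qed

definition hat_grad where
  "hat_grad z x = (\<Sum>T\<in>\<T>. indicator T x *\<^sub>R (if z \<in> vertices T then nodal_grad T z else 0))"

definition bubble_fun_grad where
  "bubble_fun_grad T x = (\<Sum>v\<in>vertices T. (\<Prod>w\<in>vertices T - {v}. nodal T w x) *\<^sub>R nodal_grad T v)"

definition bubble_grad where
  "bubble_grad T x = indicator T x *\<^sub>R bubble_fun_grad T x"

lemma hat_H10:
  assumes z: "z \<in> IV" and \<U>: "open \<U>" "bounded \<U>" "\<And>x. x \<notin> \<U> \<Longrightarrow> hat \<T> z x = 0"
  shows "hat \<T> z \<in> H10 \<U>" "AE x in lebesgue_on \<U>. weak_gradient \<U> (hat \<T> z) x = hat_grad z x"
proof -
  have z': "z \<in> all_vertices" "z \<in> \<Omega>" using z by (auto simp: interior_vertices_eq)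
  have "hat \<T> z \<in> H10 \<U> \<and> (AE x in lebesgue_on \<U>. weak_gradient \<U> (hat \<T> z) x = (\<Sum>T\<in>\<T>. indicator T x *\<^sub>R (if z \<in> vertices T then nodal_grad T z else 0)))"
  proof (rule piecewise_H10[OF \<U>(1,2) _ \<U>(3), where p="\<lambda>T. if z \<in> vertices T then nodal T z else (\<lambda>_. 0)"
        and q="\<lambda>T x. if z \<in> vertices T then nodal_grad T z else 0"])
    show "((if z \<in> vertices T then nodal T z else (\<lambda>_. 0)) has_derivative (\<lambda>h. h \<bullet> (if z \<in> vertices T then nodal_grad T z else 0))) (at x)"
      if "T \<in> \<T>" for T x
      using simplex_vertices.bary_derivative[OF simplex_vertices[OF that]] by auto
  qed (use hat_bounds[OF z'(1)] hat_zero_outside[OF z'] hat_on_element[OF z'(1)] in auto)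
  then show "hat \<T> z \<in> H10 \<U>" "AE x in lebesgue_on \<U>. weak_gradient \<U> (hat \<T> z) x = hat_grad z x"
    by (auto simp: hat_grad_def)
qed

lemma bubble_nonneg:
  assumes T: "T \<in> \<T>"
  shows "0 \<le> bubble \<T> T x"
proof (cases "x \<in> T")
  case True
  then have "0 \<le> nodal T v x" if "v \<in> vertices T" for v using that mem_element[OF T] less_imp_le by blast
  then show ?thesis using True by (simp add: bubble_eq[OF T] prod_nonneg)
qed (simp add: bubble_eq[OF T])

lemma bubble_H10:
  assumes T: "T \<in> \<T>" and \<U>: "open \<U>" "bounded \<U>" "T \<subseteq> \<U>"
  shows "bubble \<T> T \<in> H10 \<U>" "AE x in lebesgue_on \<U>. weak_gradient \<U> (bubble \<T> T) x = bubble_grad T x"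
proof -
  interpret S: simplex_vertices "vertices T" by (rule simplex_vertices[OF T])
  define P where "P x = (\<Prod>v\<in>vertices T. nodal T v x)" for x
  have dP: "(P has_derivative (\<lambda>h. h \<bullet> bubble_fun_grad T x)) (at x)" for x
  proof -
    have "(P has_derivative (\<lambda>h. \<Sum>v\<in>vertices T. (h \<bullet> nodal_grad T v) * (\<Prod>w\<in>vertices T - {v}. nodal T w x))) (at x)"
      unfolding P_def by (rule has_derivative_prod) (rule S.bary_derivative)
    then show ?thesis by (simp add: bubble_fun_grad_def inner_sum_right mult.commute)
  qed
  have cP: "continuous_on UNIV (bubble_fun_grad T)"
    unfolding bubble_fun_grad_def using S.continuous_bary by (intro continuous_intros) auto
  have "bubble \<T> T \<in> H10 \<U> \<and> (AE x in lebesgue_on \<U>. weak_gradient \<U> (bubble \<T> T) x = (\<Sum>T'\<in>\<T>. indicator T' x *\<^sub>R (if T' = T then bubble_fun_grad T x else 0)))"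
  proof (rule piecewise_H10[OF \<U>(1,2), where p="\<lambda>T'. if T' = T then P else (\<lambda>_. 0)" and q="\<lambda>T' x. if T' = T then bubble_fun_grad T x else 0"])
    show "0 \<le> bubble \<T> T x" for x by (rule bubble_nonneg[OF T])
    show "bubble \<T> T x = 0" if "x \<notin> \<U>" for x using that \<U>(3) by (auto simp: bubble_eq[OF T])
    show "bubble \<T> T x = 0" if "x \<notin> \<Omega>" for x using that element_subset[OF T] by (auto simp: bubble_eq[OF T])
    show "((if T' = T then P else (\<lambda>_. 0)) has_derivative (\<lambda>h. h \<bullet> (if T' = T then bubble_fun_grad T x else 0))) (at x)" for T' x
      using dP by auto
    show "continuous_on UNIV (\<lambda>x. if T' = T then bubble_fun_grad T x else 0)" for T' using cP by (cases "T' = T") auto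
    fix T' x assume T': "T' \<in> \<T>" "x \<in> closure T'"
    show "bubble \<T> T x = (if T' = T then P else (\<lambda>_. 0)) x"
    proof (cases "T' = T")
      case True
      have "\<exists>v\<in>vertices T. nodal T v x = 0" if xT: "x \<notin> T"
      proof -
        obtain v where v: "v \<in> vertices T" "\<not> 0 < nodal T v x" using xT mem_element[OF T] by blast
        moreover have "0 \<le> nodal T v x" using T' True v(1) mem_closure_element[OF T] by blast
        ultimately show ?thesis by (intro bexI[of _ v]) auto
      qed
      then show ?thesis using True S.fin by (auto simp: bubble_eq[OF T] P_def)
    next
      case False
      then have "x \<notin> T" using elements_disjoint[OF T T'(1) _ T'(2)] by blast
      then show ?thesis using False by (simp add: bubble_eq[OF T])
    qed
  qed
  moreover have "(\<Sum>T'\<in>\<T>. indicator T' x *\<^sub>R (if T' = T then bubble_fun_grad T x else 0)) = bubble_grad T x" for x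
  proof -
    have "(\<Sum>T'\<in>\<T>. indicator T' x *\<^sub>R (if T' = T then bubble_fun_grad T x else 0)) = (\<Sum>T'\<in>\<T>. if T' = T then bubble_grad T x else 0)"
      by (intro sum.cong) (auto simp: bubble_grad_def)
    then show ?thesis using finite_mesh T by simp
  qed
  ultimately show "bubble \<T> T \<in> H10 \<U>" "AE x in lebesgue_on \<U>. weak_gradient \<U> (bubble \<T> T) x = bubble_grad T x" by auto
qed

end

section \<open>Comparison of means across facets\<close>

section \<open>Affine changes of variables\<close>

text \<open>Uniqueness of translation invariant measures: both sides of the identity in the proof are
  \<open>\<integral>\<integral> f (\<Theta> x) g y\<close>, after shifting \<open>\<Theta> x\<close> by \<open>y\<close> and then \<open>y\<close> by \<open>- \<Theta> x\<close>.\<close>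

lemma nn_integral_affine_bijection:
  fixes \<Theta> :: "'a::euclidean_space \<Rightarrow> 'a" and f :: "'a \<Rightarrow> ennreal"
  assumes \<Theta>: "\<Theta> \<in> borel_measurable borel" "\<And>y. \<exists>y'. \<forall>x. \<Theta> (x + y') = \<Theta> x + y"
    and T: "T \<in> sets borel" "T' \<in> sets borel" "T \<in> lmeasurable" "T' \<in> lmeasurable" "0 < vol T'"
    and TT': "\<And>x. \<Theta> x \<in> T' \<longleftrightarrow> x \<in> T" and f: "f \<in> borel_measurable borel"
  shows "(\<integral>\<^sup>+x. f (\<Theta> x) \<partial>lborel) = ennreal (vol T / vol T') * (\<integral>\<^sup>+x. f x \<partial>lborel)"
proof -
  define B where "B = ball (0::'a) 1"
  define g where "g = (indicator B :: 'a \<Rightarrow> ennreal)"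
  have g [measurable]: "g \<in> borel_measurable borel" unfolding g_def B_def by (rule borel_measurable_indicator) auto
  note \<Theta>(1) [measurable]
  have shift: "(\<integral>\<^sup>+x. h (\<Theta> x + y) \<partial>lborel) = (\<integral>\<^sup>+x. h (\<Theta> x) \<partial>lborel)" if h: "h \<in> borel_measurable borel" for h :: "'a \<Rightarrow> ennreal" and y
  proof -
    obtain y' where y': "\<And>x. \<Theta> (x + y') = \<Theta> x + y" using \<Theta>(2) by blast
    have "(\<lambda>x. h (\<Theta> x)) \<in> borel_measurable borel" using h by measurable
    from lborel_nn_integral_affine[OF this, of 1 y'] show ?thesis by (simp add: y' add.commute[of y'])
  qed
  have tr: "(\<integral>\<^sup>+x. h (x + y) \<partial>lborel) = (\<integral>\<^sup>+x. h x \<partial>lborel)" if "h \<in> borel_measurable borel" for h :: "'a \<Rightarrow> ennreal" and y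
    using lborel_nn_integral_affine[OF that, of 1 y] by (simp add: add.commute)
  have key: "(\<integral>\<^sup>+x. f (\<Theta> x) \<partial>lborel) * (\<integral>\<^sup>+y. g y \<partial>lborel) = (\<integral>\<^sup>+y. f y \<partial>lborel) * (\<integral>\<^sup>+x. g (- \<Theta> x) \<partial>lborel)"
    if f [measurable]: "f \<in> borel_measurable borel" for f
  proof -
    have "(\<integral>\<^sup>+x. f (\<Theta> x) \<partial>lborel) * (\<integral>\<^sup>+y. g y \<partial>lborel) = (\<integral>\<^sup>+y. (\<integral>\<^sup>+x. f (\<Theta> x) \<partial>lborel) * g y \<partial>lborel)"
      by (rule nn_integral_cmult[symmetric]) measurable
    also have "\<dots> = (\<integral>\<^sup>+y. (\<integral>\<^sup>+x. f (\<Theta> x + y) * g y \<partial>lborel) \<partial>lborel)"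
      by (intro nn_integral_cong) (subst shift[OF f, symmetric], rule nn_integral_multc[symmetric], measurable)
    also have "\<dots> = (\<integral>\<^sup>+x. (\<integral>\<^sup>+y. f (\<Theta> x + y) * g y \<partial>lborel) \<partial>lborel)"
      by (rule lborel_pair.Fubini') measurable
    also have "\<dots> = (\<integral>\<^sup>+x. (\<integral>\<^sup>+y. f y * g (y - \<Theta> x) \<partial>lborel) \<partial>lborel)"
    proof (rule nn_integral_cong)
      fix x
      have "(\<lambda>y. f y * g (y - \<Theta> x)) \<in> borel_measurable borel" by measurable
      from tr[OF this, of "\<Theta> x"] show "(\<integral>\<^sup>+y. f (\<Theta> x + y) * g y \<partial>lborel) = (\<integral>\<^sup>+y. f y * g (y - \<Theta> x) \<partial>lborel)"
        by (simp add: add.commute)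
    qed
    also have "\<dots> = (\<integral>\<^sup>+y. (\<integral>\<^sup>+x. f y * g (y - \<Theta> x) \<partial>lborel) \<partial>lborel)"
      by (rule lborel_pair.Fubini'[symmetric]) measurable
    also have "\<dots> = (\<integral>\<^sup>+y. f y * (\<integral>\<^sup>+x. g (- \<Theta> x) \<partial>lborel) \<partial>lborel)"
    proof (rule nn_integral_cong)
      fix y
      have "(\<lambda>z. g (y - z)) \<in> borel_measurable borel" by measurable
      from shift[OF this, of y] have "(\<integral>\<^sup>+x. g (y - \<Theta> x) \<partial>lborel) = (\<integral>\<^sup>+x. g (- \<Theta> x) \<partial>lborel)" by simp
      moreover have "(\<integral>\<^sup>+x. f y * g (y - \<Theta> x) \<partial>lborel) = f y * (\<integral>\<^sup>+x. g (y - \<Theta> x) \<partial>lborel)"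
        by (rule nn_integral_cmult) measurable
      ultimately show "(\<integral>\<^sup>+x. f y * g (y - \<Theta> x) \<partial>lborel) = f y * (\<integral>\<^sup>+x. g (- \<Theta> x) \<partial>lborel)" by simp
    qed
    also have "\<dots> = (\<integral>\<^sup>+y. f y \<partial>lborel) * (\<integral>\<^sup>+x. g (- \<Theta> x) \<partial>lborel)" by (rule nn_integral_multc) measurable
    finally show ?thesis .
  qed
  define v where "v = (\<integral>\<^sup>+y. g y \<partial>lborel)"
  define c where "c = (\<integral>\<^sup>+x. g (- \<Theta> x) \<partial>lborel)"
  have "v = emeasure lborel B" by (simp add: v_def g_def B_def)
  also have "\<dots> = ennreal (vol B)"
    using emeasure_eq_measure2[of B lebesgue] by (simp add: B_def)
  finally have v: "v = ennreal (vol B)" .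
  have vp: "0 < vol B" using open_not_negligible[of B] by (simp add: B_def negligible_iff_measure less_le)
  have em: "(\<integral>\<^sup>+x. indicator A x \<partial>lborel) = ennreal (vol A)" if "A \<in> sets borel" "A \<in> lmeasurable" for A :: "'a set"
    using that emeasure_eq_measure2[of A lebesgue] by simp
  \<comment> \<open>The identity is tested with the indicator of \<open>T'\<close>, which determines
    the unknown factor between \<open>c\<close> and \<open>v\<close>.\<close>
  have "(\<integral>\<^sup>+x. indicator T' (\<Theta> x) \<partial>lborel) = (\<integral>\<^sup>+x. indicator T x \<partial>lborel :: ennreal)"
    using TT' by (simp add: indicator_def)
  then have T1: "ennreal (vol T) * v = ennreal (vol T') * c"
    using key[of "indicator T'"] T em by (simp add: v_def c_def)
  have "c = (ennreal (vol T) / ennreal (vol T')) * v"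
  proof -
    have "c = (ennreal (vol T') * c) / ennreal (vol T')"
      using T(5) by (simp add: ennreal_times_divide[symmetric] mult_divide_eq_ennreal mult.commute)
    then show ?thesis unfolding T1[symmetric] by (simp add: ennreal_times_divide mult.commute divide_ennreal_def mult_ac)
  qed
  moreover have "ennreal (vol T) / ennreal (vol T') = ennreal (vol T / vol T')"
    using T(5) by (simp add: divide_ennreal)
  ultimately have c: "c = ennreal (vol T / vol T') * v" by simp
  have "(\<integral>\<^sup>+x. f (\<Theta> x) \<partial>lborel) * v = (ennreal (vol T / vol T') * (\<integral>\<^sup>+x. f x \<partial>lborel)) * v"
    using key[OF f] by (simp add: v_def[symmetric] c_def[symmetric] c mult_ac)
  then show ?thesis using vp v 
    unfolding mult.commute[of _ v] ennreal_mult_cancel_left by auto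
qed

lemma integral_affine_bijection:
  fixes \<Theta> :: "'a::euclidean_space \<Rightarrow> 'a" and F :: "'a \<Rightarrow> real"
  assumes \<Theta>: "continuous_on UNIV \<Theta>" "\<And>y. \<exists>y'. \<forall>x. \<Theta> (x + y') = \<Theta> x + y"
    and T: "T \<in> sets borel" "T' \<in> sets borel" "bounded T" "bounded T'" "0 < vol T'"
    and TT': "\<And>x. \<Theta> x \<in> T' \<longleftrightarrow> x \<in> T" and F: "continuous_on UNIV F"
  shows "(LINT x|lebesgue_on T. F (\<Theta> x)) = vol T / vol T' * (LINT x|lebesgue_on T'. F x)"
proof -
  have l: "T \<in> lmeasurable" "T' \<in> lmeasurable" using T by (auto intro: bounded_set_imp_lmeasurable)
  have int: "integrable (lebesgue_on A) h" if "A \<in> sets borel" "bounded A" "continuous_on UNIV h" for A and h :: "'a \<Rightarrow> real"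
  proof -
    have "compact (closure A)" using that(2) by simp
    then have "integrable lborel (\<lambda>x. indicator (closure A) x *\<^sub>R h x)"
      by (rule borel_integrable_compact) (use that(3) continuous_on_subset in blast)
    then have "integrable (lebesgue_on A) (\<lambda>x. indicator (closure A) x *\<^sub>R h x)"
      by (rule integrable_lborel_imp_lebesgue_on) (use that(1) in auto)
    moreover have "indicator (closure A) x *\<^sub>R h x = h x" if "x \<in> A" for x
      using that closure_subset[of A] by (auto simp: indicator_def)
    ultimately show ?thesis
      by (subst Bochner_Integration.integrable_cong[OF refl, of _ _ "\<lambda>x. indicator (closure A) x *\<^sub>R h x"]) auto
  qed
  have nn: "(LINT x|lebesgue_on T. h (\<Theta> x)) = vol T / vol T' * (LINT x|lebesgue_on T'. h x)"
    if h: "continuous_on UNIV h" "\<And>x. 0 \<le> h x" for h :: "'a \<Rightarrow> real"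
  proof -
    have c: "continuous_on UNIV (\<lambda>x. h (\<Theta> x))" by (rule continuous_on_compose2[OF h(1) \<Theta>(1)]) simp
    have "ennreal (LINT x|lebesgue_on T. h (\<Theta> x)) = (\<integral>\<^sup>+x. ennreal (h (\<Theta> x)) * indicator T x \<partial>lborel)"
      by (rule nn_integral_eq_lebesgue_on[symmetric, OF int[OF T(1,3) c] T(1)]) (use c h in \<open>auto intro: borel_measurable_continuous_onI\<close>)
    also have "\<dots> = (\<integral>\<^sup>+x. (\<lambda>y. ennreal (h y) * indicator T' y) (\<Theta> x) \<partial>lborel)"
      using TT' by (intro nn_integral_cong) (auto simp: indicator_def)
    also have "\<dots> = ennreal (vol T / vol T') * (\<integral>\<^sup>+x. ennreal (h x) * indicator T' x \<partial>lborel)"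
    proof (rule nn_integral_affine_bijection[OF _ \<Theta>(2) T(1,2) l T(5) TT'])
      show "\<Theta> \<in> borel_measurable borel" using \<Theta>(1) by (rule borel_measurable_continuous_onI)
      have "h \<in> borel_measurable borel" using h(1) by (rule borel_measurable_continuous_onI)
      then show "(\<lambda>y. ennreal (h y) * indicator T' y) \<in> borel_measurable borel" using T(2) by (intro borel_measurable_times_ennreal) auto
    qed
    also have "(\<integral>\<^sup>+x. ennreal (h x) * indicator T' x \<partial>lborel) = ennreal (LINT x|lebesgue_on T'. h x)"
      by (rule nn_integral_eq_lebesgue_on[OF int[OF T(2,4) h(1)] T(2)]) (use h in \<open>auto intro: borel_measurable_continuous_onI\<close>)
    also have "ennreal (vol T / vol T') * ennreal (LINT x|lebesgue_on T'. h x)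
        = ennreal (vol T / vol T' * (LINT x|lebesgue_on T'. h x))"
      by (rule ennreal_mult[symmetric]) (use h T(5) in auto)
    finally have "ennreal (LINT x|lebesgue_on T. h (\<Theta> x)) = ennreal (vol T / vol T' * (LINT x|lebesgue_on T'. h x))" .
    then show ?thesis by (subst (asm) ennreal_inj) (use h T(5) in \<open>auto intro!: mult_nonneg_nonneg Bochner_Integration.integral_nonneg\<close>)
  qed
  let ?p = "\<lambda>x. max (F x) 0" and ?n = "\<lambda>x. max (- F x) 0"
  have c: "continuous_on UNIV ?p" "continuous_on UNIV ?n" by (intro continuous_intros F)+
  have c\<Theta>: "continuous_on UNIV (\<lambda>x. ?p (\<Theta> x))" "continuous_on UNIV (\<lambda>x. ?n (\<Theta> x))"
    by (rule continuous_on_compose2[OF c(1) \<Theta>(1)], simp, rule continuous_on_compose2[OF c(2) \<Theta>(1)], simp)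
  have s: "F x = ?p x - ?n x" for x by simp
  have "(LINT x|lebesgue_on T. F (\<Theta> x)) = (LINT x|lebesgue_on T. ?p (\<Theta> x) - ?n (\<Theta> x))" by (simp add: s[symmetric])
  also have "\<dots> = (LINT x|lebesgue_on T. ?p (\<Theta> x)) - (LINT x|lebesgue_on T. ?n (\<Theta> x))"
    by (rule Bochner_Integration.integral_diff[OF int[OF T(1,3) c\<Theta>(1)] int[OF T(1,3) c\<Theta>(2)]])
  also have "\<dots> = vol T / vol T' * ((LINT x|lebesgue_on T'. ?p x) - (LINT x|lebesgue_on T'. ?n x))"
    using nn[OF c(1)] nn[OF c(2)] by (simp add: right_diff_distrib)
  also have "(LINT x|lebesgue_on T'. ?p x) - (LINT x|lebesgue_on T'. ?n x) = (LINT x|lebesgue_on T'. ?p x - ?n x)"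
    by (rule Bochner_Integration.integral_diff[symmetric, OF int[OF T(2,4) c(1)] int[OF T(2,4) c(2)]])
  also have "\<dots> = (LINT x|lebesgue_on T'. F x)" by (simp add: s[symmetric])
  finally show ?thesis .
qed

section \<open>Means over neighbouring elements\<close>

definition mean_value :: "('a::euclidean_space \<Rightarrow> real) \<Rightarrow> 'a set \<Rightarrow> real" where
  "mean_value f T = (LINT x|lebesgue_on T. f x) / vol T"

definition local_error :: "('a::euclidean_space \<Rightarrow> real) \<Rightarrow> 'a set \<Rightarrow> real" where
  "local_error f T = diameter T * sqrt ((LINT x|lebesgue_on T. (norm (grad f x))\<^sup>2) / vol T)"

context mesh
begin

text \<open>The projection along the edge from \<open>a\<close> to \<open>b\<close> onto the facet
  opposite to \<open>a\<close>: the coordinate at \<open>a\<close> is handed over to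
  \<open>b\<close>. Averaging a function of the projected point over \<open>T\<close> gives a mean
  on the facet, weighted by the coordinate at \<open>b\<close>, and this weight is the same from
  both sides.\<close>

definition facet_proj where
  "facet_proj T a b x = x - nodal T a x *\<^sub>R (a - b)"

lemma bary_shift:
  assumes "T \<in> \<T>" "a \<in> vertices T" "b \<in> vertices T" "v \<in> vertices T"
  shows "nodal T v (x - t *\<^sub>R (a - b)) = nodal T v x - t * ((if v = a then 1 else 0) - (if v = b then 1 else 0))"
proof -
  have "nodal T v (x - t *\<^sub>R (a - b)) = nodal T v x - t * (nodal_grad T v \<bullet> (a - b))"
    using simplex_vertices.bary_diff[OF simplex_vertices[OF assms(1)] assms(4), of "x - t *\<^sub>R (a - b)" x] by simp
  also have "nodal_grad T v \<bullet> (a - b) = nodal T v a - nodal T v b"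
    using simplex_vertices.bary_diff[OF simplex_vertices[OF assms(1)] assms(4), of a b] by simp
  finally show ?thesis using bary_at_vertex assms by auto
qed

lemma continuous_facet_proj: "T \<in> \<T> \<Longrightarrow> a \<in> vertices T \<Longrightarrow> continuous_on UNIV (facet_proj T a b)"
  unfolding facet_proj_def using bary_continuous by (intro continuous_intros) auto

text \<open>A point and its projection are joined by a segment in the closed element with direction
  \<open>a - b\<close> and parameter length \<open>nodal T a x\<close>, at most 1. So
  \<open>translation_bound\<close> applies, followed by Cauchy-Schwarz against the constant
  1.\<close>

lemma mean_trace_bound:
  assumes f: "f \<in> test_functions \<U>" and T: "T \<in> \<T>" and ab: "a \<in> vertices T" "b \<in> vertices T" "a \<noteq> b"
  shows "\<bar>mean_value f T - mean_value (\<lambda>x. f (facet_proj T a b x)) T\<bar> \<le> local_error f T"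
proof -
  interpret C1_function f using f by (rule C1_function_test)
  interpret S: simplex_vertices "vertices T" by (rule simplex_vertices[OF T])
  let ?m = "vol T" and ?h = "diameter T" and ?I = "LINT x|lebesgue_on T. (norm (grad f x))\<^sup>2"
  let ?P = "facet_proj T a b"
  have mp: "?m > 0" using element(8)[OF T] .
  have cP: "continuous_on UNIV (\<lambda>x. f (?P x))" by (rule continuous_on_compose2[OF cont continuous_facet_proj[OF T ab(1)]]) simp
  have int: "integrable (lebesgue_on T) k" if "continuous_on UNIV k" for k :: "'a \<Rightarrow> real"
    using S.integrable_T_continuous[OF that] element_eq[OF T] by simp
  define r where "r x = f x - f (?P x)" for x
  have cr: "continuous_on UNIV r" unfolding r_def by (intro continuous_intros cont cP)
  have "ennreal (LINT x|lebesgue_on T. (r x)\<^sup>2) = (\<integral>\<^sup>+x. ennreal ((r x)\<^sup>2) * indicator T x \<partial>lborel)"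
    by (rule nn_integral_eq_lebesgue_on[symmetric])
       (use cr element(7)[OF T] in \<open>auto intro!: int continuous_intros borel_measurable_continuous_onI\<close>)
  also have "\<dots> \<le> ennreal ((norm (a - b))\<^sup>2) * (\<integral>\<^sup>+x. ennreal ((norm (grad f x))\<^sup>2) * indicator (closure T) x \<partial>lborel)"
    unfolding r_def facet_proj_def
  proof (rule translation_bound)
    fix x assume x: "x \<in> T"
    then have xc: "x \<in> closure T" using closure_subset by blast
    show "0 \<le> nodal T a x \<and> nodal T a x \<le> 1"
      using S.bary_bounds[OF _ ab(1)] xc element_eq[OF T] by simp
    fix t assume t: "0 \<le> t" "t \<le> nodal T a x"
    show "x - t *\<^sub>R (a - b) \<in> closure T"
      unfolding mem_closure_element[OF T]
    proof
      fix v assume v: "v \<in> vertices T"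
      have "0 \<le> nodal T v x" using xc v mem_closure_element[OF T] by blast
      then show "0 \<le> nodal T v (x - t *\<^sub>R (a - b))" using t ab(3) by (auto simp: bary_shift[OF T ab(1,2) v])
    qed
  qed simp
  \<comment> \<open>The segments end on the facet, which requires the closed element; its boundary
    is a null set.\<close>
  also have "(\<integral>\<^sup>+x. ennreal ((norm (grad f x))\<^sup>2) * indicator (closure T) x \<partial>lborel) = (\<integral>\<^sup>+x. ennreal ((norm (grad f x))\<^sup>2) * indicator T x \<partial>lborel)"
  proof (rule nn_integral_cong_AE)
    have "AE x in lborel. x \<notin> frontier T" by (intro AE_lborel_not_in_negligible negligible_convex_frontier element(2)[OF T])
    then show "AE x in lborel. ennreal ((norm (grad f x))\<^sup>2) * indicator (closure T) x = ennreal ((norm (grad f x))\<^sup>2) * indicator T x"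
    proof eventually_elim
      case (elim x)
      then have "x \<in> closure T \<longleftrightarrow> x \<in> T" using element(1)[OF T] closure_subset[of T] by (auto simp: frontier_def interior_open)
      then show ?case by (simp add: indicator_def)
    qed
  qed
  also have "(\<integral>\<^sup>+x. ennreal ((norm (grad f x))\<^sup>2) * indicator T x \<partial>lborel) = ennreal ?I"
    by (rule nn_integral_eq_lebesgue_on)
       (use cont_grad element(7)[OF T] in \<open>auto intro!: int continuous_intros borel_measurable_continuous_onI\<close>)
  also have "ennreal ((norm (a - b))\<^sup>2) * ennreal ?I = ennreal ((norm (a - b))\<^sup>2 * ?I)" by (simp add: ennreal_mult)
  finally have "(LINT x|lebesgue_on T. (r x)\<^sup>2) \<le> (norm (a - b))\<^sup>2 * ?I" by (subst (asm) ennreal_le_iff) auto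
  also have "\<dots> \<le> ?h\<^sup>2 * ?I"
  proof -
    have "norm (a - b) \<le> ?h" using S.dist_le_diameter[of a b] element(12)[OF T] ab element_eq[OF T] by (auto simp: dist_norm)
    then show ?thesis by (intro mult_right_mono power_mono) auto
  qed
  finally have r2: "(LINT x|lebesgue_on T. (r x)\<^sup>2) \<le> ?h\<^sup>2 * ?I" .
  have rL: "r \<in> L2 T" unfolding L2_def using cr int[of "\<lambda>x. (r x)\<^sup>2"] int[OF cr] by (auto intro!: continuous_intros)
  have oL: "(\<lambda>x. 1::real) \<in> L2 T" unfolding L2_def using int[of "\<lambda>x. 1"] by auto
  have o1: "L2_norm T (\<lambda>x. 1::real) = sqrt ?m" using element(5)[OF T] by (simp add: L2_norm_def measure_restrict_space fmeasurable_def)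
  have "\<bar>LINT x|lebesgue_on T. r x\<bar> \<le> L2_norm T r * sqrt ?m"
    using L2_Cauchy_Schwarz[OF rL oL] o1 by simp
  also have "L2_norm T r \<le> ?h * sqrt ?I"
  proof -
    have "L2_norm T r \<le> sqrt (?h\<^sup>2 * ?I)" unfolding L2_norm_def using r2 by simp
    then show ?thesis using element(9)[OF T] by (simp add: real_sqrt_mult)
  qed
  finally have "\<bar>LINT x|lebesgue_on T. r x\<bar> \<le> ?h * sqrt ?I * sqrt ?m" using mp by (simp add: mult_right_mono)
  then have "\<bar>LINT x|lebesgue_on T. r x\<bar> / ?m \<le> ?h * sqrt ?I * sqrt ?m / ?m" using mp by (intro divide_right_mono) auto
  also have "\<dots> = local_error f T" 
  proof -
    have "?h * sqrt ?I * sqrt ?m / ?m = ?h * sqrt ?I * (sqrt ?m / ?m)" by simp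
    also have "\<dots> = ?h * sqrt ?I * inverse (sqrt ?m)" using sqrt_divide_self_eq[of ?m] mp by (simp only: less_imp_le)
    finally show ?thesis by (simp add: local_error_def divide_inverse real_sqrt_mult real_sqrt_inverse)
  qed
  finally have "\<bar>(LINT x|lebesgue_on T. r x) / ?m\<bar> \<le> local_error f T" using mp by simp
  moreover have "(LINT x|lebesgue_on T. r x) = (LINT x|lebesgue_on T. f x) - (LINT x|lebesgue_on T. f (?P x))"
    unfolding r_def by (rule Bochner_Integration.integral_diff[OF int[OF cont] int[OF cP]])
  ultimately show ?thesis by (simp add: mean_value_def diff_divide_distrib)
qed

text \<open>The projected points lie on a facet outside of \<Omega>, where \<open>f\<close>
  vanishes, so the mean on the facet is 0.\<close>

lemma mean_unshared:
  assumes f: "f \<in> test_functions \<Omega>" and T: "T \<in> \<T>" "a \<in> vertices T" "unshared T a"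
  shows "\<bar>mean_value f T\<bar> \<le> local_error f T"
proof -
  obtain b where b: "b \<in> vertices T" "b \<noteq> a" using simplex_vertices.obtain_other[OF simplex_vertices[OF T(1)] T(2)] by blast
  have "f (facet_proj T a b x) = 0" if x: "x \<in> T" for x
  proof (rule test_functionsD(6)[OF f], rule unshared_facet_outside[OF T])
    have xc: "x \<in> closure T" using x closure_subset by blast
    show "nodal T a (facet_proj T a b x) = 0"
      using b by (simp add: facet_proj_def bary_shift[OF T(1,2) b(1) T(2)])
    have nn: "0 \<le> nodal T v x" if "v \<in> vertices T" for v using xc that mem_closure_element[OF T(1)] by blast
    have p: "0 \<le> nodal T b x + nodal T a x" using nn T(2) b(1) by (intro add_nonneg_nonneg) auto
    show "facet_proj T a b x \<in> closure T"
      unfolding mem_closure_element[OF T(1)] facet_proj_def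
    proof
      fix v assume v: "v \<in> vertices T"
      show "0 \<le> nodal T v (x - nodal T a x *\<^sub>R (a - b))"
        unfolding bary_shift[OF T(1,2) b(1) v] using nn[OF v] p b(2) by (cases "v = a"; cases "v = b") auto
    qed
  qed
  then have "mean_value (\<lambda>x. f (facet_proj T a b x)) T = (LINT x|lebesgue_on T. 0) / vol T"
    unfolding mean_value_def by (intro arg_cong2[of _ _ _ _ "(/)"] Bochner_Integration.integral_cong) auto
  then show ?thesis using mean_trace_bound[OF f T(1,2) b(1)] b(2) by simp
qed

text \<open>The affine map \<Theta> from \<open>T\<close> onto \<open>T'\<close> fixes the common
  facet. It transforms the projection of \<open>T'\<close> into that of \<open>T\<close>, so by the
  change of variables the two facet means agree and the triangle inequality applies.\<close>

lemma mean_neighbours: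
  assumes f: "f \<in> test_functions \<U>" and T: "T \<in> \<T>" "T' \<in> \<T>" "T \<noteq> T'" and a: "a \<in> vertices T" and sub: "vertices T - {a} \<subseteq> vertices T'"
  shows "\<bar>mean_value f T - mean_value f T'\<bar> \<le> local_error f T + local_error f T'"
proof -
  interpret C1_function f using f by (rule C1_function_test)
  obtain a' \<kappa> where n: "a' \<notin> vertices T" "vertices T' = insert a' (vertices T - {a})" "\<kappa> < 0"
    "\<And>x. nodal T' a' x = \<kappa> * nodal T a x"
    "\<And>b x. b \<in> vertices T - {a} \<Longrightarrow> nodal T' b x = nodal T b x + nodal T' b a * nodal T a x"
    by (rule facet_neighbour[OF T a sub]) blast
  obtain b where b: "b \<in> vertices T" "b \<noteq> a" using simplex_vertices.obtain_other[OF simplex_vertices[OF T(1)] a] by blast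
  have a': "a' \<in> vertices T'" and b': "b \<in> vertices T'" "a' \<noteq> b" using n(1,2) b by auto
  let ?l = "nodal T a" and ?g = "nodal_grad T a"
  \<comment> \<open>Sends \<open>a\<close> to \<open>a'\<close> and leaves points with vanishing
    coordinate at \<open>a\<close> fixed.\<close>
  define \<Theta> where "\<Theta> x = x + ?l x *\<^sub>R (a' - a)" for x
  have "1 = \<kappa> * ?l a'" using n(4)[of a'] bary_at_vertex[OF T(2) a' a'] by simp
  then have la': "?l a' = 1 / \<kappa>" using n(3) by (simp add: field_simps)
  have ld: "?l x = ?l y + ?g \<bullet> (x - y)" for x y by (rule simplex_vertices.bary_diff[OF simplex_vertices[OF T(1)] a])
  have ga: "?g \<bullet> (a' - a) = 1 / \<kappa> - 1" using ld[of a' a] la' bary_at_vertex[OF T(1) a a] by simp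
  have l\<Theta>: "?l (\<Theta> x) = ?l x / \<kappa>" for x
  proof -
    have "\<Theta> x - x = ?l x *\<^sub>R (a' - a)" by (simp add: \<Theta>_def)
    then have "?l (\<Theta> x) = ?l x + ?l x * (1 / \<kappa> - 1)" using ld[of "\<Theta> x" x] ga by simp
    then show ?thesis by (simp add: algebra_simps)
  qed
  have t1: "nodal T' a' (\<Theta> x) = ?l x" for x using n(3) by (simp add: n(4) l\<Theta>)
  have t2: "nodal T' v (\<Theta> x) = nodal T v x" if v: "v \<in> vertices T - {a}" for v x
  proof -
    have vT': "v \<in> vertices T'" "v \<noteq> a'" using v n(1,2) by auto
    have d: "nodal T' v p = nodal T' v q + nodal_grad T' v \<bullet> (p - q)" for p q
      by (rule simplex_vertices.bary_diff[OF simplex_vertices[OF T(2)] vT'(1)])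
    have "nodal_grad T' v \<bullet> (a' - a) = - nodal T' v a"
      using d[of a' a] bary_at_vertex[OF T(2) vT'(1) a'] vT'(2) by auto
    then have "nodal T' v (\<Theta> x) = nodal T' v x - ?l x * nodal T' v a"
      using d[of "\<Theta> x" x] by (simp add: \<Theta>_def)
    then show ?thesis using n(5)[OF v, of x] by simp
  qed
  have TT': "\<Theta> x \<in> T' \<longleftrightarrow> x \<in> T" for x
    unfolding mem_element[OF T(1)] mem_element[OF T(2)] using a by (auto simp: n(2) t1[unfolded n(2)] t2[unfolded n(2)])
  have proj: "facet_proj T' a' b (\<Theta> x) = facet_proj T a b x" for x
    unfolding facet_proj_def t1 by (simp add: \<Theta>_def algebra_simps)
  have c\<Theta>: "continuous_on UNIV \<Theta>" unfolding \<Theta>_def by (intro continuous_intros bary_continuous T(1) a)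
  have tr: "\<exists>y'. \<forall>x. \<Theta> (x + y') = \<Theta> x + y" for y
  proof (intro exI allI)
    fix x
    \<comment> \<open>The solution of y' + (g . y')(a' - a) = y, with g the gradient of the
      coordinate at \<open>a\<close>: multiplying by g and using \<open>ga\<close> gives g . y' =
      \<kappa> (g . y).\<close>
    define y' where "y' = y - (\<kappa> * (?g \<bullet> y)) *\<^sub>R (a' - a)"
    have "?g \<bullet> y' = \<kappa> * (?g \<bullet> y)"
      using n(3) by (simp add: y'_def inner_diff_right[of _ y] ga) (simp add: field_simps)
    then have "?l (x + y') = ?l x + \<kappa> * (?g \<bullet> y)" using ld[of "x + y'" x] by simp
    then show "\<Theta> (x + (y - (\<kappa> * (?g \<bullet> y)) *\<^sub>R (a' - a))) = \<Theta> x + y"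
      unfolding y'_def[symmetric] by (simp add: \<Theta>_def) (simp add: y'_def algebra_simps)
  qed
  let ?F = "\<lambda>x. f (facet_proj T' a' b x)"
  have cF: "continuous_on UNIV ?F" by (rule continuous_on_compose2[OF cont continuous_facet_proj[OF T(2) a']]) simp
  have "(LINT x|lebesgue_on T. ?F (\<Theta> x)) = vol T / vol T' * (LINT x|lebesgue_on T'. ?F x)"
    by (rule integral_affine_bijection[OF c\<Theta> tr element(7)[OF T(1)] element(7)[OF T(2)] element(3)[OF T(1)] element(3)[OF T(2)] element(8)[OF T(2)] TT' cF])
  then have "mean_value (\<lambda>x. f (facet_proj T a b x)) T = mean_value ?F T'"
    using element(8)[OF T(1)] element(8)[OF T(2)] by (simp add: mean_value_def proj)
  then show ?thesis
    using mean_trace_bound[OF f T(1) a b(1) b(2)[symmetric]] mean_trace_bound[OF f T(2) a' b'(1,2)] by linarith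
qed

end

section \<open>Shape regularity\<close>

text \<open>The bound from the disjoint translates, with diameter^d replaced by \<sigma> times the
  volume. The maximum with 1 makes its powers increasing in the exponent.\<close>

definition grad_const :: "nat \<Rightarrow> real \<Rightarrow> real" where
  "grad_const d \<sigma> = max 1 (unit_ball_vol (real d) * 2 ^ d * \<sigma>)"

text \<open>Bounds the number of elements at a vertex.\<close>

definition star_const :: "nat \<Rightarrow> real \<Rightarrow> nat" where
  "star_const d \<sigma> = nat \<lceil>\<sigma> * unit_ball_vol (real d)\<rceil>"

text \<open>The ratio of diameters at the two ends of a facet chain: one factor for each step, and
  at most \<open>(star_const d \<sigma>)\<^sup>2\<close> steps.\<close>

definition size_const :: "nat \<Rightarrow> real \<Rightarrow> real" where
  "size_const d \<sigma> = grad_const d \<sigma> ^ (star_const d \<sigma>)\<^sup>2"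

text \<open>The price, under the square root, for expressing the local error on one element by
  diameter and volume of another one in the same chain: the squared ratio of diameters times the
  ratio of volumes.\<close>

definition error_const :: "nat \<Rightarrow> real \<Rightarrow> real" where
  "error_const d \<sigma> = (size_const d \<sigma>)\<^sup>2 * (unit_ball_vol (real d) * size_const d \<sigma> ^ d * \<sigma>)"

lemma grad_const_ge_1: "1 \<le> grad_const d \<sigma>" by (simp add: grad_const_def)

lemma size_const_ge_1: "1 \<le> size_const d \<sigma>"
  unfolding size_const_def using grad_const_ge_1 by (rule one_le_power)

definition bubble_const :: "nat \<Rightarrow> real" where
  "bubble_const d = (1 / 2) ^ d * (1 / (2 * (real d + 1))) ^ Suc d"

text \<open>The summand 1 is for the hat functions, the other for the bubble, whose coefficient is
  divided by a bubble integral.\<close>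

definition value_const :: "nat \<Rightarrow> real" where
  "value_const d = 1 + 1 / bubble_const d"

text \<open>The factor d + 1 counts the gradients of barycentric coordinates, each at most
  \<open>grad_const\<close> over the diameter.\<close>

definition slope_const :: "nat \<Rightarrow> real \<Rightarrow> real" where
  "slope_const d \<sigma> = (real d + 1) * value_const d * grad_const d \<sigma>"

lemma bubble_const_pos: "0 < bubble_const d" by (simp add: bubble_const_def)

locale shape_mesh = mesh \<Omega> \<T> for \<Omega> :: "'a::euclidean_space set" and \<T> +
  fixes \<sigma> :: real
  assumes shape: "\<And>T. T \<in> \<T> \<Longrightarrow> diameter T ^ DIM('a) \<le> \<sigma> * vol T"
    and dim: "2 \<le> DIM('a)"
begin


lemma mesh_nonempty: "\<T> \<noteq> {}"
  using cover domain(3) by auto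

lemma \<sigma>_pos: "0 < \<sigma>"
proof -
  obtain T where T: "T \<in> \<T>" using mesh_nonempty by blast
  have "0 < \<sigma> * vol T" using shape[OF T] element(9)[OF T] by (meson less_le_trans zero_less_power)
  then show ?thesis using element(8)[OF T] by (simp add: zero_less_mult_iff)
qed

lemma bary_grad_le:
  assumes T: "T \<in> \<T>" and z: "z \<in> vertices T"
  shows "norm (nodal_grad T z) * diameter T \<le> grad_const DIM('a) \<sigma>"
proof -
  let ?n = "norm (nodal_grad T z) * diameter T" and ?m = "vol T" and ?V = "unit_ball_vol (real DIM('a))"
  have "?n * ?m \<le> ?V * (2 * diameter T) ^ DIM('a)"
    using simplex_vertices.bary_grad_bound[OF simplex_vertices[OF T] z] element_eq[OF T] by simp
  also have "\<dots> = (?V * 2 ^ DIM('a)) * diameter T ^ DIM('a)" by (simp add: power_mult_distrib)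
  also have "\<dots> \<le> (?V * 2 ^ DIM('a)) * (\<sigma> * ?m)" using shape[OF T] by (intro mult_left_mono) auto
  finally have "?n * ?m \<le> (?V * 2 ^ DIM('a) * \<sigma>) * ?m" by (simp add: mult_ac)
  then show ?thesis using element(8)[OF T] by (simp add: grad_const_def)
qed

lemma measure_element_le: "T \<in> \<T> \<Longrightarrow> vol T \<le> unit_ball_vol (real DIM('a)) * diameter T ^ DIM('a)"
  using simplex_vertices.measure_T_le[OF simplex_vertices] element_eq by metis

text \<open>In the ball about \<open>z\<close> whose radius is the smallest diameter of the star,
  each element occupies at least r^d / \<sigma>, by a homothety at \<open>z\<close>. The pieces are
  disjoint, so the volume of the ball limits their number.\<close>

lemma card_star: "card (star z) \<le> star_const DIM('a) \<sigma>"
proof (cases "star z = {}")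
  case False
  let ?V = "unit_ball_vol (real DIM('a))"
  define r where "r = Min (diameter ` star z)"
  have st: "T \<in> \<T>" "z \<in> vertices T" if "T \<in> star z" for T using that by (auto simp: star_def)
  have rT: "r \<le> diameter T" if "T \<in> star z" for T using star_finite that by (auto simp: r_def)
  have "r \<in> diameter ` star z" unfolding r_def using star_finite False by (intro Min_in) auto
  then have r: "r > 0" using element(9) st by auto
  have each: "r ^ DIM('a) \<le> \<sigma> * vol (T \<inter> cball z r)" if T: "T \<in> star z" for T
  proof -
    let ?s = "r / diameter T"
    have h: "0 < diameter T" using element(9) st[OF T] by blast
    have "?s ^ DIM('a) * vol T \<le> vol (T \<inter> cball z (?s * diameter T))"
      using simplex_vertices.measure_T_ball[OF simplex_vertices[OF st(1)[OF T]] st(2)[OF T], of ?s] r h rT[OF T] element_eq[OF st(1)[OF T]]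
      by simp
    also have "?s * diameter T = r" using h by simp
    finally have a: "?s ^ DIM('a) * vol T \<le> vol (T \<inter> cball z r)" .
    have "r ^ DIM('a) = ?s ^ DIM('a) * diameter T ^ DIM('a)" using h by (simp add: power_divide)
    also have "\<dots> \<le> ?s ^ DIM('a) * (\<sigma> * vol T)" using shape[OF st(1)[OF T]] r h by (intro mult_left_mono) auto
    also have "\<dots> = \<sigma> * (?s ^ DIM('a) * vol T)" by simp
    also have "\<dots> \<le> \<sigma> * vol (T \<inter> cball z r)" using a \<sigma>_pos by (intro mult_left_mono) auto
    finally show ?thesis .
  qed
  have lm: "T \<inter> cball z r \<in> lmeasurable" if "T \<in> star z" for T
    using element(5)[OF st(1)[OF that]] by (intro fmeasurable_Int_fmeasurable) auto
  have "real (card (star z)) * r ^ DIM('a) = (\<Sum>T\<in>star z. r ^ DIM('a))" by simp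
  also have "\<dots> \<le> (\<Sum>T\<in>star z. \<sigma> * vol (T \<inter> cball z r))" by (intro sum_mono each)
  also have "\<dots> = \<sigma> * (\<Sum>T\<in>star z. vol (T \<inter> cball z r))" by (simp add: sum_distrib_left)
  also have "(\<Sum>T\<in>star z. vol (T \<inter> cball z r)) = vol (\<Union>T\<in>star z. T \<inter> cball z r)"
  proof (rule measure_UNION'[symmetric, OF star_finite lm])
    show "pairwise (\<lambda>i j. disjnt (i \<inter> cball z r) (j \<inter> cball z r)) (star z)"
      using disjoint_mesh by (auto simp: pairwise_def disjnt_def star_def)
  qed
  also have "\<dots> \<le> vol (cball z r)"
    by (intro measure_mono_fmeasurable sets.finite_UN star_finite fmeasurableD[OF lm]) auto
  also have "\<dots> = ?V * r ^ DIM('a)" using r by (simp add: content_cball)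
  finally have "real (card (star z)) * r ^ DIM('a) \<le> (\<sigma> * ?V) * r ^ DIM('a)" using \<sigma>_pos by (simp add: mult_left_mono)
  then have "real (card (star z)) \<le> \<sigma> * ?V" using r by simp
  then show ?thesis unfolding star_const_def by linarith
qed simp

text \<open>The common facet contains \<open>z\<close> and, since the dimension is at least 2, a
  further vertex \<open>b\<close>. The edge between them belongs to both elements, and the gradient
  bound in \<open>T\<close> keeps it from being short.\<close>

lemma facet_adj_size:
  assumes "(T, T') \<in> facet_adj z"
  shows "diameter T \<le> grad_const DIM('a) \<sigma> * diameter T'"
proof -
  obtain a where T: "T \<in> \<T>" "T' \<in> \<T>" "z \<in> vertices T" "z \<in> vertices T'" and a: "a \<in> vertices T - {z}" "vertices T - {a} \<subseteq> vertices T'"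
    using assms by (auto simp: facet_adj_def star_def)
  have "card (vertices T - {z} - {a}) = DIM('a) - 1" using element(10,11)[OF T(1)] T(3) a by simp
  then have "card (vertices T - {z} - {a}) \<noteq> 0" using dim by simp
  then have "vertices T - {z} - {a} \<noteq> {}" by (metis card.empty)
  then obtain b where b: "b \<in> vertices T" "b \<noteq> z" "b \<noteq> a" by blast
  have bT': "b \<in> vertices T'" using a(2) b by blast
  have "diameter T = 1 * diameter T" by simp
  also have "\<dots> \<le> (norm (nodal_grad T z) * dist z b) * diameter T"
    using simplex_vertices.edge[OF simplex_vertices[OF T(1)] T(3) b(1,2)] element(9)[OF T(1)] by (intro mult_right_mono) auto
  also have "\<dots> = (norm (nodal_grad T z) * diameter T) * dist z b" by simp
  also have "\<dots> \<le> grad_const DIM('a) \<sigma> * dist z b" by (intro mult_right_mono bary_grad_le T) auto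
  also have "\<dots> \<le> grad_const DIM('a) \<sigma> * diameter T'"
    using simplex_vertices.dist_le_diameter[OF simplex_vertices[OF T(2)], of z b] element(12)[OF T(2)] T(4) bT' element_eq[OF T(2)] grad_const_ge_1[of "DIM('a)" \<sigma>]
    by (intro mult_left_mono) auto
  finally show ?thesis .
qed

lemma sym_facet_adj: "sym (facet_adj z)"
proof (rule symI)
  fix T T' assume "(T, T') \<in> facet_adj z"
  then obtain a where T: "T \<in> \<T>" "T' \<in> \<T>" "T \<noteq> T'" "z \<in> vertices T" "z \<in> vertices T'" and a: "a \<in> vertices T" "a \<noteq> z" "vertices T - {a} \<subseteq> vertices T'"
    by (auto simp: facet_adj_def star_def)
  obtain a' where n: "a' \<notin> vertices T" "vertices T' = insert a' (vertices T - {a})"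
    by (rule facet_neighbour[OF T(1-3) a(1,3)]) blast
  have "a' \<in> vertices T' - {z}" "vertices T' - {a'} \<subseteq> vertices T" using n T(4) by auto
  then show "(T', T) \<in> facet_adj z" using T by (auto simp: facet_adj_def star_def)
qed

text \<open>Without repetition a chain uses each pair of adjacent elements at most once, and there
  are at most as many pairs as the square of the number of elements at \<open>z\<close>.\<close>

lemma chain_length:
  assumes "(T, T') \<in> (facet_adj z)\<^sup>*"
  obtains n where "n \<le> (star_const DIM('a) \<sigma>)\<^sup>2" "(T, T') \<in> facet_adj z ^^ n"
proof -
  have sub: "facet_adj z \<subseteq> star z \<times> star z" by (auto simp: facet_adj_def)
  then have fin: "finite (facet_adj z)" using star_finite finite_subset by blast
  have "card (facet_adj z) \<le> card (star z) * card (star z)"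
    using card_mono[OF _ sub] star_finite by (simp add: card_cartesian_product)
  also have "\<dots> \<le> (star_const DIM('a) \<sigma>)\<^sup>2" using card_star[of z] by (simp add: power2_eq_square mult_le_mono)
  finally have c: "card (facet_adj z) \<le> (star_const DIM('a) \<sigma>)\<^sup>2" .
  obtain n where "n \<le> card (facet_adj z)" "(T, T') \<in> facet_adj z ^^ n"
    using assms unfolding rtrancl_finite_eq_relpow[OF fin] by blast
  with c that show ?thesis by (meson le_trans)
qed

lemma chain_size:
  assumes "(T, T') \<in> (facet_adj z)\<^sup>*" "T' \<in> \<T>"
  shows "diameter T \<le> size_const DIM('a) \<sigma> * diameter T'"
proof -
  have *: "diameter T \<le> grad_const DIM('a) \<sigma> ^ n * diameter T'" if "(T, T') \<in> facet_adj z ^^ n" for n T'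
    using that
  proof (induction n arbitrary: T')
    case (Suc n)
    then obtain S where S: "(T, S) \<in> facet_adj z ^^ n" "(S, T') \<in> facet_adj z" by auto
    have "diameter T \<le> grad_const DIM('a) \<sigma> ^ n * diameter S" by (rule Suc.IH[OF S(1)])
    also have "\<dots> \<le> grad_const DIM('a) \<sigma> ^ n * (grad_const DIM('a) \<sigma> * diameter T')" using facet_adj_size[OF S(2)] grad_const_ge_1[of "DIM('a)" \<sigma>] by (intro mult_left_mono) auto
    finally show ?case by (simp add: mult_ac)
  qed simp
  obtain n where n: "n \<le> (star_const DIM('a) \<sigma>)\<^sup>2" "(T, T') \<in> facet_adj z ^^ n" by (rule chain_length[OF assms(1)])
  have "diameter T \<le> grad_const DIM('a) \<sigma> ^ n * diameter T'" by (rule *[OF n(2)])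
  also have "\<dots> \<le> size_const DIM('a) \<sigma> * diameter T'"
    unfolding size_const_def using n(1) grad_const_ge_1 element(9)[OF assms(2)] by (intro mult_right_mono power_increasing) auto
  finally show ?thesis .
qed

lemma star_measure:
  assumes "(T, T') \<in> (facet_adj z)\<^sup>*" "T \<in> \<T>" "T' \<in> \<T>"
  shows "vol T \<le> unit_ball_vol (real DIM('a)) * size_const DIM('a) \<sigma> ^ DIM('a) * \<sigma> * vol T'"
proof -
  have "vol T \<le> unit_ball_vol (real DIM('a)) * diameter T ^ DIM('a)" by (rule measure_element_le[OF assms(2)])
  also have "\<dots> \<le> unit_ball_vol (real DIM('a)) * (size_const DIM('a) \<sigma> * diameter T') ^ DIM('a)"
    using chain_size[OF assms(1,3)] element(9)[OF assms(2)] by (intro mult_left_mono power_mono) auto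
  also have "\<dots> = (unit_ball_vol (real DIM('a)) * size_const DIM('a) \<sigma> ^ DIM('a)) * diameter T' ^ DIM('a)" by (simp add: power_mult_distrib)
  also have "\<dots> \<le> (unit_ball_vol (real DIM('a)) * size_const DIM('a) \<sigma> ^ DIM('a)) * (\<sigma> * vol T')"
    using shape[OF assms(3)] size_const_ge_1[of "DIM('a)" \<sigma>] by (intro mult_left_mono) auto
  finally show ?thesis by (simp add: mult_ac)
qed

definition grad_energy where "grad_energy f T = (LINT x|lebesgue_on T. (norm (grad f x))\<^sup>2)"

lemma grad_energy_nonneg: "0 \<le> grad_energy f T" by (simp add: grad_energy_def)

text \<open>Majorizes \<open>local_error\<close> on every element that a chain reaches from
  \<open>T\<close>, using the energy of the whole star but the size of \<open>T\<close>
  alone.\<close>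

definition star_error where
  "star_error f T z = diameter T * sqrt (error_const DIM('a) \<sigma> * (\<Sum>T'\<in>star z. grad_energy f T') / vol T)"

lemma star_error_nonneg:
  assumes T: "T \<in> \<T>"
  shows "0 \<le> star_error f T z"
  unfolding star_error_def error_const_def using element(8,9)[OF T] \<sigma>_pos size_const_ge_1[of "DIM('a)" \<sigma>]
  by (intro mult_nonneg_nonneg real_sqrt_ge_zero divide_nonneg_nonneg sum_nonneg grad_energy_nonneg) auto

lemma local_error_star:
  assumes T: "T \<in> star z" and c: "(T, T') \<in> (facet_adj z)\<^sup>*"
  shows "local_error f T' \<le> star_error f T z"
proof -
  have T': "T' \<in> star z" by (rule facet_adj_star[OF c T])
  have TT: "T \<in> \<T>" "T' \<in> \<T>" using T T' by (auto simp: star_def)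
  have c': "(T', T) \<in> (facet_adj z)\<^sup>*" using c sym_rtrancl[OF sym_facet_adj] by (meson symE)
  let ?m = "vol T" and ?m' = "vol T'" and ?B = "unit_ball_vol (real DIM('a)) * size_const DIM('a) \<sigma> ^ DIM('a) * \<sigma>"
  let ?S = "\<Sum>T'\<in>star z. grad_energy f T'"
  have m: "0 < ?m" "0 < ?m'" using element(8) TT by auto
  have K: "1 \<le> size_const DIM('a) \<sigma>" by (rule size_const_ge_1)
  have B: "0 \<le> ?B" using K \<sigma>_pos by (intro mult_nonneg_nonneg) auto
  have "grad_energy f T' \<le> ?S" using T' star_finite grad_energy_nonneg by (intro member_le_sum) auto
  then have "grad_energy f T' / ?m' \<le> ?S / ?m'" using m by (intro divide_right_mono) auto
  also have "\<dots> \<le> ?B * ?S / ?m"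
  proof -
    have "?m * ?S \<le> (?B * ?m') * ?S" using star_measure[OF c TT] by (intro mult_right_mono sum_nonneg grad_energy_nonneg) auto
    then show ?thesis using m by (simp add: field_simps)
  qed
  finally have "sqrt (grad_energy f T' / ?m') \<le> sqrt (?B * ?S / ?m)" by simp
  then have "local_error f T' \<le> (size_const DIM('a) \<sigma> * diameter T) * sqrt (?B * ?S / ?m)"
    unfolding local_error_def grad_energy_def[symmetric]
    using chain_size[OF c' TT(1)] element(9)[OF TT(1)] K by (intro mult_mono) (auto simp: grad_energy_nonneg)
  also have "\<dots> = star_error f T z"
  proof -
    have "size_const DIM('a) \<sigma> * sqrt (?B * ?S / ?m) = sqrt ((size_const DIM('a) \<sigma>)\<^sup>2 * (?B * ?S / ?m))" using K by (subst real_sqrt_mult) simp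
    then show ?thesis by (simp add: star_error_def error_const_def mult_ac)
  qed
  finally show ?thesis .
qed

lemma mean_chain:
  assumes f: "f \<in> test_functions \<U>" and T: "T \<in> star z" and c: "(T, T') \<in> (facet_adj z)\<^sup>*"
  shows "\<bar>mean_value f T - mean_value f T'\<bar> \<le> 2 * real ((star_const DIM('a) \<sigma>)\<^sup>2) * star_error f T z"
proof -
  have *: "\<bar>mean_value f T - mean_value f T'\<bar> \<le> 2 * real n * star_error f T z" if "(T, T') \<in> facet_adj z ^^ n" for n T'
    using that
  proof (induction n arbitrary: T')
    case (Suc n)
    then obtain S where S: "(T, S) \<in> facet_adj z ^^ n" "(S, T') \<in> facet_adj z" by auto
    have r: "(T, S) \<in> (facet_adj z)\<^sup>*" using S(1) relpow_imp_rtrancl by blast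
    then have r': "(T, T') \<in> (facet_adj z)\<^sup>*" using S(2) by simp
    obtain a where a: "S \<in> \<T>" "T' \<in> \<T>" "S \<noteq> T'" "a \<in> vertices S" "vertices S - {a} \<subseteq> vertices T'"
      using S(2) by (auto simp: facet_adj_def star_def)
    have "\<bar>mean_value f S - mean_value f T'\<bar> \<le> local_error f S + local_error f T'" by (rule mean_neighbours[OF f a])
    also have "\<dots> \<le> 2 * star_error f T z" using local_error_star[OF T r, of f] local_error_star[OF T r', of f] by linarith
    finally show ?case using Suc.IH[OF S(1)] by (simp add: algebra_simps)
  qed simp
  obtain n where n: "n \<le> (star_const DIM('a) \<sigma>)\<^sup>2" "(T, T') \<in> facet_adj z ^^ n" by (rule chain_length[OF c])
  have "0 \<le> star_error f T z"
    using star_error_nonneg T by (simp add: star_def)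
  then have "2 * real n * star_error f T z \<le> 2 * real ((star_const DIM('a) \<sigma>)\<^sup>2) * star_error f T z"
    using n(1) by (intro mult_right_mono mult_left_mono) (auto simp del: of_nat_power)
  with *[OF n(2)] show ?thesis by linarith
qed

section \<open>The transposed operator and its estimates on elements\<close>

section \<open>The averaged operator\<close>

definition star_measure_sum where "star_measure_sum z = (\<Sum>T\<in>star z. vol T)"

text \<open>What the coefficient of \<open>J_op\<close> becomes for an elementwise constant
  argument. The value 0 off \<Omega> allows sums over interior vertices to be extended to all
  vertices of an element.\<close>

definition vcoef where
  "vcoef f z = (if z \<in> \<Omega> then (\<Sum>T\<in>star z. LINT x|lebesgue_on T. f x) / star_measure_sum z else 0)"

definition bubble_int where "bubble_int T = (LINT x|lebesgue_on T. bubble \<T> T x)"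

definition hat_int where "hat_int z T = (LINT x|lebesgue_on T. hat \<T> z x)"

definition bcoef where
  "bcoef f T = ((LINT x|lebesgue_on T. f x) - (\<Sum>z\<in>IV. vcoef f z * hat_int z T)) / bubble_int T"

text \<open>This is \<open>P_op\<close> after the elementwise mean, hence the transpose of
  \<open>proj0\<close> after \<open>P_adj\<close>. It is written out so that it depends on integrals
  over elements only and makes sense for indicators.\<close>

definition Qd where
  "Qd f x = (\<Sum>z\<in>IV. vcoef f z * hat \<T> z x) + (\<Sum>T\<in>\<T>. bcoef f T * bubble \<T> T x)"

definition Qd_grad where
  "Qd_grad f x = (\<Sum>z\<in>IV. vcoef f z *\<^sub>R hat_grad z x) + (\<Sum>T\<in>\<T>. bcoef f T *\<^sub>R bubble_grad T x)"

lemma star_measure_pos: "T \<in> star z \<Longrightarrow> 0 < star_measure_sum z"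
  unfolding star_measure_sum_def using star_finite element(8) by (intro sum_pos2[where i=T]) (auto simp: star_def)

text \<open>In the interior the coefficient is a convex combination of the means over the star, so
  bounds for these carry over. At the boundary it is 0, and \<open>c\<close> itself has to be
  small.\<close>

lemma vcoef_bound:
  assumes z: "z \<in> vertices T" "T \<in> \<T>" and M: "\<And>T'. T' \<in> star z \<Longrightarrow> z \<in> \<Omega> \<Longrightarrow> \<bar>mean_value f T' - c\<bar> \<le> M" "z \<notin> \<Omega> \<Longrightarrow> \<bar>c\<bar> \<le> M"
  shows "\<bar>vcoef f z - c\<bar> \<le> M"
proof (cases "z \<in> \<Omega>")
  case True
  have T: "T \<in> star z" using z by (auto simp: star_def)
  note p = star_measure_pos[OF T]
  have "(\<Sum>T\<in>star z. LINT x|lebesgue_on T. f x) = (\<Sum>T'\<in>star z. vol T' * mean_value f T')"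
    by (intro sum.cong) (use element(8) in \<open>force simp: mean_value_def star_def\<close>)+
  also have "\<dots> - c * star_measure_sum z = (\<Sum>T'\<in>star z. vol T' * (mean_value f T' - c))"
    by (simp add: star_measure_sum_def sum_distrib_left sum_subtractf right_diff_distrib mult.commute)
  finally have eq: "(\<Sum>T\<in>star z. LINT x|lebesgue_on T. f x) - c * star_measure_sum z = (\<Sum>T'\<in>star z. vol T' * (mean_value f T' - c))" .
  have "\<bar>\<Sum>T'\<in>star z. vol T' * (mean_value f T' - c)\<bar> \<le> (\<Sum>T'\<in>star z. \<bar>vol T' * (mean_value f T' - c)\<bar>)"
    by (rule sum_abs)
  also have "\<dots> \<le> (\<Sum>T'\<in>star z. vol T' * M)"
    using M(1)[OF _ True] by (intro sum_mono) (auto simp: abs_mult intro: mult_left_mono)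
  also have "\<dots> = M * star_measure_sum z" by (simp add: star_measure_sum_def sum_distrib_left mult.commute)
  finally have "\<bar>(\<Sum>T\<in>star z. LINT x|lebesgue_on T. f x) - c * star_measure_sum z\<bar> \<le> M * star_measure_sum z" unfolding eq .
  then have "\<bar>(\<Sum>T\<in>star z. LINT x|lebesgue_on T. f x) - c * star_measure_sum z\<bar> / star_measure_sum z \<le> M" using p by (simp add: pos_divide_le_eq)
  moreover have "vcoef f z - c = ((\<Sum>T\<in>star z. LINT x|lebesgue_on T. f x) - c * star_measure_sum z) / star_measure_sum z"
    using p True by (simp add: vcoef_def diff_divide_distrib)
  ultimately show ?thesis using p by simp
qed (use M(2) in \<open>simp add: vcoef_def\<close>)

text \<open>In the interior a chain connects \<open>T\<close> with every element of the star. At the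
  boundary a chain leads to an element with an unshared facet, where the mean itself is bounded;
  this final comparison is the summand 1.\<close>

lemma vcoef_test:
  assumes f: "f \<in> test_functions \<Omega>" and T: "T \<in> \<T>" and z: "z \<in> vertices T"
  shows "\<bar>vcoef f z - mean_value f T\<bar> \<le> (2 * real ((star_const DIM('a) \<sigma>)\<^sup>2) + 1) * star_error f T z"
proof (rule vcoef_bound[OF z T])
  have Ts: "T \<in> star z" using T z by (simp add: star_def)
  note e0 = star_error_nonneg[OF T, of f z]
  show "\<bar>mean_value f T' - mean_value f T\<bar> \<le> (2 * real ((star_const DIM('a) \<sigma>)\<^sup>2) + 1) * star_error f T z" if "T' \<in> star z" "z \<in> \<Omega>" for T'
    using mean_chain[OF f Ts interior_star_connected[OF that(2) Ts that(1)]] e0 by (simp add: algebra_simps)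
  show "\<bar>mean_value f T\<bar> \<le> (2 * real ((star_const DIM('a) \<sigma>)\<^sup>2) + 1) * star_error f T z" if zo: "z \<notin> \<Omega>"
  proof -
    obtain T' a where T': "(T, T') \<in> (facet_adj z)\<^sup>*" "a \<in> vertices T' - {z}" "unshared T' a"
      using boundary_star_unshared[OF zo Ts] by blast
    have "T' \<in> \<T>" using facet_adj_star[OF T'(1) Ts] by (simp add: star_def)
    then have "\<bar>mean_value f T'\<bar> \<le> star_error f T z"
      using mean_unshared[OF f _ _ T'(3)] T'(2) local_error_star[OF Ts T'(1), of f] by force
    then show ?thesis using mean_chain[OF f Ts T'(1)] by (simp add: algebra_simps)
  qed
qed

lemma vertices_split: "T \<in> \<T> \<Longrightarrow> vertices T \<inter> IV = {v\<in>vertices T. v \<in> \<Omega>}"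
  using vertices_all interior_vertices_eq by auto

lemma sum_interior_vertices:
  fixes F :: "'a \<Rightarrow> 'b::comm_monoid_add"
  assumes T: "T \<in> \<T>" and z: "\<And>z. z \<in> IV \<Longrightarrow> z \<notin> vertices T \<Longrightarrow> F z = 0"
    and b: "\<And>v. v \<in> vertices T \<Longrightarrow> v \<notin> \<Omega> \<Longrightarrow> F v = 0"
  shows "(\<Sum>z\<in>IV. F z) = (\<Sum>v\<in>vertices T. F v)"
proof -
  have "(\<Sum>z\<in>IV. F z) = (\<Sum>z\<in>vertices T \<inter> IV. F z)"
    using finite_vertices z by (intro sum.mono_neutral_right) auto
  also have "\<dots> = (\<Sum>v\<in>vertices T. F v)"
    using element(10)[OF T] b vertices_split[OF T] by (intro sum.mono_neutral_left) auto
  finally show ?thesis .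
qed

lemma hat_on: "z \<in> IV \<Longrightarrow> T \<in> \<T> \<Longrightarrow> x \<in> T \<Longrightarrow> hat \<T> z x = (if z \<in> vertices T then nodal T z x else 0)"
  using hat_on_element closure_subset interior_vertices_eq by blast

lemma bubble_int_lower: "T \<in> \<T> \<Longrightarrow> bubble_const DIM('a) * vol T \<le> bubble_int T"
proof -
  assume T: "T \<in> \<T>"
  have "bubble_int T = (LINT x|lebesgue_on T. (\<Prod>v\<in>vertices T. nodal T v x))"
    unfolding bubble_int_def by (rule Bochner_Integration.integral_cong) (auto simp: bubble_eq[OF T])
  then show ?thesis
    using simplex_vertices.bubble_integral_lower[OF simplex_vertices[OF T]] element_eq[OF T] by (simp add: bubble_const_def)
qed

lemma bubble_int_pos: "T \<in> \<T> \<Longrightarrow> 0 < bubble_int T"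
  using bubble_int_lower bubble_const_pos element(8) by (meson less_le_trans mult_pos_pos)

lemma Qd_on_element:
  assumes T: "T \<in> \<T>" and x: "x \<in> T"
  shows "Qd f x = (\<Sum>v\<in>vertices T. vcoef f v * nodal T v x) + bcoef f T * (\<Prod>v\<in>vertices T. nodal T v x)"
    and "Qd_grad f x = (\<Sum>v\<in>vertices T. vcoef f v *\<^sub>R nodal_grad T v) + bcoef f T *\<^sub>R bubble_fun_grad T x"
proof -
  have nT: "x \<notin> T'" if "T' \<in> \<T>" "T' \<noteq> T" for T' using elements_disjoint[OF T that(1) x] that closure_subset by blast
  have "(\<Sum>z\<in>IV. vcoef f z * hat \<T> z x) = (\<Sum>z\<in>IV. vcoef f z * (if z \<in> vertices T then nodal T z x else 0))"
    using hat_on[OF _ T x] by (intro sum.cong) auto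
  also have "\<dots> = (\<Sum>v\<in>vertices T. vcoef f v * (if v \<in> vertices T then nodal T v x else 0))"
    by (rule sum_interior_vertices[OF T]) (auto simp: vcoef_def)
  finally have 1: "(\<Sum>z\<in>IV. vcoef f z * hat \<T> z x) = (\<Sum>v\<in>vertices T. vcoef f v * nodal T v x)" by simp
  have "(\<Sum>T'\<in>\<T>. bcoef f T' * bubble \<T> T' x) = (\<Sum>T'\<in>\<T>. if T' = T then bcoef f T * bubble \<T> T x else 0)"
    using nT by (intro sum.cong) (auto simp: bubble_eq)
  then have 2: "(\<Sum>T'\<in>\<T>. bcoef f T' * bubble \<T> T' x) = bcoef f T * (\<Prod>v\<in>vertices T. nodal T v x)"
    using finite_mesh T x by (simp add: bubble_eq)
  show "Qd f x = (\<Sum>v\<in>vertices T. vcoef f v * nodal T v x) + bcoef f T * (\<Prod>v\<in>vertices T. nodal T v x)"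
    unfolding Qd_def 1 2 ..
  have hg: "hat_grad z x = (if z \<in> vertices T then nodal_grad T z else 0)" for z
    unfolding hat_grad_def by (rule sum_indicator_element[OF T x])
  have "(\<Sum>z\<in>IV. vcoef f z *\<^sub>R hat_grad z x) = (\<Sum>v\<in>vertices T. vcoef f v *\<^sub>R hat_grad v x)"
    by (rule sum_interior_vertices[OF T]) (auto simp: vcoef_def hg)
  then have 3: "(\<Sum>z\<in>IV. vcoef f z *\<^sub>R hat_grad z x) = (\<Sum>v\<in>vertices T. vcoef f v *\<^sub>R nodal_grad T v)"
    by (simp add: hg)
  have "(\<Sum>T'\<in>\<T>. bcoef f T' *\<^sub>R bubble_grad T' x) = (\<Sum>T'\<in>\<T>. if T' = T then bcoef f T *\<^sub>R bubble_fun_grad T x else 0)"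
    using nT x by (intro sum.cong) (auto simp: bubble_grad_def)
  then have 4: "(\<Sum>T'\<in>\<T>. bcoef f T' *\<^sub>R bubble_grad T' x) = bcoef f T *\<^sub>R bubble_fun_grad T x"
    using finite_mesh T by simp
  show "Qd_grad f x = (\<Sum>v\<in>vertices T. vcoef f v *\<^sub>R nodal_grad T v) + bcoef f T *\<^sub>R bubble_fun_grad T x"
    unfolding Qd_grad_def 3 4 ..
qed

text \<open>Since the coordinates form a partition of unity, the defect of the integral is a
  weighted sum of the differences between the mean and the vertex coefficients; the weights add up
  to the volume, which cancels against the lower bound of the bubble integral.\<close>

lemma bcoef_bound:
  assumes T: "T \<in> \<T>" and M: "\<And>v. v \<in> vertices T \<Longrightarrow> \<bar>vcoef f v - mean_value f T\<bar> \<le> M"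
  shows "\<bar>bcoef f T\<bar> \<le> M / bubble_const DIM('a)"
proof -
  interpret S: simplex_vertices "vertices T" by (rule simplex_vertices[OF T])
  let ?c = "mean_value f T" and ?b = "\<lambda>v. LINT x|lebesgue_on T. nodal T v x"
  have int: "integrable (lebesgue_on T) (nodal T v)" if "v \<in> vertices T" for v
    using S.integrable_T_continuous[OF S.continuous_bary[OF that]] element_eq[OF T] by simp
  have hi: "hat_int z T = (if z \<in> vertices T then ?b z else 0)" if "z \<in> IV" for z
  proof -
    have "hat_int z T = (LINT x|lebesgue_on T. (if z \<in> vertices T then nodal T z x else 0))"
      unfolding hat_int_def by (rule Bochner_Integration.integral_cong) (use hat_on[OF that T] in auto)
    then show ?thesis by simp
  qed
  have sb: "(\<Sum>v\<in>vertices T. ?b v) = vol T"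
  proof -
    have "(\<Sum>v\<in>vertices T. ?b v) = (LINT x|lebesgue_on T. (\<Sum>v\<in>vertices T. nodal T v x))"
      by (rule Bochner_Integration.integral_sum[symmetric, OF int])
    also have "\<dots> = vol T" using element(5)[OF T] by (simp add: S.bary_representation measure_restrict_space fmeasurable_def)
    finally show ?thesis .
  qed
  have b0: "0 \<le> ?b v" if "v \<in> vertices T" for v
    by (rule Bochner_Integration.integral_nonneg_AE) (use mem_element[OF T] that in \<open>auto intro!: AE_I2 less_imp_le\<close>)
  have "(\<Sum>z\<in>IV. vcoef f z * hat_int z T) = (\<Sum>z\<in>IV. vcoef f z * (if z \<in> vertices T then ?b z else 0))"
    using hi by (intro sum.cong) auto
  also have "\<dots> = (\<Sum>v\<in>vertices T. vcoef f v * (if v \<in> vertices T then ?b v else 0))"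
    by (rule sum_interior_vertices[OF T]) (auto simp: vcoef_def)
  finally have s: "(\<Sum>z\<in>IV. vcoef f z * hat_int z T) = (\<Sum>v\<in>vertices T. vcoef f v * ?b v)" by simp
  have "(LINT x|lebesgue_on T. f x) = ?c * vol T" using element(8)[OF T] by (simp add: mean_value_def)
  also have "\<dots> = (\<Sum>v\<in>vertices T. ?c * ?b v)" by (simp add: sb[symmetric] sum_distrib_left)
  finally have n: "(LINT x|lebesgue_on T. f x) - (\<Sum>z\<in>IV. vcoef f z * hat_int z T) = (\<Sum>v\<in>vertices T. (?c - vcoef f v) * ?b v)"
    unfolding s by (simp add: sum_subtractf left_diff_distrib)
  have "\<bar>\<Sum>v\<in>vertices T. (?c - vcoef f v) * ?b v\<bar> \<le> (\<Sum>v\<in>vertices T. \<bar>(?c - vcoef f v) * ?b v\<bar>)" by (rule sum_abs)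
  also have "\<dots> \<le> (\<Sum>v\<in>vertices T. M * ?b v)"
    using M b0 by (intro sum_mono) (auto simp: abs_mult abs_minus_commute intro: mult_right_mono)
  also have "\<dots> = M * vol T" by (simp add: sb[symmetric] sum_distrib_left)
  finally have "\<bar>bcoef f T\<bar> \<le> M * vol T / bubble_int T"
    unfolding bcoef_def n using bubble_int_pos[OF T] by (simp add: divide_right_mono)
  also have "\<dots> \<le> M * vol T / (bubble_const DIM('a) * vol T)"
  proof (intro divide_left_mono bubble_int_lower[OF T] mult_nonneg_nonneg mult_pos_pos bubble_int_pos[OF T] bubble_const_pos element(8)[OF T])
    obtain v where "v \<in> vertices T" using element(11)[OF T] by fastforce
    then show "0 \<le> M" using M[of v] by linarith
  qed simp
  also have "\<dots> = M / bubble_const DIM('a)" using element(8)[OF T] by simp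
  finally show ?thesis .
qed

text \<open>Both estimates see only differences from the mean value: constants are reproduced by the
  hats of all vertices, and the gradients of the coordinates add up to 0. This also holds for
  elements at the boundary, where the missing hats have coefficient 0.\<close>

lemma Qd_element_bounds:
  assumes T: "T \<in> \<T>" and x: "x \<in> T" and M: "\<And>v. v \<in> vertices T \<Longrightarrow> \<bar>vcoef f v - mean_value f T\<bar> \<le> M"
  shows "\<bar>Qd f x - mean_value f T\<bar> \<le> value_const DIM('a) * M"
    and "norm (Qd_grad f x) \<le> slope_const DIM('a) \<sigma> * M / diameter T"
proof -
  interpret S: simplex_vertices "vertices T" by (rule simplex_vertices[OF T])
  let ?c = "mean_value f T" and ?l = "nodal T" and ?g = "nodal_grad T"
  note h = element(9)[OF T]
  obtain v where "v \<in> vertices T" using element(11)[OF T] by fastforce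
  then have M0: "0 \<le> M" using M[of v] by linarith
  have l: "0 \<le> ?l v x \<and> ?l v x \<le> 1" if "v \<in> vertices T" for v
    using S.bary_bounds[of x v] x closure_subset[of T] that element_eq[OF T] by auto
  note b = bcoef_bound[OF T M]
  have p: "0 \<le> (\<Prod>v\<in>W. ?l v x)" "(\<Prod>v\<in>W. ?l v x) \<le> 1" if "W \<subseteq> vertices T" for W
    using l that by (auto intro!: prod_nonneg prod_le_1)
  have "(\<Sum>v\<in>vertices T. vcoef f v * ?l v x) - ?c = (\<Sum>v\<in>vertices T. vcoef f v * ?l v x) - ?c * (\<Sum>v\<in>vertices T. ?l v x)"
    by (simp add: S.bary_representation)
  also have "\<dots> = (\<Sum>v\<in>vertices T. (vcoef f v - ?c) * ?l v x)" by (simp add: sum_distrib_left sum_subtractf left_diff_distrib)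
  finally have e: "(\<Sum>v\<in>vertices T. vcoef f v * ?l v x) - ?c = (\<Sum>v\<in>vertices T. (vcoef f v - ?c) * ?l v x)" .
  have "\<bar>\<Sum>v\<in>vertices T. (vcoef f v - ?c) * ?l v x\<bar> \<le> (\<Sum>v\<in>vertices T. \<bar>(vcoef f v - ?c) * ?l v x\<bar>)" by (rule sum_abs)
  also have "\<dots> \<le> (\<Sum>v\<in>vertices T. M * ?l v x)" using M l by (intro sum_mono) (auto simp: abs_mult intro: mult_right_mono)
  also have "\<dots> = M" by (simp add: sum_distrib_left[symmetric] S.bary_representation)
  finally have 1: "\<bar>(\<Sum>v\<in>vertices T. vcoef f v * ?l v x) - ?c\<bar> \<le> M" unfolding e .
  have "\<bar>bcoef f T * (\<Prod>v\<in>vertices T. ?l v x)\<bar> \<le> (M / bubble_const DIM('a)) * 1"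
    unfolding abs_mult using b p[of "vertices T"] by (intro mult_mono) auto
  with 1 have "\<bar>Qd f x - ?c\<bar> \<le> M + M / bubble_const DIM('a)" unfolding Qd_on_element(1)[OF T x] by linarith
  then show "\<bar>Qd f x - mean_value f T\<bar> \<le> value_const DIM('a) * M" by (simp add: value_const_def algebra_simps)
  have g: "norm (?g v) \<le> grad_const DIM('a) \<sigma> / diameter T" if "v \<in> vertices T" for v
    using bary_grad_le[OF T that] h by (simp add: pos_le_divide_eq)
  \<comment> \<open>A multiple of the vanishing sum of gradients is subtracted.\<close>
  have "(\<Sum>v\<in>vertices T. vcoef f v *\<^sub>R ?g v) = (\<Sum>v\<in>vertices T. vcoef f v *\<^sub>R ?g v) - ?c *\<^sub>R (\<Sum>v\<in>vertices T. ?g v)"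
    by (simp add: S.bary_grad_sum)
  also have "\<dots> = (\<Sum>v\<in>vertices T. (vcoef f v - ?c) *\<^sub>R ?g v)" by (simp add: scaleR_sum_right sum_subtractf scaleR_diff_left)
  finally have e2: "(\<Sum>v\<in>vertices T. vcoef f v *\<^sub>R ?g v) = (\<Sum>v\<in>vertices T. (vcoef f v - ?c) *\<^sub>R ?g v)" .
  have "norm (\<Sum>v\<in>vertices T. (vcoef f v - ?c) *\<^sub>R ?g v) \<le> (\<Sum>v\<in>vertices T. norm ((vcoef f v - ?c) *\<^sub>R ?g v))" by (rule norm_sum)
  also have "\<dots> \<le> (\<Sum>v\<in>vertices T. M * (grad_const DIM('a) \<sigma> / diameter T))"
    unfolding norm_scaleR using M g M0 by (intro sum_mono mult_mono) auto
  also have "\<dots> = (real DIM('a) + 1) * (M * (grad_const DIM('a) \<sigma> / diameter T))" using element(11)[OF T] by simp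
  finally have n1: "norm (\<Sum>v\<in>vertices T. vcoef f v *\<^sub>R ?g v) \<le> (real DIM('a) + 1) * (M * (grad_const DIM('a) \<sigma> / diameter T))" unfolding e2 .
  have "norm (bubble_fun_grad T x) \<le> (\<Sum>v\<in>vertices T. norm ((\<Prod>w\<in>vertices T - {v}. ?l w x) *\<^sub>R ?g v))"
    unfolding bubble_fun_grad_def by (rule norm_sum)
  also have "\<dots> \<le> (\<Sum>v\<in>vertices T. 1 * (grad_const DIM('a) \<sigma> / diameter T))"
  proof (rule sum_mono)
    fix v assume v: "v \<in> vertices T"
    show "norm ((\<Prod>w\<in>vertices T - {v}. ?l w x) *\<^sub>R ?g v) \<le> 1 * (grad_const DIM('a) \<sigma> / diameter T)"
      unfolding norm_scaleR using p[of "vertices T - {v}"] g[OF v] by (intro mult_mono) auto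
  qed
  also have "\<dots> = (real DIM('a) + 1) * (grad_const DIM('a) \<sigma> / diameter T)" using element(11)[OF T] by simp
  finally have n2: "norm (bubble_fun_grad T x) \<le> (real DIM('a) + 1) * (grad_const DIM('a) \<sigma> / diameter T)" .
  have "norm (bcoef f T *\<^sub>R bubble_fun_grad T x) \<le> (M / bubble_const DIM('a)) * ((real DIM('a) + 1) * (grad_const DIM('a) \<sigma> / diameter T))"
    unfolding norm_scaleR using b n2 M0 bubble_const_pos by (intro mult_mono) auto
  then have "norm (Qd_grad f x) \<le> (real DIM('a) + 1) * (M * (grad_const DIM('a) \<sigma> / diameter T)) + (M / bubble_const DIM('a)) * ((real DIM('a) + 1) * (grad_const DIM('a) \<sigma> / diameter T))"
    unfolding Qd_on_element(2)[OF T x] using n1 by (intro order_trans[OF norm_triangle_ineq] add_mono)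
  also have "\<dots> = slope_const DIM('a) \<sigma> * M / diameter T" by (simp add: slope_const_def value_const_def distrib_left distrib_right add_divide_distrib mult_ac)
  finally show "norm (Qd_grad f x) \<le> slope_const DIM('a) \<sigma> * M / diameter T" .
qed

text \<open>The set is either the domain or a patch. Basis functions with coefficient 0 are replaced
  by the zero function, so the support conditions concern only those that really occur.\<close>

lemma Qd_H10:
  assumes \<U>: "open \<U>" "bounded \<U>"
    and v: "\<And>z x. z \<in> IV \<Longrightarrow> vcoef f z \<noteq> 0 \<Longrightarrow> x \<notin> \<U> \<Longrightarrow> hat \<T> z x = 0"
    and b: "\<And>T. T \<in> \<T> \<Longrightarrow> bcoef f T \<noteq> 0 \<Longrightarrow> T \<subseteq> \<U>"
  shows "Qd f \<in> H10 \<U>" "AE x in lebesgue_on \<U>. weak_gradient \<U> (Qd f) x = Qd_grad f x"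
proof -
  define u where "u z = (if vcoef f z = 0 then (\<lambda>x. 0) else hat \<T> z)" for z
  define ug where "ug z = (if vcoef f z = 0 then (\<lambda>x. 0) else hat_grad z)" for z
  define w where "w T = (if bcoef f T = 0 then (\<lambda>x. 0) else bubble \<T> T)" for T
  define wg where "wg T = (if bcoef f T = 0 then (\<lambda>x. 0) else bubble_grad T)" for T
  have U: "(\<lambda>x. \<Sum>z\<in>IV. vcoef f z * u z x) \<in> H10 \<U> \<and>
    (AE x in lebesgue_on \<U>. weak_gradient \<U> (\<lambda>x. \<Sum>z\<in>IV. vcoef f z * u z x) x = (\<Sum>z\<in>IV. vcoef f z *\<^sub>R ug z x))"
  proof (rule H10_sum[OF \<U>(1) finite_vertices(2)])
    fix z assume z: "z \<in> IV"
    show "u z \<in> H10 \<U>" "AE x in lebesgue_on \<U>. weak_gradient \<U> (u z) x = ug z x"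
      using H10_zero[OF \<U>(1)] hat_H10[OF z \<U>] v[OF z] by (auto simp: u_def ug_def)
  qed
  have W: "(\<lambda>x. \<Sum>T\<in>\<T>. bcoef f T * w T x) \<in> H10 \<U> \<and>
    (AE x in lebesgue_on \<U>. weak_gradient \<U> (\<lambda>x. \<Sum>T\<in>\<T>. bcoef f T * w T x) x = (\<Sum>T\<in>\<T>. bcoef f T *\<^sub>R wg T x))"
  proof (rule H10_sum[OF \<U>(1) finite_mesh])
    fix T assume T: "T \<in> \<T>"
    show "w T \<in> H10 \<U>" "AE x in lebesgue_on \<U>. weak_gradient \<U> (w T) x = wg T x"
      using H10_zero[OF \<U>(1)] bubble_H10[OF T \<U>] b[OF T] by (auto simp: w_def wg_def)
  qed
  have e1: "(\<lambda>x. 1 * (\<Sum>z\<in>IV. vcoef f z * u z x) + 1 * (\<Sum>T\<in>\<T>. bcoef f T * w T x)) = Qd f"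
    by (rule ext) (auto simp: Qd_def u_def w_def intro!: arg_cong2[of _ _ _ _ "(+)"] sum.cong)
  have e2: "(\<Sum>z\<in>IV. vcoef f z *\<^sub>R ug z x) + (\<Sum>T\<in>\<T>. bcoef f T *\<^sub>R wg T x) = Qd_grad f x" for x
    by (auto simp: Qd_grad_def ug_def wg_def intro!: arg_cong2[of _ _ _ _ "(+)"] sum.cong)
  note l = H10_lincomb[OF \<U>(1) U[THEN conjunct1] W[THEN conjunct1], of 1 1, unfolded e1]
  show "Qd f \<in> H10 \<U>" by (rule l(1))
  show "AE x in lebesgue_on \<U>. weak_gradient \<U> (Qd f) x = Qd_grad f x"
    using l(2) U[THEN conjunct2] W[THEN conjunct2] by eventually_elim (simp add: e2[symmetric])
qed

lemma Qd_H10_domain: "Qd f \<in> H10 \<Omega>" "AE x in lebesgue_on \<Omega>. weak_gradient \<Omega> (Qd f) x = Qd_grad f x"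
  using Qd_H10[OF domain(1,2), of f] hat_zero_outside element_subset interior_vertices_eq by auto

end

section \<open>Identification of \<open>Q_op\<close> with the transpose of \<open>Qd\<close>\<close>

section \<open>The operators\<close>

lemma Hm1_add: "\<phi> \<in> Hm1 \<U> \<Longrightarrow> u \<in> H10 \<U> \<Longrightarrow> v \<in> H10 \<U> \<Longrightarrow> \<phi> (\<lambda>x. u x + v x) = \<phi> u + \<phi> v"
  and Hm1_scale: "\<phi> \<in> Hm1 \<U> \<Longrightarrow> v \<in> H10 \<U> \<Longrightarrow> \<phi> (\<lambda>x. c * v x) = c * \<phi> v"
  by (simp_all add: Hm1_def)

lemma Hm1_sum:
  assumes \<U>: "open \<U>" and \<phi>: "\<phi> \<in> Hm1 \<U>" and I: "finite I" and u: "\<And>i. i \<in> I \<Longrightarrow> u i \<in> H10 \<U>"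
  shows "(\<lambda>x. \<Sum>i\<in>I. a i * u i x) \<in> H10 \<U> \<and> \<phi> (\<lambda>x. \<Sum>i\<in>I. a i * u i x) = (\<Sum>i\<in>I. a i * \<phi> (u i))"
  using I u
proof (induction I rule: finite_induct)
  case empty
  show ?case using Hm1_scale[OF \<phi> H10_zero(1)[OF \<U>], of 0] H10_zero(1)[OF \<U>] by simp
next
  case (insert i I)
  then have IH: "(\<lambda>x. \<Sum>i\<in>I. a i * u i x) \<in> H10 \<U>" "\<phi> (\<lambda>x. \<Sum>i\<in>I. a i * u i x) = (\<Sum>i\<in>I. a i * \<phi> (u i))"
    and ui: "u i \<in> H10 \<U>" by auto
  have sc: "(\<lambda>x. a i * u i x) \<in> H10 \<U>" by (rule H10_scale(1)[OF \<U> ui])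
  have "\<phi> (\<lambda>x. a i * u i x + (\<Sum>i\<in>I. a i * u i x)) = \<phi> (\<lambda>x. a i * u i x) + \<phi> (\<lambda>x. \<Sum>i\<in>I. a i * u i x)"
    by (rule Hm1_add[OF \<phi> sc IH(1)])
  moreover have "\<phi> (\<lambda>x. a i * u i x) = a i * \<phi> (u i)" by (rule Hm1_scale[OF \<phi> ui])
  moreover have "(\<lambda>x. a i * u i x + (\<Sum>i\<in>I. a i * u i x)) \<in> H10 \<U>"
    using H10_lincomb(1)[OF \<U> sc IH(1), of 1 1] by simp
  ultimately show ?case using insert(1,2) IH(2) by simp
qed

context shape_mesh
begin

lemma continuous_L2:
  fixes f :: "'a \<Rightarrow> real"
  assumes T: "T \<in> \<T>" and f: "continuous_on UNIV f"
  shows "f \<in> L2 T"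
proof -
  interpret S: simplex_vertices "vertices T" by (rule simplex_vertices[OF T])
  have "integrable (lebesgue_on T) (\<lambda>x. (norm (f x))\<^sup>2)" "integrable (lebesgue_on T) f"
    using S.integrable_T_continuous[OF f] S.integrable_T_continuous[of "\<lambda>x. (norm (f x))\<^sup>2"] f element_eq[OF T]
    by (auto intro!: continuous_intros)
  then show ?thesis by (simp add: L2_def)
qed

lemma affine_continuous: "affine_fun_on UNIV p \<Longrightarrow> continuous_on UNIV p"
proof -
  assume "affine_fun_on UNIV p"
  then obtain a c where "p = (\<lambda>x. a \<bullet> x + c)" by (auto simp: affine_fun_on_def)
  then show ?thesis by (auto intro!: continuous_intros)
qed

lemma domain_lmeasurable: "\<Omega> \<in> lmeasurable" "\<Omega> \<in> sets lebesgue"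
  using domain(1,2) by (auto intro: bounded_set_imp_lmeasurable)

lemma L2_element:
  fixes v :: "'a \<Rightarrow> real"
  assumes "v \<in> L2 \<Omega>" "T \<in> \<T>"
  shows "v \<in> L2 T"
  using L2_subset(1)[OF assms(1) element_subset[OF assms(2)]] element(6)[OF assms(2)] domain_lmeasurable by blast

lemma L2_element_integrable:
  fixes v :: "'a \<Rightarrow> real"
  assumes "v \<in> L2 T" "T \<in> \<T>"
  shows "integrable (lebesgue_on T) v"
  using L2_inner_integrable[OF assms(1) continuous_L2[OF assms(2), of "\<lambda>_. 1"]] by simp

lemma indicator_L2: "T \<in> \<T> \<Longrightarrow> (indicator T :: 'a \<Rightarrow> real) \<in> L2 \<Omega>"
  using element(6) by (intro L2_bounded(1)[OF domain_lmeasurable(1), where B=1])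
    (auto intro!: borel_measurable_indicator simp: sets_restrict_space_iff domain_lmeasurable indicator_def element_subset)

lemma integral_indicator_element:
  assumes "T \<in> \<T>" "T' \<in> \<T>"
  shows "(LINT x|lebesgue_on T'. indicator T x) = (if T' = T then vol T else 0)"
proof -
  have "(LINT x|lebesgue_on T'. indicator T x) = (LINT x|lebesgue_on T'. (if T' = T then 1 else 0 :: real))"
  proof (rule Bochner_Integration.integral_cong[OF refl])
    fix x assume "x \<in> space (lebesgue_on T')"
    then have x: "x \<in> T'" by simp
    then have "x \<in> T \<longleftrightarrow> T' = T" using elements_disjoint[OF assms(2,1) x] closure_subset by blast
    then show "indicator T x = (if T' = T then 1 else 0 :: real)" by simp
  qed
  then show ?thesis using element(5)[OF assms(1)] by (simp add: measure_restrict_space fmeasurable_def)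
qed

lemma P0_sub_P1: "P0 \<T> \<subseteq> P1 \<T>"
proof
  fix p assume p: "p \<in> P0 \<T>"
  have "affine_fun_on T p" if T: "T \<in> \<T>" for T
  proof -
    obtain c where "\<forall>x\<in>T. p x = c" using p T unfolding P0_def by blast
    then show ?thesis unfolding affine_fun_on_def by (intro exI[of _ 0] exI[of _ c]) simp
  qed
  then show "p \<in> P1 \<T>" using p by (simp add: P0_def P1_def)
qed

lemma P1_sum_indicator:
  assumes "p \<in> P1 \<T>"
  obtains a c where "p = (\<lambda>x. \<Sum>T\<in>\<T>. indicator T x *\<^sub>R (a T \<bullet> x + c T))"
proof -
  have "\<forall>T\<in>\<T>. \<exists>a c. \<forall>x\<in>T. p x = a \<bullet> x + c" using assms by (simp add: P1_def affine_fun_on_def)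
  then obtain a where "\<forall>T\<in>\<T>. \<exists>c. \<forall>x\<in>T. p x = a T \<bullet> x + c" by metis
  then obtain c where ac: "\<And>T x. T \<in> \<T> \<Longrightarrow> x \<in> T \<Longrightarrow> p x = a T \<bullet> x + c T" by metis
  have "p x = (\<Sum>T\<in>\<T>. indicator T x *\<^sub>R (a T \<bullet> x + c T))" for x
  proof (cases "x \<in> \<Union>\<T>")
    case True
    then obtain T where T: "T \<in> \<T>" "x \<in> T" by blast
    show ?thesis using sum_indicator_element[OF T, of "\<lambda>T. a T \<bullet> x + c T"] ac[OF T] by simp
  next
    case False
    show ?thesis using sum_indicator_outside[OF False, of "\<lambda>T. a T \<bullet> x + c T"] assms False by (simp add: P1_def)
  qed
  then show ?thesis using that by blast
qed

lemma P1_L2: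
  assumes "p \<in> P1 \<T>"
  shows "p \<in> L2 \<Omega>"
proof -
  obtain a c where p: "p = (\<lambda>x. \<Sum>T\<in>\<T>. indicator T x *\<^sub>R (a T \<bullet> x + c T))" by (rule P1_sum_indicator[OF assms])
  obtain B where B: "\<And>x. x \<in> \<Omega> \<Longrightarrow> norm x \<le> B" using domain(2) by (auto simp: bounded_iff)
  have "(\<lambda>x. indicator T x *\<^sub>R (a T \<bullet> x + c T)) \<in> L2 \<Omega>" if T: "T \<in> \<T>" for T
  proof (rule L2_bounded(1)[OF domain_lmeasurable(1), where B="norm (a T) * B + \<bar>c T\<bar>"])
    have "T \<in> sets borel" by (rule element(7)[OF T])
    then have "(\<lambda>x. indicator T x *\<^sub>R (a T \<bullet> x + c T)) \<in> borel_measurable borel"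
      by (intro borel_measurable_scaleR borel_measurable_indicator borel_measurable_continuous_onI continuous_intros)
    then show "(\<lambda>x. indicator T x *\<^sub>R (a T \<bullet> x + c T)) \<in> borel_measurable (lebesgue_on \<Omega>)"
      by (rule borel_measurable_lebesgue_onI)
    fix x assume x: "x \<in> \<Omega>"
    have 1: "\<bar>a T \<bullet> x\<bar> \<le> norm (a T) * B"
      using Cauchy_Schwarz_ineq2[of "a T" x] mult_left_mono[OF B[OF x], of "norm (a T)"] by simp
    show "norm (indicator T x *\<^sub>R (a T \<bullet> x + c T)) \<le> norm (a T) * B + \<bar>c T\<bar>"
      using 1 abs_triangle_ineq[of "a T \<bullet> x" "c T"] by (cases "x \<in> T") auto
  qed
  then show ?thesis unfolding p by (rule L2_sum)
qed

text \<open>On an open element the set where two affine functions differ is open, hence empty if it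
  is null; off the elements both are 0 by the choice of representatives.\<close>

lemma P1_unique:
  assumes p: "p \<in> P1 \<T>" and q: "q \<in> P1 \<T>" and ae: "AE x in lebesgue_on \<Omega>. p x - q x = 0"
  shows "p = q"
proof
  fix x
  show "p x = q x"
  proof (cases "x \<in> \<Union>\<T>")
    case True
    then obtain T where T: "T \<in> \<T>" "x \<in> T" by blast
    obtain a c where a: "\<And>x. x \<in> T \<Longrightarrow> p x = a \<bullet> x + c" using p T(1) by (auto simp: P1_def affine_fun_on_def)
    obtain b d where b: "\<And>x. x \<in> T \<Longrightarrow> q x = b \<bullet> x + d" using q T(1) by (auto simp: P1_def affine_fun_on_def)
    define U where "U = T \<inter> {x. a \<bullet> x + c \<noteq> b \<bullet> x + d}"
    have oU: "open U" unfolding U_def by (intro open_Int element(1)[OF T(1)] open_Collect_neq continuous_intros)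
    have "AE x in lebesgue. x \<in> \<Omega> \<longrightarrow> p x - q x = 0"
      using ae domain_lmeasurable by (simp add: AE_restrict_space_iff)
    then have "AE x in lebesgue. x \<notin> U"
      by eventually_elim (use element_subset[OF T(1)] a b in \<open>auto simp: U_def\<close>)
    then have "U \<in> null_sets lebesgue" using oU by (subst AE_iff_null_sets) auto
    then have "U = {}" using open_not_negligible[OF oU] negligible_iff_null_sets by blast
    then show ?thesis using T a b by (auto simp: U_def)
  qed (use p q in \<open>auto simp: P1_def\<close>)
qed

definition piecewise :: "('a set \<Rightarrow> real) \<Rightarrow> 'a \<Rightarrow> real" where
  "piecewise c x = (\<Sum>T\<in>\<T>. indicator T x *\<^sub>R c T)"

lemma piecewise_on: "T \<in> \<T> \<Longrightarrow> x \<in> T \<Longrightarrow> piecewise c x = c T"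
  unfolding piecewise_def by (rule sum_indicator_element)

lemma piecewise_P0: "piecewise c \<in> P0 \<T>"
  using piecewise_on sum_indicator_outside by (auto simp: P0_def piecewise_def[abs_def])

lemma piecewise_L2: "piecewise c \<in> L2 \<Omega>"
  using piecewise_P0 P0_sub_P1 P1_L2 by blast

lemma L2_inner_piecewise:
  assumes "f \<in> L2 \<Omega>"
  shows "L2_inner \<Omega> (piecewise c) f = (\<Sum>T\<in>\<T>. c T * (LINT x|lebesgue_on T. f x))"
proof -
  have "L2_inner \<Omega> (piecewise c) f = (\<Sum>T\<in>\<T>. LINT x|lebesgue_on T. piecewise c x * f x)"
    unfolding L2_inner_def by (rule integral_mesh) (use L2_inner_integrable[OF piecewise_L2 assms] in simp)
  also have "\<dots> = (\<Sum>T\<in>\<T>. LINT x|lebesgue_on T. c T * f x)"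
    by (intro sum.cong Bochner_Integration.integral_cong refl) (auto simp: piecewise_on)
  finally show ?thesis by simp
qed

text \<open>Orthogonality to piecewise constants means equal integrals over each element. Uniqueness
  is obtained by testing with the function that is 1 on one element and 0 on the others.\<close>

lemma proj0_eq:
  assumes w: "w \<in> L2 \<Omega>"
  shows "proj0 \<Omega> \<T> w = piecewise (mean_value w)"
  unfolding proj0_def
proof (rule the_equality)
  have i: "L2_inner \<Omega> (\<lambda>x. w x - p x) q = (LINT x|lebesgue_on \<Omega>. w x * q x) - L2_inner \<Omega> p q" if "p \<in> P0 \<T>" "q \<in> P0 \<T>" for p q
  proof -
    have pq: "p \<in> L2 \<Omega>" "q \<in> L2 \<Omega>" using that P0_sub_P1 P1_L2 by auto
    show ?thesis unfolding L2_inner_def left_diff_distrib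
      by (rule Bochner_Integration.integral_diff) (use L2_inner_integrable[OF w pq(2)] L2_inner_integrable[OF pq] in auto)
  qed
  have wq: "(LINT x|lebesgue_on \<Omega>. w x * piecewise c x) = (\<Sum>T\<in>\<T>. c T * (LINT x|lebesgue_on T. w x))" for c
    using L2_inner_piecewise[OF w, of c] by (simp add: L2_inner_def mult.commute)
  have pc: "\<exists>c. q = piecewise c" if q: "q \<in> P0 \<T>" for q
  proof -
    have "\<forall>T\<in>\<T>. \<exists>c. \<forall>x\<in>T. q x = c" using q by (simp add: P0_def)
    then obtain c where c: "\<And>T x. T \<in> \<T> \<Longrightarrow> x \<in> T \<Longrightarrow> q x = c T" by metis
    have "q x = piecewise c x" for x
    proof (cases "x \<in> \<Union>\<T>")
      case True
      then show ?thesis using c piecewise_on by auto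
    next
      case False
      then show ?thesis using q piecewise_P0[of c] by (simp add: P0_def)
    qed
    then show ?thesis by blast
  qed
  have int: "(LINT x|lebesgue_on T. piecewise c x) = c T * vol T" if T: "T \<in> \<T>" for T c
  proof -
    have "(LINT x|lebesgue_on T. piecewise c x) = (LINT x|lebesgue_on T. c T)"
      by (rule Bochner_Integration.integral_cong) (auto simp: piecewise_on[OF T])
    then show ?thesis using element(5)[OF T] by (simp add: measure_restrict_space fmeasurable_def)
  qed
  have key: "L2_inner \<Omega> (\<lambda>x. w x - piecewise c x) (piecewise e) = (\<Sum>T\<in>\<T>. e T * ((LINT x|lebesgue_on T. w x) - c T * vol T))" for c e
  proof -
    have "L2_inner \<Omega> (piecewise c) (piecewise e) = (\<Sum>T\<in>\<T>. c T * (e T * vol T))"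
      unfolding L2_inner_piecewise[OF piecewise_L2] by (intro sum.cong) (auto simp: int)
    then show ?thesis unfolding i[OF piecewise_P0 piecewise_P0] wq by (simp add: sum_subtractf right_diff_distrib mult_ac)
  qed
  show "piecewise (mean_value w) \<in> P0 \<T> \<and> (\<forall>q\<in>P0 \<T>. L2_inner \<Omega> (\<lambda>x. w x - piecewise (mean_value w) x) q = 0)"
  proof (intro conjI ballI piecewise_P0)
    fix q assume "q \<in> P0 \<T>"
    then obtain e where e: "q = piecewise e" using pc by blast
    show "L2_inner \<Omega> (\<lambda>x. w x - piecewise (mean_value w) x) q = 0"
      unfolding e key using element(8) by (intro sum.neutral) (force simp: mean_value_def)
  qed
  fix p assume p: "p \<in> P0 \<T> \<and> (\<forall>q\<in>P0 \<T>. L2_inner \<Omega> (\<lambda>x. w x - p x) q = 0)"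
  then obtain c where c: "p = piecewise c" using pc by blast
  have "c T = mean_value w T" if T: "T \<in> \<T>" for T
  proof -
    have "L2_inner \<Omega> (\<lambda>x. w x - piecewise c x) (piecewise (\<lambda>T'. if T' = T then 1 else 0)) = 0"
      using p c piecewise_P0 by blast
    then have "(LINT x|lebesgue_on T. w x) - c T * vol T = 0"
      unfolding key using T finite_mesh by (simp add: if_distrib[of "\<lambda>t. t * _"] cong: if_cong)
    then show ?thesis using element(8)[OF T] by (simp add: mean_value_def)
  qed
  then show "p = piecewise (mean_value w)" unfolding c piecewise_def by (intro ext sum.cong) auto
qed

definition acoef where
  "acoef v z = (\<Sum>T\<in>star z. vol T * L2_inner T v (dual_hat \<T> T z) / star_measure_sum z)"

definition mu where "mu \<phi> T = \<phi> (bubble \<T> T) / bubble_int T"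

text \<open>The value of \<phi> at the hat function after bubbles have corrected its integral over
  every element to 0; \<open>mu\<close> is the value of \<phi> at a bubble of integral 1.\<close>

definition kap where "kap \<phi> z = \<phi> (hat \<T> z) - (\<Sum>T\<in>\<T>. hat_int z T * mu \<phi> T)"

lemma hat_integrable:
  assumes z: "z \<in> IV" and T: "T \<in> \<T>"
  shows "integrable (lebesgue_on T) (hat \<T> z)"
  using hat_H10(1)[OF z domain(1,2)] hat_zero_outside z interior_vertices_eq H10D(1) L2_element L2_element_integrable T by blast

lemma bubble_domain_H10: "T \<in> \<T> \<Longrightarrow> bubble \<T> T \<in> H10 \<Omega>"
  using bubble_H10(1)[OF _ domain(1,2)] element_subset by blast

lemma hat_domain_H10: "z \<in> IV \<Longrightarrow> hat \<T> z \<in> H10 \<Omega>"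
  using hat_H10(1)[OF _ domain(1,2)] hat_zero_outside interior_vertices_eq by blast

lemma P_op_eq:
  assumes v: "v \<in> L2 \<Omega>"
  shows "P_op \<Omega> \<T> v = (\<lambda>x. (\<Sum>z\<in>IV. acoef v z * hat \<T> z x) +
    (\<Sum>T\<in>\<T>. ((LINT x|lebesgue_on T. v x) - (\<Sum>z\<in>IV. acoef v z * hat_int z T)) / bubble_int T * bubble \<T> T x))"
proof -
  have J: "J_op \<Omega> \<T> v = (\<lambda>x. \<Sum>z\<in>IV. acoef v z * hat \<T> z x)"
    by (intro ext) (auto simp: J_op_def acoef_def star_measure_sum_def star_eq interior_vertices_eq intro!: sum.cong)
  have "L2_inner T (\<lambda>y. v y - J_op \<Omega> \<T> v y) (\<lambda>_. 1) / L2_inner T (bubble \<T> T) (\<lambda>_. 1)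
    = ((LINT x|lebesgue_on T. v x) - (\<Sum>z\<in>IV. acoef v z * hat_int z T)) / bubble_int T" if T: "T \<in> \<T>" for T
  proof -
    have iz: "integrable (lebesgue_on T) (\<lambda>x. acoef v z * hat \<T> z x)" if "z \<in> IV" for z
      using hat_integrable[OF that T] by simp
    have "L2_inner T (\<lambda>y. v y - J_op \<Omega> \<T> v y) (\<lambda>_. 1) = (LINT x|lebesgue_on T. v x - (\<Sum>z\<in>IV. acoef v z * hat \<T> z x))"
      by (simp add: L2_inner_def J)
    also have "\<dots> = (LINT x|lebesgue_on T. v x) - (LINT x|lebesgue_on T. (\<Sum>z\<in>IV. acoef v z * hat \<T> z x))"
      by (intro Bochner_Integration.integral_diff Bochner_Integration.integrable_sum iz L2_element_integrable[OF L2_element[OF v T] T])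
    also have "(LINT x|lebesgue_on T. (\<Sum>z\<in>IV. acoef v z * hat \<T> z x)) = (\<Sum>z\<in>IV. acoef v z * hat_int z T)"
      by (subst Bochner_Integration.integral_sum[OF iz]) (auto simp: hat_int_def)
    finally show ?thesis by (simp add: L2_inner_def bubble_int_def)
  qed
  then show ?thesis by (intro ext) (simp add: P_op_def J cong: sum.cong)
qed

text \<open>The vertex coefficients \<open>a\<close> and the element integrals \<open>F\<close> are
  arbitrary, so that the formula applies to \<open>P_op\<close> and to \<open>Qd\<close>, which
  differ only in \<open>a\<close>.\<close>

lemma functional_expand:
  assumes \<phi>: "\<phi> \<in> Hm1 \<Omega>"
  shows "\<phi> (\<lambda>x. (\<Sum>z\<in>IV. a z * hat \<T> z x) +
      (\<Sum>T\<in>\<T>. (F T - (\<Sum>z\<in>IV. a z * hat_int z T)) / bubble_int T * bubble \<T> T x))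
    = (\<Sum>T\<in>\<T>. mu \<phi> T * F T) + (\<Sum>z\<in>IV. a z * kap \<phi> z)"
proof -
  note 1 = Hm1_sum[OF domain(1) \<phi> finite_vertices(2), where u="hat \<T>", OF hat_domain_H10]
  note 2 = Hm1_sum[OF domain(1) \<phi> finite_mesh, where u="bubble \<T>", OF bubble_domain_H10]
  let ?b = "\<lambda>T. (F T - (\<Sum>z\<in>IV. a z * hat_int z T)) / bubble_int T"
  have "\<phi> (\<lambda>x. (\<Sum>z\<in>IV. a z * hat \<T> z x) + (\<Sum>T\<in>\<T>. ?b T * bubble \<T> T x)) = \<phi> (\<lambda>x. \<Sum>z\<in>IV. a z * hat \<T> z x) + \<phi> (\<lambda>x. \<Sum>T\<in>\<T>. ?b T * bubble \<T> T x)"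
    by (rule Hm1_add[OF \<phi> 1[THEN conjunct1] 2[THEN conjunct1]])
  also have "\<dots> = (\<Sum>z\<in>IV. a z * \<phi> (hat \<T> z)) + (\<Sum>T\<in>\<T>. ?b T * \<phi> (bubble \<T> T))"
    by (rule arg_cong2[of _ _ _ _ "(+)", OF 1[THEN conjunct2] 2[THEN conjunct2]])
  also have "(\<Sum>T\<in>\<T>. ?b T * \<phi> (bubble \<T> T)) = (\<Sum>T\<in>\<T>. mu \<phi> T * F T) - (\<Sum>T\<in>\<T>. \<Sum>z\<in>IV. a z * (hat_int z T * mu \<phi> T))"
  proof -
    have "(\<Sum>T\<in>\<T>. ?b T * \<phi> (bubble \<T> T)) = (\<Sum>T\<in>\<T>. (F T - (\<Sum>z\<in>IV. a z * hat_int z T)) * mu \<phi> T)"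
      by (simp add: mu_def)
    also have "\<dots> = (\<Sum>T\<in>\<T>. mu \<phi> T * F T) - (\<Sum>T\<in>\<T>. \<Sum>z\<in>IV. a z * (hat_int z T * mu \<phi> T))"
      by (simp only: left_diff_distrib sum_distrib_right sum_subtractf mult.assoc mult.commute[of "mu \<phi> _" "F _"])
    finally show ?thesis .
  qed
  also have "(\<Sum>T\<in>\<T>. \<Sum>z\<in>IV. a z * (hat_int z T * mu \<phi> T)) = (\<Sum>z\<in>IV. a z * (\<Sum>T\<in>\<T>. hat_int z T * mu \<phi> T))"
    by (subst sum.swap) (simp add: sum_distrib_left)
  finally show ?thesis by (simp add: kap_def right_diff_distrib sum_subtractf)
qed

lemma sum_star_swap:
  fixes A :: "'a \<Rightarrow> 'a set \<Rightarrow> real"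
  shows "(\<Sum>z\<in>IV. \<Sum>T\<in>star z. A z T) = (\<Sum>T\<in>\<T>. \<Sum>z\<in>IV \<inter> vertices T. A z T)"
proof -
  have "(\<Sum>z\<in>IV. \<Sum>T\<in>star z. A z T) = (\<Sum>z\<in>IV. \<Sum>T\<in>\<T>. if z \<in> vertices T then A z T else 0)"
    using finite_mesh by (simp add: star_def sum.inter_filter)
  also have "\<dots> = (\<Sum>T\<in>\<T>. \<Sum>z\<in>IV. if z \<in> vertices T then A z T else 0)" by (rule sum.swap)
  also have "\<dots> = (\<Sum>T\<in>\<T>. \<Sum>z\<in>IV \<inter> vertices T. A z T)"
    using finite_vertices(2) by (simp add: sum.inter_restrict)
  finally show ?thesis .
qed

text \<open>An explicit form of \<open>P_adj\<close>, read off from \<open>functional_expand\<close>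
  by exchanging the sums over vertices and elements.\<close>

definition adj where
  "adj \<phi> x = (\<Sum>T\<in>\<T>. indicator T x *\<^sub>R (mu \<phi> T + (\<Sum>z\<in>IV \<inter> vertices T. vol T * kap \<phi> z / star_measure_sum z * dual_hat \<T> T z x)))"

lemma adj_on: "T \<in> \<T> \<Longrightarrow> x \<in> T \<Longrightarrow> adj \<phi> x = mu \<phi> T + (\<Sum>z\<in>IV \<inter> vertices T. vol T * kap \<phi> z / star_measure_sum z * dual_hat \<T> T z x)"
  unfolding adj_def by (rule sum_indicator_element)

lemma adj_P1: "adj \<phi> \<in> P1 \<T>"
proof -
  have "affine_fun_on T (adj \<phi>)" if T: "T \<in> \<T>" for T
  proof -
    let ?I = "IV \<inter> vertices T"
    have "\<forall>z\<in>?I. \<exists>a c. \<forall>x. dual_hat \<T> T z x = a \<bullet> x + c"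
      using dual_hat(1)[OF T] by (auto simp: affine_fun_on_def)
    then obtain a where "\<forall>z\<in>?I. \<exists>c. \<forall>x. dual_hat \<T> T z x = a z \<bullet> x + c" by metis
    then obtain c where ac: "\<And>z x. z \<in> ?I \<Longrightarrow> dual_hat \<T> T z x = a z \<bullet> x + c z" by metis
    define k where "k z = vol T * kap \<phi> z / star_measure_sum z" for z
    have "adj \<phi> x = (\<Sum>z\<in>?I. k z *\<^sub>R a z) \<bullet> x + (mu \<phi> T + (\<Sum>z\<in>?I. k z * c z))" if "x \<in> T" for x
    proof -
      have "(\<Sum>z\<in>?I. k z * dual_hat \<T> T z x) = (\<Sum>z\<in>?I. k z * (a z \<bullet> x + c z))" using ac by (intro sum.cong) auto
      then show ?thesis unfolding adj_on[OF T that] k_def[symmetric] by (simp add: inner_sum_left distrib_left sum.distrib)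
    qed
    then show ?thesis unfolding affine_fun_on_def by blast
  qed
  then show ?thesis using sum_indicator_outside by (auto simp: P1_def adj_def[abs_def])
qed

lemma adj_inner:
  assumes \<phi>: "\<phi> \<in> Hm1 \<Omega>" and v: "v \<in> L2 \<Omega>"
  shows "L2_inner \<Omega> (adj \<phi>) v = \<phi> (P_op \<Omega> \<T> v)"
proof -
  let ?I = "\<lambda>T. IV \<inter> vertices T"
  let ?k = "\<lambda>T z. vol T * kap \<phi> z / star_measure_sum z"
  have "L2_inner \<Omega> (adj \<phi>) v = (\<Sum>T\<in>\<T>. LINT x|lebesgue_on T. adj \<phi> x * v x)"
    unfolding L2_inner_def by (rule integral_mesh) (use L2_inner_integrable[OF P1_L2[OF adj_P1] v] in simp)
  also have "\<dots> = (\<Sum>T\<in>\<T>. mu \<phi> T * (LINT x|lebesgue_on T. v x) + (\<Sum>z\<in>?I T. ?k T z * L2_inner T v (dual_hat \<T> T z)))"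
  proof (rule sum.cong[OF refl])
    fix T assume T: "T \<in> \<T>"
    note vT = L2_element[OF v T]
    have id: "integrable (lebesgue_on T) (\<lambda>x. ?k T z * (v x * dual_hat \<T> T z x))" if "z \<in> ?I T" for z
      using L2_inner_integrable[OF vT continuous_L2[OF T affine_continuous[OF dual_hat(1)[OF T]]]] that by simp
    have "(LINT x|lebesgue_on T. adj \<phi> x * v x) = (LINT x|lebesgue_on T. mu \<phi> T * v x + (\<Sum>z\<in>?I T. ?k T z * (v x * dual_hat \<T> T z x)))"
      by (rule Bochner_Integration.integral_cong[OF refl]) (simp add: adj_on[OF T] distrib_left sum_distrib_left mult_ac)
    also have "\<dots> = (LINT x|lebesgue_on T. mu \<phi> T * v x) + (LINT x|lebesgue_on T. (\<Sum>z\<in>?I T. ?k T z * (v x * dual_hat \<T> T z x)))"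
      using L2_element_integrable[OF vT T] id by (intro Bochner_Integration.integral_add Bochner_Integration.integrable_sum) auto
    also have "(LINT x|lebesgue_on T. (\<Sum>z\<in>?I T. ?k T z * (v x * dual_hat \<T> T z x))) = (\<Sum>z\<in>?I T. LINT x|lebesgue_on T. ?k T z * (v x * dual_hat \<T> T z x))"
      by (rule Bochner_Integration.integral_sum[OF id])
    finally show "(LINT x|lebesgue_on T. adj \<phi> x * v x) = mu \<phi> T * (LINT x|lebesgue_on T. v x) + (\<Sum>z\<in>?I T. ?k T z * L2_inner T v (dual_hat \<T> T z))"
      by (simp add: L2_inner_def)
  qed
  also have "\<dots> = (\<Sum>T\<in>\<T>. mu \<phi> T * (LINT x|lebesgue_on T. v x)) + (\<Sum>T\<in>\<T>. \<Sum>z\<in>?I T. ?k T z * L2_inner T v (dual_hat \<T> T z))"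
    by (rule sum.distrib)
  also have "(\<Sum>T\<in>\<T>. \<Sum>z\<in>?I T. ?k T z * L2_inner T v (dual_hat \<T> T z)) = (\<Sum>z\<in>IV. acoef v z * kap \<phi> z)"
    by (subst sum_star_swap[symmetric]) (auto simp: acoef_def sum_distrib_left mult_ac intro!: sum.cong)
  also have "(\<Sum>T\<in>\<T>. mu \<phi> T * (LINT x|lebesgue_on T. v x)) + (\<Sum>z\<in>IV. acoef v z * kap \<phi> z) = \<phi> (P_op \<Omega> \<T> v)"
    unfolding P_op_eq[OF v] by (rule functional_expand[OF \<phi>, symmetric])
  finally show ?thesis .
qed

text \<open>Uniqueness: the difference of two candidates is orthogonal to all test functions, hence
  0 almost everywhere, and piecewise affine representatives are then equal.\<close>

lemma P_adj_eq:
  assumes \<phi>: "\<phi> \<in> Hm1 \<Omega>"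
  shows "P_adj \<Omega> \<T> \<phi> = adj \<phi>"
  unfolding P_adj_def
proof (rule the_equality)
  show "adj \<phi> \<in> P1 \<T> \<and> (\<forall>v\<in>H10 \<Omega>. L2_inner \<Omega> (adj \<phi>) v = \<phi> (P_op \<Omega> \<T> v))"
    using adj_P1 adj_inner[OF \<phi>] H10D(1) by blast
  fix w assume w: "w \<in> P1 \<T> \<and> (\<forall>v\<in>H10 \<Omega>. L2_inner \<Omega> w v = \<phi> (P_op \<Omega> \<T> v))"
  show "w = adj \<phi>"
  proof (rule P1_unique[OF w[THEN conjunct1] adj_P1 fundamental_lemma[OF domain(1) L2_diff]])
    show wl: "w \<in> L2 \<Omega>" "adj \<phi> \<in> L2 \<Omega>" using w P1_L2 adj_P1 by auto
    fix f assume f: "f \<in> test_functions \<Omega>"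
    note fH = H10_test_function(1)[OF domain(1) f]
    note fl = H10D(1)[OF fH]
    have "(LINT x|lebesgue_on \<Omega>. f x * (w x - adj \<phi> x)) = L2_inner \<Omega> w f - L2_inner \<Omega> (adj \<phi>) f"
      unfolding L2_inner_def right_diff_distrib
      using L2_inner_integrable[OF wl(1) fl] L2_inner_integrable[OF wl(2) fl]
      by (subst Bochner_Integration.integral_diff) (auto simp: mult.commute)
    then show "(LINT x|lebesgue_on \<Omega>. f x * (w x - adj \<phi> x)) = 0" using w fH adj_inner[OF \<phi> fl] by simp
  qed
qed

text \<open>The mean of \<open>adj\<close> over an element. Each dual function has integral 1 there,
  which cancels the factor \<open>vol T\<close>.\<close>

definition Qval where
  "Qval \<phi> T = mu \<phi> T + (\<Sum>z\<in>IV \<inter> vertices T. kap \<phi> z / star_measure_sum z)"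

lemma Q_op_eq:
  assumes \<phi>: "\<phi> \<in> Hm1 \<Omega>"
  shows "Q_op \<Omega> \<T> \<phi> = piecewise (Qval \<phi>)"
proof -
  have "mean_value (adj \<phi>) T = Qval \<phi> T" if T: "T \<in> \<T>" for T
  proof -
    let ?I = "IV \<inter> vertices T"
    let ?k = "\<lambda>z. vol T * kap \<phi> z / star_measure_sum z"
    have d: "(LINT x|lebesgue_on T. dual_hat \<T> T z x) = 1" "integrable (lebesgue_on T) (dual_hat \<T> T z)" if "z \<in> ?I" for z
    proof -
      have "affine_fun_on UNIV (\<lambda>_::'a. 1)" unfolding affine_fun_on_def by (intro exI[of _ 0] exI[of _ 1]) simp
      then show "(LINT x|lebesgue_on T. dual_hat \<T> T z x) = 1" using dual_hat(2)[OF T, of z "\<lambda>_. 1"] that by (simp add: L2_inner_def)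
      show "integrable (lebesgue_on T) (dual_hat \<T> T z)"
        using L2_element_integrable[OF continuous_L2[OF T affine_continuous[OF dual_hat(1)[OF T]]] T] that by simp
    qed
    have "(LINT x|lebesgue_on T. adj \<phi> x) = (LINT x|lebesgue_on T. mu \<phi> T + (\<Sum>z\<in>?I. ?k z * dual_hat \<T> T z x))"
      by (rule Bochner_Integration.integral_cong[OF refl]) (simp add: adj_on[OF T])
    also have "\<dots> = (LINT x|lebesgue_on T. mu \<phi> T) + (LINT x|lebesgue_on T. (\<Sum>z\<in>?I. ?k z * dual_hat \<T> T z x))"
      using d(2) L2_element_integrable[OF continuous_L2[OF T] T, of "\<lambda>_. mu \<phi> T"]
      by (intro Bochner_Integration.integral_add Bochner_Integration.integrable_sum) auto
    also have "(LINT x|lebesgue_on T. (\<Sum>z\<in>?I. ?k z * dual_hat \<T> T z x)) = (\<Sum>z\<in>?I. LINT x|lebesgue_on T. ?k z * dual_hat \<T> T z x)"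
      using d(2) by (intro Bochner_Integration.integral_sum) auto
    also have "\<dots> = (\<Sum>z\<in>?I. ?k z)" using d(1) by (intro sum.cong) auto
    also have "(LINT x|lebesgue_on T. mu \<phi> T) = vol T * mu \<phi> T" using element(5)[OF T] by (simp add: measure_restrict_space fmeasurable_def)
    also have "vol T * mu \<phi> T + (\<Sum>z\<in>?I. ?k z) = vol T * Qval \<phi> T"
      by (simp add: Qval_def distrib_left sum_distrib_left)
    finally show ?thesis using element(8)[OF T] by (simp add: mean_value_def)
  qed
  then show ?thesis
    unfolding Q_op_def P_adj_eq[OF \<phi>] proj0_eq[OF P1_L2[OF adj_P1]] piecewise_def by (intro ext sum.cong) auto
qed

text \<open>Valid for every \<open>L2\<close> function \<open>f\<close>, although
  \<open>P_adj\<close> is specified by elements of \<open>H10\<close> only: the left side sees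
  \<open>f\<close> through its element integrals, just as \<open>Qd\<close> does.\<close>

lemma Q_op_inner:
  assumes \<phi>: "\<phi> \<in> Hm1 \<Omega>" and f: "f \<in> L2 \<Omega>"
  shows "L2_inner \<Omega> (Q_op \<Omega> \<T> \<phi>) f = \<phi> (Qd f)"
proof -
  let ?I = "\<lambda>T. IV \<inter> vertices T" and ?F = "\<lambda>T. LINT x|lebesgue_on T. f x"
  have "Qd f = (\<lambda>x. (\<Sum>z\<in>IV. vcoef f z * hat \<T> z x) +
      (\<Sum>T\<in>\<T>. (?F T - (\<Sum>z\<in>IV. vcoef f z * hat_int z T)) / bubble_int T * bubble \<T> T x))"
    by (rule ext) (simp add: Qd_def bcoef_def)
  then have "\<phi> (Qd f) = (\<Sum>T\<in>\<T>. mu \<phi> T * ?F T) + (\<Sum>z\<in>IV. vcoef f z * kap \<phi> z)"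
    using functional_expand[OF \<phi>] by simp
  also have "(\<Sum>z\<in>IV. vcoef f z * kap \<phi> z) = (\<Sum>z\<in>IV. \<Sum>T\<in>star z. kap \<phi> z / star_measure_sum z * ?F T)"
    by (rule sum.cong[OF refl]) (simp add: vcoef_def interior_vertices_eq sum_divide_distrib sum_distrib_right sum_distrib_left mult_ac)
  also have "\<dots> = (\<Sum>T\<in>\<T>. \<Sum>z\<in>?I T. kap \<phi> z / star_measure_sum z * ?F T)" by (rule sum_star_swap)
  also have "(\<Sum>T\<in>\<T>. mu \<phi> T * ?F T) + \<dots> = (\<Sum>T\<in>\<T>. Qval \<phi> T * ?F T)"
    by (simp add: Qval_def distrib_right sum_distrib_right sum.distrib)
  finally show ?thesis by (simp add: Q_op_eq[OF \<phi>] L2_inner_piecewise[OF f])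
qed

lemma Qval_eq:
  assumes \<phi>: "\<phi> \<in> Hm1 \<Omega>" and T: "T \<in> \<T>"
  shows "Qval \<phi> T * vol T = \<phi> (Qd (indicator T))"
proof -
  have "\<phi> (Qd (indicator T)) = (\<Sum>T'\<in>\<T>. Qval \<phi> T' * (if T' = T then vol T else 0))"
    unfolding Q_op_inner[OF \<phi> indicator_L2[OF T], symmetric] Q_op_eq[OF \<phi>] L2_inner_piecewise[OF indicator_L2[OF T]]
    by (rule sum.cong[OF refl]) (simp only: integral_indicator_element[OF T])
  then show ?thesis using finite_mesh T by (simp add: if_distrib[of "\<lambda>t. _ * t"] cong: if_cong)
qed

lemma Q_op_L2: "\<phi> \<in> Hm1 \<Omega> \<Longrightarrow> Q_op \<Omega> \<T> \<phi> \<in> L2 \<Omega>"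
  and Q_op_P0: "\<phi> \<in> Hm1 \<Omega> \<Longrightarrow> Q_op \<Omega> \<T> \<phi> \<in> P0 \<T>"
  by (simp_all add: Q_op_eq piecewise_L2 piecewise_P0)

text \<open>The bubble of \<open>T\<close> vanishes on all other elements, and its coefficient is
  chosen to restore the integral over \<open>T\<close>.\<close>

lemma Qd_integral:
  assumes T: "T \<in> \<T>"
  shows "(LINT x|lebesgue_on T. Qd f x) = (LINT x|lebesgue_on T. f x)"
proof -
  have ib: "integrable (lebesgue_on T) (bubble \<T> T)"
    using L2_element_integrable[OF L2_element[OF H10D(1)[OF bubble_domain_H10[OF T]] T] T] .
  have ih: "integrable (lebesgue_on T) (\<lambda>x. \<Sum>z\<in>IV. vcoef f z * hat \<T> z x)"
    using hat_integrable T by (intro Bochner_Integration.integrable_sum) auto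
  have "(LINT x|lebesgue_on T. Qd f x) = (LINT x|lebesgue_on T. (\<Sum>z\<in>IV. vcoef f z * hat \<T> z x) + bcoef f T * bubble \<T> T x)"
  proof (rule Bochner_Integration.integral_cong[OF refl])
    fix x assume "x \<in> space (lebesgue_on T)"
    then have x: "x \<in> T" by simp
    have nT: "x \<notin> T'" if "T' \<in> \<T>" "T' \<noteq> T" for T' using elements_disjoint[OF T that(1) x] that closure_subset by blast
    have "(\<Sum>T'\<in>\<T>. bcoef f T' * bubble \<T> T' x) = (\<Sum>T'\<in>\<T>. if T' = T then bcoef f T * bubble \<T> T x else 0)"
      using nT by (intro sum.cong) (auto simp: bubble_eq)
    then show "Qd f x = (\<Sum>z\<in>IV. vcoef f z * hat \<T> z x) + bcoef f T * bubble \<T> T x"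
      using finite_mesh T by (simp add: Qd_def)
  qed
  also have "\<dots> = (LINT x|lebesgue_on T. (\<Sum>z\<in>IV. vcoef f z * hat \<T> z x)) + (LINT x|lebesgue_on T. bcoef f T * bubble \<T> T x)"
    using ib ih by (intro Bochner_Integration.integral_add) auto
  also have "(LINT x|lebesgue_on T. (\<Sum>z\<in>IV. vcoef f z * hat \<T> z x)) = (\<Sum>z\<in>IV. vcoef f z * hat_int z T)"
    by (subst Bochner_Integration.integral_sum) (use hat_integrable T in \<open>auto simp: hat_int_def\<close>)
  finally show ?thesis using bubble_int_pos[OF T] by (simp add: bcoef_def bubble_int_def)
qed

text \<open>By transposition the second application pairs \<open>Q_op\<close> of \<phi> with
  \<open>Qd\<close> of an indicator. The former is constant on elements and \<open>Qd\<close>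
  preserves integrals over them, so \<open>Qd\<close> may be dropped.\<close>

lemma Q_op_idempotent:
  assumes \<phi>: "\<phi> \<in> Hm1 \<Omega>"
  shows "Q_op \<Omega> \<T> (L2_functional \<Omega> (Q_op \<Omega> \<T> \<phi>)) = Q_op \<Omega> \<T> \<phi>"
proof -
  let ?\<psi> = "L2_functional \<Omega> (Q_op \<Omega> \<T> \<phi>)"
  have \<psi>: "?\<psi> \<in> Hm1 \<Omega>" by (rule L2_functional_Hm1[OF domain(1,2) Q_op_L2[OF \<phi>]])
  have "Qval ?\<psi> T = Qval \<phi> T" if T: "T \<in> \<T>" for T
  proof -
    have "Qval ?\<psi> T * vol T = ?\<psi> (Qd (indicator T))" by (rule Qval_eq[OF \<psi> T])
    also have "\<dots> = (\<Sum>T'\<in>\<T>. Qval \<phi> T' * (LINT x|lebesgue_on T'. indicator T x))"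
      unfolding L2_functional_def Q_op_eq[OF \<phi>] L2_inner_piecewise[OF H10D(1)[OF Qd_H10_domain(1)]]
      by (rule sum.cong[OF refl]) (simp only: Qd_integral)
    also have "\<dots> = Qval \<phi> T * vol T"
      unfolding Qval_eq[OF \<phi> T] Q_op_inner[OF \<phi> indicator_L2[OF T], symmetric] Q_op_eq[OF \<phi>] L2_inner_piecewise[OF indicator_L2[OF T]] ..
    finally show ?thesis using element(8)[OF T] by simp
  qed
  then have "piecewise (Qval ?\<psi>) = piecewise (Qval \<phi>)" unfolding piecewise_def by (intro ext sum.cong) auto
  then show ?thesis using Q_op_eq[OF \<phi>] Q_op_eq[OF \<psi>] by simp
qed

end

section \<open>Assembly of the approximation and stability estimates\<close>

section \<open>Approximation and boundedness\<close>

text \<open>The square of the factor from \<open>vcoef_test\<close> times the constant inside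
  \<open>star_error\<close>.\<close>

definition jump_const :: "nat \<Rightarrow> real \<Rightarrow> real" where
  "jump_const d \<sigma> = (2 * real ((star_const d \<sigma>)\<^sup>2) + 1)\<^sup>2 * error_const d \<sigma>"

text \<open>Number of vertices of an element times the largest number of elements at a vertex: it
  counts how often an element occurs in stars of others, and it bounds the number of
  neighbours.\<close>

definition overlap_const :: "nat \<Rightarrow> real \<Rightarrow> real" where
  "overlap_const d \<sigma> = (real d + 1) * real (star_const d \<sigma>)"

definition volume_const :: "nat \<Rightarrow> real \<Rightarrow> real" where
  "volume_const d \<sigma> = unit_ball_vol (real d) * size_const d \<sigma> ^ d * \<sigma>"

text \<open>The term with \<open>2 ^ d\<close> is from the Poincare inequality, the other from the
  distance of \<open>Qd\<close> to the mean. The factors 2 are from squaring a sum, and the overlap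
  is from summation over the mesh.\<close>

definition approx_const :: "nat \<Rightarrow> real \<Rightarrow> real" where
  "approx_const d \<sigma> = sqrt ((2 * 2 ^ d + 2 * ((value_const d)\<^sup>2 * jump_const d \<sigma>)) * overlap_const d \<sigma>)"

definition global_const :: "nat \<Rightarrow> real \<Rightarrow> real" where
  "global_const d \<sigma> = sqrt ((slope_const d \<sigma>)\<^sup>2 * jump_const d \<sigma> * overlap_const d \<sigma>)"

text \<open>The pointwise bound for \<open>Qd\<close> of an indicator, times the square root of the
  number of elements in its support and of their volume ratio.\<close>

definition local_const :: "nat \<Rightarrow> real \<Rightarrow> real" where
  "local_const d \<sigma> = (value_const d + 1) * sqrt (overlap_const d \<sigma> * volume_const d \<sigma>)"

text \<open>The factor 2 is from the Friedrichs inequality on an element with twice its diameter, as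
  that inequality needs a number strictly above the diameter.\<close>

definition local_dual_const :: "nat \<Rightarrow> real \<Rightarrow> real" where
  "local_dual_const d \<sigma> = 2 * (slope_const d \<sigma> * size_const d \<sigma> * sqrt (overlap_const d \<sigma> * volume_const d \<sigma>))"

lemma value_const_pos: "0 < value_const d"
  using bubble_const_pos[of d] by (simp add: value_const_def add_pos_pos)

lemma slope_const_pos: "0 < slope_const d \<sigma>"
  unfolding slope_const_def using value_const_pos[of d] grad_const_ge_1[of d \<sigma>] by (intro mult_pos_pos) auto

lemma cancel_sqrt:
  fixes q :: real
  assumes "0 < m" "q * m \<le> a * (b * sqrt m)"
  shows "q * sqrt m \<le> a * b"
proof -
  have "(q * sqrt m) * sqrt m \<le> (a * b) * sqrt m" using assms by (simp add: mult.assoc)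
  then show ?thesis using assms(1) by (simp add: mult_right_le_imp_le)
qed

context shape_mesh
begin

lemma consts_nonneg: "0 \<le> error_const DIM('a) \<sigma>" "0 \<le> jump_const DIM('a) \<sigma>" "0 \<le> overlap_const DIM('a) \<sigma>" "0 \<le> volume_const DIM('a) \<sigma>"
  using \<sigma>_pos size_const_ge_1[of "DIM('a)" \<sigma>] unfolding error_const_def jump_const_def overlap_const_def volume_const_def
  by (auto intro!: mult_nonneg_nonneg)

lemma piecewise_integral_bound:
  assumes \<U>: "\<U> \<subseteq> \<Omega>" "\<U> \<in> sets lebesgue" and g: "integrable (lebesgue_on \<U>) g"
    and c: "\<And>T. T \<in> \<T> \<Longrightarrow> 0 \<le> c T" and b: "AE x in lebesgue_on \<U>. x \<in> \<Union>\<T> \<longrightarrow> g x \<le> piecewise c x"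
  shows "(LINT x|lebesgue_on \<U>. g x) \<le> (\<Sum>T\<in>\<T>. c T * vol T)"
proof -
  have "AE x in lebesgue. x \<notin> \<Omega> - \<Union>\<T>"
    using mesh_cover_ae by (subst AE_iff_null_sets[symmetric]) (auto simp: negligible_iff_null_sets)
  then have "AE x in lebesgue_on \<U>. x \<in> \<Union>\<T>"
    using \<U> by (auto simp: AE_restrict_space_iff elim!: eventually_mono)
  with b have ae: "AE x in lebesgue_on \<U>. g x \<le> piecewise c x" by eventually_elim simp
  have c0: "0 \<le> piecewise c x" for x unfolding piecewise_def using c by (intro sum_nonneg) auto
  have i: "integrable (lebesgue_on \<Omega>) (piecewise c)"
    using L2_inner_integrable[OF piecewise_L2[of c] piecewise_L2[of "\<lambda>_. 1"]] L2_inner_integrable[OF piecewise_L2[of c] L2_bounded(1)[OF domain_lmeasurable(1), of "\<lambda>_. 1" 1]] by simp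
  have "(LINT x|lebesgue_on \<U>. g x) \<le> (LINT x|lebesgue_on \<U>. piecewise c x)"
    by (rule integral_mono_AE[OF g integrable_lebesgue_on_subset[OF i \<U> domain_lmeasurable(2)] ae])
  also have "\<dots> \<le> (LINT x|lebesgue_on \<Omega>. piecewise c x)"
  proof -
    have "(LINT x|lebesgue_on \<U>. piecewise c x) = (LINT x|lebesgue. indicator \<U> x *\<^sub>R piecewise c x)"
      using \<U>(2) by (simp add: integral_restrict_space)
    also have "\<dots> \<le> (LINT x|lebesgue. indicator \<Omega> x *\<^sub>R piecewise c x)"
    proof (rule integral_mono_AE')
      show "integrable lebesgue (\<lambda>x. indicator \<Omega> x *\<^sub>R piecewise c x)"
        using i domain_lmeasurable(2) by (simp add: integrable_restrict_space)
    qed (use \<U>(1) c0 in \<open>auto intro!: AE_I2 simp: indicator_def\<close>)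
    also have "\<dots> = (LINT x|lebesgue_on \<Omega>. piecewise c x)"
      using domain_lmeasurable(2) by (simp add: integral_restrict_space)
    finally show ?thesis .
  qed
  also have "\<dots> = (\<Sum>T\<in>\<T>. LINT x|lebesgue_on T. piecewise c x)" by (rule integral_mesh[OF i])
  also have "\<dots> = (\<Sum>T\<in>\<T>. LINT x|lebesgue_on T. c T)"
    by (intro sum.cong Bochner_Integration.integral_cong refl) (auto simp: piecewise_on)
  also have "\<dots> = (\<Sum>T\<in>\<T>. c T * vol T)"
    using element(5) by (intro sum.cong) (auto simp: measure_restrict_space fmeasurable_def)
  finally show ?thesis .
qed

definition star_energy where
  "star_energy f T = (\<Sum>v\<in>vertices T. \<Sum>T'\<in>star v. grad_energy f T')"

lemma star_energy_nonneg: "0 \<le> star_energy f T"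
  unfolding star_energy_def by (intro sum_nonneg grad_energy_nonneg)

lemma star_energy_ge: "T \<in> \<T> \<Longrightarrow> v \<in> vertices T \<Longrightarrow> (\<Sum>T'\<in>star v. grad_energy f T') \<le> star_energy f T"
  unfolding star_energy_def using element(10)
  by (intro member_le_sum[of v _ "\<lambda>v. \<Sum>T'\<in>star v. grad_energy f T'"]) (auto intro!: sum_nonneg grad_energy_nonneg)

lemma grad_energy_le: "T \<in> \<T> \<Longrightarrow> grad_energy f T \<le> star_energy f T"
proof -
  assume T: "T \<in> \<T>"
  obtain v where v: "v \<in> vertices T" using element(11)[OF T] by fastforce
  have "grad_energy f T \<le> (\<Sum>T'\<in>star v. grad_energy f T')"
    using T v star_finite grad_energy_nonneg by (intro member_le_sum) (auto simp: star_def)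
  then show ?thesis using star_energy_ge[OF T v, of f] by linarith
qed

text \<open>Double counting: the energy of an element occurs once for each of its vertices and each
  element at that vertex.\<close>

lemma sum_star_energy:
  assumes f: "f \<in> test_functions \<Omega>"
  shows "(\<Sum>T\<in>\<T>. star_energy f T) \<le> overlap_const DIM('a) \<sigma> * (L2_norm \<Omega> (grad f))\<^sup>2"
proof -
  let ?e = "grad_energy f"
  have "(\<Sum>T\<in>\<T>. star_energy f T) = (\<Sum>T\<in>\<T>. \<Sum>v\<in>vertices T. \<Sum>T'\<in>\<T>. if v \<in> vertices T' then ?e T' else 0)"
    using finite_mesh by (simp add: star_energy_def star_def sum.inter_filter)
  also have "\<dots> = (\<Sum>T\<in>\<T>. \<Sum>T'\<in>\<T>. \<Sum>v\<in>vertices T. if v \<in> vertices T' then ?e T' else 0)"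
    by (intro sum.cong refl sum.swap)
  also have "\<dots> = (\<Sum>T'\<in>\<T>. \<Sum>T\<in>\<T>. \<Sum>v\<in>vertices T. if v \<in> vertices T' then ?e T' else 0)" by (rule sum.swap)
  also have "\<dots> = (\<Sum>T'\<in>\<T>. \<Sum>T\<in>\<T>. \<Sum>v\<in>vertices T'. if v \<in> vertices T then ?e T' else 0)"
  proof (rule sum.cong[OF refl], rule sum.cong[OF refl])
    fix T' T assume "T' \<in> \<T>" "T \<in> \<T>"
    then show "(\<Sum>v\<in>vertices T. if v \<in> vertices T' then ?e T' else 0) = (\<Sum>v\<in>vertices T'. if v \<in> vertices T then ?e T' else 0)"
      using sum.inter_restrict[OF element(10), of T "\<lambda>_. ?e T'" "vertices T'"] sum.inter_restrict[OF element(10), of T' "\<lambda>_. ?e T'" "vertices T"]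
      by (simp add: Int_commute)
  qed
  also have "\<dots> = (\<Sum>T'\<in>\<T>. \<Sum>v\<in>vertices T'. \<Sum>T\<in>\<T>. if v \<in> vertices T then ?e T' else 0)"
    by (intro sum.cong refl sum.swap)
  also have "\<dots> = (\<Sum>T'\<in>\<T>. \<Sum>v\<in>vertices T'. real (card (star v)) * ?e T')"
    using finite_mesh by (simp add: star_def sum.inter_filter[symmetric])
  also have "\<dots> \<le> (\<Sum>T'\<in>\<T>. \<Sum>v\<in>vertices T'. real (star_const DIM('a) \<sigma>) * ?e T')"
    by (intro sum_mono mult_right_mono grad_energy_nonneg) (simp add: card_star)
  also have "\<dots> = overlap_const DIM('a) \<sigma> * (\<Sum>T'\<in>\<T>. ?e T')"
    using element(11) by (simp add: overlap_const_def sum_distrib_left sum_distrib_right mult_ac add.commute)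
  also have "(\<Sum>T'\<in>\<T>. ?e T') = (L2_norm \<Omega> (grad f))\<^sup>2"
    unfolding grad_energy_def L2_norm_power2
    by (rule integral_mesh[symmetric]) (rule L2D(2)[OF test_functions_L2(2)[OF f domain_lmeasurable(2)]])
  finally show ?thesis .
qed

text \<open>One bound for all vertices of \<open>T\<close>, with the energies of their stars added
  up.\<close>

definition jump where
  "jump f T = diameter T * sqrt (jump_const DIM('a) \<sigma> * star_energy f T / vol T)"

lemma jump_power2: "T \<in> \<T> \<Longrightarrow> (jump f T)\<^sup>2 * vol T = jump_const DIM('a) \<sigma> * ((diameter T)\<^sup>2 * star_energy f T)"
  using element(8)[of T] consts_nonneg(2) star_energy_nonneg[of f T] by (simp add: jump_def power_mult_distrib)

lemma vcoef_jump:
  assumes f: "f \<in> test_functions \<Omega>" and T: "T \<in> \<T>" and v: "v \<in> vertices T"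
  shows "\<bar>vcoef f v - mean_value f T\<bar> \<le> jump f T"
proof -
  let ?c = "2 * real ((star_const DIM('a) \<sigma>)\<^sup>2) + 1" and ?m = "vol T"
  have c0: "0 \<le> ?c" by simp
  have "\<bar>vcoef f v - mean_value f T\<bar> \<le> ?c * star_error f T v" by (rule vcoef_test[OF f T v])
  also have "\<dots> \<le> ?c * (diameter T * sqrt (error_const DIM('a) \<sigma> * star_energy f T / ?m))"
    unfolding star_error_def using element(8,9)[OF T] star_energy_ge[OF T v] consts_nonneg(1)
    by (intro mult_left_mono real_sqrt_le_mono divide_right_mono c0) auto
  also have "\<dots> = diameter T * (?c * sqrt (error_const DIM('a) \<sigma> * star_energy f T / ?m))" by (simp only: mult_ac)
  also have "?c * sqrt (error_const DIM('a) \<sigma> * star_energy f T / ?m) = sqrt (?c\<^sup>2 * (error_const DIM('a) \<sigma> * star_energy f T / ?m))"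
    using c0 by (subst real_sqrt_mult) simp
  finally show ?thesis by (simp add: jump_def jump_const_def mult.assoc)
qed

text \<open>On each element the inverse diameter in the slope bound cancels the diameter in
  \<open>jump\<close>, so only energies are summed.\<close>

lemma Qd_gradient_bound:
  assumes f: "f \<in> test_functions \<Omega>"
  shows "L2_norm \<Omega> (weak_gradient \<Omega> (Qd f)) \<le> global_const DIM('a) \<sigma> * L2_norm \<Omega> (grad f)"
proof -
  let ?s = "slope_const DIM('a) \<sigma>"
  have "(L2_norm \<Omega> (weak_gradient \<Omega> (Qd f)))\<^sup>2 \<le> (\<Sum>T\<in>\<T>. (?s * jump f T / diameter T)\<^sup>2 * vol T)"
    unfolding L2_norm_power2
  proof (rule piecewise_integral_bound[OF subset_refl domain_lmeasurable(2) L2D(2)[OF H10D(2)[OF Qd_H10_domain(1)]]])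
    show "AE x in lebesgue_on \<Omega>. x \<in> \<Union>\<T> \<longrightarrow> (norm (weak_gradient \<Omega> (Qd f) x))\<^sup>2 \<le> piecewise (\<lambda>T. (?s * jump f T / diameter T)\<^sup>2) x"
      using Qd_H10_domain(2)[of f]
    proof eventually_elim
      case (elim x)
      show ?case
      proof
        assume "x \<in> \<Union>\<T>"
        then obtain T where T: "T \<in> \<T>" "x \<in> T" by blast
        show "(norm (weak_gradient \<Omega> (Qd f) x))\<^sup>2 \<le> piecewise (\<lambda>T. (?s * jump f T / diameter T)\<^sup>2) x"
          unfolding piecewise_on[OF T] elim
          by (intro power_mono norm_ge_zero Qd_element_bounds(2)[OF T]) (rule vcoef_jump[OF f T(1)])
      qed
    qed
  qed simp
  also have "\<dots> = (\<Sum>T\<in>\<T>. ?s\<^sup>2 * jump_const DIM('a) \<sigma> * star_energy f T)"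
  proof (rule sum.cong[OF refl])
    fix T assume T: "T \<in> \<T>"
    have "(?s * jump f T / diameter T)\<^sup>2 * vol T = ?s\<^sup>2 * ((jump f T)\<^sup>2 * vol T) / (diameter T)\<^sup>2"
      by (simp add: power_mult_distrib power_divide)
    then show "(?s * jump f T / diameter T)\<^sup>2 * vol T = ?s\<^sup>2 * jump_const DIM('a) \<sigma> * star_energy f T"
      unfolding jump_power2[OF T] using element(9)[OF T] by simp
  qed
  also have "\<dots> = ?s\<^sup>2 * jump_const DIM('a) \<sigma> * (\<Sum>T\<in>\<T>. star_energy f T)" by (simp add: sum_distrib_left)
  also have "\<dots> \<le> ?s\<^sup>2 * jump_const DIM('a) \<sigma> * (overlap_const DIM('a) \<sigma> * (L2_norm \<Omega> (grad f))\<^sup>2)"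
    using consts_nonneg(2) by (intro mult_left_mono sum_star_energy[OF f]) auto
  also have "\<dots> = (global_const DIM('a) \<sigma> * L2_norm \<Omega> (grad f))\<^sup>2"
    using consts_nonneg by (simp add: global_const_def power_mult_distrib)
  finally show ?thesis
    by (rule power2_le_imp_le) (use consts_nonneg in \<open>auto simp: global_const_def L2_norm_nonneg intro!: mult_nonneg_nonneg\<close>)
qed

lemma Q_op_bounded:
  assumes \<phi>: "\<phi> \<in> Hm1 \<Omega>"
  shows "Hm1_norm \<Omega> (L2_functional \<Omega> (Q_op \<Omega> \<T> \<phi>)) \<le> ereal (global_const DIM('a) \<sigma>) * Hm1_norm \<Omega> \<phi>"
proof -
  obtain N where N: "0 \<le> N" "Hm1_norm \<Omega> \<phi> = ereal N" "\<And>u. u \<in> H10 \<Omega> \<Longrightarrow> \<bar>\<phi> u\<bar> \<le> N * L2_norm \<Omega> (weak_gradient \<Omega> u)"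
    by (rule Hm1_norm_real[OF domain(1,3) \<phi>]) blast
  have g0: "0 \<le> global_const DIM('a) \<sigma>" using consts_nonneg by (auto simp: global_const_def intro!: mult_nonneg_nonneg)
  have "Hm1_norm \<Omega> (L2_functional \<Omega> (Q_op \<Omega> \<T> \<phi>)) \<le> ereal (global_const DIM('a) \<sigma> * N)"
  proof (rule Hm1_norm_L2_le[OF domain(1) Q_op_L2[OF \<phi>]])
    show "0 \<le> global_const DIM('a) \<sigma> * N" using g0 N(1) by simp
    fix f assume f: "f \<in> test_functions \<Omega>"
    have "L2_inner \<Omega> (Q_op \<Omega> \<T> \<phi>) f = \<phi> (Qd f)"
      by (rule Q_op_inner[OF \<phi> test_functions_L2(1)[OF f domain_lmeasurable(2)]])
    also have "\<dots> \<le> N * L2_norm \<Omega> (weak_gradient \<Omega> (Qd f))" using N(3)[OF Qd_H10_domain(1), of f] by linarith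
    also have "\<dots> \<le> N * (global_const DIM('a) \<sigma> * L2_norm \<Omega> (grad f))" by (intro mult_left_mono Qd_gradient_bound f N(1))
    finally show "L2_inner \<Omega> (Q_op \<Omega> \<T> \<phi>) f \<le> global_const DIM('a) \<sigma> * N * L2_norm \<Omega> (grad f)" by (simp add: mult_ac)
  qed
  then show ?thesis by (simp add: N(2))
qed

text \<open>The mean value is inserted: the Poincare inequality controls its distance to
  \<open>f\<close>, and the value bound on the element controls its distance to
  \<open>Qd f\<close>.\<close>

lemma Qd_approximation:
  assumes f: "f \<in> test_functions \<Omega>" and T: "T \<in> \<T>"
  shows "(L2_norm T (\<lambda>x. f x - Qd f x))\<^sup>2 \<le> (2 * 2 ^ DIM('a) + 2 * ((value_const DIM('a))\<^sup>2 * jump_const DIM('a) \<sigma>)) * ((diameter T)\<^sup>2 * star_energy f T)"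
proof -
  let ?c = "mean_value f T" and ?h = "diameter T" and ?m = "vol T" and ?v = "value_const DIM('a)"
  have fL: "f \<in> L2 T" by (rule test_functions_L2(1)[OF f element(6)[OF T]])
  have QL: "Qd f \<in> L2 T" by (rule L2_element[OF H10D(1)[OF Qd_H10_domain(1)] T])
  have cL: "(\<lambda>_. ?c) \<in> L2 T" by (rule continuous_L2[OF T]) simp
  have i1: "integrable (lebesgue_on T) (\<lambda>x. (f x - ?c)\<^sup>2)" using L2D(2)[OF L2_diff[OF fL cL]] by simp
  have i2: "integrable (lebesgue_on T) (\<lambda>x. (f x - Qd f x)\<^sup>2)" using L2D(2)[OF L2_diff[OF fL QL]] by simp
  have ic: "integrable (lebesgue_on T) (\<lambda>x. (?v * jump f T)\<^sup>2)" by (rule L2_element_integrable[OF continuous_L2[OF T] T]) simp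
  have "(L2_norm T (\<lambda>x. f x - Qd f x))\<^sup>2 = (LINT x|lebesgue_on T. (f x - Qd f x)\<^sup>2)" by (simp add: L2_norm_power2)
  also have "\<dots> \<le> (LINT x|lebesgue_on T. 2 * (f x - ?c)\<^sup>2 + 2 * (?v * jump f T)\<^sup>2)"
  proof (rule integral_mono)
    show "integrable (lebesgue_on T) (\<lambda>x. 2 * (f x - ?c)\<^sup>2 + 2 * (?v * jump f T)\<^sup>2)" using i1 ic by simp
    fix x assume "x \<in> space (lebesgue_on T)"
    then have x: "x \<in> T" by simp
    have "\<bar>Qd f x - ?c\<bar> \<le> ?v * jump f T"
      by (rule Qd_element_bounds(1)[OF T x vcoef_jump[OF f T]])
    then have "(Qd f x - ?c)\<^sup>2 \<le> (?v * jump f T)\<^sup>2" by (simp add: abs_le_square_iff[symmetric])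
    moreover have "(f x - Qd f x)\<^sup>2 \<le> 2 * (f x - ?c)\<^sup>2 + 2 * (Qd f x - ?c)\<^sup>2"
      using zero_le_power2[of "(f x - ?c) + (Qd f x - ?c)"] by (simp add: power2_eq_square algebra_simps)
    ultimately show "(f x - Qd f x)\<^sup>2 \<le> 2 * (f x - ?c)\<^sup>2 + 2 * (?v * jump f T)\<^sup>2" by linarith
  qed (rule i2)
  also have "\<dots> = 2 * (LINT x|lebesgue_on T. (f x - ?c)\<^sup>2) + 2 * ((?v * jump f T)\<^sup>2 * ?m)"
    using i1 ic element(5)[OF T] by (simp add: measure_restrict_space fmeasurable_def)
  also have "(LINT x|lebesgue_on T. (f x - ?c)\<^sup>2) \<le> 2 ^ DIM('a) * ?h\<^sup>2 * grad_energy f T"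
    unfolding mean_value_def grad_energy_def
    by (rule Poincare_convex[OF f element(2,1,3,4)[OF T]]) (metis diameter_bounded_bound dist_norm element(3)[OF T])
  also have "2 ^ DIM('a) * ?h\<^sup>2 * grad_energy f T \<le> 2 ^ DIM('a) * ?h\<^sup>2 * star_energy f T"
    by (intro mult_left_mono grad_energy_le[OF T]) auto
  also have "(?v * jump f T)\<^sup>2 * ?m = ?v\<^sup>2 * (jump_const DIM('a) \<sigma> * (?h\<^sup>2 * star_energy f T))"
    unfolding jump_power2[OF T, symmetric] by (simp add: power_mult_distrib)
  finally show ?thesis by (simp add: algebra_simps)
qed

lemma mesh_size_eq: "mesh_size \<T> = piecewise diameter"
  by (rule ext) (simp add: mesh_size_def piecewise_def mult.commute)

lemma mesh_size_norm:
  assumes \<phi>: "\<phi> \<in> L2 \<Omega>"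
  shows "(L2_norm \<Omega> (\<lambda>x. mesh_size \<T> x * \<phi> x))\<^sup>2 = (\<Sum>T\<in>\<T>. (diameter T * L2_norm T \<phi>)\<^sup>2)"
proof -
  let ?B = "\<Sum>T\<in>\<T>. \<bar>diameter T\<bar>"
  have "\<bar>piecewise diameter x\<bar> \<le> ?B" for x
    unfolding piecewise_def by (rule order_trans[OF sum_abs sum_mono]) (simp add: indicator_def)
  then have b: "(piecewise diameter x * \<phi> x)\<^sup>2 \<le> ?B\<^sup>2 * (\<phi> x)\<^sup>2" for x
    unfolding power_mult_distrib by (intro mult_right_mono) (simp_all add: abs_le_square_iff[symmetric])
  have "integrable (lebesgue_on \<Omega>) (\<lambda>x. (norm (mesh_size \<T> x * \<phi> x))\<^sup>2)"
  proof (rule Bochner_Integration.integrable_bound)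
    show "integrable (lebesgue_on \<Omega>) (\<lambda>x. ?B\<^sup>2 * (norm (\<phi> x))\<^sup>2)" using L2D(2)[OF \<phi>] by simp
    show "(\<lambda>x. (norm (mesh_size \<T> x * \<phi> x))\<^sup>2) \<in> borel_measurable (lebesgue_on \<Omega>)"
      unfolding mesh_size_eq using L2D(1)[OF \<phi>] L2D(1)[OF piecewise_L2] by measurable
  qed (use b in \<open>simp add: mesh_size_eq\<close>)
  then have "(L2_norm \<Omega> (\<lambda>x. mesh_size \<T> x * \<phi> x))\<^sup>2 = (\<Sum>T\<in>\<T>. LINT x|lebesgue_on T. (norm (mesh_size \<T> x * \<phi> x))\<^sup>2)"
    unfolding L2_norm_power2 by (rule integral_mesh)
  also have "\<dots> = (\<Sum>T\<in>\<T>. LINT x|lebesgue_on T. (diameter T)\<^sup>2 * (norm (\<phi> x))\<^sup>2)"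
    by (intro sum.cong Bochner_Integration.integral_cong refl) (auto simp: mesh_size_eq piecewise_on power_mult_distrib)
  finally show ?thesis by (simp add: power_mult_distrib L2_norm_power2)
qed

text \<open>By transposition the error tested with \<open>f\<close> is \<phi> tested with
  \<open>f - Qd f\<close>. Cauchy-Schwarz on each element leaves the diameter with \<phi>, and a
  second one over the finite mesh collects the norms.\<close>

lemma Q_op_approximation:
  assumes \<phi>: "\<phi> \<in> L2 \<Omega>"
  shows "Hm1_norm \<Omega> (\<lambda>v. L2_functional \<Omega> \<phi> v - L2_functional \<Omega> (Q_op \<Omega> \<T> (L2_functional \<Omega> \<phi>)) v)
    \<le> ereal (approx_const DIM('a) \<sigma> * L2_norm \<Omega> (\<lambda>x. mesh_size \<T> x * \<phi> x))"
proof -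
  let ?\<psi> = "L2_functional \<Omega> \<phi>" and ?q = "Q_op \<Omega> \<T> (L2_functional \<Omega> \<phi>)"
  let ?A = "2 * 2 ^ DIM('a) + 2 * ((value_const DIM('a))\<^sup>2 * jump_const DIM('a) \<sigma>)"
  have A0: "0 \<le> ?A" using consts_nonneg by simp
  have \<psi>: "?\<psi> \<in> Hm1 \<Omega>" by (rule L2_functional_Hm1[OF domain(1,2) \<phi>])
  note qL = Q_op_L2[OF \<psi>]
  have eq: "L2_functional \<Omega> \<phi> v - L2_functional \<Omega> ?q v = L2_functional \<Omega> (\<lambda>x. \<phi> x - ?q x) v" if "v \<in> L2 \<Omega>" for v
  proof -
    have "L2_functional \<Omega> \<phi> v - L2_functional \<Omega> q v = L2_functional \<Omega> (\<lambda>x. \<phi> x - q x) v" if "q \<in> L2 \<Omega>" for q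
      unfolding L2_functional_def L2_inner_def left_diff_distrib
      using L2_inner_integrable[OF \<phi> \<open>v \<in> L2 \<Omega>\<close>] L2_inner_integrable[OF that \<open>v \<in> L2 \<Omega>\<close>] by simp
    then show ?thesis using qL .
  qed
  \<comment> \<open>The two functionals are identified only for arguments in
    \<open>L2 \<Omega>\<close>, so they are exchanged under the supremum, whose arguments are in
    \<open>H10 \<Omega>\<close>.\<close>
  have "Hm1_norm \<Omega> (\<lambda>v. L2_functional \<Omega> \<phi> v - L2_functional \<Omega> ?q v) = Hm1_norm \<Omega> (L2_functional \<Omega> (\<lambda>x. \<phi> x - ?q x))"
    unfolding Hm1_norm_def by (rule SUP_cong[OF refl]) (use eq H10D(1) in auto)
  also have "\<dots> \<le> ereal (approx_const DIM('a) \<sigma> * L2_norm \<Omega> (\<lambda>x. mesh_size \<T> x * \<phi> x))"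
  proof (rule Hm1_norm_L2_le[OF domain(1) L2_diff[OF \<phi> qL]])
    show "0 \<le> approx_const DIM('a) \<sigma> * L2_norm \<Omega> (\<lambda>x. mesh_size \<T> x * \<phi> x)"
      unfolding approx_const_def using A0 consts_nonneg(3) by (intro mult_nonneg_nonneg L2_norm_nonneg real_sqrt_ge_zero) auto
    fix f assume f: "f \<in> test_functions \<Omega>"
    note fL = test_functions_L2(1)[OF f domain_lmeasurable(2)]
    note QL = H10D(1)[OF Qd_H10_domain(1), of f]
    let ?b = "\<lambda>T. sqrt (?A * star_energy f T)"
    have "L2_inner \<Omega> (\<lambda>x. \<phi> x - ?q x) f = L2_functional \<Omega> \<phi> f - L2_functional \<Omega> ?q f"
      unfolding eq[OF fL] by (simp add: L2_functional_def)
    also have "L2_functional \<Omega> ?q f = L2_functional \<Omega> \<phi> (Qd f)"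
      using Q_op_inner[OF \<psi> fL] by (simp add: L2_functional_def)
    also have "L2_functional \<Omega> \<phi> f - L2_functional \<Omega> \<phi> (Qd f) = (LINT x|lebesgue_on \<Omega>. \<phi> x * (f x - Qd f x))"
      unfolding L2_functional_def L2_inner_def right_diff_distrib
      using L2_inner_integrable[OF \<phi> fL] L2_inner_integrable[OF \<phi> QL] by simp
    also have "\<dots> = (\<Sum>T\<in>\<T>. LINT x|lebesgue_on T. \<phi> x * (f x - Qd f x))"
      by (rule integral_mesh) (use L2_inner_integrable[OF \<phi> L2_diff[OF fL QL]] in simp)
    also have "\<dots> \<le> (\<Sum>T\<in>\<T>. \<bar>diameter T * L2_norm T \<phi>\<bar> * \<bar>?b T\<bar>)"
    proof (rule sum_mono)
      fix T assume T: "T \<in> \<T>"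
      note h = element(9)[OF T]
      have "(LINT x|lebesgue_on T. \<phi> x * (f x - Qd f x)) \<le> L2_norm T \<phi> * L2_norm T (\<lambda>x. f x - Qd f x)"
        using L2_Cauchy_Schwarz[OF L2_element[OF \<phi> T] L2_element[OF L2_diff[OF fL QL] T]] by simp
      also have "L2_norm T (\<lambda>x. f x - Qd f x) \<le> sqrt (?A * ((diameter T)\<^sup>2 * star_energy f T))"
        using Qd_approximation[OF f T] by (rule real_le_rsqrt)
      also have "\<dots> = diameter T * ?b T" using h by (simp add: real_sqrt_mult)
      finally have "(LINT x|lebesgue_on T. \<phi> x * (f x - Qd f x)) \<le> L2_norm T \<phi> * (diameter T * ?b T)"
        by (simp add: mult_left_mono L2_norm_nonneg)
      also have "\<dots> = \<bar>diameter T * L2_norm T \<phi>\<bar> * \<bar>?b T\<bar>"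
        using h A0 star_energy_nonneg[of f T] L2_norm_nonneg[of T \<phi>] by (simp add: abs_mult)
      finally show "(LINT x|lebesgue_on T. \<phi> x * (f x - Qd f x)) \<le> \<bar>diameter T * L2_norm T \<phi>\<bar> * \<bar>?b T\<bar>" .
    qed
    also have "\<dots> \<le> L2_set (\<lambda>T. diameter T * L2_norm T \<phi>) \<T> * L2_set ?b \<T>" by (rule L2_set_mult_ineq)
    also have "L2_set (\<lambda>T. diameter T * L2_norm T \<phi>) \<T> = L2_norm \<Omega> (\<lambda>x. mesh_size \<T> x * \<phi> x)"
      unfolding L2_set_def mesh_size_norm[OF \<phi>, symmetric] by (simp add: L2_norm_nonneg)
    also have "L2_norm \<Omega> (\<lambda>x. mesh_size \<T> x * \<phi> x) * L2_set ?b \<T> \<le> L2_norm \<Omega> (\<lambda>x. mesh_size \<T> x * \<phi> x) * (approx_const DIM('a) \<sigma> * L2_norm \<Omega> (grad f))"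
    proof (rule mult_left_mono[OF _ L2_norm_nonneg])
      have "(\<Sum>T\<in>\<T>. (?b T)\<^sup>2) = ?A * (\<Sum>T\<in>\<T>. star_energy f T)"
        using A0 star_energy_nonneg by (simp add: sum_distrib_left)
      also have "\<dots> \<le> ?A * (overlap_const DIM('a) \<sigma> * (L2_norm \<Omega> (grad f))\<^sup>2)" by (intro mult_left_mono sum_star_energy f A0)
      finally have "L2_set ?b \<T> \<le> sqrt (?A * (overlap_const DIM('a) \<sigma> * (L2_norm \<Omega> (grad f))\<^sup>2))"
        unfolding L2_set_def by (rule real_sqrt_le_mono)
      also have "\<dots> = sqrt (?A * overlap_const DIM('a) \<sigma>) * sqrt ((L2_norm \<Omega> (grad f))\<^sup>2)"
        by (simp only: real_sqrt_mult mult.assoc)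
      also have "\<dots> = approx_const DIM('a) \<sigma> * L2_norm \<Omega> (grad f)"
        by (simp add: approx_const_def L2_norm_nonneg)
      finally show "L2_set ?b \<T> \<le> approx_const DIM('a) \<sigma> * L2_norm \<Omega> (grad f)" .
    qed
    finally show "L2_inner \<Omega> (\<lambda>x. \<phi> x - ?q x) f \<le> approx_const DIM('a) \<sigma> * L2_norm \<Omega> (\<lambda>x. mesh_size \<T> x * \<phi> x) * L2_norm \<Omega> (grad f)"
      by (simp only: mult_ac)
  qed
  finally show ?thesis .
qed

text \<open>The elements on which \<open>Qd\<close> of the indicator of \<open>T\<close> can be
  nonzero. Requiring a common interior vertex guarantees a facet chain to \<open>T\<close>, and with
  it comparable sizes; the remaining elements of the patch may touch \<open>T\<close> at boundary
  vertices alone.\<close>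

definition neighbours where
  "neighbours T = {T'\<in>\<T>. T' = T \<or> (\<exists>z\<in>vertices T \<inter> vertices T'. z \<in> \<Omega>)}"

lemma neighbours:
  assumes T: "T \<in> \<T>"
  shows "finite (neighbours T)" "real (card (neighbours T)) \<le> overlap_const DIM('a) \<sigma>"
    and "T' \<in> neighbours T \<Longrightarrow> vol T' \<le> volume_const DIM('a) \<sigma> * vol T"
    and "T' \<in> neighbours T \<Longrightarrow> diameter T \<le> size_const DIM('a) \<sigma> * diameter T'"
    and "T' \<in> neighbours T \<Longrightarrow> T' \<subseteq> element_patch \<T> T"
proof -
  show "finite (neighbours T)" using finite_mesh by (simp add: neighbours_def)
  obtain v where v: "v \<in> vertices T" using element(11)[OF T] by fastforce
  have sub: "neighbours T \<subseteq> (\<Union>z\<in>vertices T. star z)" using v T by (auto simp: neighbours_def star_def)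
  have "card (neighbours T) \<le> card (\<Union>z\<in>vertices T. star z)"
    using element(10)[OF T] star_finite by (intro card_mono[OF _ sub]) auto
  also have "\<dots> \<le> (\<Sum>z\<in>vertices T. card (star z))" by (rule card_UN_le[OF element(10)[OF T]])
  also have "\<dots> \<le> (\<Sum>z\<in>vertices T. star_const DIM('a) \<sigma>)" by (intro sum_mono card_star)
  also have "\<dots> = Suc DIM('a) * star_const DIM('a) \<sigma>" using element(11)[OF T] by simp
  finally have "real (card (neighbours T)) \<le> real (Suc DIM('a) * star_const DIM('a) \<sigma>)" by linarith
  then show "real (card (neighbours T)) \<le> overlap_const DIM('a) \<sigma>" by (simp add: overlap_const_def algebra_simps)
  assume n: "T' \<in> neighbours T"
  then have T': "T' \<in> \<T>" by (simp add: neighbours_def)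
  obtain z where z: "(T', T) \<in> (facet_adj z)\<^sup>*" "(T, T') \<in> (facet_adj z)\<^sup>*"
  proof (cases "T' = T")
    case False
    then obtain z where "z \<in> vertices T" "z \<in> vertices T'" "z \<in> \<Omega>" using n by (auto simp: neighbours_def)
    then show ?thesis using that interior_star_connected[of z T T'] interior_star_connected[of z T' T] T T' by (auto simp: star_def)
  qed (use that in blast)
  show "vol T' \<le> volume_const DIM('a) \<sigma> * vol T"
    unfolding volume_const_def by (rule star_measure[OF z(1) T' T])
  show "diameter T \<le> size_const DIM('a) \<sigma> * diameter T'" by (rule chain_size[OF z(2) T'])
  have "closure T' \<inter> closure T \<noteq> {}"
    using n element(4,12)[OF T] element(12)[OF T'] by (auto simp: neighbours_def)
  then have "T' \<subseteq> (\<Union>T'\<in>{T'\<in>\<T>. closure T' \<inter> closure T \<noteq> {}}. closure T')" using T' closure_subset by blast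
  then show "T' \<subseteq> element_patch \<T> T" unfolding element_patch_def using element(1)[OF T'] by (simp add: interior_maximal)
qed

lemma element_patch_props:
  assumes T: "T \<in> \<T>"
  shows "open (element_patch \<T> T)" "bounded (element_patch \<T> T)" "element_patch \<T> T \<noteq> {}"
    "element_patch \<T> T \<subseteq> \<Omega>" "element_patch \<T> T \<in> sets lebesgue"
proof -
  show o: "open (element_patch \<T> T)" by (simp add: element_patch_def)
  then show "element_patch \<T> T \<in> sets lebesgue" by auto
  have "(\<Union>T'\<in>{T'\<in>\<T>. closure T' \<inter> closure T \<noteq> {}}. closure T') \<subseteq> closure \<Omega>" using cover by blast
  then show s: "element_patch \<T> T \<subseteq> \<Omega>"
    using interior_mono[of _ "closure \<Omega>"] unfolding element_patch_def interior_closure by blast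
  show "bounded (element_patch \<T> T)" using s domain(2) bounded_subset by blast
  show "element_patch \<T> T \<noteq> {}"
    using neighbours(5)[OF T, of T] T element(4)[OF T] by (auto simp: neighbours_def)
qed

lemma mean_indicator:
  assumes "T \<in> \<T>" "T' \<in> \<T>"
  shows "mean_value (indicator T) T' = (if T' = T then 1 else 0)"
  using element(8)[OF assms(1)] by (simp only: mean_value_def integral_indicator_element[OF assms]) simp

lemma vcoef_indicator:
  assumes T: "T \<in> \<T>" and z: "vcoef (indicator T) z \<noteq> 0"
  shows "z \<in> vertices T" "z \<in> \<Omega>"
proof -
  show zo: "z \<in> \<Omega>" using z by (auto simp: vcoef_def split: if_splits)
  show "z \<in> vertices T"
  proof (rule ccontr)
    assume n: "z \<notin> vertices T"
    have "(\<Sum>T'\<in>star z. LINT x|lebesgue_on T'. indicator T x) = (\<Sum>T'\<in>star z. 0 :: real)"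
    proof (rule sum.cong[OF refl])
      fix T' assume "T' \<in> star z"
      then have "T' \<in> \<T>" "T' \<noteq> T" using n by (auto simp: star_def)
      then show "(LINT x|lebesgue_on T'. indicator T x) = (0 :: real)" by (simp only: integral_indicator_element[OF T] if_False)
    qed
    then show False using z zo unfolding vcoef_def by simp
  qed
qed

text \<open>Means of an indicator of an element are 0 or 1, so the difference is at most 1. For an
  element that is no neighbour, both terms vanish.\<close>

lemma vcoef_indicator_bound:
  assumes T: "T \<in> \<T>" and T': "T' \<in> \<T>" and v: "v \<in> vertices T'"
  shows "\<bar>vcoef (indicator T) v - mean_value (indicator T) T'\<bar> \<le> (if T' \<in> neighbours T then 1 else 0)"
proof (cases "T' \<in> neighbours T")
  case True
  have "\<bar>vcoef (indicator T) v - mean_value (indicator T) T'\<bar> \<le> 1"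
    by (rule vcoef_bound[OF v T']) (auto simp: mean_indicator[OF T] T' star_def)
  then show ?thesis using True by simp
next
  case False
  then have "T' \<noteq> T" "vcoef (indicator T) v = 0"
    using T T' v vcoef_indicator[OF T, of v] by (auto simp: neighbours_def)
  then show ?thesis using False by (simp add: mean_indicator[OF T T'])
qed

lemma Qd_indicator_bounds:
  assumes T: "T \<in> \<T>" and T': "T' \<in> \<T>" and x: "x \<in> T'"
  shows "\<bar>Qd (indicator T) x\<bar> \<le> (if T' \<in> neighbours T then value_const DIM('a) + 1 else 0)"
    and "norm (Qd_grad (indicator T) x) \<le> (if T' \<in> neighbours T then slope_const DIM('a) \<sigma> / diameter T' else 0)"
proof -
  note b = Qd_element_bounds[OF T' x vcoef_indicator_bound[OF T T']]
  have "T' = T \<Longrightarrow> T' \<in> neighbours T" using T by (simp add: neighbours_def)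
  then show "\<bar>Qd (indicator T) x\<bar> \<le> (if T' \<in> neighbours T then value_const DIM('a) + 1 else 0)"
    using b(1) by (auto simp: mean_indicator[OF T T'] split: if_splits)
  show "norm (Qd_grad (indicator T) x) \<le> (if T' \<in> neighbours T then slope_const DIM('a) \<sigma> / diameter T' else 0)"
    using b(2) by (auto split: if_splits)
qed

text \<open>A hat with nonzero coefficient belongs to an interior vertex of \<open>T\<close> and is
  positive only in the interior of its star, a part of the patch. Bubbles occur only on neighbours,
  which lie in the patch as well.\<close>

lemma Qd_indicator_patch:
  assumes T: "T \<in> \<T>"
  shows "Qd (indicator T) \<in> H10 (element_patch \<T> T)"
    and "AE x in lebesgue_on (element_patch \<T> T). weak_gradient (element_patch \<T> T) (Qd (indicator T)) x = Qd_grad (indicator T) x"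
    and "x \<notin> element_patch \<T> T \<Longrightarrow> Qd (indicator T) x = 0"
proof -
  let ?\<U> = "element_patch \<T> T"
  have h: "hat \<T> z x = 0" if z: "z \<in> IV" "vcoef (indicator T) z \<noteq> 0" "x \<notin> ?\<U>" for z x
  proof -
    have z': "z \<in> all_vertices" "z \<in> \<Omega>" using z(1) by (auto simp: interior_vertices_eq)
    have zT: "z \<in> closure T" using vcoef_indicator(1)[OF T z(2)] element(12)[OF T] by blast
    have "(\<Union>T'\<in>star z. closure T') \<subseteq> (\<Union>T'\<in>{T'\<in>\<T>. closure T' \<inter> closure T \<noteq> {}}. closure T')"
      using zT element(12) by (fastforce simp: star_def)
    then have "interior (\<Union>T'\<in>star z. closure T') \<subseteq> ?\<U>" unfolding element_patch_def by (rule interior_mono)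
    then have "\<not> 0 < hat \<T> z x" using hat_positive_interior_star[OF z'] z(3) by blast
    then show ?thesis using hat_bounds[OF z'(1), of x] by linarith
  qed
  have b: "T' \<subseteq> ?\<U>" if T': "T' \<in> \<T>" "bcoef (indicator T) T' \<noteq> 0" for T'
  proof -
    have "T' \<in> neighbours T"
      using bcoef_bound[OF T'(1) vcoef_indicator_bound[OF T T'(1)]] T'(2) by (auto split: if_splits)
    then show ?thesis by (rule neighbours(5)[OF T])
  qed
  show "Qd (indicator T) \<in> H10 ?\<U>" "AE x in lebesgue_on ?\<U>. weak_gradient ?\<U> (Qd (indicator T)) x = Qd_grad (indicator T) x"
    by (rule Qd_H10[OF element_patch_props(1,2)[OF T] h b]; assumption)+
  show "Qd (indicator T) x = 0" if x: "x \<notin> ?\<U>"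
  proof -
    have "(\<Sum>z\<in>IV. vcoef (indicator T) z * hat \<T> z x) = 0"
      using h[OF _ _ x] by (intro sum.neutral) auto
    moreover have "(\<Sum>T'\<in>\<T>. bcoef (indicator T) T' * bubble \<T> T' x) = 0"
      using b x by (intro sum.neutral) (auto simp: bubble_eq)
    ultimately show ?thesis by (simp only: Qd_def add_0)
  qed
qed

lemma neighbours_sum:
  assumes T: "T \<in> \<T>" and c: "\<And>T'. T' \<in> neighbours T \<Longrightarrow> c T' \<le> B" and B: "0 \<le> B"
  shows "(\<Sum>T'\<in>\<T>. (if T' \<in> neighbours T then c T' else 0) * vol T') \<le> B * (overlap_const DIM('a) \<sigma> * volume_const DIM('a) \<sigma> * vol T)"
proof -
  have "(\<Sum>T'\<in>\<T>. (if T' \<in> neighbours T then c T' else 0) * vol T') = (\<Sum>T'\<in>neighbours T. c T' * vol T')"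
    using finite_mesh by (intro sum.mono_neutral_cong_right) (auto simp: neighbours_def)
  also have "\<dots> \<le> (\<Sum>T'\<in>neighbours T. B * (volume_const DIM('a) \<sigma> * vol T))"
    using c B neighbours(3)[OF T] by (intro sum_mono mult_mono) auto
  also have "\<dots> = real (card (neighbours T)) * (B * (volume_const DIM('a) \<sigma> * vol T))" by simp
  also have "\<dots> \<le> overlap_const DIM('a) \<sigma> * (B * (volume_const DIM('a) \<sigma> * vol T))"
    using neighbours(2)[OF T] B consts_nonneg by (intro mult_right_mono) auto
  finally show ?thesis by (simp add: mult_ac)
qed

text \<open>Pointwise bounds on the neighbours are summed up. Diameters and volumes of all
  neighbours are replaced by those of \<open>T\<close> at the expense of \<open>size_const\<close>
  and \<open>volume_const\<close>.\<close>

lemma Qd_indicator_norm: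
  assumes T: "T \<in> \<T>"
  shows "L2_norm (element_patch \<T> T) (Qd (indicator T)) \<le> local_const DIM('a) \<sigma> * sqrt (vol T)"
    and "L2_norm (element_patch \<T> T) (weak_gradient (element_patch \<T> T) (Qd (indicator T))) \<le> local_dual_const DIM('a) \<sigma> / (2 * diameter T) * sqrt (vol T)"
proof -
  let ?\<U> = "element_patch \<T> T" and ?u = "Qd (indicator T)" and ?v = "value_const DIM('a) + 1" and ?s = "slope_const DIM('a) \<sigma>"
  let ?X = "overlap_const DIM('a) \<sigma> * volume_const DIM('a) \<sigma> * vol T" and ?K = "size_const DIM('a) \<sigma>"
  note H = Qd_indicator_patch[OF T] and P = element_patch_props[OF T]
  have X: "0 \<le> ?X" using consts_nonneg by simp
  have v0: "0 \<le> ?v" using value_const_pos[of "DIM('a)"] by simp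
  have s0: "0 \<le> ?s" using slope_const_pos[of "DIM('a)" \<sigma>] by simp
  have h: "0 < diameter T" by (rule element(9)[OF T])
  have K: "1 \<le> ?K" by (rule size_const_ge_1)
  have "(L2_norm ?\<U> ?u)\<^sup>2 \<le> (\<Sum>T'\<in>\<T>. (if T' \<in> neighbours T then ?v\<^sup>2 else 0) * vol T')"
    unfolding L2_norm_power2
  proof (rule piecewise_integral_bound[OF P(4,5) L2D(2)[OF H10D(1)[OF H(1)]]])
    show "AE x in lebesgue_on ?\<U>. x \<in> \<Union>\<T> \<longrightarrow> (norm (?u x))\<^sup>2 \<le> piecewise (\<lambda>T'. if T' \<in> neighbours T then ?v\<^sup>2 else 0) x"
    proof (rule AE_I2, rule impI)
      fix x assume "x \<in> \<Union>\<T>"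
      then obtain T' where T': "T' \<in> \<T>" "x \<in> T'" by blast
      show "(norm (?u x))\<^sup>2 \<le> piecewise (\<lambda>T'. if T' \<in> neighbours T then ?v\<^sup>2 else 0) x"
        unfolding piecewise_on[OF T'] using power_mono[OF Qd_indicator_bounds(1)[OF T T'], of 2] by (auto split: if_splits)
    qed
  qed simp
  also have "\<dots> \<le> ?v\<^sup>2 * ?X" by (rule neighbours_sum[OF T]) auto
  finally have "L2_norm ?\<U> ?u \<le> sqrt (?v\<^sup>2 * ?X)" by (rule real_le_rsqrt)
  also have "\<dots> = local_const DIM('a) \<sigma> * sqrt (vol T)"
    using v0 by (simp add: local_const_def real_sqrt_mult)
  finally show "L2_norm ?\<U> ?u \<le> local_const DIM('a) \<sigma> * sqrt (vol T)" .
  have "(L2_norm ?\<U> (weak_gradient ?\<U> ?u))\<^sup>2 \<le> (\<Sum>T'\<in>\<T>. (if T' \<in> neighbours T then (?s / diameter T')\<^sup>2 else 0) * vol T')"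
    unfolding L2_norm_power2
  proof (rule piecewise_integral_bound[OF P(4,5) L2D(2)[OF H10D(2)[OF H(1)]]])
    show "AE x in lebesgue_on ?\<U>. x \<in> \<Union>\<T> \<longrightarrow> (norm (weak_gradient ?\<U> ?u x))\<^sup>2 \<le> piecewise (\<lambda>T'. if T' \<in> neighbours T then (?s / diameter T')\<^sup>2 else 0) x"
      using H(2)
    proof eventually_elim
      case (elim x)
      show ?case
      proof
        assume "x \<in> \<Union>\<T>"
        then obtain T' where T': "T' \<in> \<T>" "x \<in> T'" by blast
        show "(norm (weak_gradient ?\<U> ?u x))\<^sup>2 \<le> piecewise (\<lambda>T'. if T' \<in> neighbours T then (?s / diameter T')\<^sup>2 else 0) x"
          unfolding piecewise_on[OF T'] elim using power_mono[OF Qd_indicator_bounds(2)[OF T T'], of 2] by (auto split: if_splits)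
      qed
    qed
  qed simp
  also have "\<dots> \<le> (?s * ?K / diameter T)\<^sup>2 * ?X"
  proof (rule neighbours_sum[OF T])
    fix T' assume n: "T' \<in> neighbours T"
    then have h': "0 < diameter T'" using element(9) by (simp add: neighbours_def)
    have "?s * diameter T \<le> ?s * (?K * diameter T')" by (intro mult_left_mono neighbours(4)[OF T n] s0)
    then have "?s / diameter T' \<le> ?s * ?K / diameter T" using h h' by (simp add: divide_simps mult_ac)
    then show "(?s / diameter T')\<^sup>2 \<le> (?s * ?K / diameter T)\<^sup>2" using s0 h' by (intro power_mono) auto
  qed simp
  finally have "L2_norm ?\<U> (weak_gradient ?\<U> ?u) \<le> sqrt ((?s * ?K / diameter T)\<^sup>2 * ?X)" by (rule real_le_rsqrt)
  also have "\<dots> = ?s * ?K / diameter T * sqrt ?X" using s0 h K by (subst real_sqrt_mult) simp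
  also have "\<dots> = local_dual_const DIM('a) \<sigma> / (2 * diameter T) * sqrt (vol T)"
    by (simp add: local_dual_const_def real_sqrt_mult)
  finally show "L2_norm ?\<U> (weak_gradient ?\<U> ?u) \<le> local_dual_const DIM('a) \<sigma> / (2 * diameter T) * sqrt (vol T)" .
qed

text \<open>Since \<open>Qd\<close> of the indicator vanishes off the patch, the value of
  \<open>Q_op\<close> on \<open>T\<close> depends on \<phi> through the patch alone.\<close>

lemma Qval_patch:
  assumes \<phi>: "\<phi> \<in> L2 \<Omega>" and T: "T \<in> \<T>"
  shows "Qval (L2_functional \<Omega> \<phi>) T * vol T = L2_functional (element_patch \<T> T) \<phi> (Qd (indicator T))"
proof -
  let ?\<U> = "element_patch \<T> T"
  note P = element_patch_props[OF T]
  have "Qval (L2_functional \<Omega> \<phi>) T * vol T = (LINT x|lebesgue_on \<Omega>. \<phi> x * Qd (indicator T) x)"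
    unfolding Qval_eq[OF L2_functional_Hm1[OF domain(1,2) \<phi>] T] by (simp add: L2_functional_def L2_inner_def)
  also have "\<dots> = (LINT x|lebesgue. indicator \<Omega> x *\<^sub>R (\<phi> x * Qd (indicator T) x))"
    using domain_lmeasurable(2) by (simp add: integral_restrict_space)
  also have "\<dots> = (LINT x|lebesgue. indicator ?\<U> x *\<^sub>R (\<phi> x * Qd (indicator T) x))"
    using P(4) Qd_indicator_patch(3)[OF T] by (intro Bochner_Integration.integral_cong refl) (auto simp: indicator_def)
  also have "\<dots> = (LINT x|lebesgue_on ?\<U>. \<phi> x * Qd (indicator T) x)"
    using P(5) by (simp add: integral_restrict_space)
  finally show ?thesis by (simp add: L2_functional_def L2_inner_def)
qed

lemma Q_op_local_norm:
  assumes "\<phi> \<in> Hm1 \<Omega>" "T \<in> \<T>"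
  shows "L2_norm T (Q_op \<Omega> \<T> \<phi>) = \<bar>Qval \<phi> T\<bar> * sqrt (vol T)"
proof -
  have "(L2_norm T (Q_op \<Omega> \<T> \<phi>))\<^sup>2 = (LINT x|lebesgue_on T. (Qval \<phi> T)\<^sup>2)"
    unfolding L2_norm_power2 by (rule Bochner_Integration.integral_cong) (auto simp: Q_op_eq[OF assms(1)] piecewise_on[OF assms(2)])
  also have "\<dots> = (\<bar>Qval \<phi> T\<bar> * sqrt (vol T))\<^sup>2"
    using element(5)[OF assms(2)] by (simp add: power_mult_distrib measure_restrict_space fmeasurable_def)
  finally show ?thesis by (rule power2_eq_imp_eq) (auto simp: L2_norm_nonneg)
qed

lemma Q_op_local_bounded:
  assumes \<phi>: "\<phi> \<in> L2 \<Omega>" and T: "T \<in> \<T>"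
  shows "L2_norm T (Q_op \<Omega> \<T> (L2_functional \<Omega> \<phi>)) \<le> local_const DIM('a) \<sigma> * L2_norm (element_patch \<T> T) \<phi>"
proof -
  let ?\<U> = "element_patch \<T> T" and ?q = "Qval (L2_functional \<Omega> \<phi>) T" and ?m = "vol T"
  note P = element_patch_props[OF T] and m = element(8)[OF T]
  have \<phi>P: "\<phi> \<in> L2 ?\<U>" by (rule L2_subset(1)[OF \<phi> P(4,5) domain_lmeasurable(2)])
  have "\<bar>?q\<bar> * ?m = \<bar>L2_functional ?\<U> \<phi> (Qd (indicator T))\<bar>"
    unfolding Qval_patch[OF \<phi> T, symmetric] using m by (simp add: abs_mult)
  also have "\<dots> \<le> L2_norm ?\<U> \<phi> * L2_norm ?\<U> (Qd (indicator T))"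
    using L2_Cauchy_Schwarz[OF \<phi>P H10D(1)[OF Qd_indicator_patch(1)[OF T]]] by (simp add: L2_functional_def L2_inner_def)
  also have "\<dots> \<le> L2_norm ?\<U> \<phi> * (local_const DIM('a) \<sigma> * sqrt ?m)"
    by (intro mult_left_mono Qd_indicator_norm(1) T L2_norm_nonneg)
  finally show ?thesis
    unfolding Q_op_local_norm[OF L2_functional_Hm1[OF domain(1,2) \<phi>] T] mult.commute[of "local_const _ _" "L2_norm _ _"] by (rule cancel_sqrt[OF m])
qed

text \<open>On \<open>T\<close> the result is a constant, obtained by testing \<phi> on the patch
  with a function whose gradient is of order 1/h. Paired with a test function on \<open>T\<close>,
  it gains a factor h from the Friedrichs inequality.\<close>

lemma Q_op_local_dual_bounded:
  assumes \<phi>: "\<phi> \<in> L2 \<Omega>" and T: "T \<in> \<T>"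
  shows "Hm1_norm T (L2_functional T (Q_op \<Omega> \<T> (L2_functional \<Omega> \<phi>)))
    \<le> ereal (local_dual_const DIM('a) \<sigma>) * Hm1_norm (element_patch \<T> T) (L2_functional (element_patch \<T> T) \<phi>)"
proof -
  let ?\<U> = "element_patch \<T> T" and ?q = "Qval (L2_functional \<Omega> \<phi>) T" and ?m = "vol T" and ?h = "diameter T"
  let ?Q = "Q_op \<Omega> \<T> (L2_functional \<Omega> \<phi>)" and ?C = "local_dual_const DIM('a) \<sigma>"
  note P = element_patch_props[OF T] and m = element(8)[OF T] and h = element(9)[OF T]
  note \<psi> = L2_functional_Hm1[OF domain(1,2) \<phi>]
  have C0: "0 \<le> ?C"
    unfolding local_dual_const_def using slope_const_pos[of "DIM('a)" \<sigma>] size_const_ge_1[of "DIM('a)" \<sigma>] consts_nonneg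
    by (intro mult_nonneg_nonneg real_sqrt_ge_zero) auto
  have \<phi>P: "\<phi> \<in> L2 ?\<U>" by (rule L2_subset(1)[OF \<phi> P(4,5) domain_lmeasurable(2)])
  obtain N where N: "0 \<le> N" "Hm1_norm ?\<U> (L2_functional ?\<U> \<phi>) = ereal N"
    "\<And>u. u \<in> H10 ?\<U> \<Longrightarrow> \<bar>L2_functional ?\<U> \<phi> u\<bar> \<le> N * L2_norm ?\<U> (weak_gradient ?\<U> u)"
    by (rule Hm1_norm_real[OF P(1,3) L2_functional_Hm1[OF P(1,2) \<phi>P]]) blast
  have "\<bar>?q\<bar> * ?m = \<bar>L2_functional ?\<U> \<phi> (Qd (indicator T))\<bar>"
    unfolding Qval_patch[OF \<phi> T, symmetric] using m by (simp add: abs_mult)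
  also have "\<dots> \<le> N * L2_norm ?\<U> (weak_gradient ?\<U> (Qd (indicator T)))" by (rule N(3)[OF Qd_indicator_patch(1)[OF T]])
  also have "\<dots> \<le> N * (?C / (2 * ?h) * sqrt ?m)" by (intro mult_left_mono Qd_indicator_norm(2) T N(1))
  finally have q: "\<bar>?q\<bar> * sqrt ?m \<le> N * (?C / (2 * ?h))" by (rule cancel_sqrt[OF m])
  have QL: "?Q \<in> L2 T" by (rule L2_element[OF Q_op_L2[OF \<psi>] T])
  have "Hm1_norm T (L2_functional T ?Q) \<le> ereal (?C * N)"
  proof (rule Hm1_norm_L2_le[OF element(1)[OF T] QL])
    show "0 \<le> ?C * N" using C0 N(1) by simp
    fix f assume f: "f \<in> test_functions T"
    have "L2_inner T ?Q f \<le> L2_norm T ?Q * L2_norm T f"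
      using L2_Cauchy_Schwarz[OF QL test_functions_L2(1)[OF f element(6)[OF T]]] by (simp add: L2_inner_def)
    also have "\<dots> \<le> (N * (?C / (2 * ?h))) * (2 * ?h * L2_norm T (grad f))"
      unfolding Q_op_local_norm[OF \<psi> T]
      by (rule mult_mono[OF q Friedrichs_test[OF f element(6,3)[OF T]]]) (use C0 N(1) h in \<open>auto simp: L2_norm_nonneg\<close>)
    also have "\<dots> = ?C * N * L2_norm T (grad f)" using h by simp
    finally show "L2_inner T ?Q f \<le> ?C * N * L2_norm T (grad f)" .
  qed
  then show ?thesis by (simp add: N(2))
qed

end

theorem theorem8:
  fixes \<sigma> :: real
  assumes "2 \<le> CARD('n::finite)"
  shows "\<exists>C>0. \<forall>(\<Omega> :: (real ^ 'n) set) \<T>.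
    lipschitz_domain \<Omega> \<and> regular_mesh \<Omega> \<T> \<and> shape_regularity \<T> \<le> \<sigma> \<longrightarrow>
      (\<forall>\<phi>\<in>Hm1 \<Omega>. Q_op \<Omega> \<T> \<phi> \<in> P0 \<T>) \<and>
      (\<forall>\<phi>\<in>Hm1 \<Omega>. Q_op \<Omega> \<T> (L2_functional \<Omega> (Q_op \<Omega> \<T> \<phi>)) = Q_op \<Omega> \<T> \<phi>) \<and>
      (\<forall>\<phi>\<in>L2 \<Omega>.
         Hm1_norm \<Omega> (\<lambda>v. L2_functional \<Omega> \<phi> v - L2_functional \<Omega> (Q_op \<Omega> \<T> (L2_functional \<Omega> \<phi>)) v)
           \<le> ereal (C * L2_norm \<Omega> (\<lambda>x. mesh_size \<T> x * \<phi> x))) \<and>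
      (\<forall>T\<in>\<T>. \<forall>\<phi>\<in>L2 \<Omega>.
         L2_norm T (Q_op \<Omega> \<T> (L2_functional \<Omega> \<phi>)) \<le> C * L2_norm (element_patch \<T> T) \<phi> \<and>
         Hm1_norm T (L2_functional T (Q_op \<Omega> \<T> (L2_functional \<Omega> \<phi>)))
           \<le> ereal C * Hm1_norm (element_patch \<T> T) (L2_functional (element_patch \<T> T) \<phi>)) \<and>
      (\<forall>\<phi>\<in>Hm1 \<Omega>.
         Hm1_norm \<Omega> (L2_functional \<Omega> (Q_op \<Omega> \<T> \<phi>)) \<le> ereal C * Hm1_norm \<Omega> \<phi>)"
proof -
  let ?d = "CARD('n)"
  \<comment> \<open>Absolute values make \<open>C\<close> positive and an upper bound of all four
    constants, whatever their signs.\<close>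
  define C where "C = 1 + \<bar>approx_const ?d \<sigma>\<bar> + \<bar>global_const ?d \<sigma>\<bar> + \<bar>local_const ?d \<sigma>\<bar> + \<bar>local_dual_const ?d \<sigma>\<bar>"
  have C: "0 < C" "approx_const ?d \<sigma> \<le> C" "global_const ?d \<sigma> \<le> C" "local_const ?d \<sigma> \<le> C" "local_dual_const ?d \<sigma> \<le> C"
    unfolding C_def by linarith+
  show ?thesis
  proof (intro exI[of _ C] conjI allI impI C(1))
    fix \<Omega> :: "(real ^ 'n) set" and \<T>
    assume a: "lipschitz_domain \<Omega> \<and> regular_mesh \<Omega> \<T> \<and> shape_regularity \<T> \<le> \<sigma>"
    interpret mesh \<Omega> \<T> using a by unfold_locales auto
    interpret shape_mesh \<Omega> \<T> \<sigma>
    proof unfold_locales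
      show "2 \<le> DIM(real ^ 'n)" using assms by simp
      fix T assume T: "T \<in> \<T>"
      have "diameter T ^ DIM(real ^ 'n) / measure lebesgue T \<le> shape_regularity \<T>"
        unfolding shape_regularity_def using finite_mesh T by (intro Max_ge) auto
      also have "\<dots> \<le> \<sigma>" using a by simp
      finally show "diameter T ^ DIM(real ^ 'n) \<le> \<sigma> * measure lebesgue T" using element(8)[OF T] by (simp add: pos_divide_le_eq)
    qed
    have d: "DIM(real ^ 'n) = ?d" by simp
    \<comment> \<open>On a nonempty open set the dual norm is a nonnegative real number, so the
      constant in front of it may be enlarged.\<close>
    have mono: "ereal c * Hm1_norm \<omega> \<phi> \<le> ereal C * Hm1_norm \<omega> \<phi>"
      if c: "c \<le> C" and \<omega>: "open \<omega>" "\<omega> \<noteq> {}" "\<phi> \<in> Hm1 \<omega>" for c \<phi> and \<omega> :: "(real ^ 'n) set"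
    proof -
      obtain N where "0 \<le> N" "Hm1_norm \<omega> \<phi> = ereal N" by (rule Hm1_norm_real[OF \<omega>]) blast
      then show ?thesis using c by (simp add: mult_right_mono)
    qed
    show "\<forall>\<phi>\<in>Hm1 \<Omega>. Q_op \<Omega> \<T> \<phi> \<in> P0 \<T>" using Q_op_P0 by blast
    show "\<forall>\<phi>\<in>Hm1 \<Omega>. Q_op \<Omega> \<T> (L2_functional \<Omega> (Q_op \<Omega> \<T> \<phi>)) = Q_op \<Omega> \<T> \<phi>" using Q_op_idempotent by blast
    show "\<forall>\<phi>\<in>L2 \<Omega>. Hm1_norm \<Omega> (\<lambda>v. L2_functional \<Omega> \<phi> v - L2_functional \<Omega> (Q_op \<Omega> \<T> (L2_functional \<Omega> \<phi>)) v)
        \<le> ereal (C * L2_norm \<Omega> (\<lambda>x. mesh_size \<T> x * \<phi> x))"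
    proof
      fix \<phi> :: "real ^ 'n \<Rightarrow> real" assume "\<phi> \<in> L2 \<Omega>"
      from Q_op_approximation[OF this] show "Hm1_norm \<Omega> (\<lambda>v. L2_functional \<Omega> \<phi> v - L2_functional \<Omega> (Q_op \<Omega> \<T> (L2_functional \<Omega> \<phi>)) v)
        \<le> ereal (C * L2_norm \<Omega> (\<lambda>x. mesh_size \<T> x * \<phi> x))"
        by (rule order_trans) (use C(2) in \<open>simp add: mult_right_mono L2_norm_nonneg\<close>)
    qed
    show "\<forall>\<phi>\<in>Hm1 \<Omega>. Hm1_norm \<Omega> (L2_functional \<Omega> (Q_op \<Omega> \<T> \<phi>)) \<le> ereal C * Hm1_norm \<Omega> \<phi>"
    proof
      fix \<phi> assume \<phi>: "\<phi> \<in> Hm1 \<Omega>"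
      show "Hm1_norm \<Omega> (L2_functional \<Omega> (Q_op \<Omega> \<T> \<phi>)) \<le> ereal C * Hm1_norm \<Omega> \<phi>"
        using order_trans[OF Q_op_bounded[OF \<phi>] mono[OF _ domain(1,3) \<phi>]] C(3) by simp
    qed
    show "\<forall>T\<in>\<T>. \<forall>\<phi>\<in>L2 \<Omega>.
         L2_norm T (Q_op \<Omega> \<T> (L2_functional \<Omega> \<phi>)) \<le> C * L2_norm (element_patch \<T> T) \<phi> \<and>
         Hm1_norm T (L2_functional T (Q_op \<Omega> \<T> (L2_functional \<Omega> \<phi>)))
           \<le> ereal C * Hm1_norm (element_patch \<T> T) (L2_functional (element_patch \<T> T) \<phi>)"
    proof (intro ballI conjI)
      fix T and \<phi> :: "real ^ 'n \<Rightarrow> real" assume T: "T \<in> \<T>" and \<phi>: "\<phi> \<in> L2 \<Omega>"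
      note P = element_patch_props[OF T]
      from Q_op_local_bounded[OF \<phi> T] show "L2_norm T (Q_op \<Omega> \<T> (L2_functional \<Omega> \<phi>)) \<le> C * L2_norm (element_patch \<T> T) \<phi>"
        by (rule order_trans) (use C(4) in \<open>simp add: mult_right_mono L2_norm_nonneg\<close>)
      have "\<phi> \<in> L2 (element_patch \<T> T)" by (rule L2_subset(1)[OF \<phi> P(4,5) domain_lmeasurable(2)])
      from mono[OF _ P(1,3) L2_functional_Hm1[OF P(1,2) this]]
      show "Hm1_norm T (L2_functional T (Q_op \<Omega> \<T> (L2_functional \<Omega> \<phi>)))
           \<le> ereal C * Hm1_norm (element_patch \<T> T) (L2_functional (element_patch \<T> T) \<phi>)"
        using Q_op_local_dual_bounded[OF \<phi> T] C(5) by (auto intro: order_trans)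
    qed
  qed
qed

end
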